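(* Let $\Gamma$ be a decay function on $\mathbb{Z}^m$, let $U\subset\ell^\infty(\mathbb{R}^n)$ be an open set with $0\in U$, and let $F\in C^r_\Gamma(U,\ell^\infty(\mathbb{R}^n))$ with $F(0)=0$. Let $A=DF(0)$, $\alpha_\Gamma=\inf\{|\lambda|:\lambda\in\operatorname{Spec}_\Gamma(A)\}$, $\beta_\Gamma=\sup\{|\lambda|:\lambda\in\operatorname{Spec}_\Gamma(A)\}$, $\nu=\frac{\log\alpha_\Gamma}{\log\beta_\Gamma}$ and $r_0=[\nu]+1$, where $[\cdot]$ denotes the integer part. Assume that $0\notin\operatorname{Spec}_\Gamma(A)$ and $\operatorname{Spec}_\Gamma(A)\subset\mathbb{D}(0,1)$, the open unit disc of $\mathbb{C}$. If $r\ge r_0$, then there exist a polynomial map with decay $H:\ell^\infty(\mathbb{R}^n)\to\ell^\infty(\mathbb{R}^n)$ of degree not larger than $r_0$ and $R\in C^r_\Gamma(\ell^\infty(\mathbb{R}^n),\ell^\infty(\mathbb{R}^n))$ such that $R(0)=0$, $DR(0)=\operatorname{Id}$ and $$R\circ F=H\circ R$$ in some neighborhood $U_1\subset U$ of $0$.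
   Context: Fix integers $n,m\ge1$ and a norm $\|\cdot\|$ on $\mathbb{R}^n$. $\ell^\infty(\mathbb{R}^n)$ is the Banach space of bounded families $x=(x_i)_{i\in\mathbb{Z}^m}$, $x_i\in\mathbb{R}^n$, with norm $\|x\|_\infty=\sup_i\|x_i\|$; $\ell^\infty(\mathbb{C}^n)$ is defined analogously and is the complexification of $\ell^\infty(\mathbb{R}^n)$. Decay function: $\Gamma:\mathbb{Z}^m\to\mathbb{R}^+=(0,\infty)$ with $\sum_{k}\Gamma(k)\le1$ and $\sum_k\Gamma(i-k)\Gamma(k-j)\le\Gamma(i-j)$ for all $i,j\in\mathbb{Z}^m$. Linear maps with decay: for a bounded linear map $A$ of $\ell^\infty(\mathbb{R}^n)$ (or $\ell^\infty(\mathbb{C}^n)$) let $\|A\|$ be the operator norm, $\gamma(A)=\sup_{i,k\in\mathbb{Z}^m}\sup\{\|(Au)_i\|\,\Gamma(i-k)^{-1}: \|u\|_\infty\le1,\ u_j=0 \text{ for } j\ne k\}$ and $\|A\|_\Gamma=\max\{\|A\|,\gamma(A)\}$; $L_\Gamma$ is the set of $A$ with $\|A\|_\Gamma<\infty$. Multilinear maps with decay: $L^k_\Gamma$ is the space of bounded $k$-linear maps $A:\ell^\infty(\mathbb{R}^n)^k\to\ell^\infty(\mathbb{R}^n)$ with $\|A\|_\Gamma=\max\{\|A\|,\gamma(A)\}<\infty$, where $\gamma(A)=\max_{1\le p\le k}\sup_{i,l\in\mathbb{Z}^m}\sup\|A(v_1,\ldots,v_{p-1},w,v_p,\ldots,v_{k-1})_i\|\,\Gamma(i-l)^{-1}$,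 the inner supremum being over $w$ with $\|w\|_\infty\le1$, $w_j=0$ for $j\neq l$, and $v_q$ with $\|v_q\|_\infty\le1$. For $V\subset\ell^\infty(\mathbb{R}^n)$ open and an integer $r\ge1$, $C^r_\Gamma(V,\ell^\infty(\mathbb{R}^n))$ is the space of maps $F\in C^r(V,\ell^\infty(\mathbb{R}^n))$ (Fréchet sense) with $\sup_{x\in V}\|F(x)\|_\infty<\infty$, $D^jF(x)\in L^j_\Gamma$ for all $x\in V$ and $\sup_{x\in V}\|D^jF(x)\|_\Gamma<\infty$ for $1\le j\le r$. A polynomial map with decay of degree at most $d$ is a map $P(x)=P_0+\sum_{j=1}^{d}P_j(x,\ldots,x)$ with $P_0\in\ell^\infty(\mathbb{R}^n)$ and $P_j\in L^j_\Gamma$. $\Gamma$-spectrum: for $A\in L_\Gamma$, extended complex-linearly to $\ell^\infty(\mathbb{C}^n)$, $\operatorname{Spec}_\Gamma(A)$ is the complement in $\mathbb{C}$ of the set of $\lambda$ such that $A-\lambda\operatorname{Id}$ is invertible and $(A-\lambda\operatorname{Id})^{-1}\in L_\Gamma$. *)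

theory Defs
  imports "HOL-Analysis.Analysis"
begin

section \<open>Norms on $K^n$\<close>

definition is_norm :: "(('k::real_normed_field) ^ 'n \<Rightarrow> real) \<Rightarrow> bool" where
  "is_norm N \<longleftrightarrow>
     (\<forall>x. 0 \<le> N x) \<and> (\<forall>x. N x = 0 \<longleftrightarrow> x = 0) \<and>
     (\<forall>c x. N (c *s x) = norm c * N x) \<and> (\<forall>x y. N (x + y) \<le> N x + N y)"

definition complex_vec :: "real ^ 'n \<Rightarrow> complex ^ 'n" where
  "complex_vec x = (\<chi> j. complex_of_real (x $ j))"

definition extends_norm :: "(complex ^ 'n \<Rightarrow> real) \<Rightarrow> (real ^ 'n \<Rightarrow> real) \<Rightarrow> bool" where
  "extends_norm NC N \<longleftrightarrow> (\<forall>x. NC (complex_vec x) = N x)"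

lemma is_norm_equivalent:
  fixes N :: "('k::{real_normed_field, euclidean_space}) ^ 'n \<Rightarrow> real"
  assumes "is_norm N"
  obtains c C where "c > 0" "C > 0" "\<And>x. c * norm x \<le> N x" "\<And>x. N x \<le> C * norm x"
proof -
  have N0: "\<And>x. N x \<ge> 0" and N1: "\<And>x. N x = 0 \<longleftrightarrow> x = 0"
    and N2: "\<And>c x. N (c *s x) = norm c * N x" and N3: "\<And>x y. N (x + y) \<le> N x + N y"
    using assms by (auto simp: is_norm_def)
  have scale: "N (r *\<^sub>R x) = \<bar>r\<bar> * N x" for r x
  proof -
    have "r *\<^sub>R x = of_real r *s x"
      by (simp add: vec_eq_iff scaleR_vec_def) (simp add: scaleR_conv_of_real)
    then show ?thesis by (simp add: N2)
  qed
  have Nsum: "N (sum f S) \<le> (\<Sum>i\<in>S. N (f i))" if "finite S" for f :: "'n \<Rightarrow> 'k ^ 'n" and S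
    using that
  proof induction
    case empty
    then show ?case using N1[of 0] by simp
  next
    case (insert a S)
    then show ?case using N3[of "f a" "sum f S"] by simp
  qed
  define C where "C = (\<Sum>i\<in>(UNIV::'n set). N (axis i 1)) + 1"
  have Cpos: "C > 0" unfolding C_def by (intro add_nonneg_pos sum_nonneg N0) simp
  have up: "N x \<le> C * norm x" for x
  proof -
    have "N x = N (\<Sum>i\<in>UNIV. x $ i *s axis i 1)" by (simp only: basis_expansion)
    also have "\<dots> \<le> (\<Sum>i\<in>UNIV. N (x $ i *s axis i 1))" by (rule Nsum) simp
    also have "\<dots> = (\<Sum>i\<in>UNIV. norm (x $ i) * N (axis i 1))" by (simp add: N2)
    also have "\<dots> \<le> (\<Sum>i\<in>UNIV. norm x * N (axis i 1))"
      by (intro sum_mono mult_right_mono N0 Finite_Cartesian_Product.norm_nth_le)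
    also have "\<dots> = norm x * (\<Sum>i\<in>UNIV. N (axis i 1))" by (simp add: sum_distrib_left)
    also have "\<dots> \<le> C * norm x" unfolding C_def by (simp add: algebra_simps)
    finally show ?thesis .
  qed
  have lip: "\<bar>N x - N y\<bar> \<le> C * norm (x - y)" for x y
  proof -
    have 1: "N x \<le> N (x - y) + N y" using N3[of "x - y" y] by simp
    have 2: "N y \<le> N (y - x) + N x" using N3[of "y - x" x] by simp
    have 3: "N (y - x) = N (x - y)" using scale[of "-1" "x - y"] by simp
    show ?thesis using 1 2 3 up[of "x - y"] by linarith
  qed
  have cont: "continuous_on UNIV N"
  proof (rule continuous_onI)
    fix x :: "'k ^ 'n" and e :: real
    assume "e > 0"
    show "\<exists>d>0. \<forall>x'\<in>UNIV. dist x' x < d \<longrightarrow> dist (N x') (N x) \<le> e"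
    proof (intro exI[of _ "e / C"] conjI ballI impI)
      show "e / C > 0" using \<open>e > 0\<close> Cpos by simp
      fix x' assume "dist x' x < e / C"
      then have "C * norm (x' - x) \<le> e" using Cpos by (simp add: dist_norm field_simps)
      then show "dist (N x') (N x) \<le> e" using lip[of x' x] by (simp add: dist_real_def)
    qed
  qed
  have ne: "sphere (0::'k ^ 'n) 1 \<noteq> {}" by simp
  have "\<exists>x\<in>sphere (0::'k ^ 'n) 1. \<forall>y\<in>sphere 0 1. N x \<le> N y"
    by (rule continuous_attains_inf[OF compact_sphere ne continuous_on_subset[OF cont]]) simp
  then obtain x0 where x0: "x0 \<in> sphere (0::'k ^ 'n) 1" "\<And>y. y \<in> sphere 0 1 \<Longrightarrow> N x0 \<le> N y"
    by blast
  have "x0 \<noteq> 0" using x0(1) by auto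
  then have cpos: "N x0 > 0" using N0[of x0] N1[of x0] by linarith
  have low: "N x0 * norm x \<le> N x" for x
  proof (cases "x = 0")
    case True
    then show ?thesis using N0[of x] by simp
  next
    case False
    have "N x0 \<le> N ((1 / norm x) *\<^sub>R x)" using False by (intro x0(2)) simp
    then show ?thesis using False by (simp add: scale field_simps)
  qed
  show thesis using that[OF cpos Cpos low up] .
qed

lemma exists_extends_norm:
  fixes N :: "real ^ 'n \<Rightarrow> real"
  assumes "is_norm N"
  shows "\<exists>NC. is_norm NC \<and> extends_norm NC N"
proof -
  have N0: "\<And>x. N x \<ge> 0" and N1: "\<And>x. N x = 0 \<longleftrightarrow> x = 0"
    and N2: "\<And>c x. N (c *s x) = \<bar>c\<bar> * N x" and N3: "\<And>x y. N (x + y) \<le> N x + N y"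
    using assms by (auto simp: is_norm_def)
  obtain C where C: "C > 0" "\<And>x. N x \<le> C * norm x"
    using is_norm_equivalent[OF assms] by metis
  define re :: "complex ^ 'n \<Rightarrow> real ^ 'n" where "re z = (\<chi> j. Re (z $ j))" for z
  define S where "S = sphere (0::complex) 1"
  define NC where "NC z = (SUP w\<in>S. N (re (w *s z)))" for z
  have ne: "S \<noteq> {}" unfolding S_def by simp
  have one: "1 \<in> S" "- \<i> \<in> S" unfolding S_def by auto
  have re_le: "norm (re z) \<le> norm z" for z
    unfolding norm_vec_def re_def by (rule L2_set_mono) (auto simp: abs_Re_le_cmod)
  have norm_S: "norm (w *s z) = norm z" if "w \<in> S" for w and z :: "complex ^ 'n"
    using that unfolding norm_vec_def S_def by (simp add: norm_mult)
  have bdd: "bdd_above ((\<lambda>w. N (re (w *s z))) ` S)" for z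
  proof (rule bdd_aboveI2)
    fix w assume "w \<in> S"
    have "N (re (w *s z)) \<le> C * norm (re (w *s z))" by (rule C)
    also have "\<dots> \<le> C * norm z"
      using re_le[of "w *s z"] norm_S[OF \<open>w \<in> S\<close>, of z] C(1) by (intro mult_left_mono) auto
    finally show "N (re (w *s z)) \<le> C * norm z" .
  qed
  have upper: "N (re (w *s z)) \<le> NC z" if "w \<in> S" for w z
    unfolding NC_def using bdd that by (rule cSUP_upper2[OF _ _ order_refl])
  have least: "NC z \<le> b" if "\<And>w. w \<in> S \<Longrightarrow> N (re (w *s z)) \<le> b" for z b
    unfolding NC_def by (rule cSUP_least[OF ne that])
  have pos: "0 \<le> NC z" for z
    using upper[OF one(1), of z] N0[of "re (1 *s z)"] by linarith
  have zero: "z = 0" if "NC z = 0" for z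
  proof -
    have "re (w *s z) = 0" if "w \<in> S" for w
      using upper[OF that, of z] \<open>NC z = 0\<close> N0[of "re (w *s z)"] N1[of "re (w *s z)"] by linarith
    from this[OF one(1)] this[OF one(2)] show "z = 0"
      by (simp add: re_def vec_eq_iff complex_eq_iff)
  qed
  have NC0: "NC 0 = 0"
  proof -
    have "re (w *s 0) = 0" for w by (simp add: re_def vec_eq_iff)
    then have "NC 0 \<le> 0" using N1[of 0] by (intro least) simp
    then show ?thesis using pos[of 0] by linarith
  qed
  have tri: "NC (y + z) \<le> NC y + NC z" for y z
  proof (rule least)
    fix w assume w: "w \<in> S"
    have "re (w *s (y + z)) = re (w *s y) + re (w *s z)"
      by (simp add: re_def vec_eq_iff algebra_simps)
    then show "N (re (w *s (y + z))) \<le> NC y + NC z"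
      using N3[of "re (w *s y)" "re (w *s z)"] upper[OF w, of y] upper[OF w, of z] by simp
  qed
  have homle: "NC (c *s z) \<le> cmod c * NC z" for c z
  proof (rule least)
    fix w assume w: "w \<in> S"
    show "N (re (w *s (c *s z))) \<le> cmod c * NC z"
    proof (cases "c = 0")
      case True
      then have "re (w *s (c *s z)) = 0" by (simp add: re_def vec_eq_iff)
      then show ?thesis using N1[of 0] True by simp
    next
      case False
      define u where "u = w * (c / of_real (cmod c))"
      have u: "u \<in> S" using w False by (simp add: S_def u_def norm_mult norm_divide)
      have "w * c = of_real (cmod c) * u" using False by (simp add: u_def)
      then have "w * (c * a) = of_real (cmod c) * (u * a)" for a
        by (metis mult.assoc)
      then have "Re (w * (c * a)) = cmod c * Re (u * a)" for a
        by (simp only: Re_complex_of_real Im_complex_of_real times_complex.sel)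
      then have "re (w *s (c *s z)) = cmod c *s re (u *s z)"
        unfolding re_def vec_eq_iff by (simp only: vec_lambda_beta vector_smult_component simp_thms)
      then have "N (re (w *s (c *s z))) = cmod c * N (re (u *s z))" by (simp add: N2)
      then show ?thesis using upper[OF u, of z] by (simp add: mult_left_mono)
    qed
  qed
  have hom: "NC (c *s z) = cmod c * NC z" for c z
  proof (cases "c = 0")
    case True
    then have "c *s z = 0" by (simp add: vec_eq_iff)
    then show ?thesis using NC0 True by simp
  next
    case False
    have "NC z = NC (inverse c *s (c *s z))" using False by simp
    also have "\<dots> \<le> cmod (inverse c) * NC (c *s z)" by (rule homle)
    finally have "cmod c * NC z \<le> NC (c *s z)" using False
      by (simp only: norm_inverse) (simp add: field_simps)
    then show ?thesis using homle[of c z] by linarith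
  qed
  have ext: "NC (complex_vec x) = N x" for x
  proof (rule antisym)
    have *: "re (w *s complex_vec x) = Re w *s x" for w
      by (simp add: re_def complex_vec_def vec_eq_iff)
    show "NC (complex_vec x) \<le> N x"
    proof (rule least)
      fix w assume "w \<in> S"
      then have "\<bar>Re w\<bar> \<le> 1" using abs_Re_le_cmod[of w] by (simp add: S_def)
      then show "N (re (w *s complex_vec x)) \<le> N x"
        using N0[of x] by (simp add: * N2 mult_left_le_one_le)
    qed
    show "N x \<le> NC (complex_vec x)" using upper[OF one(1), of "complex_vec x"] by (simp only: *) simp
  qed
  show ?thesis
    using pos zero NC0 tri hom ext unfolding is_norm_def extends_norm_def by blast
qed


section \<open>The lattice spaces\<close>

instantiation int :: metric_space
begin

definition dist_int :: "int \<Rightarrow> int \<Rightarrow> real" where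
  "dist_int a b = real_of_int \<bar>a - b\<bar>"

definition uniformity_int :: "(int \<times> int) filter" where
  "uniformity_int = (INF e\<in>{0<..}. principal {(x, y). dist x y < e})"

instance
proof
  fix U :: "int set"
  have "\<forall>\<^sub>F (x', y) in uniformity. x' = x \<longrightarrow> y \<in> U" if "x \<in> U" for x
  proof -
    have "\<forall>\<^sub>F (x', y) in principal {(x, y). dist x y < (1::real)}. x' = x \<longrightarrow> y \<in> U"
    proof -
      have "a = b" if "real_of_int \<bar>a - b\<bar> < 1" for a b :: int
        using that by linarith
      then show ?thesis using that by (auto simp: eventually_principal dist_int_def)
    qed
    then show ?thesis
      unfolding uniformity_int_def
      by (rule filter_leD[rotated]) (rule INF_lower, simp)
  qed
  then show "open U = (\<forall>x\<in>U. \<forall>\<^sub>F (x', y) in uniformity. x' = x \<longrightarrow> y \<in> U)"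
    by (simp add: open_discrete)
qed (auto simp: dist_int_def uniformity_int_def)

end

text \<open>Since \<^typ>\<open>int ^ 'm\<close> is discrete, every bounded family is an element of this type.
  The built-in norm of the type is the sup norm for the Euclidean norm on \<^typ>\<open>real ^ 'n\<close>; it
  only serves to provide the topology. Every quantitative notion below uses the sup norm
  \<open>supn N\<close> induced by the given norm \<open>N\<close>; the lemmas show that both give the same bounded
  families, the same topology and the same derivatives.\<close>

type_synonym ('m, 'v) linf = "(int ^ 'm) \<Rightarrow>\<^sub>C 'v"

definition supn :: "('v::real_normed_vector \<Rightarrow> real) \<Rightarrow> ('m::finite, 'v) linf \<Rightarrow> real" where
  "supn N x = (SUP i. N (x i))"

lemma bounded_family_in_bcontfun:
  fixes f :: "int ^ 'm \<Rightarrow> 'v::metric_space"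
  assumes "bounded (range f)"
  shows "f \<in> bcontfun"
proof -
  have "open {i}" for i :: "int ^ 'm"
  proof -
    have "{i} = {j. \<forall>k. j $ k \<in> {i $ k}}" by (auto simp: vec_eq_iff)
    also have "open \<dots>"
      using open_vector_box[of "\<lambda>k. {i $ k}"] by (simp add: open_discrete)
    finally show ?thesis .
  qed
  then have "open A" for A :: "(int ^ 'm) set"
    using open_Union[of "(\<lambda>i. {i}) ` A"] by auto
  then show ?thesis using assms by (simp add: bcontfun_def continuous_on_open_vimage)
qed

lemma bounded_iff_is_norm:
  fixes N :: "('k::{real_normed_field, euclidean_space}) ^ 'n \<Rightarrow> real"
  assumes "is_norm N"
  shows "bounded S \<longleftrightarrow> bdd_above (N ` S)"
proof -
  obtain c C where c: "c > 0" "C > 0" "\<And>x. c * norm x \<le> N x" "\<And>x. N x \<le> C * norm x"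
    using is_norm_equivalent[OF assms] by metis
  show ?thesis
  proof
    assume "bounded S"
    then obtain b where "\<And>x. x \<in> S \<Longrightarrow> norm x \<le> b" by (auto simp: bounded_iff)
    then have "N x \<le> C * b" if "x \<in> S" for x
      using that c(2) c(4)[of x] by (meson order_trans mult_left_mono less_imp_le)
    then show "bdd_above (N ` S)" by (rule bdd_aboveI2)
  next
    assume "bdd_above (N ` S)"
    then obtain b where "\<And>x. x \<in> S \<Longrightarrow> N x \<le> b" by (auto simp: bdd_above_def)
    then have "norm x \<le> b / c" if "x \<in> S" for x
      using that c(1) c(3)[of x] by (smt (verit) pos_le_divide_eq mult.commute)
    then show "bounded S" by (auto simp: bounded_iff)
  qed
qed

lemma supn_equivalent:
  fixes N :: "('k::{real_normed_field, euclidean_space}) ^ 'n \<Rightarrow> real"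
  assumes "is_norm N"
  obtains c C where "c > 0" "C > 0"
    "\<And>x :: ('m::finite, 'k ^ 'n) linf. c * norm x \<le> supn N x"
    "\<And>x :: ('m::finite, 'k ^ 'n) linf. supn N x \<le> C * norm x"
proof -
  obtain c C where c: "c > 0" "C > 0" "\<And>x. c * norm x \<le> N x" "\<And>x. N x \<le> C * norm x"
    using is_norm_equivalent[OF assms] by metis
  have *: "N (x i) \<le> C * norm x" for x :: "('m, 'k ^ 'n) linf" and i
    using c(2) c(4)[of "x i"] norm_bounded[of x i] by (meson order_trans mult_left_mono less_imp_le)
  have 1: "supn N x \<le> C * norm x" for x :: "('m, 'k ^ 'n) linf"
    unfolding supn_def by (rule cSUP_least) (auto simp: *)
  have 2: "c * norm x \<le> supn N x" for x :: "('m, 'k ^ 'n) linf"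
  proof -
    have "norm (x i) \<le> supn N x / c" for i
    proof -
      have "N (x i) \<le> supn N x"
        unfolding supn_def by (rule cSUP_upper) (auto intro!: bdd_aboveI2 *)
      then show ?thesis using c(1) c(3)[of "x i"] by (simp add: pos_le_divide_eq mult.commute)
    qed
    then have "norm x \<le> supn N x / c" by (rule norm_bound)
    then show ?thesis using c(1) by (simp add: pos_le_divide_eq mult.commute)
  qed
  show thesis using that[OF c(1,2) 2 1] .
qed

lemma open_iff_supn:
  fixes N :: "real ^ 'n \<Rightarrow> real" and V :: "('m::finite, real ^ 'n) linf set"
  assumes "is_norm N"
  shows "open V \<longleftrightarrow> (\<forall>x\<in>V. \<exists>e>0. \<forall>y. supn N (y - x) < e \<longrightarrow> y \<in> V)"
proof -
  obtain c C where c: "c > 0" "C > 0" "\<And>x :: ('m, real ^ 'n) linf. c * norm x \<le> supn N x"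
    "\<And>x :: ('m, real ^ 'n) linf. supn N x \<le> C * norm x"
    using supn_equivalent[OF assms] by metis
  have "(\<exists>e>0. \<forall>y. norm (y - x) < e \<longrightarrow> y \<in> V) \<longleftrightarrow>
        (\<exists>e>0. \<forall>y. supn N (y - x) < e \<longrightarrow> y \<in> V)" for x
  proof
    assume "\<exists>e>0. \<forall>y. norm (y - x) < e \<longrightarrow> y \<in> V"
    then obtain e where e: "e > 0" "\<And>y. norm (y - x) < e \<Longrightarrow> y \<in> V" by blast
    have "y \<in> V" if "supn N (y - x) < c * e" for y
    proof (rule e(2))
      have "c * norm (y - x) < c * e" using that c(3)[of "y - x"] by linarith
      then show "norm (y - x) < e" using c(1) by simp
    qed
    then show "\<exists>e>0. \<forall>y. supn N (y - x) < e \<longrightarrow> y \<in> V"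
      using e(1) c(1) by (intro exI[of _ "c * e"]) simp
  next
    assume "\<exists>e>0. \<forall>y. supn N (y - x) < e \<longrightarrow> y \<in> V"
    then obtain e where e: "e > 0" "\<And>y. supn N (y - x) < e \<Longrightarrow> y \<in> V" by blast
    have "y \<in> V" if "norm (y - x) < e / C" for y
    proof (rule e(2))
      have "C * norm (y - x) < e" using that c(2) by (simp add: field_simps)
      then show "supn N (y - x) < e" using c(4)[of "y - x"] by linarith
    qed
    then show "\<exists>e>0. \<forall>y. norm (y - x) < e \<longrightarrow> y \<in> V"
      using e(1) c(2) by (intro exI[of _ "e / C"]) simp
  qed
  then show ?thesis by (simp add: open_dist dist_norm)
qed

lemma has_derivative_iff_supn:
  fixes N :: "real ^ 'n \<Rightarrow> real" and f :: "('m::finite, real ^ 'n) linf \<Rightarrow> ('m, real ^ 'n) linf"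
  assumes "is_norm N"
  shows "(f has_derivative f') (at x) \<longleftrightarrow>
    bounded_linear f' \<and>
    (\<forall>e>0. \<forall>\<^sub>F y in nhds x. supn N (f y - f x - f' (y - x)) \<le> e * supn N (y - x))"
proof -
  obtain c C where c: "c > 0" "C > 0" "\<And>x :: ('m, real ^ 'n) linf. c * norm x \<le> supn N x"
    "\<And>x :: ('m, real ^ 'n) linf. supn N x \<le> C * norm x"
    using supn_equivalent[OF assms] by metis
  have to: "supn N u \<le> e * supn N v" if "norm u \<le> (e * c / C) * norm v" "e > 0"
    for u v :: "('m, real ^ 'n) linf" and e
  proof -
    have "supn N u \<le> C * norm u" by (rule c)
    also have "\<dots> \<le> C * ((e * c / C) * norm v)" using that(1) c(2) by (intro mult_left_mono) auto
    also have "\<dots> = e * (c * norm v)" using c(2) by simp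
    also have "\<dots> \<le> e * supn N v" using that(2) c(3)[of v] by (intro mult_left_mono) auto
    finally show ?thesis .
  qed
  have fro: "norm u \<le> e * norm v" if "supn N u \<le> (e * c / C) * supn N v" "e > 0"
    for u v :: "('m, real ^ 'n) linf" and e
  proof -
    have "c * norm u \<le> supn N u" by (rule c)
    also have "\<dots> \<le> (e * c / C) * supn N v" by (rule that)
    also have "\<dots> \<le> (e * c / C) * (C * norm v)"
      using that(2) c(1,2) c(4)[of v] by (intro mult_left_mono) auto
    also have "\<dots> = c * (e * norm v)" using c(2) by simp
    finally show ?thesis using c(1) by simp
  qed
  have "(f has_derivative f') (at x) \<longleftrightarrow> bounded_linear f' \<and>
    (\<forall>e>0. \<forall>\<^sub>F y in nhds x. norm (f y - f x - f' (y - x)) \<le> e * norm (y - x))"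
    unfolding has_derivative_at_alt eventually_nhds_metric dist_norm ..
  also have "\<dots> \<longleftrightarrow> bounded_linear f' \<and>
    (\<forall>e>0. \<forall>\<^sub>F y in nhds x. supn N (f y - f x - f' (y - x)) \<le> e * supn N (y - x))"
  proof (intro conj_cong refl iffI allI impI)
    fix e :: real assume "e > 0"
    assume "\<forall>e>0. \<forall>\<^sub>F y in nhds x. norm (f y - f x - f' (y - x)) \<le> e * norm (y - x)"
    then have "\<forall>\<^sub>F y in nhds x. norm (f y - f x - f' (y - x)) \<le> (e * c / C) * norm (y - x)"
      using \<open>e > 0\<close> c(1,2) by (auto dest!: spec[of _ "e * c / C"] simp del: times_divide_eq_left)
    then show "\<forall>\<^sub>F y in nhds x. supn N (f y - f x - f' (y - x)) \<le> e * supn N (y - x)"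
      by eventually_elim (use to \<open>e > 0\<close> in blast)
  next
    fix e :: real assume "e > 0"
    assume "\<forall>e>0. \<forall>\<^sub>F y in nhds x. supn N (f y - f x - f' (y - x)) \<le> e * supn N (y - x)"
    then have "\<forall>\<^sub>F y in nhds x. supn N (f y - f x - f' (y - x)) \<le> (e * c / C) * supn N (y - x)"
      using \<open>e > 0\<close> c(1,2) by (auto dest!: spec[of _ "e * c / C"] simp del: times_divide_eq_left)
    then show "\<forall>\<^sub>F y in nhds x. norm (f y - f x - f' (y - x)) \<le> e * norm (y - x)"
      by eventually_elim (use fro \<open>e > 0\<close> in blast)
  qed
  finally show ?thesis .
qed


section \<open>Decay functions and maps with decay\<close>

definition decay_function :: "(int ^ 'm \<Rightarrow> real) \<Rightarrow> bool" where
  "decay_function \<Gamma> \<longleftrightarrow>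
     (\<forall>k. 0 < \<Gamma> k) \<and>
     \<Gamma> summable_on UNIV \<and> (\<Sum>\<^sub>\<infinity>k. \<Gamma> k) \<le> 1 \<and>
     (\<forall>i j. (\<lambda>k. \<Gamma> (i - k) * \<Gamma> (k - j)) summable_on UNIV \<and>
            (\<Sum>\<^sub>\<infinity>k. \<Gamma> (i - k) * \<Gamma> (k - j)) \<le> \<Gamma> (i - j))"

definition supported_at :: "int ^ 'm \<Rightarrow> ('m::finite, 'v::real_normed_vector) linf \<Rightarrow> bool" where
  "supported_at k u \<longleftrightarrow> (\<forall>j. j \<noteq> k \<longrightarrow> u j = 0)"

text \<open>The norms of maps are \<^typ>\<open>ennreal\<close>-valued, so that the suprema always exist and
  boundedness is finiteness.\<close>

definition op_norm ::
  "('v::real_normed_vector \<Rightarrow> real) \<Rightarrow> (('m::finite, 'v) linf \<Rightarrow> ('m, 'v) linf) \<Rightarrow> ennreal" where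
  "op_norm N A = (SUP u\<in>{u. supn N u \<le> 1}. ennreal (supn N (A u)))"

definition op_gamma ::
  "(int ^ 'm \<Rightarrow> real) \<Rightarrow> ('v::real_normed_vector \<Rightarrow> real) \<Rightarrow>
     (('m::finite, 'v) linf \<Rightarrow> ('m, 'v) linf) \<Rightarrow> ennreal" where
  "op_gamma \<Gamma> N A =
     (SUP i. SUP k. SUP u\<in>{u. supn N u \<le> 1 \<and> supported_at k u}. ennreal (N (A u i) / \<Gamma> (i - k)))"

definition op_norm_decay ::
  "(int ^ 'm \<Rightarrow> real) \<Rightarrow> ('v::real_normed_vector \<Rightarrow> real) \<Rightarrow>
     (('m::finite, 'v) linf \<Rightarrow> ('m, 'v) linf) \<Rightarrow> ennreal" where
  "op_norm_decay \<Gamma> N A = max (op_norm N A) (op_gamma \<Gamma> N A)"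

text \<open>A \<open>k\<close>-linear map acts on argument lists of length \<open>k\<close>; its values on lists of other
  lengths are irrelevant throughout. In particular a \<open>0\<close>-linear map is the vector \<open>A []\<close>.\<close>

definition multilinear_map ::
  "nat \<Rightarrow> ('v::real_vector list \<Rightarrow> 'v) \<Rightarrow> bool" where
  "multilinear_map k A \<longleftrightarrow>
     (\<forall>vs ws. length vs + 1 + length ws = k \<longrightarrow> linear (\<lambda>u. A (vs @ u # ws)))"

definition unit_args ::
  "('v::real_normed_vector \<Rightarrow> real) \<Rightarrow> nat \<Rightarrow> ('m::finite, 'v) linf list set" where
  "unit_args N k = {vs. length vs = k \<and> (\<forall>v\<in>set vs. supn N v \<le> 1)}"

definition mult_norm ::
  "('v::real_normed_vector \<Rightarrow> real) \<Rightarrow> nat \<Rightarrow> (('m::finite, 'v) linf list \<Rightarrow> ('m, 'v) linf) \<Rightarrow> ennreal" where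
  "mult_norm N k A = (SUP vs\<in>unit_args N k. ennreal (supn N (A vs)))"

definition mult_gamma ::
  "(int ^ 'm \<Rightarrow> real) \<Rightarrow> ('v::real_normed_vector \<Rightarrow> real) \<Rightarrow> nat \<Rightarrow>
     (('m::finite, 'v) linf list \<Rightarrow> ('m, 'v) linf) \<Rightarrow> ennreal" where
  "mult_gamma \<Gamma> N k A =
     (SUP p\<in>{1..k}. SUP i. SUP l.
        SUP w\<in>{w. supn N w \<le> 1 \<and> supported_at l w}. SUP vs\<in>unit_args N (k - 1).
          ennreal (N (A (take (p - 1) vs @ w # drop (p - 1) vs) i) / \<Gamma> (i - l)))"

definition mult_norm_decay ::
  "(int ^ 'm \<Rightarrow> real) \<Rightarrow> ('v::real_normed_vector \<Rightarrow> real) \<Rightarrow> nat \<Rightarrow>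
     (('m::finite, 'v) linf list \<Rightarrow> ('m, 'v) linf) \<Rightarrow> ennreal" where
  "mult_norm_decay \<Gamma> N k A = max (mult_norm N k A) (mult_gamma \<Gamma> N k A)"

definition mult_decay ::
  "(int ^ 'm \<Rightarrow> real) \<Rightarrow> ('v::real_normed_vector \<Rightarrow> real) \<Rightarrow> nat \<Rightarrow>
     (('m::finite, 'v) linf list \<Rightarrow> ('m, 'v) linf) set" where
  "mult_decay \<Gamma> N k = {A. multilinear_map k A \<and> mult_norm_decay \<Gamma> N k A < \<infinity>}"

definition polynomial_decay ::
  "(int ^ 'm \<Rightarrow> real) \<Rightarrow> ('v::real_normed_vector \<Rightarrow> real) \<Rightarrow> nat \<Rightarrow>
     (('m::finite, 'v) linf \<Rightarrow> ('m, 'v) linf) \<Rightarrow> bool" where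
  "polynomial_decay \<Gamma> N d P \<longleftrightarrow>
     (\<exists>P0 Q. (\<forall>j\<in>{1..d}. Q j \<in> mult_decay \<Gamma> N j) \<and>
             (\<forall>x. P x = P0 + (\<Sum>j=1..d. Q j (replicate j x))))"


section \<open>Differentiability with decay\<close>

text \<open>\<open>D j x\<close> is the \<open>j\<close>-th derivative of \<open>F\<close> at \<open>x\<close>, as a bounded \<open>j\<close>-linear map: \<open>D (j + 1) x\<close>
  is the Frechet derivative at \<open>x\<close> of \<open>y \<mapsto> D j y\<close>, a map into the bounded \<open>j\<close>-linear maps with
  their operator norm, where \<open>L(E, L\<^sup>j(E))\<close> is identified with \<open>L\<^sup>j\<^sup>+\<^sup>1(E)\<close> by putting the new
  argument first. On an open set \<open>V\<close> the family is unique.\<close>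

definition frechet_derivs ::
  "('v::real_normed_vector \<Rightarrow> real) \<Rightarrow> nat \<Rightarrow> ('m::finite, 'v) linf set \<Rightarrow>
     (('m, 'v) linf \<Rightarrow> ('m, 'v) linf) \<Rightarrow>
     (nat \<Rightarrow> ('m, 'v) linf \<Rightarrow> ('m, 'v) linf list \<Rightarrow> ('m, 'v) linf) \<Rightarrow> bool" where
  "frechet_derivs N r V F D \<longleftrightarrow>
     (\<forall>x\<in>V. D 0 x [] = F x) \<and>
     (\<forall>j\<le>r. \<forall>x\<in>V. multilinear_map j (D j x) \<and> mult_norm N j (D j x) < \<infinity>) \<and>
     (\<forall>j<r. \<forall>x\<in>V. \<forall>e>0. \<forall>\<^sub>F y in nhds x.
        mult_norm N j (\<lambda>vs. D j y vs - D j x vs - D (Suc j) x ((y - x) # vs))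
          \<le> ennreal (e * supn N (y - x))) \<and>
     (\<forall>x\<in>V. \<forall>e>0. \<forall>\<^sub>F y in nhds x. mult_norm N r (\<lambda>vs. D r y vs - D r x vs) \<le> ennreal e)"

definition C_decay ::
  "(int ^ 'm \<Rightarrow> real) \<Rightarrow> ('v::real_normed_vector \<Rightarrow> real) \<Rightarrow> nat \<Rightarrow> ('m::finite, 'v) linf set \<Rightarrow>
     (('m, 'v) linf \<Rightarrow> ('m, 'v) linf) set" where
  "C_decay \<Gamma> N r V =
     {F. \<exists>D. frechet_derivs N r V F D \<and>
             (SUP x\<in>V. ennreal (supn N (F x))) < \<infinity> \<and>
             (\<forall>j\<in>{1..r}. (\<forall>x\<in>V. D j x \<in> mult_decay \<Gamma> N j) \<and>
                         (SUP x\<in>V. mult_norm_decay \<Gamma> N j (D j x)) < \<infinity>)}"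


section \<open>Complexification and spectrum\<close>

definition linf_scale :: "complex \<Rightarrow> ('m::finite, complex ^ 'n) linf \<Rightarrow> ('m, complex ^ 'n) linf" where
  "linf_scale c z = Bcontfun (\<lambda>i. c *s z i)"

definition linf_Re :: "('m::finite, complex ^ 'n) linf \<Rightarrow> ('m, real ^ 'n) linf" where
  "linf_Re z = Bcontfun (\<lambda>i. \<chi> j. Re (z i $ j))"

definition linf_Im :: "('m::finite, complex ^ 'n) linf \<Rightarrow> ('m, real ^ 'n) linf" where
  "linf_Im z = Bcontfun (\<lambda>i. \<chi> j. Im (z i $ j))"

definition linf_complex ::
  "('m::finite, real ^ 'n) linf \<Rightarrow> ('m, real ^ 'n) linf \<Rightarrow> ('m, complex ^ 'n) linf" where
  "linf_complex x y = Bcontfun (\<lambda>i. \<chi> j. Complex (x i $ j) (y i $ j))"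

lemma linf_scale_apply: "linf_scale c z i = c *s z i"
proof -
  have "norm (c *s z i) \<le> cmod c * norm z" for i
  proof -
    have "norm (c *s z i) = cmod c * norm (z i)"
      by (simp add: norm_vec_def norm_mult L2_set_right_distrib)
    then show ?thesis using norm_bounded[of z i] by (simp add: mult_left_mono)
  qed
  then have "(\<lambda>i. c *s z i) \<in> bcontfun"
    by (intro bounded_family_in_bcontfun) (auto simp: bounded_iff)
  then show ?thesis by (simp add: linf_scale_def Bcontfun_inverse)
qed

lemma linf_Re_apply: "linf_Re z i = (\<chi> j. Re (z i $ j))"
proof -
  have "norm (\<chi> j. Re (z i $ j)) \<le> norm z" for i
  proof -
    have "norm (\<chi> j. Re (z i $ j)) \<le> norm (z i)"
      unfolding norm_vec_def by (rule L2_set_mono) (auto simp: abs_Re_le_cmod)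
    then show ?thesis using norm_bounded[of z i] by linarith
  qed
  then have "(\<lambda>i. \<chi> j. Re (z i $ j)) \<in> bcontfun"
    by (intro bounded_family_in_bcontfun) (auto simp: bounded_iff)
  then show ?thesis by (simp add: linf_Re_def Bcontfun_inverse)
qed

lemma linf_Im_apply: "linf_Im z i = (\<chi> j. Im (z i $ j))"
proof -
  have "norm (\<chi> j. Im (z i $ j)) \<le> norm z" for i
  proof -
    have "norm (\<chi> j. Im (z i $ j)) \<le> norm (z i)"
      unfolding norm_vec_def by (rule L2_set_mono) (auto simp: abs_Im_le_cmod)
    then show ?thesis using norm_bounded[of z i] by linarith
  qed
  then have "(\<lambda>i. \<chi> j. Im (z i $ j)) \<in> bcontfun"
    by (intro bounded_family_in_bcontfun) (auto simp: bounded_iff)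
  then show ?thesis by (simp add: linf_Im_def Bcontfun_inverse)
qed

lemma linf_complex_apply: "linf_complex x y i = (\<chi> j. Complex (x i $ j) (y i $ j))"
proof -
  have "norm (\<chi> j. Complex (x i $ j) (y i $ j)) \<le> norm x + norm y" for i
  proof -
    have "norm (\<chi> j. Complex (x i $ j) (y i $ j))
        \<le> L2_set (\<lambda>j. norm (x i $ j) + norm (y i $ j)) UNIV"
      unfolding norm_vec_def
      by (rule L2_set_mono) (auto intro: order_trans[OF cmod_le])
    also have "\<dots> \<le> norm (x i) + norm (y i)"
      unfolding norm_vec_def by (rule L2_set_triangle_ineq)
    finally show ?thesis using norm_bounded[of x i] norm_bounded[of y i] by linarith
  qed
  then have "(\<lambda>i. \<chi> j. Complex (x i $ j) (y i $ j)) \<in> bcontfun"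
    by (intro bounded_family_in_bcontfun) (auto simp: bounded_iff)
  then show ?thesis by (simp add: linf_complex_def Bcontfun_inverse)
qed

definition complex_linear ::
  "(('m::finite, complex ^ 'n) linf \<Rightarrow> ('m, complex ^ 'n) linf) \<Rightarrow> bool" where
  "complex_linear B \<longleftrightarrow>
     (\<forall>u v. B (u + v) = B u + B v) \<and> (\<forall>c u. B (linf_scale c u) = linf_scale c (B u))"

definition complex_lin_decay ::
  "(int ^ 'm \<Rightarrow> real) \<Rightarrow> (complex ^ 'n \<Rightarrow> real) \<Rightarrow>
     (('m::finite, complex ^ 'n) linf \<Rightarrow> ('m, complex ^ 'n) linf) set" where
  "complex_lin_decay \<Gamma> NC = {B. complex_linear B \<and> op_norm_decay \<Gamma> NC B < \<infinity>}"

definition complex_extension ::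
  "(('m::finite, real ^ 'n) linf \<Rightarrow> ('m, real ^ 'n) linf) \<Rightarrow>
     ('m, complex ^ 'n) linf \<Rightarrow> ('m, complex ^ 'n) linf" where
  "complex_extension A z = linf_complex (A (linf_Re z)) (A (linf_Im z))"

definition Spec_decay ::
  "(int ^ 'm \<Rightarrow> real) \<Rightarrow> (complex ^ 'n \<Rightarrow> real) \<Rightarrow>
     (('m::finite, real ^ 'n) linf \<Rightarrow> ('m, real ^ 'n) linf) \<Rightarrow> complex set" where
  "Spec_decay \<Gamma> NC A =
     - {\<mu>. let T = (\<lambda>z. complex_extension A z - linf_scale \<mu> z)
            in bij T \<and> inv T \<in> complex_lin_decay \<Gamma> NC}"

end

theory Submission
  imports Defs "HOL-Library.Multiset" "HOL-Complex_Analysis.Complex_Analysis"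
begin

text \<open>Put \<open>L = r\<^sub>0\<close>, let \<open>H = A + p\<close> be the Taylor polynomial of \<open>F\<close> at \<open>0\<close> of degree \<open>L\<close>, where
  \<open>p\<close> has no linear part, and solve \<open>R \<circ> F = H \<circ> R\<close> as the fixed point equation
  \<open>R = T R\<close> with \<open>T R = A\<^sup>-\<^sup>1 (R \<circ> F - p \<circ> R)\<close>. The iterates \<open>T\<^sup>n id\<close> have the derivatives of the
  identity at \<open>0\<close> up to order \<open>L - 1\<close>. On maps with this property, the distance measured by the
  \<open>L\<close>-th derivative is contracted by about \<open>\<bar>A\<^sup>-\<^sup>1\<bar> \<bar>A\<bar>\<^sup>L\<close>, which is less than \<open>1\<close> in a norm adapted to the
  spectrum, as \<open>\<beta>\<^sup>L < \<alpha>\<close>. The derivatives of order \<open>L < j \<le> r\<close> converge one after the other,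
  because the \<open>j\<close>-th one is contracted in the same way up to terms given by the lower ones.

  Decay is carried along by bounding, besides \<open>\<bar>x\<bar> \<le> c\<close>, also \<open>\<bar>x\<^sub>i\<bar> \<le> c \<Gamma>(i - l)\<close> for the lattice
  points \<open>l\<close>. By the convolution inequality, a multilinear map has decay precisely if it turns bounds of
  the first kind, with at most one exception of the second kind, into a bound of the same kind as the exception.
  This property is stable under composition, so the iteration can be run with such bounds in place
  of the norm. The bounds on \<open>A\<^sup>n\<close> and \<open>A\<^sup>-\<^sup>n\<close> in terms of \<open>\<alpha>\<close> and \<open>\<beta>\<close> come from the resolvent in \<open>L\<^sub>\<Gamma>\<close> by
  Cauchy's estimates. Finally, the local conjugacy is composed with a cutoff that acts on each real
  coordinate separately, so that its derivatives are diagonal and have decay.\<close>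

text \<open>No nonresonance condition is needed because \<open>H\<close> keeps every Taylor term up
  to order \<open>L\<close>: \<open>R\<close> only has to agree with the identity to order
  \<open>L - 1\<close> at \<open>0\<close>. The gain comes from the chain rule. In the derivative of
  order \<open>L\<close> of \<open>R o F\<close>, the top derivative of \<open>R\<close> is composed
  with \<open>L\<close> copies of \<open>DF\<close>, at a cost of about \<open>b\<close> each. In
  \<open>p o R\<close> it is multiplied by \<open>Dp\<close>, which is small near \<open>0\<close>.
  The differences of lower order vanish at \<open>0\<close>, so on a small ball they are small
  multiples of the top one.

  The factor \<open>b ^ L\<close> is available only if \<open>b\<close> bounds \<open>DF\<close> on
  every single argument, decay included. So the change of norm is made on vectors, for all kinds of
  bounds at once. This is why the analysis is written for an abstract family \<open>Z\<close> of
  bounds: it is used for the norm, for bounds with decay, and for their suprema along the powers of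
  \<open>A\<close> and its inverse. Orders above \<open>L\<close> cannot enter the same contraction,
  since the lower differences come with constants that smallness of the ball does not tame there.
  The orders form a triangular system, and each one needs a bound before it has a rate.\<close>

section \<open>Multilinear maps, sizes and jets\<close>

text \<open>\<open>parts j\<close> lists the set partitions of \<open>{0..<j}\<close>. The recursion follows the product and chain
  rules: differentiating a term of Faa di Bruno's formula puts the new argument either into a block of
  its own or into an existing block.\<close>

fun parts :: "nat \<Rightarrow> nat list list list" where
  "parts 0 = [[]]"
| "parts (Suc j) = concat (map (\<lambda>\<pi>. ([0] # map (map Suc) \<pi>) #
      map (\<lambda>m. (map (map Suc) \<pi>)[m := 0 # map Suc (\<pi> ! m)]) [0..<length \<pi>]) (parts j))"

lemma mset_concat_update:
  assumes "m < length xs"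
  shows "mset (concat (xs[m := y # xs ! m])) = add_mset y (mset (concat xs))"
proof -
  have "concat xs = concat (take m xs @ xs ! m # drop (Suc m) xs)"
    using assms by (simp add: id_take_nth_drop[symmetric])
  then show ?thesis using assms by (simp add: upd_conv_take_nth_drop)
qed

lemma concat_map_Suc: "concat (map (map Suc) \<pi>) = map Suc (concat \<pi>)"
  by (simp add: map_concat)

text \<open>Only the multiset of the concatenated blocks matters: it allows sums and products over
  the arguments to be regrouped block by block.\<close>

lemma parts_props:
  "\<pi> \<in> set (parts j) \<Longrightarrow> mset (concat \<pi>) = mset [0..<j] \<and> (\<forall>I\<in>set \<pi>. I \<noteq> [])"
proof (induction j arbitrary: \<pi>)
  case 0
  then show ?case by simp
next
  case (Suc j)
  have upt: "mset [0..<Suc j] = add_mset 0 (image_mset Suc (mset [0..<j]))"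
    by (metis mset.simps(2) mset_map upt_conv_Cons map_Suc_upt zero_less_Suc)
  obtain \<sigma> where \<sigma>: "\<sigma> \<in> set (parts j)" and
    p: "\<pi> \<in> set (([0] # map (map Suc) \<sigma>) #
      map (\<lambda>m. (map (map Suc) \<sigma>)[m := 0 # map Suc (\<sigma> ! m)]) [0..<length \<sigma>])"
    using Suc.prems by (simp only: parts.simps set_concat set_map) blast
  then have d: "\<pi> = [0] # map (map Suc) \<sigma> \<or>
      (\<exists>m<length \<sigma>. \<pi> = (map (map Suc) \<sigma>)[m := 0 # map Suc (\<sigma> ! m)])"
    by auto
  have IH: "mset (concat \<sigma>) = mset [0..<j]" "\<forall>I\<in>set \<sigma>. I \<noteq> []" using Suc.IH[OF \<sigma>] by auto
  from d show ?case
  proof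
    assume "\<pi> = [0] # map (map Suc) \<sigma>"
    then show ?thesis using IH upt by (auto simp: concat_map_Suc simp del: upt_Suc)
  next
    assume "\<exists>m<length \<sigma>. \<pi> = (map (map Suc) \<sigma>)[m := 0 # map Suc (\<sigma> ! m)]"
    then obtain m where m: "m < length \<sigma>" "\<pi> = (map (map Suc) \<sigma>)[m := 0 # map Suc (\<sigma> ! m)]" by blast
    have "mset (concat \<pi>) = add_mset 0 (mset (concat (map (map Suc) \<sigma>)))"
      using mset_concat_update[of m "map (map Suc) \<sigma>" 0] m by simp
    moreover have "I \<noteq> []" if "I \<in> set \<pi>" for I
      using that IH(2) set_update_subset_insert[of "map (map Suc) \<sigma>" m "0 # map Suc (\<sigma> ! m)"]
      unfolding m(2) by auto
    ultimately show ?thesis using IH(1) upt by (simp add: concat_map_Suc del: upt_Suc)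
  qed
qed

text \<open>Every block holds at least one element. The last estimate isolates the two extreme
  partitions: \<open>j\<close> blocks must be singletons, and a block of length \<open>j\<close>
  leaves no room for another.\<close>

lemma parts_length:
  assumes "\<pi> \<in> set (parts j)"
  shows "sum_list (map length \<pi>) = j" "length \<pi> \<le> j" "\<And>I. I \<in> set \<pi> \<Longrightarrow> 1 \<le> length I"
    "\<And>I. I \<in> set \<pi> \<Longrightarrow> length I + (length \<pi> - 1) \<le> j"
proof -
  have "length (concat \<pi>) = length [0..<j]"
    using parts_props[OF assms] by (metis size_mset)
  then show s: "sum_list (map length \<pi>) = j" by (simp add: length_concat)
  have ge: "length I \<ge> 1" if "I \<in> set \<pi>" for I using parts_props[OF assms] that by (cases I) auto
  have g: "length xs \<le> sum_list (map length xs)" if "\<forall>I\<in>set xs. length I \<ge> 1" for xs :: "nat list list"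
    using that by (induction xs) auto
  show "length \<pi> \<le> j" using g[of \<pi>] ge s by auto
  show "\<And>I. I \<in> set \<pi> \<Longrightarrow> 1 \<le> length I" by (rule ge)
  show "length I + (length \<pi> - 1) \<le> j" if I: "I \<in> set \<pi>" for I
  proof -
    obtain ys zs where p: "\<pi> = ys @ I # zs" using I by (meson split_list)
    show ?thesis using s g[of ys] g[of zs] ge unfolding p by auto
  qed
qed

text \<open>The recursion of the Stirling numbers of the second kind, tested against a weight
  \<open>f\<close> on the number of blocks.\<close>

lemma parts_count:
  "(\<Sum>\<pi>\<leftarrow>parts (Suc j). f (length \<pi>)) =
   (\<Sum>\<pi>\<leftarrow>parts j. f (Suc (length \<pi>)) + real (length \<pi>) * f (length \<pi>))"
proof -
  have c: "sum_list (map f (concat xss)) = (\<Sum>xs\<leftarrow>xss. sum_list (map f xs))"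
    for f :: "nat list list \<Rightarrow> real" and xss
    by (induction xss) auto
  have k: "(\<Sum>m\<leftarrow>[0..<n]. c) = real n * c" for n and c :: real
    by (induction n) (auto simp: algebra_simps)
  show ?thesis
    by (simp add: c o_def k)
qed

text \<open>Exactly one term of the chain rule differentiates the outer map \<open>j\<close> times,
  so the leading term of the contraction estimate has coefficient 1. The gap condition would not
  tolerate a larger one.\<close>

lemma parts_count_top: "(\<Sum>\<pi>\<leftarrow>parts j. if length \<pi> = j then 1 else 0 :: real) = 1"
proof (induction j)
  case 0
  then show ?case by simp
next
  case (Suc j)
  have "(\<Sum>\<pi>\<leftarrow>parts (Suc j). if length \<pi> = Suc j then 1 else 0 :: real) =
     (\<Sum>\<pi>\<leftarrow>parts j. if length \<pi> = j then 1 else 0 :: real)"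
    unfolding parts_count[of "\<lambda>n. if n = Suc j then 1 else 0"]
    by (rule arg_cong[where f=sum_list], rule map_cong) (auto dest: parts_length(2))
  then show ?case using Suc.IH by (simp only:)
qed

text \<open>The single block carries all derivatives of the inner map. The index is
  \<open>Suc j\<close> because the only partition of the empty set has no block.\<close>

lemma parts_count_one: "(\<Sum>\<pi>\<leftarrow>parts (Suc j). if length \<pi> = 1 then 1 else 0 :: real) = 1"
proof (induction j)
  case 0
  then show ?case by simp
next
  case (Suc j)
  have *: "length \<pi> > 0" if "\<pi> \<in> set (parts (Suc j))" for \<pi>
    using parts_length(1)[OF that] by (cases \<pi>) auto
  have "(\<Sum>\<pi>\<leftarrow>parts (Suc (Suc j)). if length \<pi> = 1 then 1 else 0 :: real) =
     (\<Sum>\<pi>\<leftarrow>parts (Suc j). if length \<pi> = 1 then 1 else 0 :: real)"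
    apply (subst parts_count[of "\<lambda>n. if n = 1 then 1 else 0"])
    apply (rule arg_cong[where f=sum_list], rule map_cong[OF refl], drule *)
    apply (auto simp del: parts.simps)
    done
  then show ?case using Suc.IH by (simp only:)
qed

section \<open>Bounds for multilinear maps and their compositions\<close>

text \<open>\<open>Z t c x\<close> is read as ``\<open>x\<close> has size at most \<open>c\<close> of type \<open>t\<close>'': type \<open>0\<close> is an ordinary norm bound,
  and the types of the arguments of a multilinear map add up.\<close>

definition mult_bound :: "('t::comm_monoid_add \<Rightarrow> real \<Rightarrow> 'e::real_normed_vector \<Rightarrow> bool) \<Rightarrow> nat \<Rightarrow>
    ('e list \<Rightarrow> 'e) \<Rightarrow> real \<Rightarrow> bool" where
  "mult_bound Z k G C \<longleftrightarrow> 0 \<le> C \<and> (\<forall>l. length l = k \<longrightarrow>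
     (\<forall>q\<in>set l. Z (fst q) (fst (snd q)) (snd (snd q))) \<longrightarrow>
     Z (\<Sum>q\<leftarrow>l. fst q) (C * (\<Prod>q\<leftarrow>l. fst (snd q))) (G (map (\<lambda>q. snd (snd q)) l)))"

lemma mult_boundI:
  assumes "0 \<le> C" "\<And>l. length l = k \<Longrightarrow> (\<And>q. q \<in> set l \<Longrightarrow> Z (fst q) (fst (snd q)) (snd (snd q))) \<Longrightarrow>
     Z (\<Sum>q\<leftarrow>l. fst q) (C * (\<Prod>q\<leftarrow>l. fst (snd q))) (G (map (\<lambda>q. snd (snd q)) l))"
  shows "mult_bound Z k G C"
  using assms unfolding mult_bound_def by blast

lemma mult_boundD:
  assumes "mult_bound Z k G C" "length l = k" "\<And>q. q \<in> set l \<Longrightarrow> Z (fst q) (fst (snd q)) (snd (snd q))"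
  shows "Z (\<Sum>q\<leftarrow>l. fst q) (C * (\<Prod>q\<leftarrow>l. fst (snd q))) (G (map (\<lambda>q. snd (snd q)) l))"
  using assms unfolding mult_bound_def by blast

lemma mult_bound_nonneg: "mult_bound Z k G C \<Longrightarrow> 0 \<le> C"
  by (simp add: mult_bound_def)

lemma mult_bound_cong:
  assumes "mult_bound Z k G C" "\<And>vs. length vs = k \<Longrightarrow> G vs = G' vs"
  shows "mult_bound Z k G' C"
  using assms unfolding mult_bound_def by (metis length_map)

text \<open>The type \<open>nat\<close> is a dummy. It makes ordinary operator norms a special case
  of \<open>mult_bound\<close>.\<close>

abbreviation plain :: "nat \<Rightarrow> real \<Rightarrow> 'e::real_normed_vector \<Rightarrow> bool" where
  "plain t c x \<equiv> norm x \<le> c"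

abbreviation op_bound :: "nat \<Rightarrow> ('e::real_normed_vector list \<Rightarrow> 'e) \<Rightarrow> real \<Rightarrow> bool" where
  "op_bound \<equiv> mult_bound plain"

lemma prod_list_upt: "prod_list (map f [0..<q]) = (\<Prod>m<q. f m)" for f :: "nat \<Rightarrow> 'a::comm_monoid_mult"
  by (induction q) (auto simp: mult.commute)

lemma sum_list_upt: "sum_list (map f [0..<q]) = (\<Sum>m<q. f m)" for f :: "nat \<Rightarrow> 'a::comm_monoid_add"
  by (induction q) (auto simp: add.commute)

text \<open>Used for the types, which add up over the arguments; \<open>prod_blocks\<close> does the
  same for the bounds, which multiply.\<close>

lemma sum_blocks:
  fixes f :: "'a \<Rightarrow> 'b::comm_monoid_add"
  assumes "mset (concat \<pi>) = mset [0..<k]" "length l = k"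
  shows "(\<Sum>m<length \<pi>. \<Sum>x\<leftarrow>map ((!) l) (\<pi> ! m). f x) = (\<Sum>x\<leftarrow>l. f x)"
proof -
  have c: "(\<Sum>I\<leftarrow>\<sigma>. \<Sum>x\<leftarrow>map ((!) l) I. f x) = (\<Sum>x\<leftarrow>map ((!) l) (concat \<sigma>). f x)" for \<sigma>
    by (induction \<sigma>) auto
  have "(\<Sum>m<length \<pi>. \<Sum>x\<leftarrow>map ((!) l) (\<pi> ! m). f x) =
      sum_list (map ((\<lambda>I. \<Sum>x\<leftarrow>map ((!) l) I. f x) \<circ> (!) \<pi>) [0..<length \<pi>])"
    by (simp add: sum_list_upt)
  also have "\<dots> = (\<Sum>I\<leftarrow>\<pi>. \<Sum>x\<leftarrow>map ((!) l) I. f x)"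
    by (simp only: map_map[symmetric] map_nth)
  also have "\<dots> = sum_mset (image_mset (f \<circ> (!) l) (mset (concat \<pi>)))"
    unfolding c by (simp flip: sum_mset_sum_list mset_map)
  also have "\<dots> = sum_list (map f (map ((!) l) [0..<k]))"
    unfolding assms(1) by (simp del: mset_upt flip: sum_mset_sum_list mset_map)
  also have "map ((!) l) [0..<k] = l" using assms(2) map_nth by blast
  finally show ?thesis .
qed

lemma prod_blocks:
  fixes f :: "'a \<Rightarrow> 'b::comm_monoid_mult"
  assumes "mset (concat \<pi>) = mset [0..<k]" "length l = k"
  shows "(\<Prod>m<length \<pi>. \<Prod>x\<leftarrow>map ((!) l) (\<pi> ! m). f x) = (\<Prod>x\<leftarrow>l. f x)"
proof -
  have c: "(\<Prod>I\<leftarrow>\<sigma>. \<Prod>x\<leftarrow>map ((!) l) I. f x) = (\<Prod>x\<leftarrow>map ((!) l) (concat \<sigma>). f x)" for \<sigma>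
    by (induction \<sigma>) auto
  have "(\<Prod>m<length \<pi>. \<Prod>x\<leftarrow>map ((!) l) (\<pi> ! m). f x) =
      prod_list (map ((\<lambda>I. \<Prod>x\<leftarrow>map ((!) l) I. f x) \<circ> (!) \<pi>) [0..<length \<pi>])"
    by (simp add: prod_list_upt)
  also have "\<dots> = (\<Prod>I\<leftarrow>\<pi>. \<Prod>x\<leftarrow>map ((!) l) I. f x)"
    by (simp only: map_map[symmetric] map_nth)
  also have "\<dots> = prod_mset (image_mset (f \<circ> (!) l) (mset (concat \<pi>)))"
    unfolding c by (simp flip: prod_mset_prod_list mset_map)
  also have "\<dots> = prod_list (map f (map ((!) l) [0..<k]))"
    unfolding assms(1) by (simp del: mset_upt flip: prod_mset_prod_list mset_map)
  also have "map ((!) l) [0..<k] = l" using assms(2) map_nth by blast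
  finally show ?thesis .
qed

lemma block_index:
  assumes "mset (concat \<pi>) = mset [0..<k]" "m < length \<pi>" "i \<in> set (\<pi> ! m)"
  shows "i < k"
proof -
  have "i \<in> set (concat \<pi>)" using assms(2,3) by auto
  then have "i \<in> set [0..<k]" using assms(1) by (metis set_mset_mset)
  then show ?thesis by simp
qed

text \<open>One term of Faa di Bruno's formula. The inner maps are indexed by the position of the
  block, so that they can be exchanged one at a time.\<close>

definition comp_term :: "('e list \<Rightarrow> 'e) \<Rightarrow> (nat \<Rightarrow> 'e list \<Rightarrow> 'e) \<Rightarrow> nat list list \<Rightarrow> 'e list \<Rightarrow> 'e" where
  "comp_term B g \<pi> vs = B (map (\<lambda>m. g m (map ((!) vs) (\<pi> ! m))) [0..<length \<pi>])"

text \<open>The outputs of the blocks have types that add up to the sum of the types of all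
  arguments, hence are admissible arguments of \<open>B\<close>. For decay, at most one block
  receives the localised argument, and its output passes the localisation on.\<close>

lemma mult_bound_comp_term:
  assumes B: "mult_bound Z (length \<pi>) B CB" and \<pi>: "mset (concat \<pi>) = mset [0..<k]"
    and g: "\<And>m. m < length \<pi> \<Longrightarrow> mult_bound Z (length (\<pi> ! m)) (g m) (C m)"
  shows "mult_bound Z k (comp_term B g \<pi>) (CB * (\<Prod>m<length \<pi>. C m))"
proof (rule mult_boundI)
  show "0 \<le> CB * (\<Prod>m<length \<pi>. C m)"
    using mult_bound_nonneg[OF B] mult_bound_nonneg[OF g] by (auto intro!: mult_nonneg_nonneg prod_nonneg)
next
  fix l :: "('a \<times> real \<times> 'b) list"
  assume l: "length l = k" "\<And>q. q \<in> set l \<Longrightarrow> Z (fst q) (fst (snd q)) (snd (snd q))"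
  define v where "v = map (\<lambda>q. snd (snd q)) l"
  define bl where "bl m = map ((!) l) (\<pi> ! m)" for m
  have bl: "q \<in> set l" if "m < length \<pi>" "q \<in> set (bl m)" for m q
    using that block_index[OF \<pi>] l(1) by (auto simp: bl_def)
  have blv: "map (\<lambda>q. snd (snd q)) (bl m) = map ((!) v) (\<pi> ! m)" if "m < length \<pi>" for m
    using that block_index[OF \<pi>] l(1) by (auto simp: bl_def v_def)
  \<comment> \<open>The arguments of \<open>B\<close>, each with the type and the bound that its
    block produces.\<close>
  define L where "L = map (\<lambda>m. (\<Sum>q\<leftarrow>bl m. fst q, C m * (\<Prod>q\<leftarrow>bl m. fst (snd q)),
      g m (map ((!) v) (\<pi> ! m)))) [0..<length \<pi>]"
  have "Z (\<Sum>q\<leftarrow>bl m. fst q) (C m * (\<Prod>q\<leftarrow>bl m. fst (snd q))) (g m (map ((!) v) (\<pi> ! m)))"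
    if "m < length \<pi>" for m
    unfolding blv[OF that, symmetric]
    by (rule mult_boundD[OF g[OF that]]) (use bl[OF that] l(2) in \<open>auto simp: bl_def\<close>)
  then have "Z (\<Sum>q\<leftarrow>L. fst q) (CB * (\<Prod>q\<leftarrow>L. fst (snd q))) (B (map (\<lambda>q. snd (snd q)) L))"
    by (intro mult_boundD[OF B]) (auto simp: L_def)
  moreover have "(\<Sum>q\<leftarrow>L. fst q) = (\<Sum>q\<leftarrow>l. fst q)"
    using sum_blocks[OF \<pi> l(1), of fst] by (simp add: L_def o_def bl_def sum_list_upt)
  moreover have "(\<Prod>q\<leftarrow>L. fst (snd q)) = (\<Prod>m<length \<pi>. C m) * (\<Prod>q\<leftarrow>l. fst (snd q))"
    using prod_blocks[OF \<pi> l(1), of "\<lambda>q. fst (snd q)"]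
    by (simp add: L_def o_def bl_def prod_list_upt prod.distrib)
  moreover have "B (map (\<lambda>q. snd (snd q)) L) = comp_term B g \<pi> v"
    by (simp add: L_def comp_term_def o_def)
  ultimately show "Z (\<Sum>q\<leftarrow>l. fst q) (CB * (\<Prod>m<length \<pi>. C m) * (\<Prod>q\<leftarrow>l. fst (snd q)))
     (comp_term B g \<pi> (map (\<lambda>q. snd (snd q)) l))"
    by (simp add: v_def mult.assoc)
qed

lemma upt_split: "m < k \<Longrightarrow> [0..<k] = [0..<m] @ m # [Suc m..<k]"
  by (metis add_diff_inverse_nat less_imp_le_nat not_less upt_add_eq_append upt_conv_Cons zero_le)

text \<open>The entries are exchanged from left to right; neighbouring lists differ in one slot,
  where the map is linear.\<close>

lemma multi_telescope:
  fixes B :: "'e::real_vector list \<Rightarrow> 'e"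
  assumes "multilinear_map k B"
  shows "B (map f [0..<k]) - B (map f' [0..<k]) = (\<Sum>m<k. B (map
     (\<lambda>i. if i < m then f' i else if i = m then f i - f' i else f i) [0..<k]))"
proof -
  define b where "b m = B (map (\<lambda>i. if i < m then f' i else f i) [0..<k])" for m
  have "b m - b (Suc m) = B (map (\<lambda>i. if i < m then f' i else if i = m then f i - f' i else f i) [0..<k])"
    if "m < k" for m
  proof -
    have lin: "linear (\<lambda>u. B (map f' [0..<m] @ u # map f [Suc m..<k]))"
      using assms that unfolding multilinear_map_def by auto
    have 0: "map (\<lambda>i. if i < m then f' i else if i = m then c else f i) [0..<k] =
        map f' [0..<m] @ c # map f [Suc m..<k]" for c
      unfolding upt_split[OF that] by simp
    have 1: "b m = B (map f' [0..<m] @ f m # map f [Suc m..<k])"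
      unfolding b_def 0[symmetric] by (rule arg_cong[where f=B]) auto
    have 2: "b (Suc m) = B (map f' [0..<m] @ f' m # map f [Suc m..<k])"
      unfolding b_def 0[symmetric] by (rule arg_cong[where f=B]) auto
    have 3: "map (\<lambda>i. if i < m then f' i else if i = m then f i - f' i else f i) [0..<k] =
        map f' [0..<m] @ (f m - f' m) # map f [Suc m..<k]"
      unfolding 0[symmetric] by auto
    show ?thesis unfolding 1 2 3 by (rule linear_diff[OF lin, symmetric])
  qed
  then have "(\<Sum>m<k. B (map (\<lambda>i. if i < m then f' i else if i = m then f i - f' i else f i) [0..<k]))
      = (\<Sum>m<k. b m - b (Suc m))"
    by simp
  also have "\<dots> = b 0 - b k" by (rule sum_lessThan_telescope')
  also have "b k = B (map f' [0..<k])" unfolding b_def by (rule arg_cong[where f=B]) auto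
  finally show ?thesis by (simp add: b_def)
qed

lemma comp_term_telescope:
  fixes B :: "'e::real_vector list \<Rightarrow> 'e"
  assumes "multilinear_map (length \<pi>) B"
  shows "comp_term B g \<pi> vs - comp_term B g' \<pi> vs =
    (\<Sum>m<length \<pi>. comp_term B
       (\<lambda>i us. if i < m then g' i us else if i = m then g i us - g' i us else g i us) \<pi> vs)"
  unfolding comp_term_def
  by (rule multi_telescope[OF assms, of "\<lambda>m. g m (map ((!) vs) (\<pi> ! m))" "\<lambda>m. g' m (map ((!) vs) (\<pi> ! m))"])

section \<open>Abstract sizes\<close>

text \<open>\<open>Z t\<close> need not come from a norm on the whole space: a vector may satisfy no
  bound of type \<open>t\<close> at all. Therefore the mean value inequality \<open>Z_mvt\<close> is
  an axiom. Only type \<open>0\<close> is given by a norm, \<open>nrm\<close>, equivalent to the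
  original one.\<close>

locale sized =
  fixes Z :: "'t::comm_monoid_add \<Rightarrow> real \<Rightarrow> 'e::banach \<Rightarrow> bool" and nrm :: "'e \<Rightarrow> real" and kN :: real
  assumes Z_nonneg: "Z t c x \<Longrightarrow> 0 \<le> c"
    and Z_mono: "Z t c x \<Longrightarrow> c \<le> d \<Longrightarrow> Z t d x"
    and Z_add: "Z t c x \<Longrightarrow> Z t d y \<Longrightarrow> Z t (c + d) (x + y)"
    and Z_scaleR: "Z t c x \<Longrightarrow> Z t (\<bar>s\<bar> * c) (s *\<^sub>R x)"
    and Z_zero: "Z t 0 0"
    and Z_lim: "(\<And>n. Z t c (X n)) \<Longrightarrow> X \<longlonglongrightarrow> x \<Longrightarrow> Z t c x"
    and Z_mvt: "(\<And>s. s \<in> {0..1} \<Longrightarrow> (f has_vector_derivative f' s) (at s within {0..1})) \<Longrightarrow>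
      (\<And>s. s \<in> {0..1} \<Longrightarrow> Z t c (f' s)) \<Longrightarrow> Z t c (f 1 - f 0)"
    and Z_nrm: "Z 0 c x \<longleftrightarrow> nrm x \<le> c"
    and norm_le: "norm x \<le> nrm x"
    and nrm_le: "nrm x \<le> kN * norm x"
    and kN_pos: "0 < kN"

lemma unit_interval_bound:
  fixes f :: "real \<Rightarrow> 'a::real_normed_vector"
  assumes "\<And>s. s \<in> {0..1} \<Longrightarrow> (f has_vector_derivative f' s) (at s within {0..1})"
    and "\<And>s. s \<in> {0..1} \<Longrightarrow> norm (f' s) \<le> c"
  shows "norm (f 1 - f 0) \<le> c"
proof -
  have "norm (f 1 - f 0) \<le> c * norm (1 - 0 :: real)"
  proof (rule differentiable_bound[where S="{0..1}" and f'="\<lambda>s h. h *\<^sub>R f' s"])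
    fix s :: real assume s: "s \<in> {0..1}"
    show "(f has_derivative (\<lambda>h. h *\<^sub>R f' s)) (at s within {0..1})"
      using assms(1)[OF s] by (simp add: has_vector_derivative_def)
    show "onorm (\<lambda>h. h *\<^sub>R f' s) \<le> c"
      using mult_right_mono[OF assms(2)[OF s] abs_ge_zero] by (intro onorm_le) (simp add: mult.commute)
  qed auto
  then show ?thesis by simp
qed

text \<open>If a size is a family of weighted bounds on bounded linear maps \<open>\<phi>\<close>,
  each axiom is checked for one \<open>\<phi>\<close> at a time; the mean value inequality becomes
  the usual one for \<open>\<phi> o f\<close>.\<close>

lemma sized_functionals:
  fixes Z :: "'t::comm_monoid_add \<Rightarrow> real \<Rightarrow> 'e::banach \<Rightarrow> bool"
    and \<Phi> :: "'t \<Rightarrow> (('e \<Rightarrow> 'f::real_normed_vector) \<times> real) set"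
  assumes Z: "\<And>t c x. Z t c x \<longleftrightarrow> 0 \<le> c \<and> (\<forall>(\<phi>, w)\<in>\<Phi> t. norm (\<phi> x) \<le> c * w)"
    and bl: "\<And>t \<phi> w. (\<phi>, w) \<in> \<Phi> t \<Longrightarrow> bounded_linear \<phi> \<and> 0 \<le> w"
    and Z0: "\<And>c x. Z 0 c x \<longleftrightarrow> nrm x \<le> c"
    and "\<And>x. norm x \<le> nrm x" "\<And>x. nrm x \<le> kN * norm x" "0 < kN"
  shows "sized Z nrm kN"
proof
  show "Z t c x \<Longrightarrow> 0 \<le> c" for t c x by (simp add: Z)
  show "Z t c x \<Longrightarrow> c \<le> d \<Longrightarrow> Z t d x" for t c d x
    unfolding Z using bl by (fastforce intro: order_trans mult_right_mono)
  show "Z t (c + d) (x + y)" if "Z t c x" "Z t d y" for t c d x y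
    unfolding Z
  proof (intro conjI ballI, goal_cases)
    case 1 then show ?case using that by (simp add: Z)
  next
    case (2 p)
    obtain \<phi> w where p: "p = (\<phi>, w)" by force
    have "bounded_linear \<phi>" using bl 2 p by blast
    then have "\<phi> (x + y) = \<phi> x + \<phi> y" by (simp add: bounded_linear.linear linear_add)
    moreover have "norm (\<phi> x) \<le> c * w" "norm (\<phi> y) \<le> d * w" using that 2 p by (auto simp: Z)
    ultimately have "norm (\<phi> (x + y)) \<le> (c + d) * w"
      using norm_triangle_ineq[of "\<phi> x" "\<phi> y"] by (simp add: distrib_right)
    then show ?case using p by simp
  qed
  show "Z t (\<bar>s\<bar> * c) (s *\<^sub>R x)" if "Z t c x" for t c s x
    unfolding Z
  proof (intro conjI ballI, goal_cases)
    case 1 then show ?case using that by (simp add: Z)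
  next
    case (2 p)
    obtain \<phi> w where p: "p = (\<phi>, w)" by force
    have "bounded_linear \<phi>" using bl 2 p by blast
    then have "\<phi> (s *\<^sub>R x) = s *\<^sub>R \<phi> x" by (simp add: bounded_linear.linear linear_scale)
    moreover have "norm (\<phi> x) \<le> c * w" using that 2 p by (auto simp: Z)
    ultimately have "norm (\<phi> (s *\<^sub>R x)) \<le> \<bar>s\<bar> * c * w"
      by (simp add: mult.assoc mult_left_mono)
    then show ?case using p by simp
  qed
  show "Z t 0 0" for t
    unfolding Z using bl by (auto dest!: bl simp: bounded_linear.linear linear_0)
  show "Z t c x" if X: "\<And>n. Z t c (X n)" "X \<longlonglongrightarrow> x" for t c X x
    unfolding Z
  proof (intro conjI ballI, goal_cases)
    case 1 then show ?case using that by (simp add: Z)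
  next
    case (2 p)
    obtain \<phi> w where p: "p = (\<phi>, w)" by force
    have b: "bounded_linear \<phi>" using bl 2 p by blast
    have "(\<lambda>n. norm (\<phi> (X n))) \<longlonglongrightarrow> norm (\<phi> x)"
      by (rule tendsto_norm[OF bounded_linear.tendsto[OF b X(2)]])
    moreover have "norm (\<phi> (X n)) \<le> c * w" for n using X(1) 2 p by (auto simp: Z)
    ultimately have "norm (\<phi> x) \<le> c * w" by (intro LIMSEQ_le_const2) auto
    then show ?case using p by simp
  qed
  show "Z t c (f 1 - f 0)"
    if f: "\<And>s. s \<in> {0..1} \<Longrightarrow> (f has_vector_derivative f' s) (at s within {0..1})"
      "\<And>s. s \<in> {0..1} \<Longrightarrow> Z t c (f' s)" for f :: "real \<Rightarrow> 'e" and f' t c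
    unfolding Z
  proof (intro conjI ballI, goal_cases)
    case 1 then show ?case using f(2)[of 0] by (simp add: Z)
  next
    case (2 p)
    obtain \<phi> w where p: "p = (\<phi>, w)" by force
    have b: "bounded_linear \<phi>" using bl 2 p by blast
    have "norm (\<phi> (f 1) - \<phi> (f 0)) \<le> c * w"
    proof (rule unit_interval_bound)
      fix s :: real assume s: "s \<in> {0..1}"
      show "((\<lambda>s. \<phi> (f s)) has_vector_derivative \<phi> (f' s)) (at s within {0..1})"
        by (rule bounded_linear.has_vector_derivative[OF b f(1)[OF s]])
      show "norm (\<phi> (f' s)) \<le> c * w" using f(2)[OF s] 2 p by (auto simp: Z)
    qed
    then show ?case using p b by (simp add: bounded_linear.linear linear_diff)
  qed
qed (use assms in auto)

context sized
begin

lemma nrm_nonneg: "0 \<le> nrm x"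
  using norm_le[of x] norm_ge_zero[of x] by linarith

lemma nrm_zero [simp]: "nrm 0 = 0"
  using Z_zero[of 0] nrm_nonneg[of 0] by (simp add: Z_nrm)

lemma Z_refl: "Z 0 (nrm x) x"
  by (simp add: Z_nrm)

lemma nrm_triangle: "nrm (x + y) \<le> nrm x + nrm y"
  using Z_add[OF Z_refl[of x] Z_refl[of y]] by (simp add: Z_nrm)

lemma Z_minus: "Z t c x \<Longrightarrow> Z t c (- x)"
  using Z_scaleR[of t c x "-1"] by simp

lemma nrm_minus: "nrm (- x) = nrm x"
  using Z_minus[OF Z_refl[of x]] Z_minus[OF Z_refl[of "- x"]] by (simp add: Z_nrm)

lemma nrm_diff: "nrm (x - y) = nrm (y - x)"
  using nrm_minus[of "x - y"] by simp

lemma nrm_scaleR: "nrm (s *\<^sub>R x) \<le> \<bar>s\<bar> * nrm x"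
  using Z_scaleR[OF Z_refl[of x], of s] by (simp add: Z_nrm)

lemma continuous_nrm: "continuous_on UNIV nrm"
proof (rule continuous_onI)
  fix x :: 'e and e :: real assume "e > 0"
  have "\<bar>nrm y - nrm x\<bar> \<le> kN * norm (y - x)" for y
    using nrm_triangle[of "y - x" x] nrm_triangle[of "x - y" y] nrm_le[of "y - x"] nrm_diff[of x y]
    by (simp add: abs_le_iff)
  moreover have "kN * norm (y - x) \<le> e" if "dist y x < e / kN" for y
    using that kN_pos by (simp add: dist_norm field_simps)
  ultimately show "\<exists>d>0. \<forall>x'\<in>UNIV. dist x' x < d \<longrightarrow> dist (nrm x') (nrm x) \<le> e"
    using \<open>e > 0\<close> kN_pos by (intro exI[of _ "e / kN"]) (force simp: dist_real_def intro: order_trans)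
qed

lemma open_nrm_ball: "open {x. nrm x < d}"
  by (rule open_Collect_less[OF continuous_nrm]) auto

lemma nrm_segment:
  assumes "nrm x < d" "nrm y < d"
  shows "closed_segment x y \<subseteq> {x. nrm x < d}"
proof
  fix z assume "z \<in> closed_segment x y"
  then obtain u where u: "0 \<le> u" "u \<le> 1" "z = (1 - u) *\<^sub>R x + u *\<^sub>R y" by (auto simp: in_segment)
  have "nrm z \<le> (1 - u) * nrm x + u * nrm y"
    using nrm_triangle[of "(1 - u) *\<^sub>R x" "u *\<^sub>R y"] nrm_scaleR[of "1 - u" x] nrm_scaleR[of u y] u by simp
  also have "\<dots> < d" using assms u
    by (smt (verit, best) convex_bound_lt)
  finally show "z \<in> {x. nrm x < d}" by simp
qed

lemma mult_bound_mono: "mult_bound Z k G C \<Longrightarrow> C \<le> D \<Longrightarrow> mult_bound Z k G D"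
proof (rule mult_boundI)
  assume *: "mult_bound Z k G C" "C \<le> D"
  show "0 \<le> D" using mult_bound_nonneg[OF *(1)] *(2) by simp
  fix l :: "('t \<times> real \<times> 'e) list"
  assume l: "length l = k" "\<And>q. q \<in> set l \<Longrightarrow> Z (fst q) (fst (snd q)) (snd (snd q))"
  have "0 \<le> (\<Prod>q\<leftarrow>l. fst (snd q))" by (rule prod_list_nonneg) (use Z_nonneg[OF l(2)] in auto)
  then show "Z (\<Sum>q\<leftarrow>l. fst q) (D * (\<Prod>q\<leftarrow>l. fst (snd q))) (G (map (\<lambda>q. snd (snd q)) l))"
    using mult_boundD[OF *(1) l] *(2) by (intro Z_mono[OF mult_boundD[OF *(1) l]] mult_right_mono)
qed

lemma mult_bound_zero: "mult_bound Z k (\<lambda>vs. 0) 0"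
  by (rule mult_boundI) (auto simp: Z_zero)

lemma mult_bound_add:
  assumes "mult_bound Z k G C" "mult_bound Z k G' C'"
  shows "mult_bound Z k (\<lambda>vs. G vs + G' vs) (C + C')"
  by (rule mult_boundI) (use assms[THEN mult_bound_nonneg] Z_add[OF mult_boundD[OF assms(1)] mult_boundD[OF
      assms(2)]]
    in \<open>auto simp: distrib_right\<close>)

lemma mult_bound_minus:
  assumes "mult_bound Z k G C"
  shows "mult_bound Z k (\<lambda>vs. - G vs) C"
  by (rule mult_boundI, rule mult_bound_nonneg[OF assms], rule Z_minus[OF mult_boundD[OF assms]])

lemma mult_bound_diff:
  assumes "mult_bound Z k G C" "mult_bound Z k G' C'"
  shows "mult_bound Z k (\<lambda>vs. G vs - G' vs) (C + C')"
  using mult_bound_add[OF assms(1) mult_bound_minus[OF assms(2)]] by simp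

lemma mult_bound_swap: "mult_bound Z k (\<lambda>vs. G vs - G' vs) C \<Longrightarrow> mult_bound Z k (\<lambda>vs. G' vs - G vs) C"
  using mult_bound_minus by fastforce

lemma mult_bound_scaleR:
  assumes "mult_bound Z k G C"
  shows "mult_bound Z k (\<lambda>vs. s *\<^sub>R G vs) (\<bar>s\<bar> * C)"
  by (rule mult_boundI, simp add: mult_bound_nonneg[OF assms], subst mult.assoc, rule Z_scaleR[OF
      mult_boundD[OF assms]])

lemma mult_bound_sum:
  assumes "finite S" "\<And>i. i \<in> S \<Longrightarrow> mult_bound Z k (G i) (C i)"
  shows "mult_bound Z k (\<lambda>vs. \<Sum>i\<in>S. G i vs) (\<Sum>i\<in>S. C i)"
  using assms by (induction S) (auto intro: mult_bound_add simp: mult_bound_zero)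

lemma mult_bound_sum_list:
  assumes "\<And>p. p \<in> set ps \<Longrightarrow> mult_bound Z k (G p) (C p)"
  shows "mult_bound Z k (\<lambda>vs. \<Sum>p\<leftarrow>ps. G p vs) (\<Sum>p\<leftarrow>ps. C p)"
  using assms by (induction ps) (auto intro: mult_bound_add simp: mult_bound_zero)

lemma mult_bound_lim:
  assumes "\<And>n. mult_bound Z k (G n) C" "\<And>vs. length vs = k \<Longrightarrow> (\<lambda>n. G n vs) \<longlonglongrightarrow> G' vs"
  shows "mult_bound Z k G' C"
  by (rule mult_boundI) (use mult_bound_nonneg[OF assms(1)] in \<open>auto intro!: Z_lim[OF mult_boundD[OF
      assms(1)] assms(2)]\<close>)

text \<open>All arguments are given type \<open>0\<close>; replacing \<open>nrm\<close> by the norm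
  costs one factor \<open>kN\<close> per argument.\<close>

lemma mult_bound_op_bound:
  assumes "mult_bound Z k G C"
  shows "op_bound k G (C * kN ^ k)"
proof (rule mult_boundI)
  show "0 \<le> C * kN ^ k" using mult_bound_nonneg[OF assms] kN_pos by simp
  fix l :: "(nat \<times> real \<times> 'e) list"
  assume l: "length l = k" "\<And>q. q \<in> set l \<Longrightarrow> norm (snd (snd q)) \<le> fst (snd q)"
  let ?l = "map (\<lambda>q. (0, kN * fst (snd q), snd (snd q))) l :: ('t \<times> real \<times> 'e) list"
  have "nrm (snd (snd q)) \<le> kN * fst (snd q)" if "q \<in> set l" for q
    using nrm_le[of "snd (snd q)"] l(2)[OF that] kN_pos by (smt (verit) mult_left_mono)
  then have *: "Z (\<Sum>q\<leftarrow>?l. fst q) (C * (\<Prod>q\<leftarrow>?l. fst (snd q))) (G (map (\<lambda>q. snd (snd q)) ?l))"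
    by (intro mult_boundD[OF assms]) (use l in \<open>auto simp: Z_nrm\<close>)
  have 0: "(\<Sum>q\<leftarrow>?l. fst q) = 0" by (induction l) auto
  have 1: "(\<Prod>q\<leftarrow>?l. fst (snd q)) = kN ^ length l * (\<Prod>q\<leftarrow>l. fst (snd q))"
    by (induction l) auto
  have 2: "map (\<lambda>q. snd (snd q)) ?l = map (\<lambda>q. snd (snd q)) l" by simp
  have "nrm (G (map (\<lambda>q. snd (snd q)) l)) \<le> C * (kN ^ k * (\<Prod>q\<leftarrow>l. fst (snd q)))"
    using * unfolding 0 1 2 by (simp only: Z_nrm l(1))
  then show "norm (G (map (\<lambda>q. snd (snd q)) l)) \<le> C * kN ^ k * (\<Prod>q\<leftarrow>l. fst (snd q))"
    using norm_le[of "G (map (\<lambda>q. snd (snd q)) l)"] by (simp add: mult.assoc)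
qed

lemma mult_bound_cons:
  assumes "mult_bound Z (Suc k) G C"
  shows "mult_bound Z k (\<lambda>vs. G (h # vs)) (C * nrm h)"
proof (rule mult_boundI)
  show "0 \<le> C * nrm h" using mult_bound_nonneg[OF assms] nrm_nonneg by simp
  fix l :: "('t \<times> real \<times> 'e) list"
  assume l: "length l = k" "\<And>q. q \<in> set l \<Longrightarrow> Z (fst q) (fst (snd q)) (snd (snd q))"
  show "Z (\<Sum>q\<leftarrow>l. fst q) (C * nrm h * (\<Prod>q\<leftarrow>l. fst (snd q))) (G (h # map (\<lambda>q. snd (snd q)) l))"
  proof -
    have "Z (\<Sum>q\<leftarrow>(0, nrm h, h) # l. fst q) (C * (\<Prod>q\<leftarrow>(0, nrm h, h) # l. fst (snd q)))
       (G (map (\<lambda>q. snd (snd q)) ((0, nrm h, h) # l)))"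
      by (rule mult_boundD[OF assms]) (use l Z_refl in auto)
    then show ?thesis by (simp add: mult.assoc)
  qed
qed

lemma mult_bound_const_append:
  assumes "mult_bound Z (k + m) G C"
  shows "mult_bound Z k (\<lambda>vs. G (vs @ replicate m h)) (C * nrm h ^ m)"
proof (rule mult_boundI)
  show "0 \<le> C * nrm h ^ m" using mult_bound_nonneg[OF assms] nrm_nonneg by simp
  fix l :: "('t \<times> real \<times> 'e) list"
  assume l: "length l = k" "\<And>q. q \<in> set l \<Longrightarrow> Z (fst q) (fst (snd q)) (snd (snd q))"
  have z0: "sum_list (replicate m (0::'t)) = 0" by (induction m) auto
  have "Z (\<Sum>q\<leftarrow>l @ replicate m (0, nrm h, h). fst q) (C * (\<Prod>q\<leftarrow>l @ replicate m (0, nrm h, h). fst (snd q)))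
     (G (map (\<lambda>q. snd (snd q)) (l @ replicate m (0, nrm h, h))))"
    by (rule mult_boundD[OF assms]) (use l Z_refl in auto)
  then show "Z (\<Sum>q\<leftarrow>l. fst q) (C * nrm h ^ m * (\<Prod>q\<leftarrow>l. fst (snd q)))
     (G (map (\<lambda>q. snd (snd q)) l @ replicate m h))"
    by (simp add: z0 mult.assoc mult.commute mult.left_commute)
qed

text \<open>By telescoping, each summand contains one difference, and the other
  \<open>length \<pi> - 1\<close> inner factors cost \<open>K\<close> each.\<close>

lemma mult_bound_comp_diff:
  assumes ml: "multilinear_map (length \<pi>) B" and B: "mult_bound Z (length \<pi>) B CB"
    and \<pi>: "mset (concat \<pi>) = mset [0..<k]" and K: "1 \<le> K"
    and g: "\<And>m. m < length \<pi> \<Longrightarrow> mult_bound Z (length (\<pi> ! m)) (g m) K"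
    and g': "\<And>m. m < length \<pi> \<Longrightarrow> mult_bound Z (length (\<pi> ! m)) (g' m) K"
    and d: "\<And>m. m < length \<pi> \<Longrightarrow> mult_bound Z (length (\<pi> ! m)) (\<lambda>vs. g m vs - g' m vs) (d m)"
  shows "mult_bound Z k (\<lambda>vs. comp_term B g \<pi> vs - comp_term B g' \<pi> vs)
     (CB * K ^ (length \<pi> - 1) * (\<Sum>m<length \<pi>. d m))"
proof -
  let ?q = "length \<pi>"
  have p: "(\<Prod>i<?q. if i = m then d m else K) = K ^ (?q - 1) * d m" if "m < ?q" for m
  proof -
    have "(\<Prod>i<?q. if i = m then d m else K) = d m * (\<Prod>i\<in>{..<?q} - {m}. if i = m then d m else K)"
      using that by (subst prod.remove[of _ m]) auto
    also have "(\<Prod>i\<in>{..<?q} - {m}. if i = m then d m else K) = (\<Prod>i\<in>{..<?q} - {m}. K)"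
      by (rule prod.cong) auto
    finally show ?thesis using that by simp
  qed
  have "mult_bound Z k (comp_term B (\<lambda>i us. if i < m then g' i us else if i
      = m then g i us - g' i us else g i us) \<pi>)
      (CB * (K ^ (?q - 1) * d m))" if "m < ?q" for m
  proof -
    have "mult_bound Z (length (\<pi> ! i)) (\<lambda>us. if i < m then g' i us else if i
        = m then g i us - g' i us else g i us)
       (if i = m then d m else K)" if "i < ?q" for i
      using g[OF that] g'[OF that] d[OF that] by (cases "i < m"; cases "i = m") auto
    from mult_bound_comp_term[OF B \<pi> this] show ?thesis unfolding p[OF that] .
  qed
  then have "mult_bound Z k (\<lambda>vs. \<Sum>m<?q. comp_term B (\<lambda>i us. if i < m then g' i us else
      if i = m then g i us - g' i us else g i us) \<pi> vs) (\<Sum>m<?q. CB * (K ^ (?q - 1) * d m))"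
    by (intro mult_bound_sum) auto
  then show ?thesis
    unfolding comp_term_telescope[OF ml] by (simp add: sum_distrib_left mult.assoc)
qed

end

definition lin_bound :: "('t \<Rightarrow> real \<Rightarrow> 'e \<Rightarrow> bool) \<Rightarrow> ('e \<Rightarrow> 'e) \<Rightarrow> real \<Rightarrow> bool" where
  "lin_bound Z A a \<longleftrightarrow> 0 \<le> a \<and> (\<forall>t c x. Z t c x \<longrightarrow> Z t (a * c) (A x))"

lemma mult_bound_lin_bound: "lin_bound Z A a \<Longrightarrow> mult_bound Z k G C \<Longrightarrow> mult_bound Z k (\<lambda>vs. A (G vs)) (a * C)"
  unfolding lin_bound_def mult_bound_def by (auto simp: mult.assoc)

interpretation pl: sized plain norm 1
proof (rule sized_functionals[where \<Phi>="\<lambda>t. {(id, 1)}"])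
  show "norm x \<le> c \<longleftrightarrow> 0 \<le> c \<and> (\<forall>(\<phi>, w)\<in>{(id, 1)}. norm (\<phi> x) \<le> c * w)" for c and x :: 'a
    using norm_ge_zero[of x] by (auto simp del: norm_ge_zero intro: order_trans)
qed (auto simp: id_def)

lemma op_boundD:
  assumes "op_bound k G C" "length vs = k"
  shows "norm (G vs) \<le> C * (\<Prod>v\<leftarrow>vs. norm v)"
proof -
  let ?l = "map (\<lambda>v. (0::nat, norm v, v)) vs"
  have "norm (G (map (\<lambda>q. snd (snd q)) ?l)) \<le> C * (\<Prod>q\<leftarrow>?l. fst (snd q))"
    by (rule mult_boundD[OF assms(1)]) (use assms(2) in auto)
  then show ?thesis by (simp add: o_def)
qed

lemma op_boundI:
  assumes "0 \<le> C" "\<And>vs. length vs = k \<Longrightarrow> norm (G vs) \<le> C * (\<Prod>v\<leftarrow>vs. norm v)"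
  shows "op_bound k G C"
proof (rule mult_boundI)
  fix l :: "(nat \<times> real \<times> 'a) list"
  assume l: "length l = k" "\<And>q. q \<in> set l \<Longrightarrow> norm (snd (snd q)) \<le> fst (snd q)"
  have "(\<Prod>v\<leftarrow>map (\<lambda>q. snd (snd q)) l. norm v) \<le> (\<Prod>q\<leftarrow>l. fst (snd q))"
    using l(2)
  proof (induction l)
    case (Cons a l)
    have "norm (snd (snd a)) \<le> fst (snd a)" by (rule Cons.prems) simp
    moreover have "(\<Prod>v\<leftarrow>map (\<lambda>q. snd (snd q)) l. norm v) \<le> (\<Prod>q\<leftarrow>l. fst (snd q))"
      by (rule Cons.IH, rule Cons.prems) simp
    moreover have "0 \<le> fst (snd a)" using calculation(1) norm_ge_zero order_trans by blast
    ultimately show ?case by (auto intro!: mult_mono prod_list_nonneg)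
  qed auto
  then show "norm (G (map (\<lambda>q. snd (snd q)) l)) \<le> C * (\<Prod>q\<leftarrow>l. fst (snd q))"
    using assms(2)[of "map (\<lambda>q. snd (snd q)) l"] l(1) assms(1)
    by (smt (verit) length_map mult_left_mono)
qed (rule assms)

section \<open>Jets: families of derivatives\<close>

text \<open>A \<open>C\<^sup>r\<close> map is handled as the family of its derivatives, \<open>G j x vs\<close> being the \<open>j\<close>-th one at \<open>x\<close>.
  The derivatives of order \<open>j < r\<close> are required for fixed \<open>vs\<close> only; by the mean value inequality this and the
  continuity of \<open>G r\<close> in operator norm give Frechet differentiability in operator norm (\<open>jet_taylor\<close>).\<close>

definition jet :: "nat \<Rightarrow> 'e::banach set \<Rightarrow> (nat \<Rightarrow> 'e \<Rightarrow> 'e list \<Rightarrow> 'e) \<Rightarrow> bool" where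
  "jet r V G \<longleftrightarrow> open V \<and> (\<exists>C. \<forall>j\<le>r. \<forall>x\<in>V. op_bound j (G j x) C) \<and>
     (\<forall>j<r. \<forall>x\<in>V. \<forall>vs. length vs = j \<longrightarrow>
        ((\<lambda>y. G j y vs) has_derivative (\<lambda>h. G (Suc j) x (h # vs))) (at x)) \<and>
     (\<forall>x\<in>V. \<forall>e>0. \<forall>\<^sub>F y in nhds x. op_bound r (\<lambda>vs. G r y vs - G r x vs) e)"

lemma jet_open: "jet r V G \<Longrightarrow> open V"
  by (simp add: jet_def)

lemma jet_bound:
  assumes "jet r V G"
  obtains C where "0 \<le> C" "\<And>j x. j \<le> r \<Longrightarrow> x \<in> V \<Longrightarrow> op_bound j (G j x) C"
proof -
  obtain C where C: "\<forall>j\<le>r. \<forall>x\<in>V. op_bound j (G j x) C" using assms unfolding jet_def by blast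
  show thesis
  proof (rule that[of "max C 0"])
    show "op_bound j (G j x) (max C 0)" if "j \<le> r" "x \<in> V" for j x
      using pl.mult_bound_mono[of j "G j x" C "max C 0"] C that by auto
  qed simp
qed

lemma jet_der:
  "jet r V G \<Longrightarrow> j < r \<Longrightarrow> x \<in> V \<Longrightarrow> length vs = j \<Longrightarrow>
    ((\<lambda>y. G j y vs) has_derivative (\<lambda>h. G (Suc j) x (h # vs))) (at x)"
  by (simp add: jet_def)

lemma jet_subset: "jet r V G \<Longrightarrow> open W \<Longrightarrow> W \<subseteq> V \<Longrightarrow> jet r W G"
  unfolding jet_def subset_iff by simp meson

text \<open>A derivative is linear in its newest argument. In the older arguments, additivity and
  homogeneity are inherited by differentiating these identities one order below and using uniqueness
  of derivatives.\<close>

lemma jet_multilinear: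
  assumes J: "jet r V G"
  shows "j \<le> r \<Longrightarrow> x \<in> V \<Longrightarrow> multilinear_map j (G j x)"
proof (induction j arbitrary: x)
  case 0
  then show ?case by (simp add: multilinear_map_def)
next
  case (Suc j)
  show ?case unfolding multilinear_map_def
  proof (intro allI impI)
    fix vs ws :: "'a list" assume l: "length vs + 1 + length ws = Suc j"
    show "linear (\<lambda>u. G (Suc j) x (vs @ u # ws))"
    proof (cases vs)
      case Nil
      have "((\<lambda>y. G j y ws) has_derivative (\<lambda>h. G (Suc j) x (h # ws))) (at x)"
        using jet_der[OF J] Suc.prems l Nil by auto
      then show ?thesis using Nil by (auto dest: has_derivative_linear)
    next
      case (Cons v vs')
      have lin: "linear (\<lambda>u. G j y (vs' @ u # ws))" if "y \<in> V" for y
        using Suc.IH[OF _ that] Suc.prems l Cons unfolding multilinear_map_def by auto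
      have der: "((\<lambda>y. G j y (vs' @ u # ws)) has_derivative (\<lambda>h. G (Suc j) x (h # vs' @ u # ws))) (at x)" for u
        using jet_der[OF J] Suc.prems l Cons by auto
      have V: "open V" "x \<in> V" using J Suc.prems by (auto simp: jet_def)
      show ?thesis
      proof (rule linearI)
        fix u u'
        have "((\<lambda>y. G j y (vs' @ (u + u') # ws)) has_derivative
            (\<lambda>h. G (Suc j) x (h # vs' @ u # ws) + G (Suc j) x (h # vs' @ u' # ws))) (at x)"
          by (rule has_derivative_transform_within_open[OF has_derivative_add[OF der[of u] der[of u']] V])
            (simp add: linear_add[OF lin])
        from fun_cong[OF has_derivative_unique[OF this der[of "u + u'"]], of v]
        show "G (Suc j) x (vs @ (u + u') # ws) = G (Suc j) x (vs @ u # ws) + G (Suc j) x (vs @ u' # ws)"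
          by (simp add: Cons)
      next
        fix c u
        have "((\<lambda>y. G j y (vs' @ (c *\<^sub>R u) # ws)) has_derivative
            (\<lambda>h. c *\<^sub>R G (Suc j) x (h # vs' @ u # ws))) (at x)"
          by (rule has_derivative_transform_within_open[OF has_derivative_scaleR_right[OF der[of u]] V])
            (simp add: linear_scale[OF lin])
        from fun_cong[OF has_derivative_unique[OF this der[of "c *\<^sub>R u"]], of v]
        show "G (Suc j) x (vs @ (c *\<^sub>R u) # ws) = c *\<^sub>R G (Suc j) x (vs @ u # ws)"
          by (simp add: Cons)
      qed
    qed
  qed
qed

text \<open>Identifies composites with the identity without expanding the sum over partitions: it
  suffices to compare the maps themselves.\<close>

lemma jet_unique:
  assumes J: "jet r V G" "jet r V G'" and 0: "\<And>x. x \<in> V \<Longrightarrow> G 0 x [] = G' 0 x []"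
  shows "j \<le> r \<Longrightarrow> x \<in> V \<Longrightarrow> length vs = j \<Longrightarrow> G j x vs = G' j x vs"
proof (induction j arbitrary: x vs)
  case 0
  then show ?case using assms(3) by simp
next
  case (Suc j)
  obtain v ws where vs: "vs = v # ws" "length ws = j" using Suc.prems by (cases vs) auto
  have d: "((\<lambda>y. G j y ws) has_derivative (\<lambda>h. G (Suc j) x (h # ws))) (at x)"
    "((\<lambda>y. G' j y ws) has_derivative (\<lambda>h. G' (Suc j) x (h # ws))) (at x)"
    using jet_der[OF J(1)] jet_der[OF J(2)] Suc.prems vs by auto
  have "((\<lambda>y. G' j y ws) has_derivative (\<lambda>h. G (Suc j) x (h # ws))) (at x)"
    by (rule has_derivative_transform_within_open[OF d(1) jet_open[OF J(1)]])
      (use Suc vs in auto)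
  from fun_cong[OF has_derivative_unique[OF this d(2)], of v] show ?case using vs by simp
qed

context sized
begin

text \<open>With \<open>w = 0\<close> this is the mean value inequality; with \<open>w\<close> the
  derivative at \<open>x\<close> it estimates the first order Taylor remainder.\<close>

lemma jet_mvt:
  assumes J: "jet r V G" and j: "j < r" and seg: "closed_segment x y \<subseteq> V" and l: "length vs = j"
    and b: "\<And>z. z \<in> closed_segment x y \<Longrightarrow> Z t c (G (Suc j) z ((y - x) # vs) - w)"
  shows "Z t c (G j y vs - G j x vs - w)"
proof -
  define p where "p s = x + s *\<^sub>R (y - x)" for s :: real
  have p: "p s \<in> closed_segment x y" if "s \<in> {0..1}" for s
    using that unfolding p_def in_segment by (intro exI[of _ s]) (auto simp: algebra_simps)
  define f where "f s = G j (p s) vs - s *\<^sub>R w" for s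
  have "Z t c (f 1 - f 0)"
  proof (rule Z_mvt)
    fix s :: real assume s: "s \<in> {0..1}"
    have "((\<lambda>y. G j y vs) has_derivative (\<lambda>h. G (Suc j) (p s) (h # vs))) (at (p s))"
      using jet_der[OF J j _ l] p[OF s] seg by auto
    then have "((\<lambda>y. G j y vs) has_derivative (\<lambda>h. G (Suc j) (p s) (h # vs))) (at (p s) within p ` {0..1})"
      by (rule has_derivative_at_withinI)
    moreover have "(p has_vector_derivative (y - x)) (at s within {0..1})"
      unfolding p_def by (auto intro!: derivative_eq_intros)
    ultimately have "((\<lambda>s. G j (p s) vs) has_vector_derivative G (Suc j) (p s) ((y - x) # vs)) (at s within
        {0..1})"
      using vector_derivative_diff_chain_within[of p "y - x" s "{0..1}" "\<lambda>y. G j y vs"]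
      by (simp add: o_def)
    then show "(f has_vector_derivative (G (Suc j) (p s) ((y - x) # vs) - w)) (at s within {0..1})"
      unfolding f_def by (auto intro!: derivative_eq_intros)
    show "Z t c (G (Suc j) (p s) ((y - x) # vs) - w)" by (rule b[OF p[OF s]])
  qed
  then show ?thesis by (simp add: f_def p_def algebra_simps)
qed

lemma mult_bound_mvt:
  assumes J: "jet r V G" and j: "j < r" and seg: "closed_segment x y \<subseteq> V"
    and b: "\<And>z. z \<in> closed_segment x y \<Longrightarrow> mult_bound Z (Suc j) (G (Suc j) z) K"
  shows "mult_bound Z j (\<lambda>vs. G j y vs - G j x vs) (K * nrm (y - x))"
proof (rule mult_boundI)
  show "0 \<le> K * nrm (y - x)" using mult_bound_nonneg[OF b[of x]] nrm_nonneg by simp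
  fix l :: "('t \<times> real \<times> 'e) list"
  assume l: "length l = j" "\<And>q. q \<in> set l \<Longrightarrow> Z (fst q) (fst (snd q)) (snd (snd q))"
  let ?v = "map (\<lambda>q. snd (snd q)) l"
  have "Z (\<Sum>q\<leftarrow>l. fst q) (K * nrm (y - x) * (\<Prod>q\<leftarrow>l. fst (snd q))) (G j y ?v - G j x ?v - 0)"
  proof (rule jet_mvt[OF J j seg])
    fix z assume z: "z \<in> closed_segment x y"
    show "Z (\<Sum>q\<leftarrow>l. fst q) (K * nrm (y - x) * (\<Prod>q\<leftarrow>l. fst (snd q))) (G (Suc j) z ((y - x) # ?v) - 0)"
      using mult_boundD[OF mult_bound_cons[OF b[OF z], of "y - x"] l] by simp
  qed (use l in auto)
  then show "Z (\<Sum>q\<leftarrow>l. fst q) (K * nrm (y - x) * (\<Prod>q\<leftarrow>l. fst (snd q))) (G j y ?v - G j x ?v)"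
    by simp
qed

end

lemma ball_segment: fixes x :: "'a::real_normed_vector" shows "y \<in> ball x d \<Longrightarrow> closed_segment x y \<subseteq> ball x d"
  using closed_segment_subset[OF _ _ convex_ball, of x x d y] by (auto intro: le_less_trans[OF zero_le_dist])

text \<open>Below the top order, the bound on the next derivative gives a local Lipschitz
  estimate.\<close>

lemma jet_opcont:
  assumes J: "jet r V G" and j: "j \<le> r" and x: "x \<in> V" and e: "0 < e"
  shows "\<forall>\<^sub>F y in nhds x. op_bound j (\<lambda>vs. G j y vs - G j x vs) e"
proof (cases "j = r")
  case True
  then show ?thesis using J x e by (simp add: jet_def)
next
  case False
  obtain C where C: "0 \<le> C" "\<And>j x. j \<le> r \<Longrightarrow> x \<in> V \<Longrightarrow> op_bound j (G j x) C"
    using jet_bound[OF J] by metis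
  obtain d where d: "0 < d" "ball x d \<subseteq> V" using jet_open[OF J] x open_contains_ball by blast
  have "\<forall>\<^sub>F y in nhds x. y \<in> ball x (min d (e / (C + 1)))"
    using d(1) e C(1) by (intro eventually_nhds_in_open) auto
  then show ?thesis
  proof eventually_elim
    case (elim y)
    then have y: "y \<in> ball x d" "norm (y - x) * (C + 1) \<le> e"
      using C(1) by (auto simp: dist_norm norm_minus_commute pos_less_divide_eq)
    have "op_bound j (\<lambda>vs. G j y vs - G j x vs) (C * norm (y - x))"
      by (rule pl.mult_bound_mvt[OF J]) (use False j C(2) d(2) ball_segment[OF y(1)] in auto)
    then show ?case by (rule pl.mult_bound_mono) (use y(2) in \<open>auto simp: algebra_simps intro:
        order_trans[rotated]\<close>)
  qed
qed

lemma jet_taylor: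
  assumes J: "jet r V G" and j: "j < r" and x: "x \<in> V" and e: "0 < e"
  shows "\<forall>\<^sub>F y in nhds x. op_bound j (\<lambda>vs. G j y vs - G j x vs - G (Suc j) x ((y - x) # vs)) (e * norm (y - x))"
proof -
  have "\<forall>\<^sub>F y in nhds x. op_bound (Suc j) (\<lambda>vs. G (Suc j) y vs - G (Suc j) x vs) e \<and> y \<in> V"
    using jet_opcont[OF J, of "Suc j"] j x e jet_open[OF J]
    by (auto intro!: eventually_conj eventually_nhds_in_open)
  then obtain d where d: "0 < d"
    "\<And>y. dist y x < d \<Longrightarrow> op_bound (Suc j) (\<lambda>vs. G (Suc j) y vs - G (Suc j) x vs) e \<and> y \<in> V"
    unfolding eventually_nhds_metric by blast
  have "\<forall>\<^sub>F y in nhds x. y \<in> ball x d"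
    using d(1) by (intro eventually_nhds_in_open) auto
  then show ?thesis
  proof eventually_elim
    case (elim y)
    have seg: "closed_segment x y \<subseteq> ball x d" by (rule ball_segment[OF elim])
    show ?case
    proof (rule op_boundI)
      show "0 \<le> e * norm (y - x)" using e by simp
      fix vs :: "'a list" assume l: "length vs = j"
      show "norm (G j y vs - G j x vs - G (Suc j) x ((y - x) # vs)) \<le> e * norm (y - x) * (\<Prod>v\<leftarrow>vs. norm v)"
      proof (rule pl.jet_mvt[OF J j _ l])
        show "closed_segment x y \<subseteq> V" using seg d(2) by (force simp: dist_commute)
        fix z assume "z \<in> closed_segment x y"
        then have "op_bound (Suc j) (\<lambda>vs. G (Suc j) z vs - G (Suc j) x vs) e"
          using seg d(2) by (force simp: dist_commute)
        from op_boundD[OF this, of "(y - x) # vs"] l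
        show "norm (G (Suc j) z ((y - x) # vs) - G (Suc j) x ((y - x) # vs))
            \<le> e * norm (y - x) * (\<Prod>v\<leftarrow>vs. norm v)"
          by (simp add: mult.assoc)
      qed
    qed
  qed
qed

section \<open>The product rule and Faa di Bruno's formula\<close>

lemma has_derivative_eventuallyI:
  assumes "bounded_linear f'" "\<And>e. e > 0 \<Longrightarrow> \<forall>\<^sub>F y in nhds x. norm (f y - f x - f' (y - x)) \<le> e * norm (y - x)"
  shows "(f has_derivative f') (at x)"
  using assms by (simp add: has_derivative_at_alt eventually_nhds_metric dist_norm)

lemma has_derivative_eventuallyD:
  assumes "(f has_derivative f') (at x)" "e > 0"
  shows "\<forall>\<^sub>F y in nhds x. norm (f y - f x - f' (y - x)) \<le> e * norm (y - x)"
  using assms by (simp add: has_derivative_at_alt eventually_nhds_metric dist_norm)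

text \<open>\<open>K x (g x)\<close> is split into \<open>K x (g x0)\<close>,
  \<open>K x0 (g x - g x0)\<close> and the mixed remainder \<open>\<rho>\<close>. The latter is of
  order \<open>o(x - x0)\<close> because \<open>K\<close> is continuous in operator norm and
  \<open>g x - g x0\<close> is \<open>O(x - x0)\<close>. Differentiability of \<open>K\<close> is
  thus only needed at the fixed argument \<open>g x0\<close>.\<close>

lemma has_derivative_apply:
  fixes K :: "'a::real_normed_vector \<Rightarrow> 'b::real_normed_vector \<Rightarrow> 'c::real_normed_vector"
  assumes g: "(g has_derivative g') (at x0)" and k: "((\<lambda>x. K x (g x0)) has_derivative k') (at x0)"
    and lin0: "bounded_linear (K x0)" and lin: "\<forall>\<^sub>F x in nhds x0. linear (K x)"
    and cont: "\<And>e. e > 0 \<Longrightarrow> \<forall>\<^sub>F x in nhds x0. \<forall>w. norm (K x w - K x0 w) \<le> e * norm w"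
  shows "((\<lambda>x. K x (g x)) has_derivative (\<lambda>h. k' h + K x0 (g' h))) (at x0)"
proof -
  define \<rho> where "\<rho> x = K x (g x - g x0) - K x0 (g x - g x0)" for x
  have l0: "linear (K x0)" using lin0 by (rule bounded_linear.linear)
  obtain B where B: "B > 0" "\<And>h. norm (g' h) \<le> norm h * B"
    using bounded_linear.pos_bounded[OF has_derivative_bounded_linear[OF g]] by metis
  have "(\<rho> has_derivative (\<lambda>h. 0)) (at x0)"
  proof (rule has_derivative_eventuallyI)
    fix e :: real assume e: "e > 0"
    have "\<forall>\<^sub>F x in nhds x0. (\<forall>w. norm (K x w - K x0 w) \<le> e / (B + 1) * norm w) \<and>
        norm (g x - g x0 - g' (x - x0)) \<le> 1 * norm (x - x0)"
      using e B by (intro eventually_conj cont has_derivative_eventuallyD[OF g]) auto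
    then show "\<forall>\<^sub>F x in nhds x0. norm (\<rho> x - \<rho> x0 - 0) \<le> e * norm (x - x0)"
    proof eventually_elim
      case (elim x)
      have "norm (g x - g x0) \<le> norm (g x - g x0 - g' (x - x0)) + norm (g' (x - x0))"
        by (metis diff_add_cancel norm_triangle_ineq)
      also have "\<dots> \<le> (B + 1) * norm (x - x0)" using elim B(2)[of "x - x0"] by (simp add: algebra_simps)
      finally have "e / (B + 1) * norm (g x - g x0) \<le> e / (B + 1) * ((B + 1) * norm (x - x0))"
        using e B by (intro mult_left_mono) auto
      also have "\<dots> = e * norm (x - x0)" using B by simp
      finally have "norm (\<rho> x) \<le> e * norm (x - x0)" using elim unfolding \<rho>_def by (meson order_trans)
      moreover have "\<rho> x0 = 0" by (simp add: \<rho>_def)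
      ultimately show ?case by simp
    qed
  qed simp
  moreover have "((\<lambda>x. K x0 (g x - g x0)) has_derivative (\<lambda>h. K x0 (g' h))) (at x0)"
    by (rule bounded_linear.has_derivative[OF lin0]) (auto intro!: derivative_eq_intros g)
  ultimately have "((\<lambda>x. K x (g x0) + K x0 (g x - g x0) + \<rho> x) has_derivative
      (\<lambda>h. k' h + K x0 (g' h) + 0)) (at x0)"
    by (intro has_derivative_add k)
  moreover have "\<forall>\<^sub>F x in at x0. K x (g x0) + K x0 (g x - g x0) + \<rho> x = K x (g x)"
    using lin unfolding eventually_at_filter 
    by (auto elim!: eventually_mono simp: \<rho>_def linear_diff l0)
  ultimately have "((\<lambda>x. K x (g x)) has_derivative (\<lambda>h. k' h + K x0 (g' h) + 0)) (at x0)"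
    by (rule has_derivative_transform_eventually) (simp_all add: \<rho>_def linear_0[OF l0])
  then show ?thesis by simp
qed

lemma multilinear_bounded_linear:
  assumes "multilinear_map k B" "op_bound k B C" "length vs + 1 + length ws = k"
  shows "bounded_linear (\<lambda>u. B (vs @ u # ws))"
proof (rule bounded_linear_intro[where K="C * ((\<Prod>v\<leftarrow>vs. norm v) * (\<Prod>v\<leftarrow>ws. norm v))"])
  have lin: "linear (\<lambda>u. B (vs @ u # ws))" using assms(1,3) by (simp add: multilinear_map_def)
  show "B (vs @ (x + y) # ws) = B (vs @ x # ws) + B (vs @ y # ws)" for x y
    by (rule linear_add[OF lin])
  show "B (vs @ (r *\<^sub>R x) # ws) = r *\<^sub>R B (vs @ x # ws)" for r x
    by (rule linear_scale[OF lin])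
  show "norm (B (vs @ x # ws)) \<le> norm x * (C * ((\<Prod>v\<leftarrow>vs. norm v) * (\<Prod>v\<leftarrow>ws. norm v)))" for x
    using op_boundD[OF assms(2), of "vs @ x # ws"] assms(3) by (simp add: mult_ac)
qed

lemma has_derivative_tendsto:
  assumes "(f has_derivative f') (at x)"
  shows "(f \<longlongrightarrow> f x) (nhds x)"
  using has_derivative_continuous[OF assms] tendsto_at_iff_tendsto_nhds[of f x]
  by (simp add: isCont_def)

lemma prod_norm_nonneg: "0 \<le> (\<Prod>v\<leftarrow>vs. norm v)"
  by (induction vs) auto

text \<open>Induction on the number of slots: the last entry \<open>g q x\<close> is absorbed into
  the multilinear map, and the result \<open>\<K>\<close> is differentiated for fixed remaining
  arguments by \<open>has_derivative_apply\<close>.\<close>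

lemma multilinear_product_rule:
  fixes \<G> :: "'a::real_normed_vector \<Rightarrow> 'e::real_normed_vector list \<Rightarrow> 'e"
  assumes "\<forall>\<^sub>F x in nhds x0. multilinear_map q (\<G> x)" and "op_bound q (\<G> x0) C"
    and "\<And>e. e > 0 \<Longrightarrow> \<forall>\<^sub>F x in nhds x0. op_bound q (\<lambda>vs. \<G> x vs - \<G> x0 vs) e"
    and "\<And>ws. length ws = q \<Longrightarrow> ((\<lambda>x. \<G> x ws) has_derivative (\<lambda>h. \<G>' h ws)) (at x0)"
    and "\<And>m. m < q \<Longrightarrow> (g m has_derivative g' m) (at x0)"
  shows "((\<lambda>x. \<G> x (map (\<lambda>m. g m x) [0..<q])) has_derivative
    (\<lambda>h. \<G>' h (map (\<lambda>m. g m x0) [0..<q]) +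
      (\<Sum>m<q. \<G> x0 (map (\<lambda>i. if i = m then g' m h else g i x0) [0..<q])))) (at x0)"
  using assms
proof (induction q arbitrary: \<G> \<G>' C)
  case 0
  then show ?case by simp
next
  case (Suc q)
  note lin = Suc.prems(1) and bd = Suc.prems(2) and oc = Suc.prems(3) and der = Suc.prems(4)
    and gd = Suc.prems(5)
  have gq: "(g q has_derivative g' q) (at x0)" by (rule gd) simp
  have lin0: "multilinear_map (Suc q) (\<G> x0)" using eventually_nhds_x_imp_x[OF lin] .
  define \<K> where "\<K> x ws = \<G> x (ws @ [g q x])" for x ws
  define \<K>' where "\<K>' h ws = \<G>' h (ws @ [g q x0]) + \<G> x0 (ws @ [g' q h])" for h ws
  have C: "0 \<le> C" using mult_bound_nonneg[OF bd] .
  have cont_g: "(g q \<longlongrightarrow> g q x0) (nhds x0)"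
    by (rule has_derivative_tendsto[OF gq])
  have "((\<lambda>x. \<K> x (map (\<lambda>m. g m x) [0..<q])) has_derivative
    (\<lambda>h. \<K>' h (map (\<lambda>m. g m x0) [0..<q]) +
      (\<Sum>m<q. \<K> x0 (map (\<lambda>i. if i = m then g' m h else g i x0) [0..<q])))) (at x0)"
  proof (rule Suc.IH)
    show "\<forall>\<^sub>F x in nhds x0. multilinear_map q (\<K> x)"
      using lin
    proof eventually_elim
      case (elim x)
      show ?case unfolding multilinear_map_def
      proof (intro allI impI)
        fix vs ws :: "'e list" assume "length vs + 1 + length ws = q"
        then show "linear (\<lambda>u. \<K> x (vs @ u # ws))"
          using elim[unfolded multilinear_map_def, rule_format, of vs "ws @ [g q x]"] by (simp add: \<K>_def)
      qed
    qed
    show "op_bound q (\<K> x0) (C * norm (g q x0))"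
    proof (rule op_boundI)
      fix vs :: "'e list" assume "length vs = q"
      then show "norm (\<K> x0 vs) \<le> C * norm (g q x0) * (\<Prod>v\<leftarrow>vs. norm v)"
        using op_boundD[OF bd, of "vs @ [g q x0]"] by (simp add: \<K>_def mult_ac)
    qed (use C in simp)
    show "\<forall>\<^sub>F x in nhds x0. op_bound q (\<lambda>vs. \<K> x vs - \<K> x0 vs) e" if e: "e > 0" for e
    proof -
      define M where "M = norm (g q x0) + 1"
      have M: "M > 0" by (simp add: M_def add_nonneg_pos)
      have 1: "\<forall>\<^sub>F x in nhds x0. dist (g q x) (g q x0) < min 1 (e / (2 * (C + 1)))"
        using cont_g C e by (intro tendstoD) auto
      have 2: "\<forall>\<^sub>F x in nhds x0. op_bound (Suc q) (\<lambda>vs. \<G> x vs - \<G> x0 vs) (e / (2 * M))"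
        using e M by (intro oc) auto
      show ?thesis using 1 2
      proof eventually_elim
        case (elim x)
        have "norm (g q x) \<le> norm (g q x - g q x0) + norm (g q x0)"
          by (metis diff_add_cancel norm_triangle_ineq)
        then have gM: "norm (g q x) \<le> M" using elim(1) by (simp add: dist_norm M_def)
        have gd': "C * norm (g q x - g q x0) \<le> e / 2"
        proof -
          have "norm (g q x - g q x0) * (C + 1) \<le> e / 2" using elim(1) C
            by (simp add: dist_norm field_simps)
          then show ?thesis using norm_ge_zero[of "g q x - g q x0"]
              by (simp only: distrib_left mult_1_right mult.commute[of C])
        qed
        show ?case
        proof (rule op_boundI)
          fix vs :: "'e list" assume l: "length vs = q"
          let ?P = "\<Prod>v\<leftarrow>vs. norm v"
          have P: "0 \<le> ?P" by (rule prod_norm_nonneg)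
          have lv: "linear (\<lambda>u. \<G> x0 (vs @ u # []))" using lin0 l by (simp add: multilinear_map_def)
          have eq: "\<K> x vs - \<K> x0 vs =
              (\<G> x (vs @ [g q x]) - \<G> x0 (vs @ [g q x])) + \<G> x0 (vs @ [g q x - g q x0])"
            using linear_diff[OF lv, of "g q x" "g q x0"] by (simp add: \<K>_def)
          have "norm (\<G> x (vs @ [g q x]) - \<G> x0 (vs @ [g q x])) \<le> e / (2 * M) * (?P * norm (g q x))"
            using op_boundD[OF elim(2), of "vs @ [g q x]"] l by simp
          also have "\<dots> \<le> e / (2 * M) * (?P * M)"
            using gM e M P by (intro mult_left_mono) auto
          also have "\<dots> = e / 2 * ?P" using M by simp
          finally have 1: "norm (\<G> x (vs @ [g q x]) - \<G> x0 (vs @ [g q x])) \<le> e / 2 * ?P" .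
          have "norm (\<G> x0 (vs @ [g q x - g q x0])) \<le> C * norm (g q x - g q x0) * ?P"
            using op_boundD[OF bd, of "vs @ [g q x - g q x0]"] l by (simp add: mult_ac)
          also have "\<dots> \<le> e / 2 * ?P" using gd' P by (rule mult_right_mono)
          finally show "norm (\<K> x vs - \<K> x0 vs) \<le> e * ?P"
            unfolding eq using 1 norm_triangle_ineq[of "\<G> x (vs @ [g q x]) - \<G> x0 (vs @ [g q x])"
                "\<G> x0 (vs @ [g q x - g q x0])"]
            by simp
        qed (use e in simp)
      qed
    qed
    show "((\<lambda>x. \<K> x ws) has_derivative (\<lambda>h. \<K>' h ws)) (at x0)" if l: "length ws = q" for ws
      unfolding \<K>_def \<K>'_def
    proof (rule has_derivative_apply[where K="\<lambda>x w. \<G> x (ws @ [w])", OF gq])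
      show "((\<lambda>x. \<G> x (ws @ [g q x0])) has_derivative (\<lambda>h. \<G>' h (ws @ [g q x0]))) (at x0)"
        by (rule der) (use l in simp)
      show "bounded_linear (\<lambda>w. \<G> x0 (ws @ [w]))"
        using multilinear_bounded_linear[OF lin0 bd, of ws "[]"] l by simp
      show "\<forall>\<^sub>F x in nhds x0. linear (\<lambda>w. \<G> x (ws @ [w]))"
        using lin by eventually_elim (use l in \<open>simp add: multilinear_map_def\<close>)
      fix e :: real assume e: "e > 0"
      let ?P = "\<Prod>v\<leftarrow>ws. norm v"
      have P: "0 \<le> ?P" by (rule prod_norm_nonneg)
      have "\<forall>\<^sub>F x in nhds x0. op_bound (Suc q) (\<lambda>vs. \<G> x vs - \<G> x0 vs) (e / (?P + 1))"
        using e P by (intro oc) auto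
      then show "\<forall>\<^sub>F x in nhds x0. \<forall>w. norm (\<G> x (ws @ [w]) - \<G> x0 (ws @ [w])) \<le> e * norm w"
      proof (eventually_elim, intro allI)
        fix x w assume "op_bound (Suc q) (\<lambda>vs. \<G> x vs - \<G> x0 vs) (e / (?P + 1))"
        from op_boundD[OF this, of "ws @ [w]"] l
        have "norm (\<G> x (ws @ [w]) - \<G> x0 (ws @ [w])) \<le> e / (?P + 1) * (?P * norm w)" by simp
        also have "\<dots> = (e * norm w) * (?P / (?P + 1))" by simp
        also have "\<dots> \<le> (e * norm w) * 1" using e P by (intro mult_left_mono) auto
        finally show "norm (\<G> x (ws @ [w]) - \<G> x0 (ws @ [w])) \<le> e * norm w" by simp
      qed
    qed
    show "(g m has_derivative g' m) (at x0)" if "m < q" for m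
      using that by (intro gd) simp
  qed
  moreover have e: "map (\<lambda>i. if i = q then g' q h else g i x0) [0..<q] = map (\<lambda>i. g i x0) [0..<q]" for h
    by auto
  ultimately show ?case
    by (simp add: e \<K>_def \<K>'_def add.assoc add.commute add.left_commute)
qed

text \<open>Faa di Bruno's formula for the derivatives of the composition of \<open>G\<close> after
  \<open>f\<close>.\<close>

definition composite_jet ::
  "(nat \<Rightarrow> 'e \<Rightarrow> 'e list \<Rightarrow> 'e::comm_monoid_add) \<Rightarrow> (nat \<Rightarrow> 'e \<Rightarrow> 'e list \<Rightarrow> 'e) \<Rightarrow> nat \<Rightarrow> 'e \<Rightarrow> 'e list \<Rightarrow> 'e" where
  "composite_jet G f j x vs = (\<Sum>\<pi>\<leftarrow>parts j. comp_term (G (length \<pi>) (f 0 x [])) (\<lambda>m. f (length (\<pi> ! m)) x) \<pi> vs)"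

lemma composite_jet_0 [simp]: "composite_jet G f 0 x [] = G 0 (f 0 x []) []"
  by (simp add: composite_jet_def comp_term_def)

lemma sum_list_parts_Suc:
  "(\<Sum>\<pi>\<leftarrow>parts (Suc j). t \<pi>) = (\<Sum>\<pi>\<leftarrow>parts j. t ([0] # map (map Suc) \<pi>) +
     (\<Sum>m<length \<pi>. t ((map (map Suc) \<pi>)[m := 0 # map Suc (\<pi> ! m)])))"
  for t :: "nat list list \<Rightarrow> 'b::comm_monoid_add"
proof -
  have c: "sum_list (map t (concat xss)) = (\<Sum>xs\<leftarrow>xss. sum_list (map t xs))" for xss
    by (induction xss) auto
  show ?thesis by (simp add: c o_def sum_list_upt)
qed

lemma has_derivative_sum_list:
  assumes "\<And>p. p \<in> set ps \<Longrightarrow> (F p has_derivative F' p) (at x)"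
  shows "((\<lambda>x. \<Sum>p\<leftarrow>ps. F p x) has_derivative (\<lambda>h. \<Sum>p\<leftarrow>ps. F' p h)) (at x)"
  using assms by (induction ps) (auto intro: has_derivative_add)

lemma nth_Cons_comp_Suc: "map ((!) (h # vs)) (map Suc I) = map ((!) vs) I"
  by simp

lemma comp_term_new_block:
  "comp_term B (\<lambda>m. f (length (([0] # map (map Suc) \<pi>) ! m)) x) ([0] # map (map Suc) \<pi>) (h # vs) =
   B (f 1 x [h] # map (\<lambda>m. f (length (\<pi> ! m)) x (map ((!) vs) (\<pi> ! m))) [0..<length \<pi>])"
proof -
  have "map (\<lambda>m. f (length (([0] # map (map Suc) \<pi>) ! m)) x (map ((!) (h # vs)) (([0] # map (map Suc) \<pi>) !
      m))) [0..<Suc (length \<pi>)]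
    = f 1 x [h] # map (\<lambda>m. f (length (\<pi> ! m)) x (map ((!) vs) (\<pi> ! m))) [0..<length \<pi>]"
    unfolding map_upt_Suc by (auto simp del: upt_Suc simp: nth_Cons_comp_Suc simp del: map_map)
  then show ?thesis by (simp only: comp_term_def length_Cons length_map)
qed

lemma comp_term_insert:
  assumes "m < length \<pi>"
  shows "comp_term B (\<lambda>i. f (length ((map (map Suc) \<pi>)[m := 0 # map Suc (\<pi> ! m)] ! i)) x)
     ((map (map Suc) \<pi>)[m := 0 # map Suc (\<pi> ! m)]) (h # vs) =
   B (map (\<lambda>i. if i = m then f (Suc (length (\<pi> ! m))) x (h # map ((!) vs) (\<pi> ! m))
        else f (length (\<pi> ! i)) x (map ((!) vs) (\<pi> ! i))) [0..<length \<pi>])"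
proof -
  have "map (\<lambda>i. f (length ((map (map Suc) \<pi>)[m := 0 # map Suc (\<pi> ! m)] ! i)) x
      (map ((!) (h # vs)) ((map (map Suc) \<pi>)[m := 0 # map Suc (\<pi> ! m)] ! i))) [0..<length \<pi>] =
    map (\<lambda>i. if i = m then f (Suc (length (\<pi> ! m))) x (h # map ((!) vs) (\<pi> ! m))
        else f (length (\<pi> ! i)) x (map ((!) vs) (\<pi> ! i))) [0..<length \<pi>]"
    by (rule map_cong[OF refl]) (auto simp: nth_list_update o_def)
  then show ?thesis by (simp only: comp_term_def length_list_update length_map)
qed

lemma (in sized) mult_bound_composite_jet:
  assumes G: "\<And>q. q \<le> j \<Longrightarrow> mult_bound Z q (G q (f 0 x [])) CG"
    and f: "\<And>i. 1 \<le> i \<Longrightarrow> i \<le> j \<Longrightarrow> mult_bound Z i (f i x) K" and K: "1 \<le> K"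
  shows "mult_bound Z j (composite_jet G f j x) (\<Sum>\<pi>\<leftarrow>parts j. CG * K ^ j)"
  unfolding composite_jet_def
proof (rule mult_bound_sum_list)
  fix \<pi> assume \<pi>: "\<pi> \<in> set (parts j)"
  have "mult_bound Z j (comp_term (G (length \<pi>) (f 0 x [])) (\<lambda>m. f (length (\<pi> ! m)) x) \<pi>) (CG
      * (\<Prod>m<length \<pi>. K))"
  proof (rule mult_bound_comp_term)
    show "mult_bound Z (length \<pi>) (G (length \<pi>) (f 0 x [])) CG" using G parts_length(2)[OF \<pi>] by blast
    show "mset (concat \<pi>) = mset [0..<j]" using parts_props[OF \<pi>] by blast
    fix m assume m: "m < length \<pi>"
    show "mult_bound Z (length (\<pi> ! m)) (f (length (\<pi> ! m)) x) K"
      using parts_length(3,4)[OF \<pi>, of "\<pi> ! m"] m by (intro f) auto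
  qed
  then show "mult_bound Z j (comp_term (G (length \<pi>) (f 0 x [])) (\<lambda>m. f (length (\<pi> ! m)) x) \<pi>) (CG * K ^ j)"
    by (rule mult_bound_mono) (use K mult_bound_nonneg[OF G[OF order_refl]] parts_length(2)[OF \<pi>] in
      \<open>auto intro!: mult_left_mono power_increasing\<close>)
qed

lemma jet_tendsto:
  assumes "jet r V f" "0 < r" "x \<in> V"
  shows "((\<lambda>y. f 0 y []) \<longlongrightarrow> f 0 x []) (nhds x)"
proof -
  have "((\<lambda>y. f 0 y []) has_derivative (\<lambda>h. f 1 x [h])) (at x)"
    using jet_der[OF assms(1,2,3), of "[]"] by simp
  then show ?thesis by (rule has_derivative_tendsto)
qed

text \<open>The product rule for one term yields exactly the children of its partition: the moving
  base point of \<open>G\<close> gives the new block, the inner factor number \<open>m\<close> gives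
  the insertion into block \<open>m\<close>. As \<open>j < r\<close>, all orders that occur can
  still be differentiated.\<close>

lemma composite_jet_has_derivative:
  assumes G: "jet r W G" and f: "jet r V f" and V: "\<And>x. x \<in> V \<Longrightarrow> f 0 x [] \<in> W"
    and j: "j < r" and x: "x \<in> V" and l: "length vs = j"
  shows "((\<lambda>y. composite_jet G f j y vs) has_derivative (\<lambda>h. composite_jet G f (Suc j) x (h # vs))) (at x)"
proof -
  let ?f0 = "\<lambda>y. f 0 y []"
  have lim: "(?f0 \<longlongrightarrow> ?f0 x) (nhds x)" by (rule jet_tendsto[OF f _ x]) (use j in simp)
  have f0: "(?f0 has_derivative (\<lambda>h. f 1 x [h])) (at x)"
    using jet_der[OF f _ x, of 0 "[]"] j by simp
  obtain C where C: "0 \<le> C" "\<And>j x. j \<le> r \<Longrightarrow> x \<in> W \<Longrightarrow> op_bound j (G j x) C"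
    using jet_bound[OF G] by metis
  have trm: "((\<lambda>y. comp_term (G (length \<pi>) (f 0 y [])) (\<lambda>m. f (length (\<pi> ! m)) y) \<pi> vs) has_derivative
     (\<lambda>h. G (Suc (length \<pi>)) (?f0 x) (f 1 x [h] # map (\<lambda>m. f (length (\<pi> ! m)) x (map ((!) vs) (\<pi> ! m)))
         [0..<length \<pi>]) +
       (\<Sum>m<length \<pi>. G (length \<pi>) (?f0 x) (map (\<lambda>i.
           if i = m then f (Suc (length (\<pi> ! m))) x (h # map ((!) vs) (\<pi> ! m))
        else f (length (\<pi> ! i)) x (map ((!) vs) (\<pi> ! i))) [0..<length \<pi>])))) (at x)"
    if \<pi>: "\<pi> \<in> set (parts j)" for \<pi>
    unfolding comp_term_def
  proof (rule multilinear_product_rule[where \<G>="\<lambda>y. G (length \<pi>) (f 0 y [])" and C=C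
        and \<G>'="\<lambda>h ws. G (Suc (length \<pi>)) (f 0 x []) (f 1 x [h] # ws)"
        and g="\<lambda>m y. f (length (\<pi> ! m)) y (map ((!) vs) (\<pi> ! m))"
        and g'="\<lambda>m h. f (Suc (length (\<pi> ! m))) x (h # map ((!) vs) (\<pi> ! m))"])
    have q: "length \<pi> < r" using parts_length(2)[OF \<pi>] j by simp
    have "\<forall>\<^sub>F y in nhds x. y \<in> V" by (rule eventually_nhds_in_open[OF jet_open[OF f] x])
    then show "\<forall>\<^sub>F y in nhds x. multilinear_map (length \<pi>) (G (length \<pi>) (f 0 y []))"
      by eventually_elim (use q V in \<open>auto intro: jet_multilinear[OF G]\<close>)
    show "op_bound (length \<pi>) (G (length \<pi>) (f 0 x [])) C" using C(2) q V x by auto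
    show "\<forall>\<^sub>F y in nhds x. op_bound (length \<pi>) (\<lambda>vs. G (length \<pi>) (f 0 y []) vs - G (length \<pi>) (f 0 x []) vs) e"
      if "e > 0" for e
      by (rule eventually_compose_filterlim[OF jet_opcont[OF G _ V[OF x] that] lim]) (use q in simp)
    show "((\<lambda>y. G (length \<pi>) (f 0 y []) ws) has_derivative
        (\<lambda>h. G (Suc (length \<pi>)) (f 0 x []) (f 1 x [h] # ws))) (at x)" if "length ws = length \<pi>" for ws
      by (rule has_derivative_compose[OF f0 jet_der[OF G q V[OF x] that]])
    fix m assume m: "m < length \<pi>"
    then have "length (\<pi> ! m) < r" using parts_length(4)[OF \<pi>, of "\<pi> ! m"] j by auto
    then show "((\<lambda>y. f (length (\<pi> ! m)) y (map ((!) vs) (\<pi> ! m))) has_derivative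
       (\<lambda>h. f (Suc (length (\<pi> ! m))) x (h # map ((!) vs) (\<pi> ! m)))) (at x)"
      by (rule jet_der[OF f _ x]) simp
  qed
  have eq: "composite_jet G f (Suc j) x (h # vs) = (\<Sum>\<pi>\<leftarrow>parts j.
     G (Suc (length \<pi>)) (?f0 x) (f 1 x [h] # map (\<lambda>m. f (length (\<pi> ! m)) x (map ((!) vs) (\<pi> ! m)))
         [0..<length \<pi>]) +
       (\<Sum>m<length \<pi>. G (length \<pi>) (?f0 x) (map (\<lambda>i.
           if i = m then f (Suc (length (\<pi> ! m))) x (h # map ((!) vs) (\<pi> ! m))
        else f (length (\<pi> ! i)) x (map ((!) vs) (\<pi> ! i))) [0..<length \<pi>])))" for h
    unfolding composite_jet_def sum_list_parts_Suc comp_term_new_block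
    by (intro arg_cong[where f=sum_list] map_cong refl arg_cong2[where f="(+)"] sum.cong)
      (simp_all add: comp_term_insert)
  show ?thesis unfolding eq unfolding composite_jet_def by (rule has_derivative_sum_list[OF trm])
qed

lemma comp_jet:
  assumes G: "jet r W G" and f: "jet r V f" and V: "\<And>x. x \<in> V \<Longrightarrow> f 0 x [] \<in> W" and r: "0 < r"
  shows "jet r V (composite_jet G f)"
proof -
  obtain CG where CG: "0 \<le> CG" "\<And>j x. j \<le> r \<Longrightarrow> x \<in> W \<Longrightarrow> op_bound j (G j x) CG"
    using jet_bound[OF G] by metis
  obtain Cf where Cf: "0 \<le> Cf" "\<And>j x. j \<le> r \<Longrightarrow> x \<in> V \<Longrightarrow> op_bound j (f j x) Cf"
    using jet_bound[OF f] by metis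
  define K where "K = max 1 Cf"
  have K: "1 \<le> K" "\<And>j x. j \<le> r \<Longrightarrow> x \<in> V \<Longrightarrow> op_bound j (f j x) K"
    using pl.mult_bound_mono[OF Cf(2), of _ _ K] by (auto simp: K_def)
  define B where "B j = (\<Sum>\<pi>\<leftarrow>parts j. CG * K ^ j)" for j
  have B: "op_bound j (composite_jet G f j x) (B j)" if "j \<le> r" "x \<in> V" for j x
    unfolding B_def by (rule pl.mult_bound_composite_jet) (use that CG V K in auto)
  have "op_bound j (composite_jet G f j x) (Max (B ` {..r}))" if "j \<le> r" "x \<in> V" for j x
    by (rule pl.mult_bound_mono[OF B[OF that]]) (use that in auto)
  moreover have "\<forall>\<^sub>F y in nhds x. op_bound r (\<lambda>vs. composite_jet G f r y vs - composite_jet G f r x vs) e"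
    if x: "x \<in> V" and e: "e > 0" for x e
  proof -
    define n where "n = real (length (parts r))"
    \<comment> \<open>Per partition, changing the outer map costs \<open>K ^ r\<close> and changing
      the at most \<open>r\<close> inner ones costs \<open>CG * K ^ r * r\<close>, in units of
      \<open>\<eta>\<close>; \<open>n\<close> counts the partitions.\<close>
    define M where "M = (n + 1) * (K ^ r + CG * K ^ r * real r + 1)"
    have n: "n \<ge> 0" by (simp add: n_def)
    have Kr: "1 \<le> K ^ r" using K(1) by simp
    have M: "M > 0" unfolding M_def using n Kr CG(1)
        by (intro mult_pos_pos add_nonneg_pos add_nonneg_nonneg) auto
    define \<eta> where "\<eta> = e / M"
    have \<eta>: "\<eta> > 0" using e M by (simp add: \<eta>_def)
    have lim: "((\<lambda>y. f 0 y []) \<longlongrightarrow> f 0 x []) (nhds x)" by (rule jet_tendsto[OF f r x])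
    have 1: "\<forall>\<^sub>F y in nhds x. \<forall>q\<in>{..r}. op_bound q (\<lambda>vs. G q (f 0 y []) vs - G q (f 0 x []) vs) \<eta>"
      using eventually_compose_filterlim[OF jet_opcont[OF G _ V[OF x] \<eta>] lim]
      by (intro eventually_ball_finite) auto
    have 2: "\<forall>\<^sub>F y in nhds x. \<forall>q\<in>{..r}. op_bound q (\<lambda>vs. f q y vs - f q x vs) \<eta>"
      using jet_opcont[OF f _ x \<eta>] by (intro eventually_ball_finite) auto
    have 3: "\<forall>\<^sub>F y in nhds x. y \<in> V" by (rule eventually_nhds_in_open[OF jet_open[OF f] x])
    show ?thesis using 1 2 3
    proof eventually_elim
      case (elim y)
      have "op_bound r (\<lambda>vs. comp_term (G (length \<pi>) (f 0 y [])) (\<lambda>m. f (length (\<pi> ! m)) y) \<pi> vs -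
          comp_term (G (length \<pi>) (f 0 x [])) (\<lambda>m. f (length (\<pi> ! m)) x) \<pi> vs)
          (\<eta> * (K ^ r + CG * K ^ r * real r))" if \<pi>: "\<pi> \<in> set (parts r)" for \<pi>
      proof -
        let ?q = "length \<pi>"
        have q: "?q \<le> r" by (rule parts_length(2)[OF \<pi>])
        have ms: "mset (concat \<pi>) = mset [0..<r]" using parts_props[OF \<pi>] by blast
        have len: "length (\<pi> ! m) \<le> r" if "m < ?q" for m
          using parts_length(4)[OF \<pi>, of "\<pi> ! m"] that by auto
        have a: "op_bound r (comp_term (\<lambda>vs. G ?q (f 0 y []) vs - G ?q (f 0 x []) vs) (\<lambda>m. f (length (\<pi> !
            m)) y) \<pi>)
            (\<eta> * (\<Prod>m<?q. K))"
          by (rule mult_bound_comp_term) (use elim q len K(2) ms in auto)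
        have b: "op_bound r (\<lambda>vs. comp_term (G ?q (f 0 x [])) (\<lambda>m. f (length (\<pi> ! m)) y) \<pi> vs -
            comp_term (G ?q (f 0 x [])) (\<lambda>m. f (length (\<pi> ! m)) x) \<pi> vs)
            (CG * K ^ (?q - 1) * (\<Sum>m<?q. \<eta>))"
          by (rule pl.mult_bound_comp_diff) (use elim q len K x CG(2) V ms in \<open>auto intro!:
              jet_multilinear[OF G]\<close>)
        have "op_bound r (\<lambda>vs. comp_term (G ?q (f 0 y [])) (\<lambda>m. f (length (\<pi> ! m)) y) \<pi> vs -
          comp_term (G ?q (f 0 x [])) (\<lambda>m. f (length (\<pi> ! m)) x) \<pi> vs)
          (\<eta> * (\<Prod>m<?q. K) + CG * K ^ (?q - 1) * (\<Sum>m<?q. \<eta>))"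
          by (rule mult_bound_cong[OF pl.mult_bound_add[OF a b]]) (simp add: comp_term_def)
        then show ?thesis
        proof (rule pl.mult_bound_mono)
          have "K ^ ?q \<le> K ^ r" "K ^ (?q - 1) \<le> K ^ r" using K(1) q by (auto intro!: power_increasing)
          then have h1: "\<eta> * K ^ ?q \<le> \<eta> * K ^ r"
            and h2: "CG * K ^ (?q - 1) * (real ?q * \<eta>) \<le> CG * K ^ r * (real r * \<eta>)"
            using CG(1) K(1) \<eta> q by (auto intro!: mult_mono)
          have "\<eta> * (\<Prod>m<?q. K) + CG * K ^ (?q - 1) * (\<Sum>m<?q. \<eta>) =
              \<eta> * K ^ ?q + CG * K ^ (?q - 1) * (real ?q * \<eta>)" by simp
          also have "\<dots> \<le> \<eta> * K ^ r + CG * K ^ r * (real r * \<eta>)" by (rule add_mono[OF h1 h2])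
          also have "\<dots> = \<eta> * (K ^ r + CG * K ^ r * real r)" by (simp add: algebra_simps)
          finally show "\<eta> * (\<Prod>m<?q. K) + CG * K ^ (?q - 1) * (\<Sum>m<?q. \<eta>)
             \<le> \<eta> * (K ^ r + CG * K ^ r * real r)" .
        qed
      qed
      then have "op_bound r (\<lambda>vs. \<Sum>\<pi>\<leftarrow>parts r. comp_term (G (length \<pi>) (f 0 y [])) (\<lambda>m. f (length (\<pi> ! m)) y)
          \<pi> vs -
          comp_term (G (length \<pi>) (f 0 x [])) (\<lambda>m. f (length (\<pi> ! m)) x) \<pi> vs)
          (\<Sum>\<pi>\<leftarrow>parts r. \<eta> * (K ^ r + CG * K ^ r * real r))"
        by (rule pl.mult_bound_sum_list)
      then have "op_bound r (\<lambda>vs. composite_jet G f r y vs - composite_jet G f r x vs)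
          (\<Sum>\<pi>\<leftarrow>parts r. \<eta> * (K ^ r + CG * K ^ r * real r))"
        unfolding composite_jet_def by (simp add: sum_list_subtractf)
      then show ?case
      proof (rule pl.mult_bound_mono)
        have "(\<Sum>\<pi>\<leftarrow>parts r. \<eta> * (K ^ r + CG * K ^ r * real r)) = \<eta> * (n * (K ^ r + CG * K ^ r * real r))"
          by (simp add: sum_list_triv n_def)
        also have "\<dots> \<le> \<eta> * M" unfolding M_def using \<eta> n Kr CG(1) K(1)
          by (intro mult_left_mono mult_mono) auto
        also have "\<dots> = e" using M by (simp add: \<eta>_def)
        finally show "(\<Sum>\<pi>\<leftarrow>parts r. \<eta> * (K ^ r + CG * K ^ r * real r)) \<le> e" .
      qed
    qed
  qed
  ultimately show ?thesis
    unfolding jet_def using jet_open[OF f] composite_jet_has_derivative[OF G f V] by blast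
qed

section \<open>Symmetry of higher derivatives\<close>

lemma jet_line:
  assumes "jet r V G" "j < r" "x + s *\<^sub>R v \<in> V" "length vs = j"
  shows "((\<lambda>s. G j (x + s *\<^sub>R v) vs) has_vector_derivative G (Suc j) (x + s *\<^sub>R v) (v # vs)) (at s within S)"
proof -
  have "((\<lambda>y. G j y vs) has_derivative (\<lambda>h. G (Suc j) (x + s *\<^sub>R v) (h # vs)))
      (at (x + s *\<^sub>R v) within (\<lambda>s. x + s *\<^sub>R v) ` S)"
    by (rule has_derivative_at_withinI[OF jet_der[OF assms]])
  moreover have "((\<lambda>s. x + s *\<^sub>R v) has_vector_derivative v) (at s within S)"
    by (auto intro!: derivative_eq_intros)
  ultimately show ?thesis
    using vector_derivative_diff_chain_within[of "\<lambda>s. x + s *\<^sub>R v" v s S "\<lambda>y. G j y vs"]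
    by (simp add: o_def)
qed

text \<open>The mean value inequality is used twice, along \<open>h\<close> for the increment in
  \<open>k\<close> and then along \<open>k\<close>; subtracting the constant \<open>?w\<close> turns
  continuity of the second derivative into the error \<open>e\<close>.\<close>

lemma second_difference_bound:
  assumes J: "jet r V G" and j: "Suc j < r" and x: "x \<in> V" and l: "length vs = j" and e: "0 < e"
  obtains d where "0 < d" "\<And>h k. norm h < d \<Longrightarrow> norm k < d \<Longrightarrow>
    norm ((G j (x + h + k) vs - G j (x + h) vs) - (G j (x + k) vs - G j x vs) - G (Suc (Suc j)) x (k # h # vs))
      \<le> e * norm k * norm h * (\<Prod>v\<leftarrow>vs. norm v)"
proof -
  have "\<forall>\<^sub>F y in nhds x. op_bound (Suc (Suc j)) (\<lambda>vs. G (Suc (Suc j)) y vs - G (Suc (Suc j)) x vs) e \<and> y \<in> V"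
    using jet_opcont[OF J, of "Suc (Suc j)"] j x e jet_open[OF J]
    by (auto intro!: eventually_conj eventually_nhds_in_open)
  then obtain D where D: "0 < D"
    "\<And>y. dist y x < D \<Longrightarrow> op_bound (Suc (Suc j)) (\<lambda>vs. G (Suc (Suc j)) y vs - G (Suc (Suc j)) x vs) e \<and> y \<in> V"
    unfolding eventually_nhds_metric by blast
  show thesis
  proof (rule that[of "D / 2"])
    show "0 < D / 2" using D by simp
    fix h k :: 'a assume hk: "norm h < D / 2" "norm k < D / 2"
    let ?w = "G (Suc (Suc j)) x (k # h # vs)"
    let ?P = "\<Prod>v\<leftarrow>vs. norm v"
    define f where "f s = (G j (x + k + s *\<^sub>R h) vs - G j (x + s *\<^sub>R h) vs) - s *\<^sub>R ?w" for s :: real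
    have near: "norm (s *\<^sub>R h + u *\<^sub>R k) < D" if "s \<in> {0..1}" "u \<in> {0..1}" for s u :: real
    proof -
      have "norm (s *\<^sub>R h) \<le> norm h" "norm (u *\<^sub>R k) \<le> norm k"
        using that by (auto simp: mult_left_le_one_le)
      then show ?thesis using norm_triangle_ineq[of "s *\<^sub>R h" "u *\<^sub>R k"] hk by simp
    qed
    have inV: "x + s *\<^sub>R h + u *\<^sub>R k \<in> V" and
      obn: "op_bound (Suc (Suc j)) (\<lambda>vs. G (Suc (Suc j)) (x + s *\<^sub>R h + u *\<^sub>R k) vs - G (Suc (Suc j)) x vs) e"
      if "s \<in> {0..1}" "u \<in> {0..1}" for s u :: real
      using D(2)[of "x + s *\<^sub>R h + u *\<^sub>R k"] near[OF that] by (auto simp: dist_norm add.assoc)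
    have "norm (f 1 - f 0) \<le> e * norm k * norm h * ?P"
    proof (rule unit_interval_bound)
      fix s :: real assume s: "s \<in> {0..1}"
      have eq: "x + s *\<^sub>R h + 1 *\<^sub>R k = x + k + s *\<^sub>R h" by simp
      have in1: "x + k + s *\<^sub>R h \<in> V" using inV[OF s, of 1] unfolding eq by simp
      have in0: "x + s *\<^sub>R h \<in> V" using inV[OF s, of 0] by simp
      show "(f has_vector_derivative (G (Suc j) (x + k + s *\<^sub>R h) (h # vs) - G (Suc j) (x
          + s *\<^sub>R h) (h # vs)) - ?w)
          (at s within {0..1})"
        unfolding f_def
        by (rule derivative_eq_intros jet_line[OF J _ in1 l] jet_line[OF J _ in0 l] refl | use j in simp)+
      have "norm (G (Suc j) (x + s *\<^sub>R h + k) (h # vs) - G (Suc j) (x + s *\<^sub>R h) (h # vs) - ?w)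
          \<le> e * norm k * norm h * ?P"
      proof (rule pl.jet_mvt[OF J j])
        fix z assume "z \<in> closed_segment (x + s *\<^sub>R h) (x + s *\<^sub>R h + k)"
        then obtain u where u: "u \<in> {0..1}" "z = x + s *\<^sub>R h + u *\<^sub>R k"
          unfolding in_segment by (auto simp: algebra_simps)
        from op_boundD[OF obn[OF s u(1)], of "k # h # vs"] l
        show "norm (G (Suc (Suc j)) z ((x + s *\<^sub>R h + k - (x + s *\<^sub>R h)) # h # vs) - ?w)
            \<le> e * norm k * norm h * ?P"
          by (simp add: u(2) mult.assoc)
      next
        show "closed_segment (x + s *\<^sub>R h) (x + s *\<^sub>R h + k) \<subseteq> V"
        proof
          fix z assume "z \<in> closed_segment (x + s *\<^sub>R h) (x + s *\<^sub>R h + k)"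
          then obtain u where u: "u \<in> {0..1}" "z = x + s *\<^sub>R h + u *\<^sub>R k"
            unfolding in_segment by (auto simp: algebra_simps)
          then show "z \<in> V" using inV[OF s u(1)] by simp
        qed
      qed (use l in simp)
      then show "norm (G (Suc j) (x + k + s *\<^sub>R h) (h # vs) - G (Suc j) (x + s *\<^sub>R h) (h # vs) - ?w)
          \<le> e * norm k * norm h * ?P"
        by (simp add: add.assoc add.commute)
    qed
    then show "norm ((G j (x + h + k) vs - G j (x + h) vs) - (G j (x + k) vs - G j x vs) - ?w)
        \<le> e * norm k * norm h * ?P"
      by (simp add: f_def algebra_simps)
  qed
qed

text \<open>The second difference is symmetric in \<open>h\<close> and \<open>k\<close>, and both
  mixed derivatives approximate it up to an arbitrarily small multiple of
  \<open>norm k * norm h\<close>.\<close>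

lemma jet_swap:
  assumes J: "jet r V G" and j: "Suc j < r" and x: "x \<in> V" and l: "length vs = j"
  shows "G (Suc (Suc j)) x (k # h # vs) = G (Suc (Suc j)) x (h # k # vs)"
proof -
  let ?P = "\<Prod>v\<leftarrow>vs. norm v"
  let ?B = "G (Suc (Suc j)) x"
  have ml: "multilinear_map (Suc (Suc j)) ?B" by (rule jet_multilinear[OF J _ x]) (use j in simp)
  have bound: "norm (?B (k # h # vs) - ?B (h # k # vs)) \<le> e * (2 * norm k * norm h * ?P)" if e: "e > 0" for e
  proof -
    obtain d where d: "0 < d" "\<And>h k. norm h < d \<Longrightarrow> norm k < d \<Longrightarrow>
      norm ((G j (x + h + k) vs - G j (x + h) vs) - (G j (x + k) vs - G j x vs) - ?B (k # h # vs))
        \<le> e * norm k * norm h * ?P"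
      using second_difference_bound[OF J j x l e] by metis
    \<comment> \<open>The approximation holds for short vectors only. Scaling both by
      \<open>t\<close> makes them short, and \<open>t * t\<close> cancels by bilinearity.\<close>
    define t where "t = d / (2 * (norm h + norm k + 1))"
    have t: "t > 0" unfolding t_def using d by (intro divide_pos_pos) (auto intro: add_nonneg_pos)
    have sm: "norm (t *\<^sub>R v) < d" if "norm v \<le> norm h + norm k" for v
    proof -
      have "norm (t *\<^sub>R v) = t * norm v" using t by simp
      also have "\<dots> \<le> t * (norm h + norm k)" using t that by (intro mult_left_mono) auto
      also have "\<dots> < t * (2 * (norm h + norm k + 1))" using t 
        by (intro mult_strict_left_mono) (auto simp: add_strict_increasing2 add_nonneg_pos add.commute)
      also have "\<dots> = d" unfolding t_def by (simp add: add_nonneg_eq_0_iff)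
      finally show ?thesis .
    qed
    have s2: "?B (t *\<^sub>R a # t *\<^sub>R b # vs) = (t * t) *\<^sub>R ?B (a # b # vs)" for a b
    proof -
      have "linear (\<lambda>u. ?B ([] @ u # (t *\<^sub>R b # vs)))" "linear (\<lambda>u. ?B ([a] @ u # vs))"
        using ml[unfolded multilinear_map_def, rule_format, of "[]" "t *\<^sub>R b # vs"]
          ml[unfolded multilinear_map_def, rule_format, of "[a]" vs] l by auto
      from linear_scale[OF this(1), of t a] linear_scale[OF this(2), of t b] show ?thesis by simp
    qed
    have "norm (?B (t *\<^sub>R k # t *\<^sub>R h # vs) - ?B (t *\<^sub>R h # t *\<^sub>R k # vs)) \<le>
        e * norm (t *\<^sub>R k) * norm (t *\<^sub>R h) * ?P + e * norm (t *\<^sub>R h) * norm (t *\<^sub>R k) * ?P"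
      (is "norm (?b1 - ?b2) \<le> ?e1 + ?e2")
    proof -
      have "norm ((G j (x + t *\<^sub>R h + t *\<^sub>R k) vs - G j (x + t *\<^sub>R h) vs) - (G j (x
          + t *\<^sub>R k) vs - G j x vs) - ?b1) \<le> ?e1"
        by (rule d(2)) (auto intro!: sm simp del: norm_scaleR)
      moreover have "norm ((G j (x + t *\<^sub>R k + t *\<^sub>R h) vs - G j (x + t *\<^sub>R k) vs) - (G j (x
          + t *\<^sub>R h) vs - G j x vs) - ?b2) \<le> ?e2"
        by (rule d(2)) (auto intro!: sm simp del: norm_scaleR)
      moreover have "?b1 - ?b2 =
         ((G j (x + t *\<^sub>R k + t *\<^sub>R h) vs - G j (x + t *\<^sub>R k) vs) - (G j (x + t *\<^sub>R h) vs - G j x vs) - ?b2) -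
         ((G j (x + t *\<^sub>R h + t *\<^sub>R k) vs - G j (x + t *\<^sub>R h) vs) - (G j (x + t *\<^sub>R k) vs - G j x vs) - ?b1)"
        by (simp add: algebra_simps)
      ultimately show ?thesis using norm_triangle_ineq4 by (smt (verit, best))
    qed
    also have "\<dots> = (t * t) * (e * (2 * norm k * norm h * ?P))" using t by simp
    finally have "(t * t) * norm (?B (k # h # vs) - ?B (h # k # vs))
        \<le> (t * t) * (e * (2 * norm k * norm h * ?P))"
      unfolding s2 scaleR_right_diff_distrib[symmetric] using t by simp
    then show ?thesis using t by simp
  qed
  have "norm (?B (k # h # vs) - ?B (h # k # vs)) \<le> 0"
  proof (rule field_le_epsilon)
    fix e :: real assume e: "e > 0"
    define M where "M = 2 * norm k * norm h * ?P"
    have M: "0 \<le> M" using prod_norm_nonneg[of vs] by (simp add: M_def)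
    have "norm (?B (k # h # vs) - ?B (h # k # vs)) \<le> e / (M + 1) * M"
      unfolding M_def by (rule bound) (use e M in \<open>simp add: M_def[symmetric]\<close>)
    also have "\<dots> \<le> e" using e M by (simp add: field_simps)
    finally show "norm (?B (k # h # vs) - ?B (h # k # vs)) \<le> 0 + e" by simp
  qed
  then show ?thesis by simp
qed

text \<open>Permutations of the tail come from the order below by differentiation, and
  \<open>jet_swap\<close> exchanges the first two arguments; together these reach every
  permutation.\<close>

lemma jet_symmetric:
  assumes J: "jet r V G"
  shows "j \<le> r \<Longrightarrow> x \<in> V \<Longrightarrow> length vs = j \<Longrightarrow> mset vs = mset ws \<Longrightarrow> G j x vs = G j x ws"
proof (induction j arbitrary: x vs ws)
  case 0
  then show ?case by simp
next
  case (Suc j)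
  have tail: "G (Suc j) x (h # us) = G (Suc j) x (h # us')"
      if l: "length us = j" and m: "mset us = mset us'" for h us us'
  proof -
    have l': "length us' = j" using l m mset_eq_length by metis
    have d: "((\<lambda>y. G j y us) has_derivative (\<lambda>h. G (Suc j) x (h # us))) (at x)"
      "((\<lambda>y. G j y us') has_derivative (\<lambda>h. G (Suc j) x (h # us'))) (at x)"
      using jet_der[OF J _ \<open>x \<in> V\<close>] Suc.prems(1) l l' by auto
    have "((\<lambda>y. G j y us') has_derivative (\<lambda>h. G (Suc j) x (h # us))) (at x)"
      by (rule has_derivative_transform_within_open[OF d(1) jet_open[OF J] \<open>x \<in> V\<close>])
        (use Suc.IH[OF _ _ l m] Suc.prems(1) in auto)
    from fun_cong[OF has_derivative_unique[OF this d(2)], of h] show ?thesis .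
  qed
  obtain v us where vs: "vs = v # us" "length us = j" using Suc.prems by (cases vs) auto
  have "length ws = Suc j" using Suc.prems(3,4) mset_eq_length by metis
  then obtain w us' where ws: "ws = w # us'" "length us' = j" by (cases ws) auto
  show ?case
  proof (cases "v = w")
    case True
    then show ?thesis using tail[of us us'] vs ws Suc.prems(4) by simp
  next
    case False
    then have "w \<in> set us" using Suc.prems(4) vs ws by (metis list.set_intros(1) set_ConsD set_mset_mset)
    then obtain zs where zs: "mset us = mset (w # zs)"
      by (metis ex_mset in_set_conv_decomp mset.simps(2) mset_append union_mset_add_mset_right)
    have us': "mset us' = mset (v # zs)" using Suc.prems(4) zs vs ws
      by (simp add: add_mset_commute)
    have lz: "j = Suc (length zs)" using zs vs(2) by (metis length_Cons size_mset)
    have "G (Suc j) x (v # us) = G (Suc j) x (v # w # zs)" by (rule tail[OF vs(2) zs])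
    also have "\<dots> = G (Suc j) x (w # v # zs)"
      using jet_swap[OF J _ \<open>x \<in> V\<close> refl, of zs v w] Suc.prems(1) lz by simp
    also have "\<dots> = G (Suc j) x (w # us')" by (rule tail[symmetric, OF ws(2) us'])
    finally show ?thesis using vs ws by simp
  qed
qed

section \<open>Construction of jets: linear images, limits, polynomials\<close>

text \<open>A bounded derivative of order \<open>Suc r\<close> makes \<open>G r\<close> locally
  Lipschitz, which replaces a direct check of its continuity in operator norm.\<close>

lemma jetI_lipschitz:
  assumes V: "open V" and C: "\<And>j x. j \<le> Suc r \<Longrightarrow> x \<in> V \<Longrightarrow> op_bound j (G j x) C"
    and der: "\<And>j x vs. j \<le> r \<Longrightarrow> x \<in> V \<Longrightarrow> length vs = j \<Longrightarrow>
      ((\<lambda>y. G j y vs) has_derivative (\<lambda>h. G (Suc j) x (h # vs))) (at x)"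
  shows "jet r V G"
  unfolding jet_def
proof (intro conjI ballI allI impI)
  show "\<exists>C. \<forall>j\<le>r. \<forall>x\<in>V. op_bound j (G j x) C" using C by (intro exI[of _ C]) auto
  fix x and e :: real assume x: "x \<in> V" and e: "0 < e"
  obtain d where d: "0 < d" "ball x d \<subseteq> V" using V x open_contains_ball by blast
  have C0: "0 \<le> C" using mult_bound_nonneg[OF C[OF _ x, of 0]] by simp
  have "\<forall>\<^sub>F y in nhds x. y \<in> ball x (min d (e / (C + 1)))"
    using d(1) e C0 by (intro eventually_nhds_in_open) auto
  then show "\<forall>\<^sub>F y in nhds x. op_bound r (\<lambda>vs. G r y vs - G r x vs) e"
  proof eventually_elim
    case (elim y)
    then have y: "y \<in> ball x d" "C * norm (y - x) \<le> e"
    proof -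
      have "norm (y - x) * (C + 1) \<le> e" using elim C0
        by (auto simp: dist_norm norm_minus_commute pos_less_divide_eq)
      then show "C * norm (y - x) \<le> e" using norm_ge_zero[of "y - x"]
          by (simp only: distrib_left mult_1_right mult.commute[of C])
    qed auto
    show ?case
    proof (rule op_boundI)
      fix vs :: "'a list" assume l: "length vs = r"
      have "norm (G r y vs - G r x vs) \<le> (C * (\<Prod>v\<leftarrow>vs. norm v)) * norm (y - x)"
      proof (rule differentiable_bound[where S="ball x d" and f'="\<lambda>z h. G (Suc r) z (h # vs)"])
        fix z assume z: "z \<in> ball x d"
        show "((\<lambda>y. G r y vs) has_derivative (\<lambda>h. G (Suc r) z (h # vs))) (at z within ball x d)"
          by (rule has_derivative_at_withinI[OF der]) (use z d l in auto)
        show "onorm (\<lambda>h. G (Suc r) z (h # vs)) \<le> C * (\<Prod>v\<leftarrow>vs. norm v)"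
        proof (rule onorm_bound)
          show "0 \<le> C * (\<Prod>v\<leftarrow>vs. norm v)" using C0 prod_norm_nonneg[of vs] by simp
          fix h show "norm (G (Suc r) z (h # vs)) \<le> C * (\<Prod>v\<leftarrow>vs. norm v) * norm h"
            using op_boundD[OF C[OF order_refl, of z], of "h # vs"] z d l by (auto simp: mult_ac)
        qed
      qed (use y d in auto)
      also have "\<dots> = (C * norm (y - x)) * (\<Prod>v\<leftarrow>vs. norm v)" by simp
      also have "\<dots> \<le> e * (\<Prod>v\<leftarrow>vs. norm v)" using y(2) prod_norm_nonneg by (rule mult_right_mono)
      finally show "norm (G r y vs - G r x vs) \<le> e * (\<Prod>v\<leftarrow>vs. norm v)" .
    qed (use e in simp)
  qed
qed (use V der in auto)

lemma jet_linear_image: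
  assumes J: "jet r V G" and L: "bounded_linear L"
  shows "jet r V (\<lambda>j x vs. L (G j x vs))"
proof -
  obtain K where K: "0 < K" "\<And>x. norm (L x) \<le> norm x * K" using bounded_linear.pos_bounded[OF L] by metis
  obtain C where C: "\<And>j x. j \<le> r \<Longrightarrow> x \<in> V \<Longrightarrow> op_bound j (G j x) C" using jet_bound[OF J] by metis
  have lin_bound: "lin_bound plain L K"
    unfolding lin_bound_def
  proof (intro conjI allI impI)
    fix c and x :: 'a assume "norm x \<le> c"
    then have "norm x * K \<le> c * K" using K by simp
    then show "norm (L x) \<le> K * c" using K(2)[of x] by (simp add: mult.commute)
  qed (use K in simp)
  show ?thesis unfolding jet_def
  proof (intro conjI ballI allI impI)
    show "open V" by (rule jet_open[OF J])
    show "\<exists>C. \<forall>j\<le>r. \<forall>x\<in>V. op_bound j (\<lambda>vs. L (G j x vs)) C"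
      using mult_bound_lin_bound[OF lin_bound C] by blast
    fix x assume x: "x \<in> V"
    show "((\<lambda>y. L (G j y vs)) has_derivative (\<lambda>h. L (G (Suc j) x (h # vs)))) (at x)"
      if "j < r" "length vs = j" for j vs
      by (rule bounded_linear.has_derivative[OF L jet_der[OF J that(1) x that(2)]])
    fix e :: real assume "0 < e"
    then have "\<forall>\<^sub>F y in nhds x. op_bound r (\<lambda>vs. G r y vs - G r x vs) (e / K)"
      using K by (intro jet_opcont[OF J _ x]) auto
    then show "\<forall>\<^sub>F y in nhds x. op_bound r (\<lambda>vs. L (G r y vs) - L (G r x vs)) e"
    proof eventually_elim
      case (elim y)
      from mult_bound_lin_bound[OF lin_bound elim] show ?case
        using K by (simp add: linear_diff[OF bounded_linear.linear[OF L]])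
    qed
  qed
qed

lemma jet_diff:
  assumes J: "jet r V G" and J': "jet r V G'"
  shows "jet r V (\<lambda>j x vs. G j x vs - G' j x vs)"
proof -
  obtain C where C: "\<And>j x. j \<le> r \<Longrightarrow> x \<in> V \<Longrightarrow> op_bound j (G j x) C" using jet_bound[OF J] by metis
  obtain C' where C': "\<And>j x. j \<le> r \<Longrightarrow> x \<in> V \<Longrightarrow> op_bound j (G' j x) C'" using jet_bound[OF J'] by metis
  show ?thesis unfolding jet_def
  proof (intro conjI ballI allI impI)
    show "open V" by (rule jet_open[OF J])
    show "\<exists>C. \<forall>j\<le>r. \<forall>x\<in>V. op_bound j (\<lambda>vs. G j x vs - G' j x vs) C"
      using pl.mult_bound_diff[OF C C'] by blast
    fix x assume x: "x \<in> V"
    show "((\<lambda>y. G j y vs - G' j y vs) has_derivative (\<lambda>h. G (Suc j) x (h # vs) - G' (Suc j) x (h # vs))) (at x)"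
      if "j < r" "length vs = j" for j vs
      by (rule has_derivative_diff[OF jet_der[OF J that(1) x that(2)] jet_der[OF J' that(1) x that(2)]])
    fix e :: real assume e: "0 < e"
    have "\<forall>\<^sub>F y in nhds x. op_bound r (\<lambda>vs. G r y vs - G r x vs) (e / 2)"
      "\<forall>\<^sub>F y in nhds x. op_bound r (\<lambda>vs. G' r y vs - G' r x vs) (e / 2)"
      using e by (auto intro!: jet_opcont[OF J _ x] jet_opcont[OF J' _ x])
    then show "\<forall>\<^sub>F y in nhds x. op_bound r (\<lambda>vs. G r y vs - G' r y vs - (G r x vs - G' r x vs)) e"
    proof eventually_elim
      case (elim y)
      have "op_bound r (\<lambda>vs. G r y vs - G' r y vs - (G r x vs - G' r x vs)) (e / 2 + e / 2)"
        by (rule mult_bound_cong[OF pl.mult_bound_diff[OF elim]]) simp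
      then show ?case by simp
    qed
  qed
qed

text \<open>For fixed arguments this is termwise differentiation under uniform convergence of the
  derivatives, on a convex set. Continuity of the top order is the usual argument with three times
  \<open>e / 3\<close>.\<close>

lemma jet_limit:
  fixes G :: "nat \<Rightarrow> nat \<Rightarrow> 'e::banach \<Rightarrow> 'e list \<Rightarrow> 'e"
  assumes J: "\<And>n. jet r V (G n)" and cV: "convex V"
    and lim: "\<And>j e. j \<le> r \<Longrightarrow> 0 < e \<Longrightarrow> \<forall>\<^sub>F n in sequentially. \<forall>x\<in>V. op_bound j (\<lambda>vs. G n j x vs - H j x vs) e"
  shows "jet r V H"
  unfolding jet_def
proof (intro conjI ballI allI impI)
  have V: "open V" by (rule jet_open[OF J[of 0]])
  show "open V" by (rule V)
  have "\<forall>\<^sub>F n in sequentially. \<forall>j\<in>{..r}. \<forall>x\<in>V. op_bound j (\<lambda>vs. G n j x vs - H j x vs) 1"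
    using lim by (intro eventually_ball_finite) auto
  then obtain n where n: "\<forall>j\<in>{..r}. \<forall>x\<in>V. op_bound j (\<lambda>vs. G n j x vs - H j x vs) 1"
    by (auto simp: eventually_sequentially)
  obtain C where C: "\<And>j x. j \<le> r \<Longrightarrow> x \<in> V \<Longrightarrow> op_bound j (G n j x) C" using jet_bound[OF J] by metis
  have "op_bound j (H j x) (C + 1)" if "j \<le> r" "x \<in> V" for j x
    using pl.mult_bound_diff[OF C[OF that], of "\<lambda>vs. G n j x vs - H j x vs" 1] n that by simp
  then show "\<exists>C. \<forall>j\<le>r. \<forall>x\<in>V. op_bound j (H j x) C" by blast
  fix x assume x: "x \<in> V"
  show "((\<lambda>y. H j y vs) has_derivative (\<lambda>h. H (Suc j) x (h # vs))) (at x)"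
    if j: "j < r" and l: "length vs = j" for j vs
  proof -
    let ?P = "\<Prod>v\<leftarrow>vs. norm v"
    have P: "0 \<le> ?P" by (rule prod_norm_nonneg)
    have conv: "(\<lambda>n. G n j y vs) \<longlonglongrightarrow> H j y vs" if y: "y \<in> V" for y
    proof (rule tendstoI)
      fix e :: real assume e: "0 < e"
      have "\<forall>\<^sub>F n in sequentially. \<forall>x\<in>V. op_bound j (\<lambda>vs. G n j x vs - H j x vs) (e / (?P + 1))"
        using e P j by (intro lim) auto
      then show "\<forall>\<^sub>F n in sequentially. dist (G n j y vs) (H j y vs) < e"
      proof eventually_elim
        case (elim n)
        have "norm (G n j y vs - H j y vs) \<le> e / (?P + 1) * ?P" using op_boundD[OF elim[rule_format, OF y] l] .
        also have "\<dots> < e" using e P by (simp add: field_simps)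
        finally show ?case by (simp add: dist_norm)
      qed
    qed
    have "\<exists>g. \<forall>y\<in>V. (\<lambda>n. G n j y vs) \<longlonglongrightarrow> g y \<and> (g has_derivative (\<lambda>h. H (Suc j) y (h # vs))) (at y within V)"
    proof (rule has_derivative_sequence[where f="\<lambda>n y. G n j y vs" and f'="\<lambda>n y h. G n (Suc j) y (h # vs)"
          and g'="\<lambda>y h. H (Suc j) y (h # vs)", OF cV _ _ x conv[OF x]])
      show "((\<lambda>y. G n j y vs) has_derivative (\<lambda>h. G n (Suc j) y (h # vs))) (at y within V)" if "y \<in> V" for n y
        by (rule has_derivative_at_withinI[OF jet_der[OF J j that l]])
      fix e :: real assume e: "0 < e"
      have "\<forall>\<^sub>F n in sequentially. \<forall>x\<in>V. op_bound (Suc j) (\<lambda>vs. G n (Suc j) x vs - H (Suc j) x vs) (e / (?P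
          + 1))"
        using e P j by (intro lim) auto
      then show "\<forall>\<^sub>F n in sequentially. \<forall>y\<in>V. \<forall>h. norm (G n (Suc j) y (h # vs) - H (Suc j) y (h # vs))
          \<le> e * norm h"
      proof (eventually_elim, intro ballI allI)
        fix n y h assume a: "\<forall>x\<in>V. op_bound (Suc j) (\<lambda>vs. G n (Suc j) x vs - H (Suc j) x vs) (e / (?P + 1))"
            "y \<in> V"
        have "norm (G n (Suc j) y (h # vs) - H (Suc j) y (h # vs)) \<le> e / (?P + 1) * (norm h * ?P)"
          using op_boundD[OF a(1)[rule_format, OF a(2)], of "h # vs"] l by simp
        also have "\<dots> = (e * norm h) * (?P / (?P + 1))" by simp
        also have "\<dots> \<le> (e * norm h) * 1" using e P by (intro mult_left_mono) auto
        finally show "norm (G n (Suc j) y (h # vs) - H (Suc j) y (h # vs)) \<le> e * norm h" by simp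
      qed
    qed
    then obtain g where g: "\<And>y. y \<in> V \<Longrightarrow> (\<lambda>n. G n j y vs) \<longlonglongrightarrow> g y"
      "\<And>y. y \<in> V \<Longrightarrow> (g has_derivative (\<lambda>h. H (Suc j) y (h # vs))) (at y within V)" by blast
    have eq: "g y = H j y vs" if "y \<in> V" for y using LIMSEQ_unique[OF g(1)[OF that] conv[OF that]] .
    have "(g has_derivative (\<lambda>h. H (Suc j) x (h # vs))) (at x)"
      using g(2)[OF x] at_within_open[OF x V] by simp
    then show ?thesis by (rule has_derivative_transform_within_open[OF _ V x]) (rule eq)
  qed
  fix e :: real assume e: "0 < e"
  have "\<forall>\<^sub>F n in sequentially. \<forall>x\<in>V. op_bound r (\<lambda>vs. G n r x vs - H r x vs) (e / 3)"
    using e by (intro lim) auto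
  then obtain n where n: "\<And>x. x \<in> V \<Longrightarrow> op_bound r (\<lambda>vs. G n r x vs - H r x vs) (e / 3)"
    by (auto simp: eventually_sequentially)
  have "\<forall>\<^sub>F y in nhds x. op_bound r (\<lambda>vs. G n r y vs - G n r x vs) (e / 3)"
    using e by (intro jet_opcont[OF J _ x]) auto
  moreover have "\<forall>\<^sub>F y in nhds x. y \<in> V" by (rule eventually_nhds_in_open[OF V x])
  ultimately show "\<forall>\<^sub>F y in nhds x. op_bound r (\<lambda>vs. H r y vs - H r x vs) e"
  proof eventually_elim
    case (elim y)
    have "op_bound r (\<lambda>vs. H r y vs - H r x vs) (e / 3 + e / 3 + e / 3)"
      by (rule mult_bound_cong[OF pl.mult_bound_add[OF pl.mult_bound_diff[OF elim(1) n[OF elim(2)]] n[OF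
          x]]]) simp
    then show ?case by simp
  qed
qed

definition linear_jet :: "('e \<Rightarrow> 'e) \<Rightarrow> nat \<Rightarrow> 'e::real_normed_vector \<Rightarrow> 'e list \<Rightarrow> 'e" where
  "linear_jet A j x vs = (if j = 0 then A x else if j = 1 then A (hd vs) else 0)"

lemma jet_linear_jet:
  assumes A: "bounded_linear (A :: 'e::banach \<Rightarrow> 'e)" and V: "open V" "\<And>x. x \<in> V \<Longrightarrow> norm x \<le> D"
  shows "jet r V (linear_jet A)"
proof -
  obtain K where K: "0 < K" "\<And>x. norm (A x) \<le> norm x * K" using bounded_linear.pos_bounded[OF A] by metis
  show ?thesis
  proof (rule jetI_lipschitz[OF V(1)])
    fix j and x :: 'e assume x: "x \<in> V"
    have D: "0 \<le> D" using V(2)[OF x] norm_ge_zero[of x] by linarith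
    show "op_bound j (linear_jet A j x) (D * K + K)"
    proof (rule op_boundI)
      show "0 \<le> D * K + K" using D K by simp
      fix vs :: "'e list" assume l: "length vs = j"
      consider "j = 0" | "j = 1" | "j > 1" by linarith
      then show "norm (linear_jet A j x vs) \<le> (D * K + K) * (\<Prod>v\<leftarrow>vs. norm v)"
      proof cases
        case 1
        have "norm (A x) \<le> D * K" using K(2)[of x] V(2)[OF x] K(1) by (smt (verit) mult_right_mono)
        then show ?thesis using 1 l K by (simp add: linear_jet_def)
      next
        case 2
        then obtain v where v: "vs = [v]" using l by (cases vs) auto
        have "norm v * K \<le> (D * K + K) * norm v" using D K by (simp add: algebra_simps)
        then show ?thesis using 2 v K(2)[of v] by (simp add: linear_jet_def)
      next
        case 3
        then show ?thesis using D K prod_norm_nonneg[of vs] by (simp add: linear_jet_def)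
      qed
    qed
  next
    fix j and x :: 'e and vs :: "'e list" assume "length vs = j"
    show "((\<lambda>y. linear_jet A j y vs) has_derivative (\<lambda>h. linear_jet A (Suc j) x (h # vs))) (at x)"
    proof (cases j)
      case 0
      then show ?thesis using bounded_linear_imp_has_derivative[OF A] by (simp add: linear_jet_def)
    next
      case (Suc i)
      then show ?thesis by (simp add: linear_jet_def)
    qed
  qed
qed

text \<open>The derivatives of the polynomial with terms \<open>S k (x, ..., x) / k!\<close>: for
  symmetric \<open>S k\<close>, differentiating \<open>j\<close> times leaves the factor
  \<open>1 / (k - j)!\<close>.\<close>

definition taylor_jet :: "(nat \<Rightarrow> 'e::real_normed_vector list \<Rightarrow> 'e) \<Rightarrow> nat \<Rightarrow> nat \<Rightarrow> 'e \<Rightarrow> 'e list \<Rightarrow> 'e" where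
  "taylor_jet S d j x vs = (\<Sum>k=j..d. (1 / fact (k - j)) *\<^sub>R S k (vs @ replicate (k - j) x))"

lemma taylor_jet_at_0:
  assumes "\<And>k. k \<le> d \<Longrightarrow> multilinear_map k (S k)" "j \<le> d" "length vs = j"
  shows "taylor_jet S d j 0 vs = S j vs"
proof -
  have "S k (vs @ replicate (k - j) 0) = 0" if "k \<in> {Suc j..d}" for k
  proof -
    define i where "i = k - Suc j"
    have i: "k - j = Suc i" using that by (auto simp: i_def)
    have "linear (\<lambda>u. S k (vs @ u # replicate i 0))"
      using assms(1)[of k] that assms(3) i unfolding multilinear_map_def by auto
    from linear_0[OF this] show ?thesis using i by simp
  qed
  then have "(\<Sum>k=Suc j..d. (1 / fact (k - j)) *\<^sub>R S k (vs @ replicate (k - j) 0)) = 0" by simp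
  then show ?thesis using assms(2) by (simp add: taylor_jet_def sum.atLeast_Suc_atMost)
qed

lemma (in sized) mult_bound_taylor_jet:
  assumes S: "\<And>k. k \<le> d \<Longrightarrow> mult_bound Z k (S k) C" and x: "nrm x \<le> 1"
  shows "mult_bound Z j (taylor_jet S d j x) (real (Suc d) * C)"
proof -
  have C: "0 \<le> C" using mult_bound_nonneg[OF S[of 0]] by simp
  have "mult_bound Z j (\<lambda>vs. (1 / fact (k - j)) *\<^sub>R S k (vs @ replicate (k - j) x)) C" if k: "k \<in> {j..d}" for k
  proof -
    have "mult_bound Z (j + (k - j)) (S k) C" using S k by simp
    from mult_bound_scaleR[OF mult_bound_const_append[OF this, of x], of "1 / fact (k - j)"]
    show ?thesis
    proof (rule mult_bound_mono)
      have n1: "nrm x ^ (k - j) \<le> 1" using x nrm_nonneg by (simp add: power_le_one)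
      have a: "C * nrm x ^ (k - j) \<le> C" using mult_left_mono[OF n1 C] by simp
      have "0 \<le> C * nrm x ^ (k - j)" using C nrm_nonneg[of x] by simp
      then have "\<bar>1 / fact (k - j)\<bar> * (C * nrm x ^ (k - j)) \<le> 1 * C"
        by (intro mult_mono a) auto
      then show "\<bar>1 / fact (k - j)\<bar> * (C * nrm x ^ (k - j)) \<le> C" by simp
    qed
  qed
  from mult_bound_sum[OF _ this, of "{j..d}"] have
      "mult_bound Z j (taylor_jet S d j x) (real (card {j..d}) * C)"
    unfolding taylor_jet_def by simp
  then show ?thesis by (rule mult_bound_mono) (use C in \<open>auto intro!: mult_right_mono\<close>)
qed

text \<open>By symmetry the \<open>k - j\<close> contributions of the product rule coincide, with
  \<open>h\<close> moved to the front, and this factor turns \<open>1 / (k - j)!\<close> into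
  \<open>1 / (k - Suc j)!\<close>.\<close>

lemma taylor_jet_derivative:
  fixes S :: "nat \<Rightarrow> 'e::banach list \<Rightarrow> 'e"
  assumes ml: "\<And>k. k \<le> d \<Longrightarrow> multilinear_map k (S k)" and bd: "\<And>k. k \<le> d \<Longrightarrow> op_bound k (S k) C"
    and sym: "\<And>k vs ws. k \<le> d \<Longrightarrow> length vs = k \<Longrightarrow> mset vs = mset ws \<Longrightarrow> S k vs = S k ws"
    and l: "length vs = j"
  shows "((\<lambda>y. taylor_jet S d j y vs) has_derivative (\<lambda>h. taylor_jet S d (Suc j) x (h # vs))) (at x)"
proof -
  have trm: "((\<lambda>y. S k (vs @ replicate (k - j) y)) has_derivative
      (\<lambda>h. real (k - j) *\<^sub>R S k (h # vs @ replicate (k - Suc j) x))) (at x)" if k: "k \<in> {j..d}" for k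
  proof -
    let ?q = "k - j"
    have "((\<lambda>y. S k (vs @ map (\<lambda>m. y) [0..<?q])) has_derivative
      (\<lambda>h. 0 + (\<Sum>m<?q. S k (vs @ map (\<lambda>i. if i = m then h else x) [0..<?q])))) (at x)"
    proof (rule multilinear_product_rule[where \<G>="\<lambda>x ws. S k (vs @ ws)" and \<G>'="\<lambda>h ws. 0"
          and g="\<lambda>m y. y" and g'="\<lambda>m h. h" and C="C * (\<Prod>v\<leftarrow>vs. norm v)"])
      have "multilinear_map ?q (\<lambda>ws. S k (vs @ ws))" unfolding multilinear_map_def
      proof (intro allI impI)
        fix us ws :: "'e list" assume "length us + 1 + length ws = ?q"
        then show "linear (\<lambda>u. S k (vs @ us @ u # ws))"
          using ml[of k, unfolded multilinear_map_def, rule_format, of "vs @ us" ws] k l by simp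
      qed
      then show "\<forall>\<^sub>F x in nhds x. multilinear_map ?q (\<lambda>ws. S k (vs @ ws))" by simp
      show "op_bound ?q (\<lambda>ws. S k (vs @ ws)) (C * (\<Prod>v\<leftarrow>vs. norm v))"
      proof (rule op_boundI)
        show "0 \<le> C * (\<Prod>v\<leftarrow>vs. norm v)" using mult_bound_nonneg[OF bd[of 0]] prod_norm_nonneg[of vs] by simp
        show "norm (S k (vs @ ws)) \<le> C * (\<Prod>v\<leftarrow>vs. norm v) * (\<Prod>v\<leftarrow>ws. norm v)" if "length ws = ?q" for ws
          using op_boundD[OF bd, of k "vs @ ws"] that k l by (simp add: mult.assoc)
      qed
      show "\<forall>\<^sub>F x in nhds x. op_bound ?q (\<lambda>ws. S k (vs @ ws) - S k (vs @ ws)) e" if "e > 0" for e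
      proof -
        have "op_bound ?q (\<lambda>ws. 0 :: 'e) e" by (rule pl.mult_bound_mono[OF pl.mult_bound_zero]) (use that in
            simp)
        then show ?thesis by simp
      qed
    qed auto
    note D = this
    have e1: "S k (vs @ map (\<lambda>i. if i = m then h else x) [0..<?q]) = S k (h # vs @ replicate (k - Suc j) x)"
      if "m < ?q" for m h
    proof (rule sym)
      show "mset (vs @ map (\<lambda>i. if i = m then h else x) [0..<?q]) = mset (h # vs @ replicate (k - Suc j) x)"
      proof -
        have "map (\<lambda>i. if i = m then h else x) [0..<?q] =
            map (\<lambda>i. if i = m then h else x) [0..<m] @ h # map (\<lambda>i. if i = m then h else x) [Suc m..<?q]"
          by (simp add: upt_split[OF that])
        also have "map (\<lambda>i. if i = m then h else x) [0..<m] = replicate m x"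
          by (simp add: list_eq_iff_nth_eq)
        also have "map (\<lambda>i. if i = m then h else x) [Suc m..<?q] = replicate (?q - Suc m) x"
          by (simp add: list_eq_iff_nth_eq)
        finally have "mset (map (\<lambda>i. if i = m then h else x) [0..<?q]) =
            add_mset h (mset (replicate m x @ replicate (?q - Suc m) x))" by simp
        also have "replicate m x @ replicate (?q - Suc m) x = replicate (m + (?q - Suc m)) x"
          by (simp only: replicate_add)
        also have "m + (?q - Suc m) = k - Suc j" using that by simp
        finally show ?thesis by simp
      qed
    qed (use k l in auto)
    have e2: "map (\<lambda>m. y) [0..<?q] = replicate ?q y" for y :: 'e
      by (simp add: map_replicate_const)
    have eq: "(\<lambda>h. 0 + (\<Sum>m<?q. S k (vs @ map (\<lambda>i. if i = m then h else x) [0..<?q]))) =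
        (\<lambda>h. real ?q *\<^sub>R S k (h # vs @ replicate (k - Suc j) x))"
      by (rule ext) (simp add: e1 sum_constant_scaleR)
    show ?thesis using D unfolding eq e2 .
  qed
  have "((\<lambda>y. taylor_jet S d j y vs) has_derivative
     (\<lambda>h. \<Sum>k=j..d. (1 / fact (k - j)) *\<^sub>R (real (k - j) *\<^sub>R S k (h # vs @ replicate (k - Suc j) x)))) (at x)"
    unfolding taylor_jet_def by (intro has_derivative_sum has_derivative_scaleR_right trm)
  moreover have "(\<Sum>k=j..d. (1 / fact (k - j)) *\<^sub>R (real (k - j) *\<^sub>R S k (h # vs @ replicate (k - Suc j) x))) =
      taylor_jet S d (Suc j) x (h # vs)" for h
  proof -
    \<comment> \<open>The term \<open>k = j\<close> does not depend on \<open>y\<close>; its factor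
      \<open>real (k - j)\<close> is \<open>0\<close>.\<close>
    have "(\<Sum>k=j..d. (1 / fact (k - j)) *\<^sub>R (real (k - j) *\<^sub>R S k (h # vs @ replicate (k - Suc j) x))) =
       (\<Sum>k=Suc j..d. (1 / fact (k - j)) *\<^sub>R (real (k - j) *\<^sub>R S k (h # vs @ replicate (k - Suc j) x)))"
      by (rule sum.mono_neutral_right) (auto simp: Suc_le_eq)
    also have "\<dots> = (\<Sum>k=Suc j..d. (1 / fact (k - Suc j)) *\<^sub>R S k (h # vs @ replicate (k - Suc j) x))"
    proof (rule sum.cong[OF refl])
      fix k assume "k \<in> {Suc j..d}"
      moreover define i where "i = k - Suc j"
      ultimately have i: "k - j = Suc i" "k - Suc j = i" by (auto simp: i_def)
      have "1 / fact (Suc i) * real (Suc i) = 1 / fact i"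
        by (simp only: fact_Suc) (simp del: of_nat_Suc)
      then show "(1 / fact (k - j)) *\<^sub>R (real (k - j) *\<^sub>R S k (h # vs @ replicate (k - Suc j) x)) =
         (1 / fact (k - Suc j)) *\<^sub>R S k (h # vs @ replicate (k - Suc j) x)"
        unfolding i by (simp only: scaleR_scaleR)
    qed
    finally show ?thesis by (simp add: taylor_jet_def)
  qed
  ultimately show ?thesis by simp
qed

lemma jet_taylor_jet:
  fixes S :: "nat \<Rightarrow> 'e::banach list \<Rightarrow> 'e"
  assumes ml: "\<And>k. k \<le> d \<Longrightarrow> multilinear_map k (S k)" and bd: "\<And>k. k \<le> d \<Longrightarrow> op_bound k (S k) C"
    and sym: "\<And>k vs ws. k \<le> d \<Longrightarrow> length vs = k \<Longrightarrow> mset vs = mset ws \<Longrightarrow> S k vs = S k ws"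
    and V: "open V" "\<And>x. x \<in> V \<Longrightarrow> norm x \<le> 1"
  shows "jet r V (taylor_jet S d)"
proof (rule jetI_lipschitz[OF V(1)])
  show "op_bound j (taylor_jet S d j x) (real (Suc d) * C)" if "x \<in> V" for j x
    by (rule pl.mult_bound_taylor_jet[OF bd V(2)[OF that]])
  show "((\<lambda>y. taylor_jet S d j y vs) has_derivative (\<lambda>h. taylor_jet S d (Suc j) x (h # vs))) (at x)"
    if "length vs = j" for j x vs
    by (rule taylor_jet_derivative[OF ml bd sym that])
qed

section \<open>The fixed point iteration\<close>

text \<open>\<open>Z\<close> is meant to be the adapted size, in which one application of
  \<open>A\<close> costs \<open>b\<close> and one of its inverse \<open>Ai\<close> costs
  \<open>a\<close>; then \<open>a * b ^ L < 1\<close> expresses the spectral gap. \<open>M\<close>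
  bounds all derivatives of \<open>F\<close> uniformly.\<close>

locale contraction_data = sized Z nrm kN
  for Z :: "'t::comm_monoid_add \<Rightarrow> real \<Rightarrow> 'e::banach \<Rightarrow> bool" and nrm kN +
  fixes Fj :: "nat \<Rightarrow> 'e \<Rightarrow> 'e list \<Rightarrow> 'e" and A Ai :: "'e \<Rightarrow> 'e" and r L :: nat and a b M \<delta>0 :: real
  assumes L2: "2 \<le> L" and Lr: "L \<le> r" and \<delta>0: "0 < \<delta>0"
    and FJ: "jet r {x. nrm x < \<delta>0} Fj"
    and FM: "\<And>j x. j \<le> r \<Longrightarrow> nrm x < \<delta>0 \<Longrightarrow> mult_bound Z j (Fj j x) M" and M1: "1 \<le> M"
    and F0: "Fj 0 0 [] = 0" and F1: "\<And>v. Fj 1 0 [v] = A v"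
    and blA: "bounded_linear A" and blAi: "bounded_linear Ai"
    and AAi: "\<And>x. A (Ai x) = x" and AiA: "\<And>x. Ai (A x) = x"
    and dA: "lin_bound Z A b" and dAi: "lin_bound Z Ai a"
    and b1: "b < 1" and ab: "a * b ^ L < 1"
begin

definition "H y = taylor_jet (\<lambda>k. Fj k 0) L 0 y []" for y :: 'e

definition "p j y vs = taylor_jet (\<lambda>k. Fj k 0) L j y vs - linear_jet A j y vs" for j and y :: 'e and vs

text \<open>Bounds all derivatives of \<open>p\<close> on the unit ball: \<open>Suc L\<close> Taylor
  terms of size \<open>M\<close>, and \<open>b\<close> for the subtracted linear part.\<close>

definition "Mp = real (Suc L) * M + b"

text \<open>Since \<open>H = A + p\<close>, the equation \<open>R \<circ> F = H \<circ> R\<close> means \<open>T R = R\<close>.\<close>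

definition "T R j x vs = Ai (composite_jet R Fj j x vs - composite_jet p R j x vs)" for R j and x :: 'e and vs

abbreviation "idj \<equiv> linear_jet (\<lambda>x::'e. x)"

lemma a0: "0 \<le> a" and b0: "0 \<le> b" using dA dAi by (auto simp: lin_bound_def)

lemma Mp0: "0 \<le> Mp" using b0 M1 by (simp add: Mp_def)

lemma zero_mem: "nrm 0 < \<delta>0" using \<delta>0 by simp

lemma S_ml: "k \<le> r \<Longrightarrow> multilinear_map k (Fj k 0)"
  using jet_multilinear[OF FJ] \<delta>0 by simp

lemma S_sym: "k \<le> r \<Longrightarrow> length vs = k \<Longrightarrow> mset vs = mset ws \<Longrightarrow> Fj k 0 vs = Fj k 0 ws"
  using jet_symmetric[OF FJ] \<delta>0 by simp

lemma mult_bound_linear_jet: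
  assumes B: "lin_bound Z B c" and y: "nrm y \<le> 1"
  shows "mult_bound Z j (linear_jet B j y) c"
proof (rule mult_boundI)
  show c: "0 \<le> c" using B by (simp add: lin_bound_def)
  fix l :: "('t \<times> real \<times> 'e) list"
  assume l: "length l = j" "\<And>q. q \<in> set l \<Longrightarrow> Z (fst q) (fst (snd q)) (snd (snd q))"
  consider "j = 0" | "j = 1" | "j > 1" by linarith
  then show "Z (\<Sum>q\<leftarrow>l. fst q) (c * (\<Prod>q\<leftarrow>l. fst (snd q))) (linear_jet B j y (map (\<lambda>q. snd (snd q)) l))"
  proof cases
    case 1
    have "Z 0 1 y" using y by (simp add: Z_nrm)
    then have "Z 0 (c * 1) (B y)" using B unfolding lin_bound_def by blast
    then show ?thesis using 1 l by (simp add: linear_jet_def)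
  next
    case 2
    then obtain q where q: "l = [q]" using l by (cases l) auto
    have "Z (fst q) (c * fst (snd q)) (B (snd (snd q)))" using B l(2)[of q] q unfolding lin_bound_def by simp
    then show ?thesis using 2 q by (simp add: linear_jet_def)
  next
    case 3
    have "0 \<le> (\<Prod>q\<leftarrow>l. fst (snd q))" by (rule prod_list_nonneg) (use Z_nonneg[OF l(2)] in auto)
    then have "Z (\<Sum>q\<leftarrow>l. fst q) (c * (\<Prod>q\<leftarrow>l. fst (snd q))) 0" using c by (intro Z_mono[OF Z_zero]) auto
    then show ?thesis using 3 by (simp add: linear_jet_def)
  qed
qed

lemma lin_bound_id: "lin_bound Z (\<lambda>x. x) 1"
  by (simp add: lin_bound_def)

lemma mult_bound_idj: "nrm y \<le> 1 \<Longrightarrow> mult_bound Z j (idj j y) 1"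
  by (rule mult_bound_linear_jet[OF lin_bound_id])

lemma mult_bound_p: "nrm y \<le> 1 \<Longrightarrow> mult_bound Z j (p j y) Mp"
  unfolding p_def Mp_def
  by (intro mult_bound_diff mult_bound_taylor_jet mult_bound_linear_jet[OF dA]) (use Lr \<delta>0 FM in auto)

lemma jet_p: "jet s {x. nrm x < 1} p"
proof -
  have 1: "open {x. nrm x < 1}" by (rule open_nrm_ball)
  have 2: "norm x \<le> 1" if "x \<in> {x. nrm x < 1}" for x using that norm_le[of x] by simp
  have b: "op_bound k (Fj k 0) (\<Sum>i\<le>L. M * kN ^ i)" if "k \<le> L" for k
  proof (rule pl.mult_bound_mono)
    show "op_bound k (Fj k 0) (M * kN ^ k)" using mult_bound_op_bound[OF FM[OF _ zero_mem]] that Lr by simp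
    show "M * kN ^ k \<le> (\<Sum>i\<le>L. M * kN ^ i)"
      by (rule member_le_sum[where f="\<lambda>i. M * kN ^ i"]) (use that M1 kN_pos in auto)
  qed
  have t: "jet s {x. nrm x < 1} (taylor_jet (\<lambda>k. Fj k 0) L)"
    by (rule jet_taylor_jet[OF _ b _ 1 2]) (use Lr in \<open>auto intro: S_ml S_sym\<close>)
  have "jet s {x. nrm x < 1} (\<lambda>j y vs. taylor_jet (\<lambda>k. Fj k 0) L j y vs - linear_jet A j y vs)"
    by (rule jet_diff[OF t jet_linear_jet[OF blA 1 2]])
  then show ?thesis unfolding p_def[abs_def] .
qed

lemma p_lip:
  assumes "nrm y < 1" "nrm y' < 1"
  shows "mult_bound Z q (\<lambda>vs. p q y vs - p q y' vs) (Mp * nrm (y - y'))"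
proof (rule mult_bound_mvt[OF jet_p[of "Suc q"]])
  show "closed_segment y' y \<subseteq> {x. nrm x < 1}" by (rule nrm_segment) (use assms in auto)
  then show "mult_bound Z (Suc q) (p (Suc q) z) Mp" if "z \<in> closed_segment y' y" for z
    using that by (intro mult_bound_p) force
qed simp

lemma p_at_0: "j \<le> L \<Longrightarrow> length vs = j \<Longrightarrow> p j 0 vs = Fj j 0 vs - linear_jet A j 0 vs"
  unfolding p_def using Lr taylor_jet_at_0[of L "\<lambda>k. Fj k 0" j vs] S_ml by simp

text \<open>\<open>p\<close> has no linear part, so its first derivative vanishes at
  \<open>0\<close> and grows at most linearly. This keeps the term of \<open>p o R\<close> with the
  top derivative of \<open>R\<close> from spoiling the contraction.\<close>

lemma p1_small:
  assumes "nrm y < 1"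
  shows "mult_bound Z 1 (p 1 y) (Mp * nrm y)"
proof -
  have z: "p 1 0 vs = 0" if l: "length vs = 1" for vs
  proof -
    obtain v where "vs = [v]" using l by (cases vs) auto
    then show ?thesis using p_at_0[of 1 vs] L2 F1 by (simp add: linear_jet_def)
  qed
  have "mult_bound Z 1 (\<lambda>vs. p 1 y vs - p 1 0 vs) (Mp * nrm (y - 0))"
    by (rule p_lip) (use assms in auto)
  from mult_bound_cong[OF this] show ?thesis using z by simp
qed

lemma T_jet:
  assumes R: "jet r V R" and V: "V \<subseteq> {x. nrm x < \<delta>0}" and FV: "\<And>x. x \<in> V \<Longrightarrow> Fj 0 x [] \<in> V"
    and R1: "\<And>x. x \<in> V \<Longrightarrow> nrm (R 0 x []) < 1"
  shows "jet r V (T R)"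
proof -
  have r: "0 < r" using L2 Lr by simp
  have F: "jet r V Fj" by (rule jet_subset[OF FJ jet_open[OF R] V])
  have 1: "jet r V (composite_jet R Fj)" by (rule comp_jet[OF R F FV r])
  have 2: "jet r V (composite_jet p R)" by (rule comp_jet[OF jet_p R _ r]) (use R1 in simp)
  show ?thesis unfolding T_def[abs_def] by (rule jet_linear_image[OF jet_diff[OF 1 2] blAi])
qed

section \<open>The contraction estimate, one term of the chain rule at a time\<close>

text \<open>Collects the influence of the differences of order below \<open>j\<close>. Each
  partition gives \<open>M ^ j\<close> from \<open>R o F\<close>, and from \<open>p o R\<close> one
  unit of \<open>Mp * K ^ j\<close> for the base point of \<open>p\<close> and at most
  \<open>j\<close> for the inner factors.\<close>

definition "Cc j K = real (length (parts j)) * (M ^ j + Mp * K ^ j * (real j + 1))"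

lemma Cc0: "1 \<le> K \<Longrightarrow> 0 \<le> Cc j K"
  unfolding Cc_def using Mp0 M1 by simp

text \<open>The inner factors are the same for \<open>R\<close> and \<open>S\<close>, so only the
  outer map changes. The \<open>j\<close>-th difference meets \<open>j\<close> singleton blocks,
  hence \<open>j\<close> copies of \<open>DF\<close> at \<open>b'\<close> each; in every other
  partition the difference has lower order.\<close>

lemma T_term_F:
  assumes \<pi>: "\<pi> \<in> set (parts j)" and j: "1 \<le> j" "j \<le> r" and x: "nrm x < \<delta>0"
    and Fb: "mult_bound Z 1 (Fj 1 x) b'" and b': "b' \<le> 1"
    and dF: "\<And>i. i \<le> j \<Longrightarrow> mult_bound Z i (\<lambda>vs. R i (Fj 0 x []) vs - S i (Fj 0 x []) vs) (d i)"
  shows "mult_bound Z j (\<lambda>vs. comp_term (R (length \<pi>) (Fj 0 x [])) (\<lambda>m. Fj (length (\<pi> ! m)) x) \<pi> vs -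
       comp_term (S (length \<pi>) (Fj 0 x [])) (\<lambda>m. Fj (length (\<pi> ! m)) x) \<pi> vs)
     ((if length \<pi> = j then b' ^ j * d j else 0) + M ^ j * (\<Sum>i<j. d i))"
proof -
  let ?y = "Fj 0 x []"
  have d0: "0 \<le> d i" if "i \<le> j" for i using mult_bound_nonneg[OF dF[OF that]] .
  have ds: "0 \<le> (\<Sum>i<j. d i)" by (intro sum_nonneg d0) auto
  have ms: "mset (concat \<pi>) = mset [0..<j]" using parts_props[OF \<pi>] by blast
  have q: "length \<pi> \<le> j" by (rule parts_length(2)[OF \<pi>])
  have eq: "comp_term (R (length \<pi>) ?y) f \<pi> vs - comp_term (S (length \<pi>) ?y) f \<pi> vs =
     comp_term (\<lambda>vs. R (length \<pi>) ?y vs - S (length \<pi>) ?y vs) f \<pi> vs" for f vs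
    by (simp add: comp_term_def)
  show ?thesis unfolding eq
  proof (cases "length \<pi> = j")
    case True
    have "length (\<pi> ! m) = 1" if "m < length \<pi>" for m
      using parts_length(3,4)[OF \<pi>, of "\<pi> ! m"] that True by force
    then have "mult_bound Z j (comp_term (\<lambda>vs. R (length \<pi>) ?y vs - S (length \<pi>) ?y vs) (\<lambda>m. Fj (length (\<pi> !
        m)) x) \<pi>)
        (d (length \<pi>) * (\<Prod>m<length \<pi>. b'))"
      by (intro mult_bound_comp_term[OF dF[OF q] ms]) (use Fb in auto)
    then show "mult_bound Z j (comp_term (\<lambda>vs. R (length \<pi>) ?y vs - S (length \<pi>) ?y vs) (\<lambda>m. Fj (length (\<pi> !
        m)) x) \<pi>)
        ((if length \<pi> = j then b' ^ j * d j else 0) + M ^ j * (\<Sum>i<j. d i))"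
      by (rule mult_bound_mono) (use True ds M1 in \<open>auto simp: mult.commute\<close>)
  next
    case False
    have "length (\<pi> ! m) \<le> r" if "m < length \<pi>" for m
      using parts_length(4)[OF \<pi>, of "\<pi> ! m"] that j by auto
    then have "mult_bound Z j (comp_term (\<lambda>vs. R (length \<pi>) ?y vs - S (length \<pi>) ?y vs) (\<lambda>m. Fj (length (\<pi> !
        m)) x) \<pi>)
        (d (length \<pi>) * (\<Prod>m<length \<pi>. M))"
      by (intro mult_bound_comp_term[OF dF[OF q] ms] FM x)
    then show "mult_bound Z j (comp_term (\<lambda>vs. R (length \<pi>) ?y vs - S (length \<pi>) ?y vs) (\<lambda>m. Fj (length (\<pi> !
        m)) x) \<pi>)
        ((if length \<pi> = j then b' ^ j * d j else 0) + M ^ j * (\<Sum>i<j. d i))"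
    proof (rule mult_bound_mono)
      have "d (length \<pi>) * M ^ length \<pi> \<le> (\<Sum>i<j. d i) * M ^ j"
        using False q M1 d0 ds by (intro mult_mono member_le_sum power_increasing) auto
      then show "d (length \<pi>) * (\<Prod>m<length \<pi>. M) \<le> (if length \<pi>
          = j then b' ^ j * d j else 0) + M ^ j * (\<Sum>i<j. d i)"
        using False by (simp add: mult.commute)
    qed
  qed
qed

text \<open>Here the base point of \<open>p\<close> and the inner factors both change. The
  \<open>j\<close>-th difference occurs only for a single block, where the outer factor is the small
  first derivative of \<open>p\<close>. The bound \<open>K\<close> on \<open>R\<close> is required
  below order \<open>j\<close> only, so that the estimate can be used to establish a bound for the
  \<open>j\<close>-th derivative of \<open>R\<close>.\<close>

lemma T_term_p:
  assumes \<pi>: "\<pi> \<in> set (parts j)" and j: "1 \<le> j" "j \<le> r" and K: "1 \<le> K"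
    and Rx: "nrm (R 0 x []) < 1" and Sx: "nrm (S 0 x []) < 1"
    and Sb: "\<And>i. 1 \<le> i \<Longrightarrow> i \<le> j \<Longrightarrow> mult_bound Z i (S i x) K"
    and Rb: "\<And>i. 1 \<le> i \<Longrightarrow> i < j \<Longrightarrow> mult_bound Z i (R i x) K"
    and dx: "\<And>i. i \<le> j \<Longrightarrow> mult_bound Z i (\<lambda>vs. R i x vs - S i x vs) (d i)"
  shows "mult_bound Z j (\<lambda>vs. comp_term (p (length \<pi>) (R 0 x [])) (\<lambda>m. R (length (\<pi> ! m)) x) \<pi> vs -
       comp_term (p (length \<pi>) (S 0 x [])) (\<lambda>m. S (length (\<pi> ! m)) x) \<pi> vs)
     ((if length \<pi> = 1 then Mp * nrm (R 0 x []) * d j else 0) + Mp * K ^ j * (real j + 1) * (\<Sum>i<j. d i))"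
proof -
  let ?q = "length \<pi>"
  let ?D = "\<Sum>i<j. d i"
  have d0: "0 \<le> d i" if "i \<le> j" for i using mult_bound_nonneg[OF dx[OF that]] .
  have ds: "0 \<le> ?D" by (intro sum_nonneg d0) auto
  have dle: "d i \<le> ?D" if "i < j" for i using d0 that by (intro member_le_sum) auto
  have ms: "mset (concat \<pi>) = mset [0..<j]" using parts_props[OF \<pi>] by blast
  have q: "?q \<le> j" by (rule parts_length(2)[OF \<pi>])
  have q1: "1 \<le> ?q" using parts_length(1)[OF \<pi>] j(1) by (cases \<pi>) auto
  have len: "1 \<le> length (\<pi> ! m)" "length (\<pi> ! m) + (?q - 1) \<le> j" if "m < ?q" for m
    using parts_length(3,4)[OF \<pi>, of "\<pi> ! m"] that by auto
  have lenj: "length (\<pi> ! m) \<le> j" if "m < ?q" for m using len(2)[OF that] by simp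
  have Kq: "K ^ ?q \<le> K ^ j" "K ^ (?q - 1) \<le> K ^ j" "1 \<le> K ^ j" using K q by (auto intro!: power_increasing)
  have mlp: "multilinear_map ?q (p ?q (R 0 x []))"
    by (rule jet_multilinear[OF jet_p[of ?q]]) (use Rx in auto)
  have nd: "nrm (R 0 x [] - S 0 x []) \<le> d 0"
    using mult_boundD[OF dx[of 0], of "[]"] by (simp add: Z_nrm)
  \<comment> \<open>The change of base point is a difference of order \<open>0\<close>, which is one
    of the lower orders since \<open>1 \<le> j\<close>.\<close>
  have 2: "mult_bound Z j (comp_term (\<lambda>vs. p ?q (R 0 x []) vs - p ?q (S 0 x []) vs) (\<lambda>m. S (length (\<pi> ! m))
      x) \<pi>)
      (Mp * K ^ j * ?D)"
  proof (rule mult_bound_mono)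
    show "mult_bound Z j (comp_term (\<lambda>vs. p ?q (R 0 x []) vs - p ?q (S 0 x []) vs) (\<lambda>m. S (length (\<pi> ! m)) x) \<pi>)
      (Mp * nrm (R 0 x [] - S 0 x []) * (\<Prod>m<?q. K))"
      by (intro mult_bound_comp_term[OF p_lip[OF Rx Sx] ms] Sb) (use len lenj in auto)
    have "Mp * nrm (R 0 x [] - S 0 x []) * K ^ ?q \<le> Mp * ?D * K ^ j"
      using Mp0 K Kq nd dle[of 0] j(1) ds nrm_nonneg by (intro mult_mono) auto
    then show "Mp * nrm (R 0 x [] - S 0 x []) * (\<Prod>m<?q. K) \<le> Mp * K ^ j * ?D"
      by (simp add: mult_ac)
  qed
  have 1: "mult_bound Z j (\<lambda>vs. comp_term (p ?q (R 0 x [])) (\<lambda>m. R (length (\<pi> ! m)) x) \<pi> vs -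
       comp_term (p ?q (R 0 x [])) (\<lambda>m. S (length (\<pi> ! m)) x) \<pi> vs)
     ((if ?q = 1 then Mp * nrm (R 0 x []) * d j else 0) + Mp * K ^ j * real j * ?D)"
  proof (cases "?q = 1")
    case True
    have l0: "length (\<pi> ! 0) = j" using parts_length(1)[OF \<pi>] True by (cases \<pi>) auto
    have tel: "comp_term (p ?q (R 0 x [])) (\<lambda>m. R (length (\<pi> ! m)) x) \<pi> vs -
       comp_term (p ?q (R 0 x [])) (\<lambda>m. S (length (\<pi> ! m)) x) \<pi> vs =
       comp_term (p ?q (R 0 x [])) (\<lambda>m us. R j x us - S j x us) \<pi> vs" for vs
      unfolding comp_term_telescope[OF mlp] using True l0 by (simp add: comp_term_def)
    have "mult_bound Z j (comp_term (p ?q (R 0 x [])) (\<lambda>m us. R j x us - S j x us) \<pi>) (Mp * nrm (R 0 x [])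
        * (\<Prod>m<?q. d j))"
      by (rule mult_bound_comp_term) (use True l0 dx[of j] ms p1_small[OF Rx] in \<open>auto simp: less_Suc0\<close>)
    then have "mult_bound Z j (comp_term (p ?q (R 0 x [])) (\<lambda>m us. R j x us - S j x us) \<pi>)
        ((if ?q = 1 then Mp * nrm (R 0 x []) * d j else 0) + Mp * K ^ j * real j * ?D)"
      by (rule mult_bound_mono) (use True Mp0 K ds in auto)
    then show ?thesis unfolding tel .
  next
    case False
    \<comment> \<open>With several blocks, none of them can take all \<open>j\<close>
      arguments.\<close>
    then have lt: "length (\<pi> ! m) < j" if "m < ?q" for m using len[OF that] q1 by linarith
    have "mult_bound Z j (\<lambda>vs. comp_term (p ?q (R 0 x [])) (\<lambda>m. R (length (\<pi> ! m)) x) \<pi> vs -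
       comp_term (p ?q (R 0 x [])) (\<lambda>m. S (length (\<pi> ! m)) x) \<pi> vs)
       (Mp * K ^ (?q - 1) * (\<Sum>m<?q. d (length (\<pi> ! m))))"
    proof (rule mult_bound_comp_diff[OF mlp mult_bound_p ms K])
      fix m assume m: "m < ?q"
      show "mult_bound Z (length (\<pi> ! m)) (R (length (\<pi> ! m)) x) K" by (rule Rb[OF len(1)[OF m] lt[OF m]])
      show "mult_bound Z (length (\<pi> ! m)) (S (length (\<pi> ! m)) x) K" by (rule Sb[OF len(1)[OF m] lenj[OF m]])
      show "mult_bound Z (length (\<pi> ! m)) (\<lambda>vs. R (length (\<pi> ! m)) x vs - S (length (\<pi> ! m)) x vs) (d
          (length (\<pi> ! m)))"
        by (rule dx[OF lenj[OF m]])
    qed (use Rx in simp)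
    then show ?thesis
    proof (rule mult_bound_mono)
      have "(\<Sum>m<?q. d (length (\<pi> ! m))) \<le> (\<Sum>m<?q. ?D)" by (intro sum_mono dle lt) auto
      also have "\<dots> \<le> real j * ?D" using q ds by (simp add: mult_right_mono)
      finally have "Mp * K ^ (?q - 1) * (\<Sum>m<?q. d (length (\<pi> ! m))) \<le> Mp * K ^ j * (real j * ?D)"
        using Mp0 K Kq lt d0 by (intro mult_mono sum_nonneg) (auto intro: less_imp_le)
      then show "Mp * K ^ (?q - 1) * (\<Sum>m<?q. d (length (\<pi> ! m))) \<le>
          (if ?q = 1 then Mp * nrm (R 0 x []) * d j else 0) + Mp * K ^ j * real j * ?D"
        using False by (simp add: mult.assoc)
    qed
  qed
  have "mult_bound Z j (\<lambda>vs. comp_term (p ?q (R 0 x [])) (\<lambda>m. R (length (\<pi> ! m)) x) \<pi> vs -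
       comp_term (p ?q (S 0 x [])) (\<lambda>m. S (length (\<pi> ! m)) x) \<pi> vs)
     ((if ?q = 1 then Mp * nrm (R 0 x []) * d j else 0) + Mp * K ^ j * real j * ?D + Mp * K ^ j * ?D)"
    by (rule mult_bound_cong[OF mult_bound_add[OF 1 2]]) (simp add: comp_term_def)
  then show ?thesis by (rule mult_bound_mono) (simp add: algebra_simps)
qed

text \<open>Exactly one partition has \<open>j\<close> blocks and exactly one has a single block. So
  the coefficient of \<open>d j\<close> is \<open>a * (b' ^ j + Mp * nrm (R 0 x []))\<close>,
  without a combinatorial factor, and everything else goes into \<open>Cc\<close>.\<close>

lemma T_diff:
  assumes j: "1 \<le> j" "j \<le> r" and K: "1 \<le> K" and x: "nrm x < \<delta>0"
    and Fb: "mult_bound Z 1 (Fj 1 x) b'" and b': "b' \<le> 1"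
    and Rx: "nrm (R 0 x []) < 1" and Sx: "nrm (S 0 x []) < 1"
    and Sb: "\<And>i. 1 \<le> i \<Longrightarrow> i \<le> j \<Longrightarrow> mult_bound Z i (S i x) K"
    and Rb: "\<And>i. 1 \<le> i \<Longrightarrow> i < j \<Longrightarrow> mult_bound Z i (R i x) K"
    and dx: "\<And>i. i \<le> j \<Longrightarrow> mult_bound Z i (\<lambda>vs. R i x vs - S i x vs) (d i)"
    and dF: "\<And>i. i \<le> j \<Longrightarrow> mult_bound Z i (\<lambda>vs. R i (Fj 0 x []) vs - S i (Fj 0 x []) vs) (d i)"
  shows "mult_bound Z j (\<lambda>vs. T R j x vs - T S j x vs)
     (a * ((b' ^ j + Mp * nrm (R 0 x [])) * d j + Cc j K * (\<Sum>i<j. d i)))"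
proof -
  let ?D = "\<Sum>i<j. d i"
  have s: "(\<Sum>\<pi>\<leftarrow>parts j. if P \<pi> then c else 0) = c * (\<Sum>\<pi>\<leftarrow>parts j. if P \<pi> then 1 else 0)"
    for P and c :: real
    by (simp add: sum_list_const_mult[symmetric] if_distrib cong: if_cong)
  have one: "(\<Sum>\<pi>\<leftarrow>parts j. if length \<pi> = 1 then 1 else 0 :: real) = 1"
    using parts_count_one[of "j - 1"] j(1) by simp
  have f1: "mult_bound Z j (\<lambda>vs. composite_jet R Fj j x vs - composite_jet S Fj j x vs)
      (\<Sum>\<pi>\<leftarrow>parts j. (if length \<pi> = j then b' ^ j * d j else 0) + M ^ j * ?D)"
    unfolding composite_jet_def sum_list_subtractf[symmetric]
    by (rule mult_bound_sum_list, rule T_term_F[where R=R and S=S and d=d, OF _ j x Fb b' dF])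
  have e1: "(\<Sum>\<pi>\<leftarrow>parts j. (if length \<pi> = j then b' ^ j * d j else 0) + M ^ j * ?D) =
      b' ^ j * d j + real (length (parts j)) * (M ^ j * ?D)"
    unfolding sum_list_addf s[of "\<lambda>\<pi>. length \<pi> = j" "b' ^ j * d j"] parts_count_top by (simp add: sum_list_triv)
  have f2: "mult_bound Z j (\<lambda>vs. composite_jet p R j x vs - composite_jet p S j x vs)
      (\<Sum>\<pi>\<leftarrow>parts j. (if length \<pi> = 1 then Mp * nrm (R 0 x []) * d j else 0) + Mp * K ^ j * (real j + 1) * ?D)"
    unfolding composite_jet_def sum_list_subtractf[symmetric]
    by (rule mult_bound_sum_list, rule T_term_p[where R=R and S=S and d=d, OF _ j K Rx Sx Sb Rb dx])
  have e2: "(\<Sum>\<pi>\<leftarrow>parts j. (if length \<pi> = 1 then Mp * nrm (R 0 x []) * d j else 0) + Mp * K ^ j * (real j + 1)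
      * ?D) =
      Mp * nrm (R 0 x []) * d j + real (length (parts j)) * (Mp * K ^ j * (real j + 1) * ?D)"
    unfolding sum_list_addf s[of "\<lambda>\<pi>. length \<pi> = 1" "Mp * nrm (R 0 x []) * d j"] one
        by (simp add: sum_list_triv)
  have "mult_bound Z j (\<lambda>vs. (composite_jet R Fj j x vs - composite_jet S Fj j x vs) - (composite_jet p R j
      x vs - composite_jet p S j x vs))
      ((b' ^ j * d j + real (length (parts j)) * (M ^ j * ?D)) +
        (Mp * nrm (R 0 x []) * d j + real (length (parts j)) * (Mp * K ^ j * (real j + 1) * ?D)))"
    by (rule mult_bound_diff[OF f1[unfolded e1] f2[unfolded e2]])
  from mult_bound_lin_bound[OF dAi this] have "mult_bound Z j (\<lambda>vs. T R j x vs - T S j x vs)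
      (a * ((b' ^ j * d j + real (length (parts j)) * (M ^ j * ?D)) +
        (Mp * nrm (R 0 x []) * d j + real (length (parts j)) * (Mp * K ^ j * (real j + 1) * ?D))))"
    by (rule mult_bound_cong) (simp add: T_def linear_diff[OF bounded_linear.linear[OF blAi]])
  then show ?thesis by (rule mult_bound_mono) (simp add: Cc_def algebra_simps)
qed

text \<open>The size of the derivatives of \<open>T idj\<close>, the first iterate, where all inner
  bounds are \<open>M\<close> or \<open>1\<close>.\<close>

definition "C0 j = a * (real (length (parts j)) * (M ^ j + Mp))"

lemma C0_nonneg: "0 \<le> C0 j"
  unfolding C0_def using a0 Mp0 M1 by simp

lemma T_id_bound:
  assumes "j \<le> r" "nrm x < \<delta>0" "nrm x \<le> 1" "nrm (Fj 0 x []) \<le> 1"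
  shows "mult_bound Z j (T idj j x) (C0 j)"
proof -
  have 1: "mult_bound Z j (composite_jet idj Fj j x) (\<Sum>\<pi>\<leftarrow>parts j. 1 * M ^ j)"
    by (rule mult_bound_composite_jet) (use assms M1 in \<open>auto intro: mult_bound_idj FM\<close>)
  have "idj 0 x [] = x" by (simp add: linear_jet_def)
  then have 2: "mult_bound Z j (composite_jet p idj j x) (\<Sum>\<pi>\<leftarrow>parts j. Mp * 1 ^ j)"
    by (intro mult_bound_composite_jet) (use assms in \<open>auto intro: mult_bound_idj mult_bound_p\<close>)
  from mult_bound_lin_bound[OF dAi mult_bound_diff[OF 1 2]] have
      "mult_bound Z j (T idj j x) (a * ((\<Sum>\<pi>\<leftarrow>parts j. 1 * M ^ j) + (\<Sum>\<pi>\<leftarrow>parts j. Mp * 1 ^ j)))"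
    unfolding T_def[abs_def] .
  then show ?thesis by (rule mult_bound_mono) (simp add: C0_def sum_list_triv algebra_simps)
qed

end

section \<open>Convergence of the iterates\<close>

text \<open>The limit is taken for each list of arguments in the Banach space; the geometric tail
  bound passes to it because sizes are closed under limits.\<close>

lemma (in sized) geometric_limit:
  assumes d: "\<And>n. mult_bound Z j (\<lambda>vs. G (Suc n) vs - G n vs) (E * \<tau> ^ n)" and \<tau>: "0 \<le> \<tau>" "\<tau> < 1"
  shows "\<exists>H. \<forall>n. mult_bound Z j (\<lambda>vs. G n vs - H vs) (E * \<tau> ^ n / (1 - \<tau>))"
proof -
  have E: "0 \<le> E" using mult_bound_nonneg[OF d[of 0]] by simp
  have tail: "mult_bound Z j (\<lambda>vs. G m vs - G n vs) (E * \<tau> ^ n / (1 - \<tau>))" if "n \<le> m" for n m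
  proof -
    have "mult_bound Z j (\<lambda>vs. \<Sum>i=n..<m. G (Suc i) vs - G i vs) (\<Sum>i=n..<m. E * \<tau> ^ i)"
      by (intro mult_bound_sum d) auto
    moreover have "(\<Sum>i=n..<m. G (Suc i) vs - G i vs) = G m vs - G n vs" for vs
      using sum_Suc_diff'[OF that, of "\<lambda>i. G i vs"] .
    moreover have "(\<Sum>i=n..<m. E * \<tau> ^ i) \<le> E * \<tau> ^ n / (1 - \<tau>)"
    proof -
      have "(\<Sum>i=n..<m. \<tau> ^ i) * (1 - \<tau>) = \<tau> ^ n - \<tau> ^ m"
        using sum_Suc_diff'[OF that, of "\<lambda>i. - (\<tau> ^ i)"]
            by (simp add: sum_distrib_left sum_distrib_right algebra_simps)
      then have "(\<Sum>i=n..<m. \<tau> ^ i) \<le> \<tau> ^ n / (1 - \<tau>)"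
        using \<tau> by (simp add: pos_le_divide_eq)
      from mult_left_mono[OF this E] show ?thesis by (simp add: sum_distrib_left)
    qed
    ultimately show ?thesis using mult_bound_mono by simp
  qed
  have conv: "convergent (\<lambda>n. G n vs)" if l: "length vs = j" for vs
  proof -
    define c where "c = E / (1 - \<tau>) * kN ^ j * (\<Prod>v\<leftarrow>vs. norm v)"
    have c0: "0 \<le> c" using E \<tau> kN_pos prod_norm_nonneg[of vs] by (simp add: c_def)
    have le: "norm (G m vs - G n vs) \<le> c * \<tau> ^ n" if "n \<le> m" for m n
      using op_boundD[OF mult_bound_op_bound[OF tail[OF that]] l] by (simp add: c_def mult_ac)
    have "Cauchy (\<lambda>n. G n vs)"
    proof (rule metric_CauchyI)
      fix e :: real assume e: "0 < e"
      have "(\<lambda>n. c * \<tau> ^ n) \<longlonglongrightarrow> c * 0" using \<tau> by (intro tendsto_intros LIMSEQ_power_zero) auto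
      then have "\<forall>\<^sub>F n in sequentially. c * \<tau> ^ n < e / 2" using e by (intro order_tendstoD) auto
      then obtain N where N: "c * \<tau> ^ N < e / 2" by (auto simp: eventually_sequentially)
      have "dist (G m vs) (G n vs) < e" if "N \<le> m" "N \<le> n" for m n
        using le[OF that(1)] le[OF that(2)] N dist_triangle_half_l[of "G m vs" "G N vs" e "G n vs"]
        by (simp add: dist_norm norm_minus_commute)
      then show "\<exists>M. \<forall>m\<ge>M. \<forall>n\<ge>M. dist (G m vs) (G n vs) < e" by blast
    qed
    then show ?thesis by (simp add: Cauchy_convergent_iff)
  qed
  show ?thesis
  proof (intro exI allI)
    fix n
    have "mult_bound Z j (\<lambda>vs. lim (\<lambda>m. G m vs) - G n vs) (E * \<tau> ^ n / (1 - \<tau>))"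
    proof (rule mult_bound_lim)
      show "mult_bound Z j (\<lambda>vs. G (m + n) vs - G n vs) (E * \<tau> ^ n / (1 - \<tau>))" for m by (rule tail) simp
      show "(\<lambda>m. G (m + n) vs - G n vs) \<longlonglongrightarrow> lim (\<lambda>m. G m vs) - G n vs" if "length vs = j" for vs
        using conv[OF that] by (intro tendsto_intros LIMSEQ_ignore_initial_segment) (simp add:
            convergent_LIMSEQ_iff)
    qed
    then show "mult_bound Z j (\<lambda>vs. G n vs - lim (\<lambda>m. G m vs)) (E * \<tau> ^ n / (1 - \<tau>))" by (rule mult_bound_swap)
  qed
qed

text \<open>Descending induction from order \<open>L\<close>: the difference vanishes at
  \<open>0\<close>, so the mean value inequality along the segment from \<open>0\<close> gains a
  factor \<open>\<delta>\<close> per order.\<close>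

lemma (in sized) difference_vanishing:
  assumes R: "jet r {x. nrm x < \<delta>} R" and S: "jet r {x. nrm x < \<delta>} S" and L: "L \<le> r" and \<delta>: "0 < \<delta>"
    and eq: "\<And>j vs. j < L \<Longrightarrow> length vs = j \<Longrightarrow> R j 0 vs = S j 0 vs"
    and D: "\<And>x. nrm x < \<delta> \<Longrightarrow> mult_bound Z L (\<lambda>vs. R L x vs - S L x vs) D"
    and i: "i \<le> L"
  shows "nrm x < \<delta> \<Longrightarrow> mult_bound Z i (\<lambda>vs. R i x vs - S i x vs) (\<delta> ^ (L - i) * D)"
  using i
proof (induction i arbitrary: x rule: inc_induct)
  case base
  then show ?case using D by simp
next
  case (step i)
  have D0: "0 \<le> D" using mult_bound_nonneg[OF D[OF step.prems]] .
  have J: "jet r {x. nrm x < \<delta>} (\<lambda>j x vs. R j x vs - S j x vs)" by (rule jet_diff[OF R S])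
  have seg: "closed_segment 0 x \<subseteq> {x. nrm x < \<delta>}" by (rule nrm_segment) (use \<delta> step.prems in auto)
  have "mult_bound Z i (\<lambda>vs. (R i x vs - S i x vs) - (R i 0 vs - S i 0 vs)) (\<delta> ^ (L - Suc i) * D * nrm (x - 0))"
    by (rule mult_bound_mvt[OF J _ seg]) (use step L seg in auto)
  then have "mult_bound Z i (\<lambda>vs. (R i x vs - S i x vs) - (R i 0 vs - S i 0 vs)) (\<delta> ^ (L - i) * D)"
  proof (rule mult_bound_mono)
    have "\<delta> ^ (L - Suc i) * D * nrm x \<le> \<delta> ^ (L - Suc i) * D * \<delta>"
      using step.prems \<delta> D0 by (intro mult_left_mono) auto
    also have "\<dots> = \<delta> ^ (L - i) * D"
      using step.hyps by (simp add: Suc_diff_Suc[symmetric] mult_ac)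
    finally show "\<delta> ^ (L - Suc i) * D * nrm (x - 0) \<le> \<delta> ^ (L - i) * D" by simp
  qed
  then show ?case by (rule mult_bound_cong) (use step.hyps eq in auto)
qed

text \<open>\<open>D0\<close> is the radius of a ball, for the supremum of the \<open>L\<close>-th derivative, that the contraction \<open>T\<close> maps
  into itself: \<open>T\<close> moves its centre, the identity, by at most \<open>C0 L\<close>.\<close>

locale iteration = contraction_data +
  fixes b' \<delta> D0 :: real
  assumes b': "0 \<le> b'" "b' \<le> 1" and ab': "a * b' ^ L < 1"
    and \<delta>: "0 < \<delta>" "\<delta> \<le> \<delta>0" "2 * \<delta> < 1" and \<delta>b: "M * \<delta> \<le> b' - b"
    and D0: "D0 = C0 L / (1 - (1 + a * b' ^ L) / 2)"
    and \<delta>1: "a * (Mp * (2 * \<delta>)) \<le> (1 - a * b' ^ L) / 4"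
    and \<delta>2: "a * (Cc L (max 2 D0) * (real L * \<delta>)) \<le> (1 - a * b' ^ L) / 4"
    and \<delta>3: "\<delta> * D0 \<le> 1"
begin

definition "V = {x. nrm x < \<delta>}"

text \<open>Halfway between the ideal rate \<open>a * b' ^ L\<close> and \<open>1\<close>. The
  smallness conditions \<open>\<delta>1\<close> and \<open>\<delta>2\<close> each spend one quarter
  of this gap.\<close>

definition "\<theta> = (1 + a * b' ^ L) / 2"

text \<open>A recursion with factor \<open>\<theta>\<close>, driven by lower orders that decay like
  \<open>\<tau> ^ n\<close>, decays like \<open>\<tau> ^ n\<close> again because
  \<open>\<tau>\<close> is strictly larger than \<open>\<theta>\<close>. So one rate serves all
  orders.\<close>

definition "\<tau> = (1 + \<theta>) / 2"

lemma rates: "0 < \<theta>" "\<theta> < \<tau>" "\<tau> < 1" "0 < \<tau>" "\<theta> < 1"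
  using ab' a0 b' by (auto simp: \<theta>_def \<tau>_def intro: add_pos_nonneg)

lemma D0_nonneg: "0 \<le> D0"
  unfolding D0 \<theta>_def[symmetric] using C0_nonneg rates by simp

lemma D0_fix: "\<theta> * D0 + C0 L = D0"
  unfolding D0 \<theta>_def[symmetric] using rates by (simp add: field_simps)

lemma rate_L: "a * (b' ^ L + Mp * (2 * \<delta>)) + a * (Cc L (max 2 D0) * (real L * \<delta>)) \<le> \<theta>"
  using \<delta>1 \<delta>2 by (simp add: \<theta>_def field_simps)

lemma rate_j:
  assumes "L \<le> j"
  shows "a * (b' ^ j + Mp * (2 * \<delta>)) \<le> \<theta>"
proof -
  have "a * b' ^ j \<le> a * b' ^ L" using assms b' a0 by (intro mult_left_mono power_decreasing) auto
  then show ?thesis using \<delta>1 ab' by (simp add: \<theta>_def field_simps)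
qed

lemma V: "open V" "convex V" "0 \<in> V" "V \<subseteq> {x. nrm x < \<delta>0}"
proof -
  show "open V" unfolding V_def by (rule open_nrm_ball)
  show "convex V" unfolding convex_contains_segment V_def using nrm_segment by blast
qed (use \<delta> in \<open>auto simp: V_def\<close>)

lemma V_less: "x \<in> V \<Longrightarrow> nrm x < \<delta>0" "x \<in> V \<Longrightarrow> nrm x < 1" "x \<in> V \<Longrightarrow> nrm x < \<delta>"
  using \<delta> by (auto simp: V_def)

lemma FJV: "jet r V Fj"
  by (rule jet_subset[OF FJ V(1,4)])

text \<open>The margin \<open>b' - b\<close> absorbs the variation of \<open>DF\<close> over the
  ball, at most \<open>M * \<delta>\<close>.\<close>

lemma F1_bound:
  assumes "x \<in> V"
  shows "mult_bound Z 1 (Fj 1 x) b'"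
proof -
  have seg: "closed_segment 0 x \<subseteq> V"
    unfolding V_def by (rule nrm_segment) (use assms \<delta> in \<open>auto simp: V_def\<close>)
  have 1: "mult_bound Z 1 (\<lambda>vs. Fj 1 x vs - Fj 1 0 vs) (M * nrm (x - 0))"
    by (rule mult_bound_mvt[OF FJV _ seg]) (use L2 Lr seg V_less FM in auto)
  have 2: "mult_bound Z 1 (Fj 1 0) b"
  proof (rule mult_bound_cong[OF mult_bound_linear_jet[OF dA, of 0 1]])
    show "linear_jet A 1 0 vs = Fj 1 0 vs" if "length vs = 1" for vs
      using that F1 by (cases vs) (auto simp: linear_jet_def)
  qed simp
  have "mult_bound Z 1 (Fj 1 x) (M * nrm (x - 0) + b)" by (rule mult_bound_cong[OF mult_bound_add[OF 1 2]]) simp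
  then show ?thesis
  proof (rule mult_bound_mono)
    have "M * nrm x \<le> M * \<delta>" using V_less(3)[OF assms] M1 by (intro mult_left_mono) auto
    then show "M * nrm (x - 0) + b \<le> b'" using \<delta>b by simp
  qed
qed

lemma FV:
  assumes "x \<in> V"
  shows "Fj 0 x [] \<in> V"
proof -
  have seg: "closed_segment 0 x \<subseteq> V"
    unfolding V_def by (rule nrm_segment) (use assms \<delta> in \<open>auto simp: V_def\<close>)
  have "mult_bound Z 0 (\<lambda>vs. Fj 0 x vs - Fj 0 0 vs) (b' * nrm (x - 0))"
    by (rule mult_bound_mvt[OF FJV _ seg]) (use L2 Lr seg F1_bound in auto)
  from mult_boundD[OF this, of "[]"] have "nrm (Fj 0 x []) \<le> b' * nrm x" by (simp add: Z_nrm F0)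
  also have "\<dots> \<le> nrm x" using b' nrm_nonneg[of x] by (simp add: mult_left_le_one_le)
  finally show ?thesis using V_less(3)[OF assms] by (simp add: V_def)
qed

lemma jet_id: "jet r V idj"
proof (rule jet_linear_jet[OF bounded_linear_ident V(1)])
  show "norm x \<le> 1" if "x \<in> V" for x using V_less(2)[OF that] norm_le[of x] by linarith
qed

text \<open>The ball is prescribed for order \<open>L\<close> alone, where the derivative of the
  identity is \<open>0\<close>. The orders below follow from the values at \<open>0\<close>; those
  above \<open>L\<close> have no bound known in advance and are treated one by one in
  \<open>Rn_level\<close>.\<close>

definition invariant :: "(nat \<Rightarrow> 'b \<Rightarrow> 'b list \<Rightarrow> 'b) \<Rightarrow> bool" where
  "invariant R \<longleftrightarrow> jet r V R \<and> (\<forall>j<L. \<forall>vs. length vs = j \<longrightarrow> R j 0 vs = idj j 0 vs) \<and>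
     (\<forall>x\<in>V. mult_bound Z L (\<lambda>vs. R L x vs - idj L x vs) D0)"

lemma inv_low:
  assumes "invariant R" "i \<le> L" "x \<in> V"
  shows "mult_bound Z i (\<lambda>vs. R i x vs - idj i x vs) (\<delta> ^ (L - i) * D0)"
  using assms jet_id unfolding invariant_def V_def
  by (intro difference_vanishing[where r=r and L=L]) (use Lr \<delta> in auto)

lemma \<delta>_power:
  assumes "i < L" "0 \<le> D"
  shows "\<delta> ^ (L - i) * D \<le> \<delta> * D"
proof -
  have "\<delta> ^ (L - i) \<le> \<delta> ^ 1" using assms \<delta> by (intro power_decreasing) auto
  then show ?thesis using assms by (intro mult_right_mono) auto
qed

lemma inv_small:
  assumes "invariant R" "x \<in> V"
  shows "nrm (R 0 x []) \<le> 2 * \<delta>"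
proof -
  from mult_boundD[OF inv_low[OF assms(1) _ assms(2), of 0], of "[]"]
  have "nrm (R 0 x [] - x) \<le> \<delta> ^ L * D0" by (simp add: Z_nrm linear_jet_def)
  \<comment> \<open>One power of \<open>\<delta>\<close> is spent on
    \<open>\<delta> * D0 \<le> 1\<close>, the other remains; this uses
    \<open>2 \<le> L\<close>.\<close>
  also have "\<dots> \<le> \<delta> ^ 2 * D0" using L2 \<delta> D0_nonneg by (intro mult_right_mono power_decreasing) auto
  also have "\<dots> = \<delta> * (\<delta> * D0)" by (simp add: power2_eq_square)
  also have "\<dots> \<le> \<delta> * 1" using \<delta>3 \<delta> by (intro mult_left_mono) auto
  finally show ?thesis using nrm_triangle[of "R 0 x [] - x" x] V_less(3)[OF assms(2)] by simp
qed

lemma inv_bound: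
  assumes "invariant R" "x \<in> V" "i \<le> L"
  shows "mult_bound Z i (R i x) (max 2 D0)"
proof (cases "i = L")
  case True
  have "mult_bound Z L (\<lambda>vs. R L x vs - idj L x vs) D0" using assms by (simp add: invariant_def)
  then have "mult_bound Z L (R L x) D0" using L2 by (simp add: linear_jet_def)
  then show ?thesis unfolding True by (rule mult_bound_mono) simp
next
  case False
  have "mult_bound Z i (R i x) (\<delta> ^ (L - i) * D0 + 1)"
    by (rule mult_bound_cong[OF mult_bound_add[OF inv_low[OF assms(1,3,2)] mult_bound_idj]])
      (use V_less(2)[OF assms(2)] in auto)
  then show ?thesis
    by (rule mult_bound_mono) (use \<delta>_power[of i D0] D0_nonneg \<delta>3 False assms(3) in auto)
qed

lemma inv_id: "invariant idj"
  unfolding invariant_def using jet_id mult_bound_mono[OF mult_bound_zero D0_nonneg] by simp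

lemma composite_jet_id: "j \<le> r \<Longrightarrow> x \<in> V \<Longrightarrow> length vs = j \<Longrightarrow> composite_jet idj Fj j x vs = Fj j x vs"
proof (rule jet_unique[OF comp_jet[OF jet_id FJV FV] FJV])
  show "0 < r" using L2 Lr by simp
qed (auto simp: linear_jet_def)

lemma composite_jet_p_id: "j \<le> r \<Longrightarrow> x \<in> V \<Longrightarrow> length vs = j \<Longrightarrow> composite_jet p idj j x vs = p j x vs"
proof (rule jet_unique[OF comp_jet[OF jet_p jet_id] jet_subset[OF jet_p V(1)]])
  show "0 < r" using L2 Lr by simp
qed (auto simp: linear_jet_def V_less)

text \<open>As \<open>F 0 = 0\<close>, the derivatives of \<open>T R\<close> at \<open>0\<close> up
  to order \<open>j\<close> depend only on those of \<open>R\<close> at \<open>0\<close> up to order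
  \<open>j\<close>, and these are the ones of the identity. For the identity, \<open>F - p\<close>
  and \<open>A\<close> have the same derivatives at \<open>0\<close> below order \<open>L\<close>,
  and \<open>Ai\<close> cancels \<open>A\<close>.\<close>

lemma T_at_0:
  assumes R: "invariant R" and j: "j < L" and l: "length vs = j"
  shows "T R j 0 vs = idj j 0 vs"
proof -
  have eq: "R i 0 us = idj i 0 us" if "i \<le> j" "length us = i" for i us
    using R that j by (simp add: invariant_def)
  have 1: "composite_jet R Fj j 0 vs = composite_jet idj Fj j 0 vs"
    unfolding composite_jet_def comp_term_def F0
    by (intro arg_cong[where f=sum_list] map_cong refl eq) (auto dest: parts_length(2))
  have R0: "R 0 0 [] = idj 0 0 []" by (rule eq) auto
  have 2: "composite_jet p R j 0 vs = composite_jet p idj j 0 vs"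
    unfolding composite_jet_def comp_term_def R0
  proof (intro arg_cong[where f=sum_list] map_cong refl arg_cong2[where f="p _"] eq)
    fix \<pi> m assume "\<pi> \<in> set (parts j)" "m \<in> set [0..<length \<pi>]"
    then show "length (\<pi> ! m) \<le> j" using parts_length(4)[of \<pi> j "\<pi> ! m"] by auto
  qed simp
  have jr: "j \<le> r" using j Lr by simp
  have "T R j 0 vs = Ai (Fj j 0 vs - p j 0 vs)"
    unfolding T_def 1 2 composite_jet_id[OF jr V(3) l] composite_jet_p_id[OF jr V(3) l] ..
  also have "\<dots> = Ai (linear_jet A j 0 vs)" using p_at_0[of j vs] j l by simp
  also have "\<dots> = idj j 0 vs"
    using linear_0[OF bounded_linear.linear[OF blAi]] AiA by (simp add: linear_jet_def)
  finally show ?thesis .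
qed

lemma T_id_L:
  assumes "j \<le> r" "x \<in> V"
  shows "mult_bound Z j (T idj j x) (C0 j)"
  by (rule T_id_bound) (use assms V_less FV in \<open>auto intro: less_imp_le\<close>)

text \<open>By \<open>difference_vanishing\<close> the lower differences are at most
  \<open>\<delta> * e\<close>, so that their large constant \<open>Cc\<close> is compensated by the
  small ball.\<close>

lemma T_diff_L:
  assumes R: "invariant R" and S: "invariant S" and x: "x \<in> V" and e: "0 \<le> e"
    and d: "\<And>x. x \<in> V \<Longrightarrow> mult_bound Z L (\<lambda>vs. R L x vs - S L x vs) e"
  shows "mult_bound Z L (\<lambda>vs. T R L x vs - T S L x vs) (\<theta> * e)"
proof -
  have low: "mult_bound Z i (\<lambda>vs. R i x vs - S i x vs) (\<delta> ^ (L - i) * e)" if "i \<le> L" "x \<in> V" for i x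
  proof (rule difference_vanishing[where r=r and L=L])
    show "jet r {x. nrm x < \<delta>} R" "jet r {x. nrm x < \<delta>} S"
      using R S by (auto simp: invariant_def V_def)
    show "R j 0 vs = S j 0 vs" if "j < L" "length vs = j" for j vs
      using R S that by (simp add: invariant_def)
  qed (use Lr \<delta> d that in \<open>auto simp: V_def\<close>)
  define dd where "dd i = (if i < L then \<delta> * e else e)" for i
  have dd: "mult_bound Z i (\<lambda>vs. R i x vs - S i x vs) (dd i)" if "i \<le> L" "x \<in> V" for i x
    by (rule mult_bound_mono[OF low[OF that]]) (use \<delta>_power[of i e] e that in \<open>auto simp: dd_def\<close>)
  have "mult_bound Z L (\<lambda>vs. T R L x vs - T S L x vs)
     (a * ((b' ^ L + Mp * nrm (R 0 x [])) * dd L + Cc L (max 2 D0) * (\<Sum>i<L. dd i)))"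
  proof (rule T_diff[where R=R and S=S and d=dd, OF _ Lr _ V_less(1)[OF x] F1_bound[OF x] b'(2)])
    show "nrm (R 0 x []) < 1" "nrm (S 0 x []) < 1"
      using inv_small[OF R x] inv_small[OF S x] \<delta> by auto
  qed (use L2 x inv_bound[OF R x] inv_bound[OF S x] dd FV[OF x] in auto)
  then show ?thesis
  proof (rule mult_bound_mono)
    have "a * ((b' ^ L + Mp * nrm (R 0 x [])) * e) \<le> a * ((b' ^ L + Mp * (2 * \<delta>)) * e)"
      using a0 e Mp0 inv_small[OF R x] by (intro mult_left_mono mult_right_mono add_left_mono) auto
    moreover have "(a * (b' ^ L + Mp * (2 * \<delta>)) + a * (Cc L (max 2 D0) * (real L * \<delta>))) * e \<le> \<theta> * e"
      using rate_L e by (rule mult_right_mono)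
    moreover have "(\<Sum>i<L. dd i) = real L * (\<delta> * e)" by (simp add: dd_def)
    ultimately show "a * ((b' ^ L + Mp * nrm (R 0 x [])) * dd L + Cc L (max 2 D0) * (\<Sum>i<L. dd i)) \<le> \<theta> * e"
      by (simp add: dd_def algebra_simps)
  qed
qed

lemma idj_L: "L \<le> j \<Longrightarrow> idj j x vs = 0"
  using L2 by (simp add: linear_jet_def)

lemma inv_T:
  assumes R: "invariant R"
  shows "invariant (T R)"
  unfolding invariant_def
proof (intro conjI ballI allI impI)
  show "jet r V (T R)"
    by (rule T_jet[OF _ V(4) FV]) (use R inv_small[OF R] \<delta> in \<open>auto simp: invariant_def intro: le_less_trans\<close>)
  show "T R j 0 vs = idj j 0 vs" if "j < L" "length vs = j" for j vs
    by (rule T_at_0[OF R that])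
  fix x assume x: "x \<in> V"
  have 1: "mult_bound Z L (\<lambda>vs. T R L x vs - T idj L x vs) (\<theta> * D0)"
    by (rule T_diff_L[OF R inv_id x D0_nonneg]) (use R in \<open>simp add: invariant_def\<close>)
  show "mult_bound Z L (\<lambda>vs. T R L x vs - idj L x vs) D0"
    using mult_bound_add[OF 1 T_id_L[OF Lr x]] by (simp add: idj_L D0_fix)
qed

definition "Rn n = (T ^^ n) idj"

lemma Rn_Suc: "Rn (Suc n) = T (Rn n)" and Rn_0: "Rn 0 = idj"
  by (simp_all add: Rn_def)

lemma inv_Rn: "invariant (Rn n)"
  by (induction n) (auto simp: Rn_Suc Rn_0 inv_id inv_T)

lemma Rn_diff_L:
  "x \<in> V \<Longrightarrow> mult_bound Z L (\<lambda>vs. Rn (Suc n) L x vs - Rn n L x vs) (C0 L * \<tau> ^ n)"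
proof (induction n arbitrary: x)
  case 0
  then show ?case using T_id_L[OF Lr] by (simp add: Rn_Suc Rn_0 idj_L)
next
  case (Suc n)
  have e: "0 \<le> C0 L * \<tau> ^ n" using C0_nonneg rates by simp
  have "mult_bound Z L (\<lambda>vs. T (Rn (Suc n)) L x vs - T (Rn n) L x vs) (\<theta> * (C0 L * \<tau> ^ n))"
    by (rule T_diff_L[OF inv_Rn inv_Rn Suc.prems e Suc.IH])
  then show ?case unfolding Rn_Suc
    by (rule mult_bound_mono) (use mult_right_mono[OF less_imp_le[OF rates(2)] e] in \<open>simp add: mult_ac\<close>)
qed

definition "level j K E \<longleftrightarrow> 0 \<le> K \<and> 0 \<le> E \<and>
     (\<forall>n. \<forall>x\<in>V. mult_bound Z j (Rn n j x) K \<and> mult_bound Z j (\<lambda>vs. Rn (Suc n) j x vs - Rn n j x vs) (E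
         * \<tau> ^ n))"

lemma level_choice:
  assumes "\<And>j. j \<in> S \<Longrightarrow> \<exists>K E. level j K E"
  obtains Kf Ef where "\<And>j. j \<in> S \<Longrightarrow> level j (Kf j) (Ef j)"
proof -
  have "\<forall>j\<in>S. \<exists>q. level j (fst q) (snd q)" using assms by fastforce
  from bchoice[OF this] obtain f where "\<forall>j\<in>S. level j (fst (f j)) (snd (f j))" by blast
  then show thesis using that[of "\<lambda>j. fst (f j)" "\<lambda>j. snd (f j)"] by blast
qed

text \<open>Up to order \<open>L\<close> this is the contraction. Above \<open>L\<close> the lower
  orders act as a forcing term that is already bounded and convergent; the \<open>j\<close>-th
  derivatives are shown to be bounded first, since the estimate for their steps needs such a
  bound.\<close>

lemma Rn_level: "j \<le> r \<Longrightarrow> \<exists>K E. level j K E"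
proof (induction j rule: less_induct)
  case (less j)
  show ?case
  proof (cases "j \<le> L")
    case True
    have "mult_bound Z j (\<lambda>vs. Rn (Suc n) j x vs - Rn n j x vs) (C0 L * \<tau> ^ n)" if x: "x \<in> V" for n x
    proof -
      have e: "0 \<le> C0 L * \<tau> ^ n" using C0_nonneg rates by simp
      have "mult_bound Z j (\<lambda>vs. Rn (Suc n) j x vs - Rn n j x vs) (\<delta> ^ (L - j) * (C0 L * \<tau> ^ n))"
      proof (rule difference_vanishing[where r=r and L=L])
        show "jet r {x. nrm x < \<delta>} (Rn (Suc n))" "jet r {x. nrm x < \<delta>} (Rn n)"
          using inv_Rn by (auto simp: invariant_def V_def)
        show "Rn (Suc n) j 0 vs = Rn n j 0 vs" if "j < L" "length vs = j" for j vs
          using inv_Rn that by (simp add: invariant_def)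
      qed (use Lr \<delta> Rn_diff_L True x in \<open>auto simp: V_def\<close>)
      then show ?thesis
        by (rule mult_bound_mono) (use \<delta> e in \<open>auto intro!: mult_left_le_one_le power_le_one\<close>)
    qed
    then show ?thesis
      using inv_bound[OF inv_Rn _ True] C0_nonneg unfolding level_def
          by (intro exI[of _ "max 2 D0"] exI[of _ "C0 L"]) auto
  next
    case False
    obtain Kf Ef where lev: "\<And>i. i \<in> {..<j} \<Longrightarrow> level i (Kf i) (Ef i)"
      using level_choice[of "{..<j}"] less by (metis lessThan_iff less_imp_le order_trans)
    have KE: "\<And>i. i < j \<Longrightarrow> 0 \<le> Kf i" "\<And>i. i < j \<Longrightarrow> 0 \<le> Ef i"
      "\<And>i n x. i < j \<Longrightarrow> x \<in> V \<Longrightarrow> mult_bound Z i (Rn n i x) (Kf i)"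
      "\<And>i n x. i < j \<Longrightarrow> x \<in> V \<Longrightarrow> mult_bound Z i (\<lambda>vs. Rn (Suc n) i x vs - Rn n i x vs) (Ef i * \<tau> ^ n)"
      using lev unfolding level_def by auto
    define K0 where "K0 = 1 + (\<Sum>i<j. Kf i)"
    define E0 where "E0 = (\<Sum>i<j. Ef i)"
    have "0 \<le> (\<Sum>i<j. Kf i)" by (rule sum_nonneg) (use KE(1) in auto)
    then have K0: "1 \<le> K0" by (simp add: K0_def)
    have E0: "0 \<le> E0" unfolding E0_def by (rule sum_nonneg) (use KE(2) in auto)
    have Kle: "Kf i \<le> K0" "Ef i \<le> E0" if "i < j" for i
      using that KE(1,2) member_le_sum[of i "{..<j}" Kf] member_le_sum[of i "{..<j}" Ef]
      by (auto simp: K0_def E0_def)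
    have Rb: "mult_bound Z i (Rn n i x) K0" if "i < j" "x \<in> V" for i n x
      by (rule mult_bound_mono[OF KE(3)[OF that] Kle(1)[OF that(1)]])
    have Rd: "mult_bound Z i (\<lambda>vs. Rn (Suc n) i x vs - Rn n i x vs) (E0 * \<tau> ^ n)" if "i < j" "x \<in> V" for i n x
      by (rule mult_bound_mono[OF KE(4)[OF that] mult_right_mono[OF Kle(2)[OF that(1)]]]) (use rates in simp)
    have Lj: "L \<le> j" and j1: "1 \<le> j" using False L2 by auto
    have j: "j \<le> r" by (rule less.prems)
    \<comment> \<open>\<open>R\<close> is bounded only below order \<open>j\<close> here. This is
      what permits the comparison of the iterates with the identity before the \<open>j\<close>-th
      derivatives of the iterates are bounded.\<close>
    have step: "mult_bound Z j (\<lambda>vs. T R j x vs - T S j x vs) (\<theta> * dj + a * (Cc j K * (real j * di)))"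
      if R: "invariant R" and S: "invariant S" and x: "x \<in> V" and K: "1 \<le> K" and dj: "0 \<le> dj" and di: "0 \<le> di"
        and Sb: "\<And>i. 1 \<le> i \<Longrightarrow> i \<le> j \<Longrightarrow> mult_bound Z i (S i x) K"
        and Rb: "\<And>i. 1 \<le> i \<Longrightarrow> i < j \<Longrightarrow> mult_bound Z i (R i x) K"
        and d: "\<And>i x. i < j \<Longrightarrow> x \<in> V \<Longrightarrow> mult_bound Z i (\<lambda>vs. R i x vs - S i x vs) di"
          "\<And>x. x \<in> V \<Longrightarrow> mult_bound Z j (\<lambda>vs. R j x vs - S j x vs) dj" for R S x K dj di
    proof -
      define dd where "dd i = (if i < j then di else dj)" for i
      have dd: "mult_bound Z i (\<lambda>vs. R i x vs - S i x vs) (dd i)" if "i \<le> j" "x \<in> V" for i x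
        using d that by (cases "i = j") (auto simp: dd_def)
      have "mult_bound Z j (\<lambda>vs. T R j x vs - T S j x vs)
        (a * ((b' ^ j + Mp * nrm (R 0 x [])) * dd j + Cc j K * (\<Sum>i<j. dd i)))"
      proof (rule T_diff[where R=R and S=S and d=dd, OF j1 j K V_less(1)[OF x] F1_bound[OF x] b'(2) _ _ Sb Rb])
        show "nrm (R 0 x []) < 1" "nrm (S 0 x []) < 1"
          using inv_small[OF R x] inv_small[OF S x] \<delta> by auto
      qed (use x dd FV[OF x] in auto)
      then show ?thesis
      proof (rule mult_bound_mono)
        have "a * ((b' ^ j + Mp * nrm (R 0 x [])) * dj) \<le> a * ((b' ^ j + Mp * (2 * \<delta>)) * dj)"
          using a0 dj Mp0 inv_small[OF R x] by (intro mult_left_mono mult_right_mono add_left_mono) auto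
        moreover have "(a * (b' ^ j + Mp * (2 * \<delta>))) * dj \<le> \<theta> * dj"
          using rate_j[OF Lj] dj by (rule mult_right_mono)
        moreover have "(\<Sum>i<j. dd i) = real j * di" by (simp add: dd_def)
        ultimately show "a * ((b' ^ j + Mp * nrm (R 0 x [])) * dd j + Cc j K * (\<Sum>i<j. dd i)) \<le>
            \<theta> * dj + a * (Cc j K * (real j * di))"
          by (simp add: dd_def algebra_simps)
      qed
    qed
    have idb: "mult_bound Z i (idj i x) 1" if "x \<in> V" for i x
      by (rule mult_bound_idj) (use V_less(2)[OF that] in simp)
    \<comment> \<open>The part of the \<open>j\<close>-th derivative of \<open>T (Rn n)\<close> that
      is not controlled by the \<open>j\<close>-th derivative of \<open>Rn n\<close>: the lower
      differences to the identity, at most \<open>K0 + 1\<close>, and \<open>T idj\<close> itself.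
      \<open>D\<close> is the fixed point of the resulting affine recursion.\<close>
    define c where "c = a * (Cc j K0 * (real j * (K0 + 1))) + C0 j"
    define D where "D = c / (1 - \<theta>)"
    have c0: "0 \<le> c" unfolding c_def using a0 Cc0[OF K0] K0 C0_nonneg by simp
    have D: "0 \<le> D" "\<theta> * D + c = D" using c0 rates by (auto simp: D_def field_simps)
    have RD: "mult_bound Z j (Rn n j x) D" if "x \<in> V" for n x
      using that
    proof (induction n arbitrary: x)
      case 0
      show ?case unfolding Rn_0
        by (rule mult_bound_cong[OF mult_bound_mono[OF mult_bound_zero D(1)]]) (simp add: idj_L[OF Lj])
    next
      case (Suc n)
      have 1: "mult_bound Z j (\<lambda>vs. T (Rn n) j x vs - T idj j x vs) (\<theta> * D + a * (Cc j K0 * (real j * (K0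
          + 1))))"
      proof (rule step[OF inv_Rn inv_id Suc.prems K0 D(1)])
        show "mult_bound Z i (idj i x) K0" for i by (rule mult_bound_mono[OF idb[OF Suc.prems] K0])
        show "mult_bound Z i (\<lambda>vs. Rn n i x vs - idj i x vs) (K0 + 1)" if "i < j" "x \<in> V" for i x
          by (rule mult_bound_diff[OF Rb[OF that] idb[OF that(2)]])
        show "mult_bound Z j (\<lambda>vs. Rn n j x vs - idj j x vs) D" if "x \<in> V" for x
          using Suc.IH[OF that] Lj by (simp add: idj_L)
      qed (use K0 Rb Suc.prems in auto)
      have "mult_bound Z j (T (Rn n) j x) (\<theta> * D + a * (Cc j K0 * (real j * (K0 + 1))) + C0 j)"
        by (rule mult_bound_cong[OF mult_bound_add[OF 1 T_id_L[OF j Suc.prems]]]) simp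
      then show ?case unfolding Rn_Suc by (rule mult_bound_mono) (use D(2) in \<open>simp add: c_def\<close>)
    qed
    define K1 where "K1 = max K0 D"
    have K1: "1 \<le> K1" using K0 by (simp add: K1_def)
    have RK1: "mult_bound Z i (Rn n i x) K1" if "i \<le> j" "x \<in> V" for i n x
      using mult_bound_mono[OF Rb, of i x K1 n] mult_bound_mono[OF RD, of x K1 n] that
      by (cases "i = j") (auto simp: K1_def)
    define c1 where "c1 = a * (Cc j K1 * (real j * E0))"
    have c1: "0 \<le> c1" unfolding c1_def using a0 Cc0[OF K1] E0 by simp
    \<comment> \<open>Large enough for the first step, and such that
      \<open>c1 \<le> (\<tau> - \<theta>) * E\<close>, which closes the forced recursion at rate
      \<open>\<tau>\<close>.\<close>
    define E where "E = C0 j + c1 / (\<tau> - \<theta>)"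
    have E: "0 \<le> E" "C0 j \<le> E" using c1 C0_nonneg rates by (auto simp: E_def)
    have "c1 / (\<tau> - \<theta>) \<le> E" using C0_nonneg by (simp add: E_def)
    then have Ec: "c1 \<le> (\<tau> - \<theta>) * E" using rates by (simp add: pos_divide_le_eq mult.commute)
    have Ed: "mult_bound Z j (\<lambda>vs. Rn (Suc n) j x vs - Rn n j x vs) (E * \<tau> ^ n)" if "x \<in> V" for n x
      using that
    proof (induction n arbitrary: x)
      case 0
      then show ?case using mult_bound_mono[OF T_id_L[OF j] E(2)] Lj by (simp add: Rn_Suc Rn_0 idj_L)
    next
      case (Suc n)
      have \<tau>n: "0 \<le> \<tau> ^ n" using rates by simp
      have "mult_bound Z j (\<lambda>vs. T (Rn (Suc n)) j x vs - T (Rn n) j x vs)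
          (\<theta> * (E * \<tau> ^ n) + a * (Cc j K1 * (real j * (E0 * \<tau> ^ n))))"
        by (rule step[OF inv_Rn inv_Rn Suc.prems K1]) (use E E0 \<tau>n RK1 Rd Suc in auto)
      then have "mult_bound Z j (\<lambda>vs. T (Rn (Suc n)) j x vs - T (Rn n) j x vs) (\<tau> * (E * \<tau> ^ n))"
      proof (rule mult_bound_mono)
        have "c1 * \<tau> ^ n \<le> (\<tau> - \<theta>) * E * \<tau> ^ n" using Ec \<tau>n by (rule mult_right_mono)
        then show "\<theta> * (E * \<tau> ^ n) + a * (Cc j K1 * (real j * (E0 * \<tau> ^ n))) \<le> \<tau> * (E * \<tau> ^ n)"
          by (simp add: c1_def algebra_simps)
      qed
      then show ?case by (simp add: Rn_Suc mult_ac)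
    qed
    show ?thesis
      using RK1[OF order_refl] Ed E(1) K1 unfolding level_def by (intro exI[of _ K1] exI[of _ E]) auto
  qed
qed

text \<open>All derivatives up to order \<open>r\<close> converge uniformly at rate
  \<open>\<tau>\<close>, so the limits form a jet; the functional equation is the limit of
  \<open>Rn (Suc n) = T (Rn n)\<close> at order \<open>0\<close>.\<close>

lemma conjugacy:
  "\<exists>G C. jet r V G \<and> (\<forall>j\<le>r. \<forall>x\<in>V. mult_bound Z j (G j x) C) \<and> G 0 0 [] = 0 \<and> (\<forall>v. G 1 0 [v] = v) \<and>
     (\<forall>x\<in>V. G 0 (Fj 0 x []) [] = H (G 0 x []))"
proof -
  obtain Kf Ef where lev: "\<And>j. j \<in> {..r} \<Longrightarrow> level j (Kf j) (Ef j)"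
    using level_choice[of "{..r}"] Rn_level by (metis atMost_iff)
  have KE: "\<And>j. j \<le> r \<Longrightarrow> 0 \<le> Kf j" "\<And>j. j \<le> r \<Longrightarrow> 0 \<le> Ef j"
    "\<And>j n x. j \<le> r \<Longrightarrow> x \<in> V \<Longrightarrow> mult_bound Z j (Rn n j x) (Kf j)"
    "\<And>j n x. j \<le> r \<Longrightarrow> x \<in> V \<Longrightarrow> mult_bound Z j (\<lambda>vs. Rn (Suc n) j x vs - Rn n j x vs) (Ef j * \<tau> ^ n)"
    using lev unfolding level_def by auto
  have "\<forall>q\<in>{..r} \<times> V. \<exists>H. \<forall>n. mult_bound Z (fst q) (\<lambda>vs. Rn n (fst q) (snd q) vs - H vs) (Ef (fst q)
      * \<tau> ^ n / (1 - \<tau>))"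
  proof
    fix q assume q: "q \<in> {..r} \<times> V"
    show "\<exists>H. \<forall>n. mult_bound Z (fst q) (\<lambda>vs. Rn n (fst q) (snd q) vs - H vs) (Ef (fst q) * \<tau> ^ n / (1 - \<tau>))"
      by (rule geometric_limit[OF KE(4)]) (use q rates in auto)
  qed
  from bchoice[OF this] obtain G' where G': "\<And>q n. q \<in> {..r} \<times> V \<Longrightarrow>
      mult_bound Z (fst q) (\<lambda>vs. Rn n (fst q) (snd q) vs - G' q vs) (Ef (fst q) * \<tau> ^ n / (1 - \<tau>))"
    by blast
  define G where "G j x = G' (j, x)" for j x
  have G: "mult_bound Z j (\<lambda>vs. Rn n j x vs - G j x vs) (Ef j / (1 - \<tau>) * \<tau> ^ n)" if "j \<le> r" "x \<in> V" for j x n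
    using G'[of "(j, x)" n] that by (simp add: G_def)
  have \<tau>lim: "(\<lambda>n. c * \<tau> ^ n) \<longlonglongrightarrow> 0" for c
  proof -
    have "(\<lambda>n. c * \<tau> ^ n) \<longlonglongrightarrow> c * 0" using rates by (intro tendsto_intros LIMSEQ_power_zero) auto
    then show ?thesis by simp
  qed
  have unif: "\<forall>\<^sub>F n in sequentially. \<forall>x\<in>V. op_bound j (\<lambda>vs. Rn n j x vs - G j x vs) e" if "j \<le> r" "0 < e"
      for j e
  proof -
    have "\<forall>\<^sub>F n in sequentially. (Ef j / (1 - \<tau>) * kN ^ j) * \<tau> ^ n < e"
      using order_tendstoD(2)[OF \<tau>lim that(2)] .
    then show ?thesis
    proof eventually_elim
      case (elim n)
      then show ?case using pl.mult_bound_mono[OF mult_bound_op_bound[OF G[OF that(1)]]] by (auto simp: mult_ac)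
    qed
  qed
  have conv: "(\<lambda>n. Rn n j x vs) \<longlonglongrightarrow> G j x vs" if j: "j \<le> r" "x \<in> V" "length vs = j" for j x vs
  proof -
    have nb: "norm (Rn n j x vs - G j x vs) \<le> (Ef j / (1 - \<tau>) * kN ^ j * (\<Prod>v\<leftarrow>vs. norm v)) * \<tau> ^ n" for n
      using op_boundD[OF mult_bound_op_bound[OF G[OF j(1,2)]] j(3)] by (simp add: mult_ac)
    have "(\<lambda>n. Rn n j x vs - G j x vs) \<longlonglongrightarrow> 0"
      by (rule Lim_null_comparison[OF always_eventually[OF allI[OF nb]] \<tau>lim])
    then show ?thesis by (simp add: LIM_zero_iff)
  qed
  have JG: "jet r V G"
    by (rule jet_limit[where G=Rn, OF _ V(2) unif]) (use inv_Rn in \<open>auto simp: invariant_def\<close>)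
  have B: "mult_bound Z j (G j x) (\<Sum>i\<le>r. Kf i)" if "j \<le> r" "x \<in> V" for j x
    by (rule mult_bound_mono[OF mult_bound_lim[OF KE(3)[OF that] conv[OF that]]])
      (use that KE(1) member_le_sum[of j "{..r}" Kf] in auto)
  have at0: "G j 0 vs = idj j 0 vs" if "j < L" "length vs = j" for j vs
  proof (rule LIMSEQ_unique[OF conv[OF _ V(3) that(2)]])
    show "j \<le> r" using that Lr by simp
    show "(\<lambda>n. Rn n j 0 vs) \<longlonglongrightarrow> idj j 0 vs" using inv_Rn that by (simp add: invariant_def)
  qed
  have eqn: "G 0 (Fj 0 x []) [] = H (G 0 x [])" if x: "x \<in> V" for x
  proof -
    let ?y = "G 0 x []"
    have r0: "0 < r" using L2 Lr by simp
    have c: "(\<lambda>n. Rn n 0 x []) \<longlonglongrightarrow> ?y" "(\<lambda>n. Rn n 0 (Fj 0 x []) []) \<longlonglongrightarrow> G 0 (Fj 0 x []) []"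
      using conv x FV[OF x] by auto
    have "Z 0 (2 * \<delta>) ?y" by (rule Z_lim[OF _ c(1)]) (use inv_small[OF inv_Rn x] in \<open>simp add: Z_nrm\<close>)
    then have y1: "?y \<in> {x. nrm x < 1}" using \<delta> by (simp add: Z_nrm)
    have "(\<lambda>n. p 0 (Rn n 0 x []) []) \<longlonglongrightarrow> p 0 ?y []"
      using filterlim_compose[OF jet_tendsto[OF jet_p[of 1] _ y1] c(1)] by simp
    then have "(\<lambda>n. Ai (Rn n 0 (Fj 0 x []) [] - p 0 (Rn n 0 x []) [])) \<longlonglongrightarrow> Ai (G 0 (Fj 0 x []) [] - p 0 ?y [])"
      by (intro bounded_linear.tendsto[OF blAi] tendsto_diff c(2))
    moreover have "Ai (Rn n 0 (Fj 0 x []) [] - p 0 (Rn n 0 x []) []) = Rn (Suc n) 0 x []" for n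
      by (simp add: Rn_Suc T_def)
    ultimately have "(\<lambda>n. Rn (Suc n) 0 x []) \<longlonglongrightarrow> Ai (G 0 (Fj 0 x []) [] - p 0 ?y [])" by simp
    from LIMSEQ_unique[OF LIMSEQ_Suc[OF c(1)] this]
    \<comment> \<open>Applying \<open>A\<close> to the fixed point equation removes
      \<open>Ai\<close>; adding \<open>p\<close> then gives \<open>H = A + p\<close>.\<close>
    have "A ?y = G 0 (Fj 0 x []) [] - p 0 ?y []" using AAi by metis
    then show ?thesis by (simp add: p_def H_def linear_jet_def)
  qed
  show ?thesis
    using JG B at0[of 0 "[]"] at0[of 1 "[_]"] eqn L2
    by (intro exI[of _ G] exI[of _ "\<Sum>i\<le>r. Kf i"]) (auto simp: linear_jet_def)
qed

end

context contraction_data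
begin

lemma eventually_small: "0 < e \<Longrightarrow> \<forall>\<^sub>F x in at_right 0. c * x \<le> (e::real)" for c :: real
proof -
  assume e: "0 < e"
  have "((\<lambda>x. c * x) \<longlongrightarrow> c * 0) (at_right 0)" by (intro tendsto_intros)
  then have "\<forall>\<^sub>F x in at_right 0. c * x < e" by (rule order_tendstoD) (use e in simp)
  then show ?thesis by eventually_elim simp
qed

text \<open>The choices are not circular: \<open>b'\<close> depends on the gap only,
  \<open>D0\<close> on \<open>b'\<close>, and \<open>\<delta>\<close> comes last, subject to
  finitely many linear smallness conditions.\<close>

theorem local_conjugacy:
  "\<exists>\<delta> G C. 0 < \<delta> \<and> \<delta> \<le> \<delta>0 \<and> jet r {x. nrm x < \<delta>} G \<and> (\<forall>j\<le>r. \<forall>x\<in>{x. nrm x < \<delta>}. mult_bound Z j (G j x) C) \<and>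
     G 0 0 [] = 0 \<and> (\<forall>v. G 1 0 [v] = v) \<and>
     (\<forall>x\<in>{x. nrm x < \<delta>}. nrm (Fj 0 x []) < \<delta> \<and> G 0 (Fj 0 x []) [] = H (G 0 x []))"
proof -
  have "((\<lambda>t. a * t ^ L) \<longlongrightarrow> a * b ^ L) (at_right b)" by (intro tendsto_intros)
  then have "\<forall>\<^sub>F t in at_right b. a * t ^ L < 1" by (rule order_tendstoD) (rule ab)
  moreover have "\<forall>\<^sub>F t in at_right b. t < 1"
    by (rule order_tendstoD(2)[OF tendsto_ident_at b1])
  ultimately have "\<forall>\<^sub>F t in at_right b. b < t \<and> t < 1 \<and> a * t ^ L < 1"
    using eventually_at_right_less[of b] by eventually_elim auto
  from eventually_happens'[OF _ this] obtain b' where b': "b < b'" "b' < 1" "a * b' ^ L < 1"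
    by (auto simp: trivial_limit_at_right_real)
  define D0 where "D0 = C0 L / (1 - (1 + a * b' ^ L) / 2)"
  have pos: "0 < (1 - a * b' ^ L) / 4" using b' by simp
  have "\<forall>\<^sub>F \<delta> in at_right 0. 0 < \<delta> \<and> 1 * \<delta> \<le> \<delta>0 \<and> 1 * \<delta> \<le> 1 / 4 \<and> M * \<delta> \<le> b' - b \<and>
      (a * Mp * 2) * \<delta> \<le> (1 - a * b' ^ L) / 4 \<and>
      (a * Cc L (max 2 D0) * real L) * \<delta> \<le> (1 - a * b' ^ L) / 4 \<and> D0 * \<delta> \<le> 1"
    by (intro eventually_conj eventually_at_right_less eventually_small) (use \<delta>0 b' pos in simp_all)
  from eventually_happens'[OF _ this] obtain \<delta> where \<delta>: "0 < \<delta>" "\<delta> \<le> \<delta>0" "\<delta> \<le> 1 / 4" "M * \<delta> \<le> b' - b"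
    "(a * Mp * 2) * \<delta> \<le> (1 - a * b' ^ L) / 4"
    "(a * Cc L (max 2 D0) * real L) * \<delta> \<le> (1 - a * b' ^ L) / 4" "D0 * \<delta> \<le> 1"
    by (auto simp: trivial_limit_at_right_real)
  interpret iteration Z nrm kN Fj A Ai r L a b M \<delta>0 b' \<delta> D0
    by unfold_locales (use \<delta> b' b0 D0_def in \<open>simp_all add: mult_ac\<close>)
  show ?thesis
    using conjugacy \<delta> FV unfolding V_def by (intro exI[of _ \<delta>]) auto
qed

end

section \<open>Sizes with decay\<close>

instance bcontfun :: (metric_space, banach) banach ..

section \<open>The sizes given by a decay function\<close>

definition decay_weight :: "(int ^ 'm \<Rightarrow> real) \<Rightarrow> (int ^ 'm) multiset \<Rightarrow> int ^ 'm \<Rightarrow> real" where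
  "decay_weight \<Gamma> t i = (\<Prod>l\<in>#t. \<Gamma> (i - l))"

text \<open>The type \<open>{#}\<close> is the norm and the type \<open>{#l#}\<close> is decay away from \<open>l\<close>. Types with at least two points
  impose no condition; they only make the types a commutative monoid.\<close>

definition decay_size :: "(int ^ 'm \<Rightarrow> real) \<Rightarrow> (int ^ 'm) multiset \<Rightarrow> real \<Rightarrow> ('m::finite,
    'v::real_normed_vector) linf \<Rightarrow> bool" where
  "decay_size \<Gamma> t c x \<longleftrightarrow> 0 \<le> c \<and> (size t \<le> 1 \<longrightarrow> (\<forall>i. norm (x i) \<le> c * decay_weight \<Gamma> t i))"

lemma decay_weight_simps [simp]: "decay_weight \<Gamma> {#} i = 1"
    "decay_weight \<Gamma> (add_mset l t) i = \<Gamma> (i - l) * decay_weight \<Gamma> t i"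
  by (auto simp: decay_weight_def)

lemma decay_weight_add: "decay_weight \<Gamma> (s + t) i = decay_weight \<Gamma> s i * decay_weight \<Gamma> t i"
  by (simp add: decay_weight_def)

lemma decay_weight_pos: "decay_function \<Gamma> \<Longrightarrow> 0 < decay_weight \<Gamma> t i"
  by (induction t) (auto simp: decay_function_def)

lemma decay_size_0: "decay_size \<Gamma> 0 c x \<longleftrightarrow> norm x \<le> c"
proof
  show "decay_size \<Gamma> 0 c x \<Longrightarrow> norm x \<le> c" by (rule norm_bound) (simp add: decay_size_def)
  show "decay_size \<Gamma> 0 c x" if "norm x \<le> c"
    using that norm_bounded[of x] norm_ge_zero[of x] unfolding decay_size_def
    by (auto intro: order_trans simp del: norm_ge_zero)
qed

lemma bounded_linear_eval: "bounded_linear (\<lambda>x :: ('m::finite, 'v::real_normed_vector) linf. x i)"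
  by (rule bounded_linear_intro[where K=1]) (auto simp: norm_bounded)

text \<open>The functionals are the evaluations at the lattice points, weighted by
  \<open>decay_weight\<close>; types with two or more points get none.\<close>

lemma sized_decay_size:
  assumes "decay_function \<Gamma>"
  shows "sized (decay_size \<Gamma> :: _ \<Rightarrow> _ \<Rightarrow> ('m::finite, 'v::banach) linf \<Rightarrow> bool) norm 1"
proof (rule sized_functionals[where \<Phi>="\<lambda>t. if size t
    \<le> 1 then range (\<lambda>i. (\<lambda>x. apply_bcontfun x i, decay_weight \<Gamma> t i)) else {}"])
  show "decay_size \<Gamma> t c x \<longleftrightarrow> 0 \<le> c \<and> (\<forall>(\<phi>, w)\<in>(if size t
      \<le> 1 then range (\<lambda>i. (\<lambda>x. apply_bcontfun x i, decay_weight \<Gamma> t i)) else {}). norm (\<phi> x) \<le> c * w)"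
    for t c and x :: "('m, 'v) linf"
    by (auto simp: decay_size_def)
qed (auto simp: decay_size_0 bounded_linear_eval less_imp_le[OF decay_weight_pos[OF assms]] split: if_splits)

lemma bounded_linf_apply:
  fixes f :: "int ^ 'm \<Rightarrow> 'v::real_normed_vector"
  assumes "\<And>i. norm (f i) \<le> b"
  shows "apply_bcontfun (Bcontfun f) i = f i"
proof -
  have "f \<in> bcontfun" by (rule bounded_family_in_bcontfun) (use assms in \<open>auto simp: bounded_iff\<close>)
  then show ?thesis by (simp add: Bcontfun_inverse)
qed

definition restrict_linf :: "(int ^ 'm) set \<Rightarrow> ('m::finite, 'v::real_normed_vector) linf \<Rightarrow> ('m, 'v) linf" where
  "restrict_linf S x = Bcontfun (\<lambda>i. if i \<in> S then x i else 0)"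

lemma restrict_linf_apply: "restrict_linf S x i = (if i \<in> S then x i else 0)"
  unfolding restrict_linf_def by (rule bounded_linf_apply[where b="norm x"]) (auto simp: norm_bounded)

text \<open>Since the sum of \<open>\<Gamma>\<close> is at most \<open>1\<close>, at most
  \<open>1 / e\<close> points carry the value \<open>e\<close> or more.\<close>

lemma decay_level_finite:
  assumes "decay_function \<Gamma>" "0 < e"
  shows "finite {k. e \<le> \<Gamma> k}"
proof -
  have pos: "\<And>k. 0 < \<Gamma> k" and sm: "\<Gamma> summable_on UNIV" "(\<Sum>\<^sub>\<infinity>k. \<Gamma> k) \<le> 1"
    using assms(1) by (auto simp: decay_function_def)
  have "card F \<le> nat \<lceil>1 / e\<rceil>" if F: "F \<subseteq> {k. e \<le> \<Gamma> k}" "finite F" for F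
  proof -
    have "real (card F) * e = (\<Sum>k\<in>F. e)" by simp
    also have "\<dots> \<le> (\<Sum>k\<in>F. \<Gamma> k)" using F by (intro sum_mono) auto
    also have "\<dots> \<le> (\<Sum>\<^sub>\<infinity>k. \<Gamma> k)"
      by (rule finite_sum_le_infsum[OF sm(1) F(2)]) (use pos in \<open>auto intro: less_imp_le\<close>)
    finally have "real (card F) * e \<le> 1" using sm(2) by simp
    then have "real (card F) \<le> 1 / e" using assms(2) by (simp add: field_simps)
    then show ?thesis by linarith
  qed
  then show ?thesis using finite_if_finite_subsets_card_bdd by blast
qed

lemma decay_conv_sum:
  assumes "decay_function \<Gamma>" "finite S"
  shows "(\<Sum>k\<in>S. \<Gamma> (i - k) * \<Gamma> (k - l)) \<le> \<Gamma> (i - l)"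
proof -
  have pos: "\<And>k. 0 < \<Gamma> k" and sm: "(\<lambda>k. \<Gamma> (i - k) * \<Gamma> (k - l)) summable_on UNIV"
    "(\<Sum>\<^sub>\<infinity>k. \<Gamma> (i - k) * \<Gamma> (k - l)) \<le> \<Gamma> (i - l)"
    using assms(1) by (auto simp: decay_function_def)
  have "(\<Sum>k\<in>S. \<Gamma> (i - k) * \<Gamma> (k - l)) \<le> (\<Sum>\<^sub>\<infinity>k. \<Gamma> (i - k) * \<Gamma> (k - l))"
    by (rule finite_sum_le_infsum[OF sm(1) assms(2)]) (use pos in \<open>auto intro: less_imp_le\<close>)
  then show ?thesis using sm(2) by simp
qed

text \<open>A vector of type \<open>{#l#}\<close> is split into its entries: the one at
  \<open>k\<close> contributes at most \<open>K * \<Gamma> (i - k) * c * \<Gamma> (k - l)\<close> at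
  \<open>i\<close>, and the convolution inequality sums this to \<open>\<Gamma> (i - l)\<close>.
  Linearity gives finite sums only. A general bounded family is not a norm limit of finite
  truncations, but one with decay is, as \<open>\<Gamma>\<close> is small off a finite set.\<close>

lemma lin_bound_decay_linear:
  fixes T :: "('m::finite, 'v::banach) linf \<Rightarrow> ('m, 'v) linf"
  assumes \<Gamma>: "decay_function \<Gamma>" and lin: "linear T" and K: "0 \<le> K"
    and n: "\<And>x. norm (T x) \<le> K * norm x"
    and d: "\<And>l u i. supported_at l u \<Longrightarrow> norm (T u i) \<le> K * \<Gamma> (i - l) * norm u"
  shows "lin_bound (decay_size \<Gamma>) T K"
  unfolding lin_bound_def
proof (intro conjI allI impI K)
  fix t c and x :: "('m, 'v) linf"
  assume Z: "decay_size \<Gamma> t c x"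
  then have c: "0 \<le> c" by (simp add: decay_size_def)
  have pos: "\<And>k. 0 < \<Gamma> k" using \<Gamma> by (auto simp: decay_function_def)
  consider "t = {#}" | l where "t = {#l#}" | "2 \<le> size t"
    by (metis One_nat_def Suc_1 Suc_leI le_neq_implies_less less_one not_le size_1_singleton_mset
        size_eq_0_iff_empty)
  then show "decay_size \<Gamma> t (K * c) (T x)"
  proof cases
    case 1
    then have "norm x \<le> c" using Z decay_size_0 by force
    then have "norm (T x) \<le> K * c" using n[of x] K by (meson mult_left_mono order_trans)
    then show ?thesis using 1 decay_size_0 by force
  next
    case (2 l)
    have x: "norm (x i) \<le> c * \<Gamma> (i - l)" for i using Z 2 by (simp add: decay_size_def)
    have "norm (T x i) \<le> K * c * \<Gamma> (i - l)" for i
    proof (rule field_le_epsilon)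
      fix e :: real assume e: "0 < e"
      \<comment> \<open>The truncation error \<open>c * \<eta>\<close> costs at most
        \<open>K * (c * \<eta>) \<le> e\<close>; the summand \<open>1\<close> covers
        \<open>K * c = 0\<close>.\<close>
      define \<eta> where "\<eta> = e / (K * c + 1)"
      have Kc: "0 < K * c + 1" using K c by (simp add: add_nonneg_pos)
      have \<eta>: "0 < \<eta>" using e Kc by (simp add: \<eta>_def)
      define S where "S = (\<lambda>k. k + l) ` {k. \<eta> \<le> \<Gamma> k}"
      have S: "finite S" unfolding S_def using decay_level_finite[OF \<Gamma> \<eta>] by simp
      have out: "\<Gamma> (k - l) < \<eta>" if "k \<notin> S" for k
      proof (rule ccontr)
        assume "\<not> \<Gamma> (k - l) < \<eta>"
        then have "k \<in> S" unfolding S_def by (intro image_eqI[of _ _ "k - l"]) auto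
        then show False using that by simp
      qed
      have "norm (x - restrict_linf S x) \<le> c * \<eta>"
      proof (rule norm_bound)
        fix k
        show "norm ((x - restrict_linf S x) k) \<le> c * \<eta>"
        proof (cases "k \<in> S")
          case True
          then show ?thesis using c \<eta> by (simp add: restrict_linf_apply)
        next
          case False
          have "c * \<Gamma> (k - l) \<le> c * \<eta>" using out[OF False] c by (intro mult_left_mono) auto
          then show ?thesis using False x[of k] by (simp add: restrict_linf_apply)
        qed
      qed
      then have 1: "norm (T (x - restrict_linf S x)) \<le> K * (c * \<eta>)"
        using n[of "x - restrict_linf S x"] K by (meson mult_left_mono order_trans)
      have "restrict_linf S x = (\<Sum>k\<in>S. restrict_linf {k} x)"
      proof (rule bcontfun_eqI)
        fix j
        have "(\<Sum>k\<in>S. restrict_linf {k} x) j = (\<Sum>k\<in>S. restrict_linf {k} x j)"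
          by (rule linear_sum[OF bounded_linear.linear[OF bounded_linear_eval]])
        then show "restrict_linf S x j = (\<Sum>k\<in>S. restrict_linf {k} x) j"
          using S by (simp add: restrict_linf_apply)
      qed
      then have "T (restrict_linf S x) i = (\<Sum>k\<in>S. T (restrict_linf {k} x) i)"
        by (simp add: linear_sum[OF lin] linear_sum[OF bounded_linear.linear[OF bounded_linear_eval]])
      then have "norm (T (restrict_linf S x) i) \<le> (\<Sum>k\<in>S. norm (T (restrict_linf {k} x) i))"
        by (simp add: norm_sum)
      also have "\<dots> \<le> (\<Sum>k\<in>S. K * c * (\<Gamma> (i - k) * \<Gamma> (k - l)))"
      proof (rule sum_mono)
        fix k
        have "norm (restrict_linf {k} x) \<le> c * \<Gamma> (k - l)"
          by (rule norm_bound) (use x[of k] c pos[of "k - l"] in \<open>auto simp: restrict_linf_apply\<close>)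
        then have "K * \<Gamma> (i - k) * norm (restrict_linf {k} x) \<le> K * \<Gamma> (i - k) * (c * \<Gamma> (k - l))"
          using K pos[of "i - k"] by (intro mult_left_mono) auto
        moreover have "norm (T (restrict_linf {k} x) i) \<le> K * \<Gamma> (i - k) * norm (restrict_linf {k} x)"
          by (rule d) (auto simp: supported_at_def restrict_linf_apply)
        ultimately show "norm (T (restrict_linf {k} x) i) \<le> K * c * (\<Gamma> (i - k) * \<Gamma> (k - l))"
          by (simp add: mult_ac)
      qed
      also have "\<dots> \<le> K * c * \<Gamma> (i - l)"
        unfolding sum_distrib_left[symmetric] using decay_conv_sum[OF \<Gamma> S] K c by (intro mult_left_mono) auto
      finally have 2: "norm (T (restrict_linf S x) i) \<le> K * c * \<Gamma> (i - l)" .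
      have "T x i = T (restrict_linf S x) i + T (x - restrict_linf S x) i"
        by (simp add: linear_diff[OF lin])
      then have "norm (T x i) \<le> K * c * \<Gamma> (i - l) + K * (c * \<eta>)"
        using 1 2 norm_bounded[of "T (x - restrict_linf S x)" i]
          norm_triangle_ineq[of "T (restrict_linf S x) i" "T (x - restrict_linf S x) i"] by simp
      also have "K * (c * \<eta>) \<le> e"
        unfolding \<eta>_def using e Kc by (simp add: pos_divide_le_eq algebra_simps)
      finally show "norm (T x i) \<le> K * c * \<Gamma> (i - l) + e" by simp
    qed
    then show ?thesis using 2 K c by (simp add: decay_size_def)
  next
    case 3
    then show ?thesis using K c by (simp add: decay_size_def)
  qed
qed

lemma sum_list_singleton_mset:
  "sum_list (map f l) = {#a#} \<Longrightarrow>
    \<exists>xs q ys. l = xs @ q # ys \<and> f q = {#a#} \<and> (\<forall>x\<in>set xs \<union> set ys. f x = {#})"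
proof (induction l)
  case Nil
  then show ?case by simp
next
  case (Cons b l)
  have "f b + sum_list (map f l) = {#a#}" using Cons.prems by simp
  then consider "f b = {#a#}" "sum_list (map f l) = {#}" | "f b = {#}" "sum_list (map f l) = {#a#}"
    by (auto simp: union_is_single)
  then show ?case
  proof cases
    case 1
    have "f x = {#}" if "x \<in> set l" for x
      using 1(2) that by (induction l) auto
    then show ?thesis using 1(1) by (intro exI[of _ "[]"] exI[of _ b] exI[of _ l]) auto
  next
    case 2
    then obtain xs q ys where "l = xs @ q # ys" "f q = {#a#}" "\<forall>x\<in>set xs \<union> set ys. f x = {#}"
      using Cons.IH by blast
    then show ?thesis using 2(1) by (intro exI[of _ "b # xs"] exI[of _ q] exI[of _ ys]) auto
  qed
qed

lemma prod_list_norm_le: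
  assumes "\<And>q. q \<in> set l \<Longrightarrow> norm (g q) \<le> f q"
  shows "(\<Prod>q\<leftarrow>l. norm (g q)) \<le> (\<Prod>q\<leftarrow>l. f q)" "0 \<le> (\<Prod>q\<leftarrow>l. f q)"
proof -
  have "(\<Prod>q\<leftarrow>l. norm (g q)) \<le> (\<Prod>q\<leftarrow>l. f q) \<and> 0 \<le> (\<Prod>q\<leftarrow>l. f q)"
    using assms
  proof (induction l)
    case (Cons b l)
    have b: "norm (g b) \<le> f b" by (rule Cons.prems) simp
    then have "0 \<le> f b" using norm_ge_zero order_trans by blast
    moreover have "(\<Prod>q\<leftarrow>l. norm (g q)) \<le> (\<Prod>q\<leftarrow>l. f q) \<and> 0 \<le> (\<Prod>q\<leftarrow>l. f q)"
      by (rule Cons.IH, rule Cons.prems) simp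
    moreover have "0 \<le> (\<Prod>q\<leftarrow>l. norm (g q))" by (rule prod_list_nonneg) auto
    ultimately show ?case using b by (auto intro!: mult_mono)
  qed simp
  then show "(\<Prod>q\<leftarrow>l. norm (g q)) \<le> (\<Prod>q\<leftarrow>l. f q)" "0 \<le> (\<Prod>q\<leftarrow>l. f q)" by auto
qed

text \<open>If the types add up to a single point, exactly one argument is localised; the others are
  frozen and the linear case applies in that slot. A sum with two or more points imposes no
  condition.\<close>

lemma mult_bound_decay_size_multilinear:
  fixes G :: "('m::finite, 'v::banach) linf list \<Rightarrow> ('m, 'v) linf"
  assumes \<Gamma>: "decay_function \<Gamma>" and ml: "multilinear_map k G" and K: "0 \<le> K"
    and n: "\<And>vs. length vs = k \<Longrightarrow> norm (G vs) \<le> K * (\<Prod>v\<leftarrow>vs. norm v)"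
    and d: "\<And>vs ws w l i. length vs + 1 + length ws = k \<Longrightarrow> supported_at l w \<Longrightarrow>
      norm (G (vs @ w # ws) i) \<le> K * \<Gamma> (i - l) * ((\<Prod>v\<leftarrow>vs. norm v) * norm w * (\<Prod>v\<leftarrow>ws. norm v))"
  shows "mult_bound (decay_size \<Gamma>) k G K"
proof (rule mult_boundI[OF K])
  fix l :: "((int ^ 'm) multiset \<times> real \<times> ('m, 'v) linf) list"
  assume l: "length l = k" "\<And>q. q \<in> set l \<Longrightarrow> decay_size \<Gamma> (fst q) (fst (snd q)) (snd (snd q))"
  let ?t = "\<Sum>q\<leftarrow>l. fst q" and ?c = "\<Prod>q\<leftarrow>l. fst (snd q)" and ?v = "map (\<lambda>q. snd (snd q)) l"
  interpret sized "decay_size \<Gamma> :: _ \<Rightarrow> _ \<Rightarrow> ('m, 'v) linf \<Rightarrow> bool" norm 1 by (rule sized_decay_size[OF \<Gamma>])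
  have c0: "0 \<le> ?c" by (rule prod_list_nonneg) (use l(2) in \<open>auto simp: decay_size_def\<close>)
  have nv: "norm (snd (snd q)) \<le> fst (snd q)" if "q \<in> set l" "fst q = {#}" for q
    using l(2)[OF that(1)] that(2) decay_size_0 by force
  consider "?t = {#}" | a where "?t = {#a#}" | "2 \<le> size ?t"
    by (metis One_nat_def Suc_1 Suc_leI le_neq_implies_less less_one not_le size_1_singleton_mset
        size_eq_0_iff_empty)
  then show "decay_size \<Gamma> ?t (K * ?c) (G ?v)"
  proof cases
    case 1
    then have "fst q = {#}" if "q \<in> set l" for q using that by (induction l) auto
    then have "(\<Prod>q\<leftarrow>l. norm (snd (snd q))) \<le> ?c" using nv by (intro prod_list_norm_le) auto
    then have "K * (\<Prod>v\<leftarrow>?v. norm v) \<le> K * ?c" using K by (intro mult_left_mono) (auto simp: o_def)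
    then have "norm (G ?v) \<le> K * ?c" using n[of ?v] l(1) by (auto intro: order_trans)
    then show ?thesis unfolding 1 using decay_size_0 by force
  next
    case (2 a)
    obtain xs q ys where q: "l = xs @ q # ys" "fst q = {#a#}" "\<And>x. x \<in> set xs \<union> set ys \<Longrightarrow> fst x = {#}"
      using sum_list_singleton_mset[OF 2] by blast
    let ?xs = "map (\<lambda>q. snd (snd q)) xs" and ?ys = "map (\<lambda>q. snd (snd q)) ys"
    let ?P = "(\<Prod>v\<leftarrow>?xs. norm v) * (\<Prod>v\<leftarrow>?ys. norm v)"
    let ?C = "(\<Prod>q\<leftarrow>xs. fst (snd q)) * (\<Prod>q\<leftarrow>ys. fst (snd q))"
    have P0: "0 \<le> ?P" using prod_norm_nonneg[of ?xs] prod_norm_nonneg[of ?ys] by simp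
    have len: "length ?xs + 1 + length ?ys = k" using l(1) q(1) by simp
    have "lin_bound (decay_size \<Gamma>) (\<lambda>w. G (?xs @ w # ?ys)) (K * ?P)"
    proof (rule lin_bound_decay_linear[OF \<Gamma>])
      show "linear (\<lambda>w. G (?xs @ w # ?ys))" using ml len unfolding multilinear_map_def by blast
      show "norm (G (?xs @ w # ?ys)) \<le> K * ?P * norm w" for w
        using n[of "?xs @ w # ?ys"] len by (simp add: mult_ac)
      show "norm (G (?xs @ u # ?ys) i) \<le> K * ?P * \<Gamma> (i - l) * norm u" if "supported_at l u" for l u i
        using d[OF len that, of i] by (simp add: mult_ac)
    qed (use K P0 in simp)
    then have "decay_size \<Gamma> (fst q) (K * ?P * fst (snd q)) (G (?xs @ snd (snd q) # ?ys))"
      using l(2)[of q] q(1) unfolding lin_bound_def by auto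
    then have "decay_size \<Gamma> ?t (K * ?P * fst (snd q)) (G ?v)" using 2 q(1,2) by simp
    then show ?thesis
    proof (rule Z_mono)
      have "norm (snd (snd x)) \<le> fst (snd x)" if "x \<in> set xs \<union> set ys" for x
        using nv[of x] q(1,3) that by auto
      then have "(\<Prod>v\<leftarrow>?xs. norm v) \<le> (\<Prod>q\<leftarrow>xs. fst (snd q))" "(\<Prod>v\<leftarrow>?ys. norm v) \<le> (\<Prod>q\<leftarrow>ys. fst (snd q))"
        "0 \<le> (\<Prod>q\<leftarrow>xs. fst (snd q))"
        using prod_list_norm_le[of xs "\<lambda>q. snd (snd q)" "\<lambda>q. fst (snd q)"]
          prod_list_norm_le[of ys "\<lambda>q. snd (snd q)" "\<lambda>q. fst (snd q)"] by (auto simp: o_def)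
      then have "?P \<le> ?C" using prod_norm_nonneg[of ?ys] by (intro mult_mono) auto
      moreover have "0 \<le> fst (snd q)" using l(2)[of q] q(1) by (auto simp: decay_size_def)
      ultimately have "K * ?P * fst (snd q) \<le> K * ?C * fst (snd q)" using K
          by (intro mult_right_mono mult_left_mono) auto
      then show "K * ?P * fst (snd q) \<le> K * ?c" using q(1) by (simp add: mult_ac)
    qed
  next
    case 3
    then show ?thesis using K c0 by (simp add: decay_size_def)
  qed
qed

section \<open>Comparison with the norms of maps with decay\<close>

lemma multilinear_scaleR:
  assumes ml: "multilinear_map k G"
  shows "G (map (\<lambda>i. c i *\<^sub>R v i) [0..<k]) = (\<Prod>i<k. c i) *\<^sub>R G (map v [0..<k])"
proof -
  have "G (map (\<lambda>i. if i < m then c i *\<^sub>R v i else v i) [0..<k]) = (\<Prod>i<m. c i) *\<^sub>R G (map v [0..<k])"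
    if "m \<le> k" for m
    using that
  proof (induction m)
    case 0
    then show ?case by simp
  next
    case (Suc m)
    then have m: "m < k" by simp
    have lin: "linear (\<lambda>u. G (map (\<lambda>i. c i *\<^sub>R v i) [0..<m] @ u # map v [Suc m..<k]))"
      using ml m unfolding multilinear_map_def by auto
    have 1: "map (\<lambda>i. if i < Suc m then c i *\<^sub>R v i else v i) [0..<k] =
        map (\<lambda>i. c i *\<^sub>R v i) [0..<m] @ (c m *\<^sub>R v m) # map v [Suc m..<k]"
      unfolding upt_split[OF m] by simp
    have 2: "map (\<lambda>i. if i < m then c i *\<^sub>R v i else v i) [0..<k] =
        map (\<lambda>i. c i *\<^sub>R v i) [0..<m] @ v m # map v [Suc m..<k]"
      unfolding upt_split[OF m] by simp
    have "G (map (\<lambda>i. if i < Suc m then c i *\<^sub>R v i else v i) [0..<k]) =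
        c m *\<^sub>R G (map (\<lambda>i. if i < m then c i *\<^sub>R v i else v i) [0..<k])"
      unfolding 1 2 by (rule linear_scale[OF lin])
    also have "\<dots> = (\<Prod>i<Suc m. c i) *\<^sub>R G (map v [0..<k])"
      using Suc by (simp add: mult.commute)
    finally show ?case .
  qed
  moreover have "map (\<lambda>i. if i < k then c i *\<^sub>R v i else v i) [0..<k] = map (\<lambda>i. c i *\<^sub>R v i) [0..<k]"
    by auto
  ultimately show ?thesis by (metis order_refl)
qed

text \<open>Every argument is rescaled to norm \<open>s\<close>, unless one is \<open>0\<close> and
  the value vanishes. \<open>Q\<close> carries a side condition stable under scaling, here the
  support of one argument.\<close>

lemma multilinear_bound_scale:
  fixes G :: "'e::real_normed_vector list \<Rightarrow> 'e"
  assumes ml: "multilinear_map k G" and \<nu>: "\<And>c x. \<nu> (c *\<^sub>R x) = \<bar>c\<bar> * \<nu> x" and s: "0 < s"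
    and Q: "\<And>i c x. i < k \<Longrightarrow> Q i x \<Longrightarrow> Q i (c *\<^sub>R x)"
    and bound: "\<And>vs. length vs = k \<Longrightarrow> (\<And>i. i < k \<Longrightarrow> norm (vs ! i) \<le> s \<and> Q i (vs ! i)) \<Longrightarrow> \<nu> (G vs) \<le> K"
    and vs: "length vs = k" "\<And>i. i < k \<Longrightarrow> Q i (vs ! i)"
  shows "\<nu> (G vs) \<le> K * (1 / s) ^ k * (\<Prod>v\<leftarrow>vs. norm v)"
proof (cases "\<exists>i<k. vs ! i = 0")
  case True
  then obtain i where i: "i < k" "vs ! i = 0" by blast
  have lin: "linear (\<lambda>u. G (take i vs @ u # drop (Suc i) vs))"
    using ml i(1) vs(1) unfolding multilinear_map_def by auto
  have "G vs = G (take i vs @ 0 # drop (Suc i) vs)"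
    using i vs(1) by (metis id_take_nth_drop)
  also have "\<dots> = 0" by (rule linear_0[OF lin])
  finally have "\<nu> (G vs) = 0" using \<nu>[of 0 0] by simp
  moreover have "(\<Prod>v\<leftarrow>vs. norm v) = 0"
  proof -
    have "0 \<in> set vs" using i vs(1) nth_mem by metis
    then show ?thesis by (auto simp: prod_list_zero_iff image_iff)
  qed
  ultimately show ?thesis by simp
next
  case False
  define c where "c i = s / norm (vs ! i)" for i
  have c: "0 < c i" if "i < k" for i using False that s by (simp add: c_def)
  have "\<nu> (G (map (\<lambda>i. c i *\<^sub>R vs ! i) [0..<k])) \<le> K"
    by (rule bound) (use vs Q False s in \<open>auto simp: c_def\<close>)
  moreover have "map ((!) vs) [0..<k] = vs" using vs(1) map_nth by blast
  moreover have P: "0 < (\<Prod>i<k. c i)" by (rule prod_pos) (use c in auto)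
  ultimately have "(\<Prod>i<k. c i) * \<nu> (G vs) \<le> K"
    unfolding multilinear_scaleR[OF ml] \<nu> by simp
  moreover have "(\<Prod>i<k. c i) = s ^ k / (\<Prod>v\<leftarrow>vs. norm v)"
  proof -
    have "(\<Prod>v\<leftarrow>vs. norm v) = (\<Prod>i<k. norm (vs ! i))"
      using vs(1) by (metis (no_types, lifting) map_map map_nth o_def prod_list_upt map_eq_conv)
    then show ?thesis by (simp add: c_def prod_dividef)
  qed
  moreover have "0 < (\<Prod>v\<leftarrow>vs. norm v)"
    using P s calculation(2) prod_norm_nonneg[of vs] by (metis div_by_0 less_irrefl less_le)
  ultimately show ?thesis using s by (simp add: field_simps power_one_over)
qed

context
  fixes N :: "('k::{real_normed_field, euclidean_space}) ^ 'n \<Rightarrow> real" and \<Gamma> :: "int ^ 'm::finite \<Rightarrow> real"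
  assumes N: "is_norm N" and \<Gamma>: "decay_function \<Gamma>"
begin

text \<open>The constant \<open>\<kappa>\<close> does not depend on \<open>G\<close>, so a bound
  uniform in the base point of a derivative stays uniform.\<close>

lemma mult_bound_of_mult_norm_decay:
  "\<exists>\<kappa>\<ge>0. \<forall>K G. 0 \<le> K \<longrightarrow> multilinear_map k G \<longrightarrow> mult_norm_decay \<Gamma> N k G \<le> ennreal K \<longrightarrow>
     mult_bound (decay_size \<Gamma> :: _ \<Rightarrow> _ \<Rightarrow> ('m, 'k ^ 'n) linf \<Rightarrow> bool) k G (\<kappa> * K)"
proof -
  obtain c1 C1 where c1: "c1 > 0" "C1 > 0" "\<And>x. c1 * norm x \<le> N x" "\<And>x. N x \<le> C1 * norm x"
    using is_norm_equivalent[OF N] by metis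
  obtain c2 C2 where c2: "c2 > 0" "C2 > 0" "\<And>x :: ('m, 'k ^ 'n) linf. c2 * norm x \<le> supn N x"
    "\<And>x :: ('m, 'k ^ 'n) linf. supn N x \<le> C2 * norm x"
    using supn_equivalent[OF N] by metis
  have pos: "\<And>k. 0 < \<Gamma> k" using \<Gamma> by (auto simp: decay_function_def)
  have unit: "supn N x \<le> 1" if "norm x \<le> 1 / C2" for x :: "('m, 'k ^ 'n) linf"
    using c2(4)[of x] that c2(2) by (simp add: pos_le_divide_eq mult.commute)
  define \<kappa> where "\<kappa> = (1 / c1 + 1 / c2) * C2 ^ k"
  have \<kappa>: "0 \<le> \<kappa>" using c1 c2 by (simp add: \<kappa>_def)
  have "mult_bound (decay_size \<Gamma>) k G (\<kappa> * K)" if K: "0 \<le> K" and ml: "multilinear_map k G"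
    and b: "mult_norm_decay \<Gamma> N k G \<le> ennreal K" for K and G :: "('m, 'k ^ 'n) linf list \<Rightarrow> ('m, 'k ^ 'n) linf"
  proof (rule mult_bound_decay_size_multilinear[OF \<Gamma> ml])
    show "0 \<le> \<kappa> * K" using \<kappa> K by simp
    have b1: "supn N (G vs) \<le> K" if "vs \<in> unit_args N k" for vs
      using b that K unfolding mult_norm_decay_def mult_norm_def by (simp add: SUP_le_iff)
    have b2: "N (G (take (p - 1) vs @ w # drop (p - 1) vs) i) / \<Gamma> (i - l) \<le> K"
      if "p \<in> {1..k}" "supn N w \<le> 1" "supported_at l w" "vs \<in> unit_args N (k - 1)" for p i l w vs
      using b that K unfolding mult_norm_decay_def mult_gamma_def by (simp add: SUP_le_iff)
    show "norm (G vs) \<le> \<kappa> * K * (\<Prod>v\<leftarrow>vs. norm v)" if l: "length vs = k" for vs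
    proof -
      have "norm (G vs) \<le> K / c2 * (1 / (1 / C2)) ^ k * (\<Prod>v\<leftarrow>vs. norm v)"
      proof (rule multilinear_bound_scale[OF ml, where Q="\<lambda>i x. True"])
        fix us :: "('m, 'k ^ 'n) linf list"
        assume us: "length us = k" "\<And>i. i < k \<Longrightarrow> norm (us ! i) \<le> 1 / C2 \<and> True"
        have "us \<in> unit_args N k" unfolding unit_args_def using us unit by (auto simp: in_set_conv_nth)
        from b1[OF this] c2(3)[of "G us"] c2(1) show "norm (G us) \<le> K / c2"
          by (simp add: pos_le_divide_eq mult.commute)
      qed (use c2 l in auto)
      also have "\<dots> \<le> \<kappa> * K * (\<Prod>v\<leftarrow>vs. norm v)"
        using c1 c2 K prod_norm_nonneg[of vs] by (intro mult_right_mono) (auto simp: \<kappa>_def field_simps)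
      finally show ?thesis .
    qed
    show "norm (G (vs @ w # ws) i) \<le> \<kappa> * K * \<Gamma> (i - l) * ((\<Prod>v\<leftarrow>vs. norm v) * norm w * (\<Prod>v\<leftarrow>ws. norm v))"
      if l: "length vs + 1 + length ws = k" and sp: "supported_at l w" for vs ws w l i
    proof -
      let ?p = "length vs"
      have "norm (G (vs @ w # ws) i) \<le> K * \<Gamma> (i - l) / c1 * (1 / (1 / C2)) ^ k * (\<Prod>v\<leftarrow>vs @ w # ws. norm v)"
      proof (rule multilinear_bound_scale[OF ml, where \<nu>="\<lambda>x. norm (x i)"
          and Q="\<lambda>j x. j = ?p \<longrightarrow> supported_at l x"])
        fix us :: "('m, 'k ^ 'n) linf list"
        assume us: "length us = k" "\<And>i. i < k \<Longrightarrow> norm (us ! i) \<le> 1 / C2 \<and> (i = ?p \<longrightarrow> supported_at l (us ! i))"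
        \<comment> \<open>\<open>mult_gamma\<close> lists the localised argument separately, so it
          is taken out of the list here.\<close>
        let ?us = "take ?p us @ drop (Suc ?p) us"
        have p: "?p < k" using l by simp
        have "?us \<in> unit_args N (k - 1)"
          unfolding unit_args_def using us unit p
          by (auto simp: in_set_conv_nth dest!: in_set_takeD in_set_dropD)
        from b2[of "?p + 1" "us ! ?p" l ?us i, OF _ _ _ this]
        have "N (G (take ?p us @ us ! ?p # drop (Suc ?p) us) i) / \<Gamma> (i - l) \<le> K"
          using us p unit by auto
        moreover have "take ?p us @ us ! ?p # drop (Suc ?p) us = us"
          using id_take_nth_drop[of ?p us] us(1) p by simp
        ultimately have "N (G us i) \<le> K * \<Gamma> (i - l)" using pos[of "i - l"] by (simp add: pos_divide_le_eq)
        then show "norm (G us i) \<le> K * \<Gamma> (i - l) / c1"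
          using c1(3)[of "G us i"] c1(1) by (simp add: pos_le_divide_eq mult.commute)
      qed (use c2 l sp in \<open>auto simp: supported_at_def nth_append\<close>)
      also have "\<dots> = K * \<Gamma> (i - l) * (1 / c1 * C2 ^ k) * (\<Prod>v\<leftarrow>vs @ w # ws. norm v)" by simp
      also have "\<dots> \<le> K * \<Gamma> (i - l) * \<kappa> * (\<Prod>v\<leftarrow>vs @ w # ws. norm v)"
        using c1 c2 K pos[of "i - l"] prod_norm_nonneg[of "vs @ w # ws"]
        by (intro mult_right_mono mult_left_mono) (auto simp: \<kappa>_def distrib_right)
      finally show ?thesis by (simp add: mult_ac)
    qed
  qed
  then show ?thesis using \<kappa> by blast
qed

lemma op_bound_of_mult_norm:
  "\<exists>\<kappa>\<ge>0. \<forall>K G. 0 \<le> K \<longrightarrow> multilinear_map k G \<longrightarrow> mult_norm N k G \<le> ennreal K \<longrightarrow>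
     op_bound k (G :: ('m, 'k ^ 'n) linf list \<Rightarrow> ('m, 'k ^ 'n) linf) (\<kappa> * K)"
proof -
  obtain c2 C2 where c2: "c2 > 0" "C2 > 0" "\<And>x :: ('m, 'k ^ 'n) linf. c2 * norm x \<le> supn N x"
    "\<And>x :: ('m, 'k ^ 'n) linf. supn N x \<le> C2 * norm x"
    using supn_equivalent[OF N] by metis
  have unit: "supn N x \<le> 1" if "norm x \<le> 1 / C2" for x :: "('m, 'k ^ 'n) linf"
    using c2(4)[of x] that c2(2) by (simp add: pos_le_divide_eq mult.commute)
  have "op_bound k G (1 / c2 * C2 ^ k * K)" if K: "0 \<le> K" and ml: "multilinear_map k G"
    and b: "mult_norm N k G \<le> ennreal K" for K and G :: "('m, 'k ^ 'n) linf list \<Rightarrow> ('m, 'k ^ 'n) linf"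
  proof (rule op_boundI)
    show "0 \<le> 1 / c2 * C2 ^ k * K" using K c2 by simp
    have b1: "supn N (G vs) \<le> K" if "vs \<in> unit_args N k" for vs
      using b that K unfolding mult_norm_def by (simp add: SUP_le_iff)
    fix vs :: "('m, 'k ^ 'n) linf list" assume l: "length vs = k"
    have "norm (G vs) \<le> K / c2 * (1 / (1 / C2)) ^ k * (\<Prod>v\<leftarrow>vs. norm v)"
    proof (rule multilinear_bound_scale[OF ml, where Q="\<lambda>i x. True"])
      fix us :: "('m, 'k ^ 'n) linf list"
      assume us: "length us = k" "\<And>i. i < k \<Longrightarrow> norm (us ! i) \<le> 1 / C2 \<and> True"
      have "us \<in> unit_args N k" unfolding unit_args_def using us unit by (auto simp: in_set_conv_nth)
      from b1[OF this] c2(3)[of "G us"] c2(1) show "norm (G us) \<le> K / c2"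
        by (simp add: pos_le_divide_eq mult.commute)
    qed (use c2 l in auto)
    then show "norm (G vs) \<le> 1 / c2 * C2 ^ k * K * (\<Prod>v\<leftarrow>vs. norm v)" by (simp add: mult_ac)
  qed
  then show ?thesis using c2 by (intro exI[of _ "1 / c2 * C2 ^ k"]) auto
qed

lemma prod_list_le_power:
  assumes "\<And>v. v \<in> set vs \<Longrightarrow> norm v \<le> s" "0 \<le> s"
  shows "(\<Prod>v\<leftarrow>vs. norm v) \<le> s ^ length vs"
  using prod_list_norm_le(1)[of vs "\<lambda>v. v" "\<lambda>v. s"] assms by (simp add: map_replicate_const)

lemma mult_norm_of_op_bound:
  "\<exists>\<kappa>\<ge>0. \<forall>C G. op_bound k G C \<longrightarrow> mult_norm N k (G :: ('m, 'k ^ 'n) linf list \<Rightarrow> ('m, 'k ^ 'n) linf)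
      \<le> ennreal (\<kappa> * C)"
proof -
  obtain c2 C2 where c2: "c2 > 0" "C2 > 0" "\<And>x :: ('m, 'k ^ 'n) linf. c2 * norm x \<le> supn N x"
    "\<And>x :: ('m, 'k ^ 'n) linf. supn N x \<le> C2 * norm x"
    using supn_equivalent[OF N] by metis
  have "mult_norm N k G \<le> ennreal (C2 * (1 / c2) ^ k * C)" if G: "op_bound k G C"
    for C and G :: "('m, 'k ^ 'n) linf list \<Rightarrow> ('m, 'k ^ 'n) linf"
    unfolding mult_norm_def
  proof (rule SUP_least)
    fix vs :: "('m, 'k ^ 'n) linf list" assume vs: "vs \<in> unit_args N k"
    have C: "0 \<le> C" by (rule mult_bound_nonneg[OF G])
    have "norm v \<le> 1 / c2" if "v \<in> set vs" for v
      using vs that c2(1) c2(3)[of v] unfolding unit_args_def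
          by (auto simp: pos_le_divide_eq mult.commute intro: order_trans)
    then have "(\<Prod>v\<leftarrow>vs. norm v) \<le> (1 / c2) ^ k"
      using prod_list_le_power[of vs "1 / c2"] vs c2 by (simp add: unit_args_def)
    then have "C * (\<Prod>v\<leftarrow>vs. norm v) \<le> C * (1 / c2) ^ k" using C by (rule mult_left_mono)
    then have "norm (G vs) \<le> C * (1 / c2) ^ k"
      using op_boundD[OF G, of vs] vs by (simp add: unit_args_def)
    then have "supn N (G vs) \<le> C2 * (C * (1 / c2) ^ k)"
      using c2(4)[of "G vs"] c2(2) by (meson less_imp_le mult_left_mono order_trans)
    then show "ennreal (supn N (G vs)) \<le> ennreal (C2 * (1 / c2) ^ k * C)"
      by (intro ennreal_leI) (simp add: mult_ac)
  qed
  then show ?thesis using c2 by (intro exI[of _ "C2 * (1 / c2) ^ k"]) auto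
qed

text \<open>A vector supported at \<open>l\<close> has type \<open>{#l#}\<close>; all other
  arguments get type \<open>0\<close>.\<close>

lemma mult_norm_decay_of_mult_bound:
  "\<exists>\<kappa>\<ge>0. \<forall>C G. mult_bound (decay_size \<Gamma>) k G C \<longrightarrow>
     mult_norm_decay \<Gamma> N k (G :: ('m, 'k ^ 'n) linf list \<Rightarrow> ('m, 'k ^ 'n) linf) \<le> ennreal (\<kappa> * C)"
proof -
  interpret sized "decay_size \<Gamma> :: _ \<Rightarrow> _ \<Rightarrow> ('m, 'k ^ 'n) linf \<Rightarrow> bool" norm 1 by (rule sized_decay_size[OF \<Gamma>])
  obtain \<kappa>1 where \<kappa>1: "0 \<le> \<kappa>1" "\<And>C G. op_bound k G C \<Longrightarrow>
      mult_norm N k (G :: ('m, 'k ^ 'n) linf list \<Rightarrow> ('m, 'k ^ 'n) linf) \<le> ennreal (\<kappa>1 * C)"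
    using mult_norm_of_op_bound[of k] by blast
  obtain c1 C1 where c1: "c1 > 0" "C1 > 0" "\<And>x. c1 * norm x \<le> N x" "\<And>x. N x \<le> C1 * norm x"
    using is_norm_equivalent[OF N] by metis
  obtain c2 C2 where c2: "c2 > 0" "C2 > 0" "\<And>x :: ('m, 'k ^ 'n) linf. c2 * norm x \<le> supn N x"
    "\<And>x :: ('m, 'k ^ 'n) linf. supn N x \<le> C2 * norm x"
    using supn_equivalent[OF N] by metis
  have pos: "\<And>k. 0 < \<Gamma> k" using \<Gamma> by (auto simp: decay_function_def)
  have unit: "norm v \<le> 1 / c2" if "supn N v \<le> 1" for v :: "('m, 'k ^ 'n) linf"
    using c2(3)[of v] c2(1) that by (simp add: pos_le_divide_eq mult.commute)
  define \<kappa>2 where "\<kappa>2 = C1 * ((1 / c2) ^ k / \<Gamma> 0)"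
  have \<kappa>2: "0 \<le> \<kappa>2" using c1 c2 pos[of 0] by (simp add: \<kappa>2_def)
  have "mult_gamma \<Gamma> N k G \<le> ennreal (\<kappa>2 * C)" if G: "mult_bound (decay_size \<Gamma>) k G C"
    for C and G :: "('m, 'k ^ 'n) linf list \<Rightarrow> ('m, 'k ^ 'n) linf"
    unfolding mult_gamma_def
  proof (intro SUP_least)
    fix p i l and w :: "('m, 'k ^ 'n) linf" and vs :: "('m, 'k ^ 'n) linf list"
    assume p: "p \<in> {1..k}" and w: "w \<in> {w. supn N w \<le> 1 \<and> supported_at l w}" and vs: "vs \<in> unit_args N (k - 1)"
    let ?s = "1 / c2"
    have s: "0 \<le> ?s" using c2 by simp
    define tr where "tr v = ({#} :: (int ^ 'm) multiset, ?s, v)" for v :: "('m, 'k ^ 'n) linf"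
    let ?l = "map tr (take (p - 1) vs) @ ({#l#}, ?s / \<Gamma> 0, w) # map tr (drop (p - 1) vs)"
    \<comment> \<open>Only the entry at \<open>l\<close> counts, where the weight is
      \<open>\<Gamma> 0\<close>; this is the origin of the division by \<open>\<Gamma> 0\<close> in
      \<open>\<kappa>2\<close>.\<close>
    have wl: "decay_size \<Gamma> {#l#} (?s / \<Gamma> 0) w"
    proof -
      have "norm (w j) \<le> ?s / \<Gamma> 0 * \<Gamma> (j - l)" for j
      proof (cases "j = l")
        case True
        then show ?thesis using unit[of w] w norm_bounded[of w l] pos[of 0] by simp
      next
        case False
        then show ?thesis using w s pos[of 0] pos[of "j - l"] by (simp add: supported_at_def)
      qed
      then show ?thesis using s pos[of 0] by (simp add: decay_size_def)
    qed
    have Zl: "decay_size \<Gamma> (\<Sum>q\<leftarrow>?l. fst q) (C * (\<Prod>q\<leftarrow>?l. fst (snd q))) (G (map (\<lambda>q. snd (snd q)) ?l))"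
    proof (rule mult_boundD[OF G])
      show "length ?l = k" using p vs by (auto simp: unit_args_def)
      fix q assume "q \<in> set ?l"
      then consider "q = ({#l#}, ?s / \<Gamma> 0, w)" | v where "v \<in> set vs" "q = tr v"
        by (auto dest: in_set_takeD in_set_dropD)
      then show "decay_size \<Gamma> (fst q) (fst (snd q)) (snd (snd q))"
      proof cases
        case 1
        then show ?thesis using wl by simp
      next
        case (2 v)
        then have "norm v \<le> ?s" using vs unit by (auto simp: unit_args_def)
        then show ?thesis using 2 decay_size_0 unfolding tr_def by force
      qed
    qed
    have e1: "(\<Sum>q\<leftarrow>?l. fst q) = {#l#}"
    proof -
      have "(\<Sum>q\<leftarrow>map tr us. fst q) = {#}" for us by (induction us) (auto simp: tr_def)
      then show ?thesis by simp
    qed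
    have e2: "(\<Prod>q\<leftarrow>?l. fst (snd q)) = ?s ^ k / \<Gamma> 0"
    proof -
      have *: "(\<Prod>q\<leftarrow>map tr us. fst (snd q)) = ?s ^ length us" for us by (induction us) (auto simp: tr_def)
      have "length (take (p - 1) vs) + Suc (length (drop (p - 1) vs)) = k" using p vs
          by (auto simp: unit_args_def)
      then have "?s ^ k = ?s ^ length (take (p - 1) vs) * (?s * ?s ^ length (drop (p - 1) vs))"
        by (metis power_Suc power_add)
      then show ?thesis by (simp only: map_append list.map prod_list.append prod_list.Cons
          * fst_conv snd_conv) simp
    qed
    have e3: "map (\<lambda>q. snd (snd q)) ?l = take (p - 1) vs @ w # drop (p - 1) vs"
      by (simp add: tr_def o_def)
    have "decay_size \<Gamma> {#l#} (C * (?s ^ k / \<Gamma> 0)) (G (take (p - 1) vs @ w # drop (p - 1) vs))"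
      using Zl unfolding e1 e2 e3 .
    then have "norm (G (take (p - 1) vs @ w # drop (p - 1) vs) i) \<le> C * (?s ^ k / \<Gamma> 0) * \<Gamma> (i - l)"
      by (simp add: decay_size_def)
    then have "N (G (take (p - 1) vs @ w # drop (p - 1) vs) i) \<le> C1 * (C * (?s ^ k / \<Gamma> 0) * \<Gamma> (i - l))"
      using c1(2) c1(4)[of "G (take (p - 1) vs @ w # drop (p - 1) vs) i"]
          by (meson less_imp_le mult_left_mono order_trans)
    then show "ennreal (N (G (take (p - 1) vs @ w # drop (p - 1) vs) i) / \<Gamma> (i - l)) \<le> ennreal (\<kappa>2 * C)"
      using pos[of "i - l"] by (intro ennreal_leI) (simp add: \<kappa>2_def pos_divide_le_eq mult_ac)
  qed
  then have "mult_norm_decay \<Gamma> N k G \<le> ennreal ((\<kappa>1 + \<kappa>2) * C)" if G: "mult_bound (decay_size \<Gamma>) k G C"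
    for C and G :: "('m, 'k ^ 'n) linf list \<Rightarrow> ('m, 'k ^ 'n) linf"
  proof -
    have C: "0 \<le> C" by (rule mult_bound_nonneg[OF G])
    have "op_bound k G C" using mult_bound_op_bound[OF G] by simp
    from \<kappa>1(2)[OF this] have "mult_norm N k G \<le> ennreal ((\<kappa>1 + \<kappa>2) * C)"
      by (rule order_trans) (use \<kappa>1 \<kappa>2 C in \<open>auto intro!: ennreal_leI simp: distrib_right\<close>)
    moreover have "ennreal (\<kappa>2 * C) \<le> ennreal ((\<kappa>1 + \<kappa>2) * C)"
      using \<kappa>1 \<kappa>2 C by (auto intro!: ennreal_leI simp: distrib_right)
    ultimately show ?thesis
      using \<open>\<And>G C. mult_bound (decay_size \<Gamma>) k G C \<Longrightarrow> mult_gamma \<Gamma> N k G \<le> ennreal (\<kappa>2 * C)\<close>[OF G]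
      unfolding mult_norm_decay_def by (auto intro: order_trans)
  qed
  then show ?thesis using \<kappa>1 \<kappa>2 by (intro exI[of _ "\<kappa>1 + \<kappa>2"]) auto
qed

lemma op_norm_decay_eq:
  "op_norm_decay \<Gamma> N T = mult_norm_decay \<Gamma> N 1 (\<lambda>vs. T (hd vs))"
proof -
  have 1: "unit_args N 1 = (\<lambda>u. [u]) ` {u :: ('m, 'k ^ 'n) linf. supn N u \<le> 1}"
    unfolding unit_args_def by (auto simp: length_Suc_conv image_iff)
  have 0: "unit_args N 0 = {[] :: ('m, 'k ^ 'n) linf list}" by (auto simp: unit_args_def)
  have "op_norm N T = mult_norm N 1 (\<lambda>vs. T (hd vs))"
    unfolding op_norm_def mult_norm_def 1 by (simp add: image_image)
  moreover have "op_gamma \<Gamma> N T = mult_gamma \<Gamma> N 1 (\<lambda>vs. T (hd vs))"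
    unfolding op_gamma_def mult_gamma_def by (simp add: 0)
  ultimately show ?thesis by (simp add: op_norm_decay_def mult_norm_decay_def)
qed

lemma lin_bound_iff_op_norm_decay:
  assumes "linear T"
  shows "(\<exists>K. lin_bound (decay_size \<Gamma>) T K) \<longleftrightarrow> op_norm_decay \<Gamma> N (T :: ('m, 'k ^ 'n) linf \<Rightarrow> ('m, 'k ^ 'n)
      linf) < \<infinity>"
proof
  have mult_bound_lin_bound: "mult_bound (decay_size \<Gamma>) 1 (\<lambda>vs. T (hd vs)) K \<longleftrightarrow> lin_bound (decay_size \<Gamma>) T K"
      for K
  proof
    assume m: "mult_bound (decay_size \<Gamma>) 1 (\<lambda>vs. T (hd vs)) K"
    show "lin_bound (decay_size \<Gamma>) T K" unfolding lin_bound_def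
    proof (intro conjI allI impI)
      show "0 \<le> K" by (rule mult_bound_nonneg[OF m])
      show "decay_size \<Gamma> t (K * c) (T x)" if "decay_size \<Gamma> t c x" for t c x
        using mult_boundD[OF m, of "[(t, c, x)]"] that by simp
    qed
  next
    assume d: "lin_bound (decay_size \<Gamma>) T K"
    show "mult_bound (decay_size \<Gamma>) 1 (\<lambda>vs. T (hd vs)) K"
    proof (rule mult_boundI)
      show "0 \<le> K" using d by (simp add: lin_bound_def)
      fix l :: "((int ^ 'm) multiset \<times> real \<times> ('m, 'k ^ 'n) linf) list"
      assume l: "length l = 1" "\<And>q. q \<in> set l \<Longrightarrow> decay_size \<Gamma> (fst q) (fst (snd q)) (snd (snd q))"
      then obtain q where q: "l = [q]" by (auto simp: length_Suc_conv)
      then have "decay_size \<Gamma> (fst q) (K * fst (snd q)) (T (snd (snd q)))"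
        using d l(2)[of q] by (simp add: lin_bound_def)
      then show "decay_size \<Gamma> (\<Sum>q\<leftarrow>l. fst q) (K * (\<Prod>q\<leftarrow>l. fst (snd q))) (T (hd (map (\<lambda>q. snd (snd q)) l)))"
        using q by simp
    qed
  qed
  {
    assume "\<exists>K. lin_bound (decay_size \<Gamma>) T K"
    then obtain K where "mult_bound (decay_size \<Gamma>) 1 (\<lambda>vs. T (hd vs)) K" using mult_bound_lin_bound by blast
    then obtain e where "op_norm_decay \<Gamma> N T \<le> ennreal e"
      unfolding op_norm_decay_eq using mult_norm_decay_of_mult_bound[of 1] by blast
    then show "op_norm_decay \<Gamma> N T < \<infinity>" using ennreal_less_top le_less_trans by (metis infinity_ennreal_def)
  next
    assume a: "op_norm_decay \<Gamma> N T < \<infinity>"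
    have ml: "multilinear_map 1 (\<lambda>vs. T (hd vs))"
      using assms by (simp add: multilinear_map_def)
    obtain K where K: "0 \<le> K" "op_norm_decay \<Gamma> N T = ennreal K"
      using a by (cases "op_norm_decay \<Gamma> N T") auto
    then have "mult_norm_decay \<Gamma> N 1 (\<lambda>vs. T (hd vs)) \<le> ennreal K" by (simp add: op_norm_decay_eq)
    then show "\<exists>K. lin_bound (decay_size \<Gamma>) T K" using mult_bound_of_mult_norm_decay[of 1] ml K(1)
        mult_bound_lin_bound by blast
  }
qed

end

section \<open>The spectrum and the growth of powers\<close>

lemma linf_scale_simps:
  "linf_scale a (linf_scale b u) = linf_scale (a * b) u"
  "linf_scale 1 u = u" "linf_scale 0 u = 0" "linf_scale a 0 = 0"
  "linf_scale a (u + v) = linf_scale a u + linf_scale a v"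
  "linf_scale a (u - v) = linf_scale a u - linf_scale a v"
  "linf_scale (a + b) u = linf_scale a u + linf_scale b u"
  "linf_scale (a - b) u = linf_scale a u - linf_scale b u"
  "linf_scale (- a) u = - linf_scale a u"
  for u v :: "('m::finite, complex ^ 'n) linf"
  by (rule bcontfun_eqI, simp add: linf_scale_apply vector_sadd_rdistrib vector_ssub_ldistrib
      vector_add_ldistrib vector_sub_rdistrib)+

lemma linf_scale_of_real: "linf_scale (complex_of_real r) u = r *\<^sub>R u"
  by (rule bcontfun_eqI) (simp add: linf_scale_apply vec_eq_iff, simp add: scaleR_conv_of_real[where
      'a=complex])

lemma norm_vector_scale: "norm (c *s z) = cmod c * norm z" for z :: "complex ^ 'n"
  by (simp add: norm_vec_def norm_mult L2_set_right_distrib)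

lemma complex_linear_linear: "complex_linear B \<Longrightarrow> linear B"
  unfolding complex_linear_def by (rule linearI) (auto simp flip: linf_scale_of_real)

lemma complex_linear_simps:
  assumes "complex_linear B"
  shows "B (u + v) = B u + B v" "B (linf_scale c u) = linf_scale c (B u)" "B (u - v) = B u - B v" "B 0 = 0"
  using assms linear_diff[OF complex_linear_linear[OF assms]] linear_0[OF complex_linear_linear[OF assms]]
  unfolding complex_linear_def by auto

lemma decay_size_scale: "decay_size \<Gamma> t c u \<Longrightarrow> decay_size \<Gamma> t (cmod \<zeta> * c) (linf_scale \<zeta> u)"
  unfolding decay_size_def by (auto simp: linf_scale_apply norm_vector_scale mult.assoc mult_left_mono)

lemma norm_scale_le: "norm (linf_scale \<zeta> u) \<le> cmod \<zeta> * norm u"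
  using decay_size_scale[of _ 0 "norm u" u \<zeta>] by (simp add: decay_size_0)

lemma (in sized) lin_bound_mono: "lin_bound Z A a \<Longrightarrow> a \<le> b \<Longrightarrow> lin_bound Z A b"
  unfolding lin_bound_def using Z_mono mult_right_mono Z_nonneg by (meson order_trans)

lemma lin_bound_compose: "lin_bound Z S a \<Longrightarrow> lin_bound Z T b \<Longrightarrow> lin_bound Z (\<lambda>u. S (T u)) (a * b)"
  unfolding lin_bound_def by (auto simp: mult.assoc)

lemma lin_bound_norm: "lin_bound (decay_size \<Gamma>) T K \<Longrightarrow> norm (T u) \<le> K * norm u"
  unfolding lin_bound_def using decay_size_0 by (metis order_refl)

lemma lin_bound_bounded_linear:
  assumes "lin_bound (decay_size \<Gamma>) T K" "linear T"
  shows "bounded_linear T"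
  by (rule bounded_linear_intro[where K=K])
    (use assms linear_add linear_scale lin_bound_norm[OF assms(1)] in \<open>auto simp: mult.commute linear_cmul\<close>)

lemma bounded_linear_linf_scale: "bounded_linear (linf_scale c)"
  by (rule bounded_linear_intro[where K="cmod c"])
    (auto simp: linf_scale_simps norm_scale_le mult.commute simp flip: linf_scale_of_real)

lemma decay_size_limit_const:
  assumes "\<And>n. decay_size \<Gamma> t (c n) x" "c \<longlonglongrightarrow> d"
  shows "decay_size \<Gamma> t d x"
  unfolding decay_size_def
proof (intro conjI impI allI)
  show "0 \<le> d" by (rule LIMSEQ_le_const[OF assms(2)]) (use assms(1) in \<open>auto simp: decay_size_def\<close>)
  fix i assume "size t \<le> 1"
  then show "norm (x i) \<le> d * decay_weight \<Gamma> t i"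
    by (intro LIMSEQ_le_const[OF tendsto_mult_right[OF assms(2)]]) (use assms(1) in \<open>auto simp: decay_size_def\<close>)
qed

definition inverse_decay where
  "inverse_decay \<Gamma> T S K \<longleftrightarrow> complex_linear S \<and> lin_bound (decay_size \<Gamma>) S K \<and> (\<forall>u. S (T u) = u) \<and>
      (\<forall>u. T (S u) = u)"

context
  fixes \<Gamma> :: "int ^ 'm::finite \<Rightarrow> real"
  assumes \<Gamma>: "decay_function \<Gamma>"
begin

text \<open>The Neumann series is summed at each vector. Its partial sums satisfy the bound for
  every type, and this passes to the limit because sizes are closed.\<close>

lemma neumann_inverse:
  fixes B :: "('m, complex ^ 'n) linf \<Rightarrow> ('m, complex ^ 'n) linf"
  assumes cl: "complex_linear B" and lin_bound: "lin_bound (decay_size \<Gamma>) B (1 / 2)"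
  shows "\<exists>S. inverse_decay \<Gamma> (\<lambda>u. u - B u) S 2"
proof -
  interpret sized "decay_size \<Gamma> :: _ \<Rightarrow> _ \<Rightarrow> ('m, complex ^ 'n) linf \<Rightarrow> bool" norm 1
      by (rule sized_decay_size[OF \<Gamma>])
  have bl: "bounded_linear B" by (rule lin_bound_bounded_linear[OF lin_bound complex_linear_linear[OF cl]])
  define P where "P k u = (\<Sum>n<k. (B ^^ n) u)" for k u
  define S where "S u = (\<Sum>n. (B ^^ n) u)" for u
  have Bn: "decay_size \<Gamma> t ((1 / 2) ^ n * c) ((B ^^ n) u)" if "decay_size \<Gamma> t c u" for t c u n
    using that
  proof (induction n)
    case (Suc n)
    then have "decay_size \<Gamma> t (1 / 2 * ((1 / 2) ^ n * c)) (B ((B ^^ n) u))" using lin_bound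
        unfolding lin_bound_def by blast
    then show ?case by (simp add: mult.assoc)
  qed simp
  have nB: "norm ((B ^^ n) u) \<le> (1 / 2) ^ n * norm u" for n u
    using Bn[OF Z_refl] by (simp add: Z_nrm)
  have sm: "summable (\<lambda>n. (B ^^ n) u)" for u
    by (rule summable_comparison_test'[of "\<lambda>n. (1 / 2) ^ n * norm u" 0])
      (use nB in \<open>auto intro!: summable_mult2 summable_geometric\<close>)
  have PS: "(\<lambda>k. P k u) \<longlonglongrightarrow> S u" for u
    unfolding P_def S_def using summable_LIMSEQ[OF sm] .
  have B0: "(\<lambda>n. (B ^^ n) u) \<longlonglongrightarrow> 0" for u by (rule summable_LIMSEQ_zero[OF sm])
  have clB: "complex_linear (B ^^ n)" for n
    by (induction n) (use complex_linear_simps[OF cl] in \<open>auto simp: complex_linear_def\<close>)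
  have "complex_linear S" unfolding complex_linear_def
  proof (intro conjI allI)
    fix u v show "S (u + v) = S u + S v"
      unfolding S_def by (simp add: complex_linear_simps(1)[OF clB] suminf_add[OF sm sm])
  next
    fix c u show "S (linf_scale c u) = linf_scale c (S u)"
      unfolding S_def
      by (simp add: complex_linear_simps(2)[OF clB] bounded_linear.suminf[OF bounded_linear_linf_scale sm])
  qed
  moreover have "lin_bound (decay_size \<Gamma>) S 2" unfolding lin_bound_def
  proof (intro conjI allI impI)
    fix t c and u :: "('m, complex ^ 'n) linf" assume Z: "decay_size \<Gamma> t c u"
    have c: "0 \<le> c" by (rule Z_nonneg[OF Z])
    show "decay_size \<Gamma> t (2 * c) (S u)"
    proof (rule Z_lim[OF _ PS])
      fix k
      have "decay_size \<Gamma> t (\<Sum>n<k. (1 / 2) ^ n * c) (P k u)"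
      proof (induction k)
        case 0
        then show ?case using Z_zero by (simp add: P_def)
      next
        case (Suc k)
        show ?case using Z_add[OF Suc Bn[OF Z, of k]] by (simp add: P_def)
      qed
      moreover have "(\<Sum>n<k. (1 / 2) ^ n * c) \<le> 2 * c"
      proof -
        have "(\<Sum>n<k. (1 / 2 :: real) ^ n) \<le> 2"
          by (simp add: sum_gp_strict)
        then show ?thesis using c unfolding sum_distrib_right[symmetric] by (rule mult_right_mono)
      qed
      ultimately show "decay_size \<Gamma> t (2 * c) (P k u)" by (rule Z_mono)
    qed
  qed simp
  moreover have "S (u - B u) = u" for u
  proof (rule LIMSEQ_unique[OF PS])
    have "P k (u - B u) = u - (B ^^ k) u" for k
      by (induction k) (auto simp: P_def complex_linear_simps(3)[OF clB] funpow_swap1)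
    then show "(\<lambda>k. P k (u - B u)) \<longlonglongrightarrow> u" using tendsto_diff[OF tendsto_const B0, of u u] by simp
  qed
  moreover have "S u - B (S u) = u" for u
  proof (rule LIMSEQ_unique)
    show "(\<lambda>k. P k u - B (P k u)) \<longlonglongrightarrow> S u - B (S u)"
      by (intro tendsto_diff PS bounded_linear.tendsto[OF bl])
    have "P k u - B (P k u) = u - (B ^^ k) u" for k
    proof (induction k)
      case 0
      then show ?case by (simp add: P_def complex_linear_simps[OF cl])
    next
      case (Suc k)
      have "P (Suc k) u = P k u + (B ^^ k) u" by (simp add: P_def)
      then show ?case using Suc complex_linear_simps(1)[OF cl, of "P k u" "(B ^^ k) u"]
        by (simp add: algebra_simps)
    qed
    then show "(\<lambda>k. P k u - B (P k u)) \<longlonglongrightarrow> u" using tendsto_diff[OF tendsto_const B0, of u u] by simp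
  qed
  ultimately show ?thesis unfolding inverse_decay_def by blast
qed

text \<open>\<open>T - \<mu>\<close> factors as \<open>1 - B\<close> after
  \<open>T - \<zeta>\<close> with \<open>B = (\<mu> - \<zeta>) S\<close>, and the first factor has a
  Neumann inverse.\<close>

lemma inverse_decay_perturb:
  fixes T :: "('m, complex ^ 'n) linf \<Rightarrow> ('m, complex ^ 'n) linf"
  assumes T: "inverse_decay \<Gamma> (\<lambda>u. T u - linf_scale \<zeta> u) S K" and cl: "complex_linear T"
    and small: "cmod (\<mu> - \<zeta>) * K \<le> 1 / 2"
  shows "\<exists>S' K'. inverse_decay \<Gamma> (\<lambda>u. T u - linf_scale \<mu> u) S' K'"
proof -
  interpret sized "decay_size \<Gamma> :: _ \<Rightarrow> _ \<Rightarrow> ('m, complex ^ 'n) linf \<Rightarrow> bool" norm 1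
      by (rule sized_decay_size[OF \<Gamma>])
  have S: "complex_linear S" "lin_bound (decay_size \<Gamma>) S K" "\<And>u. S (T u - linf_scale \<zeta> u) = u"
      "\<And>u. T (S u) - linf_scale \<zeta> (S u) = u"
    using T by (auto simp: inverse_decay_def)
  define B where "B u = linf_scale (\<mu> - \<zeta>) (S u)" for u
  have B: "complex_linear B" unfolding B_def complex_linear_def
    by (simp add: complex_linear_simps[OF S(1)] linf_scale_simps(1,5) mult.commute)
  have "lin_bound (decay_size \<Gamma>) B (1 / 2)" unfolding lin_bound_def
  proof (intro conjI allI impI)
    fix t c and u :: "('m, complex ^ 'n) linf"
    assume Z: "decay_size \<Gamma> t c u"
    then have "decay_size \<Gamma> t (cmod (\<mu> - \<zeta>) * (K * c)) (B u)"
      unfolding B_def using S(2) by (intro decay_size_scale) (simp add: lin_bound_def)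
    then show "decay_size \<Gamma> t (1 / 2 * c) (B u)"
      by (rule Z_mono) (use mult_right_mono[OF small Z_nonneg[OF Z]] in \<open>simp add: mult.assoc\<close>)
  qed simp
  then obtain J where J: "complex_linear J" "lin_bound (decay_size \<Gamma>) J 2" "\<And>u. J (u - B u) = u"
      "\<And>u. J u - B (J u) = u"
    using neumann_inverse[OF B] by (auto simp: inverse_decay_def)
  have eq: "T u - linf_scale \<mu> u = (T u - linf_scale \<zeta> u) - B (T u - linf_scale \<zeta> u)" for u
    by (simp add: B_def S(3) linf_scale_simps algebra_simps)
  have "inverse_decay \<Gamma> (\<lambda>u. T u - linf_scale \<mu> u) (\<lambda>u. S (J u)) (K * 2)"
    unfolding inverse_decay_def
  proof (intro conjI allI)
    show "complex_linear (\<lambda>u. S (J u))"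
      using S(1) J(1) by (simp add: complex_linear_def)
    show "lin_bound (decay_size \<Gamma>) (\<lambda>u. S (J u)) (K * 2)" by (rule lin_bound_compose[OF S(2) J(2)])
    show "S (J (T u - linf_scale \<mu> u)) = u" for u unfolding eq J(3) S(3) ..
    show "T (S (J u)) - linf_scale \<mu> (S (J u)) = u" for u unfolding eq S(4) J(4) ..
  qed
  then show ?thesis by blast
qed

text \<open>For fixed \<open>u\<close>, \<open>i\<close> and \<open>j\<close> the component \<open>(R \<zeta> u)\<^sub>i\<^sub>j\<close> of the resolvent is a holomorphic function of
    \<open>\<zeta>\<close> with
  Taylor coefficients \<open>(T\<^sup>n u)\<^sub>i\<^sub>j\<close>, and \<open>R \<zeta>\<close> has decay uniformly on compact discs; so Cauchy's
  estimates apply to scalar functions only.\<close>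

lemma resolvent_power_bound:
  fixes T :: "('m, complex ^ 'n) linf \<Rightarrow> ('m, complex ^ 'n) linf"
  assumes cl: "complex_linear T" and T: "lin_bound (decay_size \<Gamma>) T K"
    and inv: "\<And>\<zeta>. cmod \<zeta> < \<rho>' \<Longrightarrow> \<exists>S C. inverse_decay \<Gamma> (\<lambda>u. u - linf_scale \<zeta> (T u)) S C"
    and \<rho>: "0 < \<rho>" "\<rho> < \<rho>'"
  shows "\<exists>M. \<forall>n. lin_bound (decay_size \<Gamma>) (T ^^ n) (M / \<rho> ^ n)"
proof -
  interpret sized "decay_size \<Gamma> :: _ \<Rightarrow> _ \<Rightarrow> ('m, complex ^ 'n) linf \<Rightarrow> bool" norm 1
      by (rule sized_decay_size[OF \<Gamma>])
  have "\<forall>\<zeta>\<in>ball 0 \<rho>'. \<exists>q. inverse_decay \<Gamma> (\<lambda>u. u - linf_scale \<zeta> (T u)) (fst q) (snd q)"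
    using inv by fastforce
  from bchoice[OF this] obtain q where q: "\<And>\<zeta>. \<zeta> \<in> ball 0 \<rho>' \<Longrightarrow>
      inverse_decay \<Gamma> (\<lambda>u. u - linf_scale \<zeta> (T u)) (fst (q \<zeta>)) (snd (q \<zeta>))"
    by blast
  define R where "R \<zeta> = fst (q \<zeta>)" for \<zeta>
  define KR where "KR \<zeta> = max 1 (snd (q \<zeta>))" for \<zeta>
  have R: "complex_linear (R \<zeta>)" "\<And>u. R \<zeta> (u - linf_scale \<zeta> (T u)) = u"
      "\<And>u. R \<zeta> u - linf_scale \<zeta> (T (R \<zeta> u)) = u"
    if "\<zeta> \<in> ball 0 \<rho>'" for \<zeta>
    using q[OF that] by (auto simp: inverse_decay_def R_def)
  have RK: "lin_bound (decay_size \<Gamma>) (R \<zeta>) (KR \<zeta>)" if "\<zeta> \<in> ball 0 \<rho>'" for \<zeta>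
    unfolding R_def KR_def
    by (rule lin_bound_mono[of _ "snd (q \<zeta>)"]) (use q[OF that] in \<open>auto simp: inverse_decay_def\<close>)
  have KR1: "1 \<le> KR \<zeta>" for \<zeta> by (simp add: KR_def)
  define K1 where "K1 = max 1 K"
  have K1: "1 \<le> K1" "lin_bound (decay_size \<Gamma>) T K1"
    unfolding K1_def by (simp, rule lin_bound_mono[OF T], simp)
  \<comment> \<open>The resolvent identity for \<open>1 - \<zeta> T\<close>, which bears the extra
    factor \<open>T\<close>.\<close>
  have resolvent: "R \<zeta> u = R \<mu> u + linf_scale (\<zeta> - \<mu>) (R \<zeta> (T (R \<mu> u)))"
    if l: "\<zeta> \<in> ball 0 \<rho>'" "\<mu> \<in> ball 0 \<rho>'" for \<zeta> \<mu> u
  proof -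
    let ?w = "R \<mu> u"
    have "u = (?w - linf_scale \<zeta> (T ?w)) + linf_scale (\<zeta> - \<mu>) (T ?w)"
      using R(3)[OF l(2), of u] by (simp add: linf_scale_simps)
    then have "R \<zeta> u = R \<zeta> ((?w - linf_scale \<zeta> (T ?w)) + linf_scale (\<zeta> - \<mu>) (T ?w))" by simp
    then show ?thesis
      by (simp only: complex_linear_simps(1,2)[OF R(1)[OF l(1)]] R(2)[OF l(1)])
  qed
  have loc: "lin_bound (decay_size \<Gamma>) (R \<zeta>) (2 * KR \<mu>)"
    if l: "\<zeta> \<in> ball 0 \<rho>'" "\<mu> \<in> ball 0 \<rho>'" and s: "cmod (\<zeta> - \<mu>) * (K1 * KR \<mu>) \<le> 1 / 2" for \<zeta> \<mu>
  proof -
    \<comment> \<open>The resolvent identity is fed with its own estimate. The bound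
      \<open>KR \<zeta>\<close>, not controlled in \<open>\<zeta>\<close>, is halved each time and
      disappears in the limit, which leaves a bound depending on \<open>\<mu>\<close> alone.\<close>
    have step: "lin_bound (decay_size \<Gamma>) (R \<zeta>) (2 * KR \<mu> + KR \<zeta> * (1 / 2) ^ k)" for k
    proof (induction k)
      case 0
      show ?case by (rule lin_bound_mono[OF RK[OF l(1)]]) (use KR1[of \<mu>] in simp)
    next
      case (Suc k)
      show ?case unfolding lin_bound_def
      proof (intro conjI allI impI)
        show "0 \<le> 2 * KR \<mu> + KR \<zeta> * (1 / 2) ^ Suc k" using KR1[of \<mu>] KR1[of \<zeta>] by simp
        fix t c and u :: "('m, complex ^ 'n) linf"
    assume Z: "decay_size \<Gamma> t c u"
        have c: "0 \<le> c" by (rule Z_nonneg[OF Z])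
        let ?C = "2 * KR \<mu> + KR \<zeta> * (1 / 2) ^ k"
        have C: "0 \<le> ?C" using KR1[of \<mu>] KR1[of \<zeta>] by simp
        have Zm: "decay_size \<Gamma> t (KR \<mu> * c) (R \<mu> u)" using RK[OF l(2)] Z by (simp add: lin_bound_def)
        then have "decay_size \<Gamma> t (K1 * (KR \<mu> * c)) (T (R \<mu> u))" using K1(2) by (simp add: lin_bound_def)
        then have "decay_size \<Gamma> t (?C * (K1 * (KR \<mu> * c))) (R \<zeta> (T (R \<mu> u)))" using Suc
            unfolding lin_bound_def by blast
        then have "decay_size \<Gamma> t (KR \<mu> * c + cmod (\<zeta> - \<mu>) * (?C * (K1 * (KR \<mu> * c)))) (R \<zeta> u)"
          by (subst resolvent[OF l]) (rule Z_add[OF Zm decay_size_scale])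
        then show "decay_size \<Gamma> t ((2 * KR \<mu> + KR \<zeta> * (1 / 2) ^ Suc k) * c) (R \<zeta> u)"
        proof (rule Z_mono)
          have "cmod (\<zeta> - \<mu>) * (K1 * KR \<mu>) * (?C * c) \<le> 1 / 2 * (?C * c)"
            using s C c by (intro mult_right_mono) auto
          then show "KR \<mu> * c + cmod (\<zeta> - \<mu>) * (?C * (K1 * (KR \<mu> * c)))
              \<le> (2 * KR \<mu> + KR \<zeta> * (1 / 2) ^ Suc k) * c"
            by (simp add: algebra_simps)
        qed
      qed
    qed
    show ?thesis unfolding lin_bound_def
    proof (intro conjI allI impI)
      show "0 \<le> 2 * KR \<mu>" using KR1[of \<mu>] by simp
      fix t c and u :: "('m, complex ^ 'n) linf"
    assume Z: "decay_size \<Gamma> t c u"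
      show "decay_size \<Gamma> t (2 * KR \<mu> * c) (R \<zeta> u)"
      proof (rule decay_size_limit_const)
        show "decay_size \<Gamma> t ((2 * KR \<mu> + KR \<zeta> * (1 / 2) ^ k) * c) (R \<zeta> u)" for k
          using step[of k] Z by (simp add: lin_bound_def)
        have "(\<lambda>k. (2 * KR \<mu> + KR \<zeta> * (1 / 2) ^ k) * c) \<longlonglongrightarrow> (2 * KR \<mu> + KR \<zeta> * 0) * c"
          by (intro tendsto_intros LIMSEQ_power_zero) auto
        then show "(\<lambda>k. (2 * KR \<mu> + KR \<zeta> * (1 / 2) ^ k) * c) \<longlonglongrightarrow> 2 * KR \<mu> * c" by simp
      qed
    qed
  qed
  define \<epsilon> where "\<epsilon> \<mu> = 1 / (2 * (K1 * KR \<mu>))" for \<mu>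
  have \<epsilon>0: "0 < \<epsilon> \<mu>" for \<mu> using K1(1) KR1[of \<mu>] by (simp add: \<epsilon>_def)
  have \<epsilon>: "cmod (\<zeta> - \<mu>) * (K1 * KR \<mu>) \<le> 1 / 2" if "\<zeta> \<in> ball \<mu> (\<epsilon> \<mu>)" for \<zeta> \<mu>
  proof -
    have "0 < K1 * KR \<mu>" using K1(1) KR1[of \<mu>] by simp
    then show ?thesis using that by (simp add: \<epsilon>_def dist_norm norm_minus_commute field_simps)
  qed
  have sub: "cball 0 \<rho> \<subseteq> ball 0 \<rho>'" using \<rho> by auto
  \<comment> \<open>Compactness turns the local bounds into one bound \<open>M\<close> on the closed
    disc.\<close>
  obtain C' where C': "C' \<subseteq> cball 0 \<rho>" "finite C'" "cball 0 \<rho> \<subseteq> (\<Union>\<mu>\<in>C'. ball \<mu> (\<epsilon> \<mu>))"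
    by (rule compactE_image[of "cball 0 \<rho>" "cball 0 \<rho>" "\<lambda>\<mu>. ball \<mu> (\<epsilon> \<mu>)"]) (use \<epsilon>0 in force)+
  define M where "M = (\<Sum>\<mu>\<in>C'. 2 * KR \<mu>)"
  have M: "lin_bound (decay_size \<Gamma>) (R \<zeta>) M" if "\<zeta> \<in> cball 0 \<rho>" for \<zeta>
  proof -
    obtain \<mu> where \<mu>: "\<mu> \<in> C'" "\<zeta> \<in> ball \<mu> (\<epsilon> \<mu>)" using C'(3) \<open>\<zeta> \<in> cball 0 \<rho>\<close> by blast
    have "lin_bound (decay_size \<Gamma>) (R \<zeta>) (2 * KR \<mu>)"
        by (rule loc[OF _ _ \<epsilon>[OF \<mu>(2)]]) (use \<mu>(1) C'(1) sub that in blast)+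
    moreover have "2 * KR \<mu> \<le> M" unfolding M_def
      by (rule member_le_sum) (use \<mu> C' KR1 in \<open>auto intro: order_trans[OF zero_le_one]\<close>)
    ultimately show ?thesis by (rule lin_bound_mono)
  qed
  define g where "g u i j \<zeta> = R \<zeta> u i $ j" for u i j \<zeta>
  have comp: "cmod (x i $ j) \<le> norm x" for x :: "('m, complex ^ 'n) linf" and i j
    using Finite_Cartesian_Product.norm_nth_le[of "x i" j] norm_bounded[of x i] by linarith
  have der: "(g u i j has_field_derivative (R \<mu> (T (R \<mu> u)) i $ j)) (at \<mu>)" if \<mu>: "\<mu> \<in> ball 0 \<rho>'" for u i j \<mu>
    unfolding has_field_derivative_iff
  proof (rule Lim_transform_eventually)
    let ?w = "T (R \<mu> u)"
    have near: "\<forall>\<^sub>F \<zeta> in at \<mu>. \<zeta> \<in> ball 0 \<rho>' \<inter> ball \<mu> (\<epsilon> \<mu>) \<and> \<zeta> \<noteq> \<mu>"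
    proof -
      have "\<forall>\<^sub>F \<zeta> in at \<mu>. \<zeta> \<in> (ball 0 \<rho>' \<inter> ball \<mu> (\<epsilon> \<mu>)) - {\<mu>}"
        using \<mu> \<epsilon>0[of \<mu>] by (intro eventually_at_in_open open_Int open_ball) auto
      then show ?thesis by eventually_elim auto
    qed
    then show "\<forall>\<^sub>F \<zeta> in at \<mu>. R \<zeta> ?w i $ j = (g u i j \<zeta> - g u i j \<mu>) / (\<zeta> - \<mu>)"
    proof eventually_elim
      case (elim \<zeta>)
      then have l: "\<zeta> \<in> ball 0 \<rho>'" by blast
      show ?case unfolding g_def resolvent[OF l \<mu>, of u] using elim
          by (simp add: linf_scale_apply eq_divide_eq algebra_simps)
    qed
    have "((\<lambda>\<zeta>. R \<zeta> ?w i $ j - R \<mu> ?w i $ j) \<longlongrightarrow> 0) (at \<mu>)"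
    proof (rule Lim_null_comparison)
      show "\<forall>\<^sub>F \<zeta> in at \<mu>. norm (R \<zeta> ?w i $ j - R \<mu> ?w i $ j) \<le> cmod (\<zeta> - \<mu>) * (2 * KR \<mu> * norm (T (R \<mu> ?w)))"
        using near
      proof eventually_elim
        case (elim \<zeta>)
        then have l: "\<zeta> \<in> ball 0 \<rho>'" "\<zeta> \<in> ball \<mu> (\<epsilon> \<mu>)" by auto
        let ?v = "R \<zeta> (T (R \<mu> ?w))"
        have "norm (R \<zeta> ?w i $ j - R \<mu> ?w i $ j) = cmod (linf_scale (\<zeta> - \<mu>) ?v i $ j)"
          unfolding resolvent[OF l(1) \<mu>, of ?w] by simp
        also have "\<dots> \<le> cmod (\<zeta> - \<mu>) * norm ?v" using comp norm_scale_le by (rule order_trans)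
        also have "\<dots> \<le> cmod (\<zeta> - \<mu>) * (2 * KR \<mu> * norm (T (R \<mu> ?w)))"
          by (rule mult_left_mono[OF lin_bound_norm[OF loc[OF l(1) \<mu> \<epsilon>[OF l(2)]]]]) simp
        finally show ?case .
      qed
      have "((\<lambda>\<zeta>. cmod (\<zeta> - \<mu>) * (2 * KR \<mu> * norm (T (R \<mu> ?w)))) \<longlongrightarrow> cmod (\<mu> - \<mu>) * (2 * KR \<mu>
          * norm (T (R \<mu> ?w)))) (at \<mu>)"
        by (intro tendsto_intros)
      then show "((\<lambda>\<zeta>. cmod (\<zeta> - \<mu>) * (2 * KR \<mu> * norm (T (R \<mu> ?w)))) \<longlongrightarrow> 0) (at \<mu>)" by simp
    qed
    then show "((\<lambda>\<zeta>. R \<zeta> ?w i $ j) \<longlongrightarrow> R \<mu> ?w i $ j) (at \<mu>)" by (simp add: LIM_zero_iff)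
  qed
  have hol: "g u i j holomorphic_on ball 0 \<rho>'" for u i j
    unfolding holomorphic_on_def field_differentiable_def
    using der has_field_derivative_at_within by blast
  have zero: "0 \<in> ball (0::complex) \<rho>'" using \<rho> by simp
  have R0: "R 0 u = u" for u using R(2)[OF zero, of u] by (simp add: linf_scale_simps)
  \<comment> \<open>The resolvent identity with \<open>\<mu> = 0\<close>; it shifts Taylor
    coefficients and so identifies them with components of powers of \<open>T\<close>.\<close>
  have g_rec: "g u i j \<zeta> = u i $ j + \<zeta> * g (T u) i j \<zeta>" if "\<zeta> \<in> ball 0 \<rho>'" for u i j \<zeta>
    unfolding g_def resolvent[OF that zero, of u] R0 by (simp add: linf_scale_apply)
  have exp: "g u i j has_fps_expansion fps_expansion (g u i j) 0" for u i j
    by (rule has_fps_expansion_fps_expansion[OF _ zero hol]) simp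
  have coef: "fps_nth (fps_expansion (g u i j) 0) n = (T ^^ n) u i $ j" for n u i j
  proof -
    have eq: "fps_expansion (g u i j) 0 = fps_const (u i $ j) + fps_X * fps_expansion (g (T u) i j) 0" for u
    proof (rule fps_expansion_eqI)
      have h1: "(\<lambda>\<zeta>. u i $ j + \<zeta> * g (T u) i j \<zeta>) has_fps_expansion fps_const (u i $ j) + fps_X
          * fps_expansion (g (T u) i j) 0"
        by (intro fps_expansion_intros exp)
      have h2: "\<forall>\<^sub>F \<zeta> in nhds 0. u i $ j + \<zeta> * g (T u) i j \<zeta> = g u i j \<zeta>"
        using eventually_nhds_in_open[OF open_ball zero] by eventually_elim (rule g_rec[symmetric])
      show "g u i j has_fps_expansion fps_const (u i $ j) + fps_X * fps_expansion (g (T u) i j) 0"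
        using h1 unfolding has_fps_expansion_cong[OF h2 refl] .
    qed
    have rec: "fps_nth (fps_expansion (g u i j) 0) n =
        (if n = 0 then u i $ j else fps_nth (fps_expansion (g (T u) i j) 0) (n - 1))" for u n
      by (subst eq) simp
    show ?thesis
    proof (induction n arbitrary: u)
      case 0
      then show ?case by (simp add: rec[of u 0])
    next
      case (Suc n)
      then show ?case by (simp add: rec[of u "Suc n"] funpow_swap1)
    qed
  qed
  have "lin_bound (decay_size \<Gamma>) (T ^^ n) (real CARD('n) * M / \<rho> ^ n)" for n
    unfolding lin_bound_def
  proof (intro conjI allI impI)
    have M0: "0 \<le> M" using M[of 0] \<rho> by (simp add: lin_bound_def)
    then show "0 \<le> real CARD('n) * M / \<rho> ^ n" using \<rho> by simp
    fix t c and u :: "('m, complex ^ 'n) linf"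
    assume Z: "decay_size \<Gamma> t c u"
    have c: "0 \<le> c" by (rule Z_nonneg[OF Z])
    have "norm ((T ^^ n) u i) \<le> real CARD('n) * M / \<rho> ^ n * c * decay_weight \<Gamma> t i" if t: "size t \<le> 1" for i
    proof -
      have "cmod ((T ^^ n) u i $ j) \<le> M * c * decay_weight \<Gamma> t i / \<rho> ^ n" for j
      proof -
        have "norm ((deriv ^^ n) (g u i j) 0) \<le> fact n * (M * c * decay_weight \<Gamma> t i) / \<rho> ^ n"
        proof (rule Cauchy_inequality)
          show "g u i j holomorphic_on ball 0 \<rho>" by (rule holomorphic_on_subset[OF hol]) (use \<rho> in auto)
          show "continuous_on (cball 0 \<rho>) (g u i j)"
            by (rule continuous_on_subset[OF holomorphic_on_imp_continuous_on[OF hol] sub])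
          fix \<zeta> :: complex assume "norm (0 - \<zeta>) = \<rho>"
          then have "lin_bound (decay_size \<Gamma>) (R \<zeta>) M" by (intro M) simp
          then have "decay_size \<Gamma> t (M * c) (R \<zeta> u)" using Z by (simp add: lin_bound_def)
          then have "norm (R \<zeta> u i) \<le> M * c * decay_weight \<Gamma> t i" using t by (simp add: decay_size_def)
          then show "norm (g u i j \<zeta>) \<le> M * c * decay_weight \<Gamma> t i"
            unfolding g_def using Finite_Cartesian_Product.norm_nth_le order_trans by blast
        qed (use \<rho> in simp)
        moreover have "(deriv ^^ n) (g u i j) 0 = fact n * ((T ^^ n) u i $ j)"
          using coef[of u i j n] by (simp add: fps_expansion_def field_simps)
        ultimately have "fact n * cmod ((T ^^ n) u i $ j) \<le> fact n * (M * c * decay_weight \<Gamma> t i / \<rho> ^ n)"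
          by (simp add: norm_mult)
        then show ?thesis by (rule mult_left_le_imp_le) (rule fact_gt_zero)
      qed
      then have "(\<Sum>j\<in>UNIV. cmod ((T ^^ n) u i $ j)) \<le> (\<Sum>j\<in>(UNIV :: 'n set). M * c * decay_weight \<Gamma> t i / \<rho> ^ n)"
        by (intro sum_mono)
      moreover have "norm ((T ^^ n) u i) \<le> (\<Sum>j\<in>UNIV. cmod ((T ^^ n) u i $ j))"
        unfolding norm_vec_def by (rule L2_set_le_sum) auto
      ultimately show ?thesis by (simp add: mult_ac)
    qed
    then show "decay_size \<Gamma> t (real CARD('n) * M / \<rho> ^ n * c) ((T ^^ n) u)"
      using M0 \<rho> c by (simp add: decay_size_def)
  qed
  then show ?thesis by blast
qed

end

section \<open>Complexification and the growth of powers\<close>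

lemma complex_vec_norms:
  "norm (\<chi> j. Re (z $ j)) \<le> norm z" "norm (\<chi> j. Im (z $ j)) \<le> norm z"
  "norm (\<chi> j. Complex (x $ j) (y $ j)) \<le> norm x + norm y"
  "norm (\<chi> j. Complex (x $ j) 0) = norm x"
  for z :: "complex ^ 'n" and x y :: "real ^ 'n"
proof -
  show "norm (\<chi> j. Re (z $ j)) \<le> norm z" "norm (\<chi> j. Im (z $ j)) \<le> norm z"
    unfolding norm_vec_def by (rule L2_set_mono; auto simp: abs_Re_le_cmod abs_Im_le_cmod)+
  show "norm (\<chi> j. Complex (x $ j) 0) = norm x"
    by (simp add: norm_vec_def complex_norm)
  have "norm (\<chi> j. Complex (x $ j) (y $ j)) \<le> L2_set (\<lambda>j. norm (x $ j) + norm (y $ j)) UNIV"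
    unfolding norm_vec_def by (rule L2_set_mono) (auto intro: order_trans[OF cmod_le])
  also have "\<dots> \<le> norm x + norm y"
    unfolding norm_vec_def by (rule L2_set_triangle_ineq)
  finally show "norm (\<chi> j. Complex (x $ j) (y $ j)) \<le> norm x + norm y" .
qed

lemma decay_size_complex:
  "decay_size \<Gamma> t c z \<Longrightarrow> decay_size \<Gamma> t c (linf_Re z)" "decay_size \<Gamma> t c z \<Longrightarrow> decay_size \<Gamma> t c (linf_Im z)"
  "decay_size \<Gamma> t c x \<Longrightarrow> decay_size \<Gamma> t d y \<Longrightarrow> decay_size \<Gamma> t (c + d) (linf_complex x y)"
  "decay_size \<Gamma> t c (linf_complex x 0) \<longleftrightarrow> decay_size \<Gamma> t c x"
  unfolding decay_size_def linf_Re_apply linf_Im_apply linf_complex_apply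
  by (auto simp: complex_vec_norms(4) distrib_right intro: order_trans[OF complex_vec_norms(1)]
      order_trans[OF complex_vec_norms(2)] order_trans[OF complex_vec_norms(3)] add_mono)

lemma linf_complex_parts:
  "linf_Re (linf_complex x y) = x" "linf_Im (linf_complex x y) = y"
  "linf_complex (linf_Re z) (linf_Im z) = z"
  by (rule bcontfun_eqI, simp add: linf_Re_apply linf_Im_apply linf_complex_apply vec_eq_iff)+

lemma linf_parts_simps:
  "linf_Re (z + w) = linf_Re z + linf_Re w" "linf_Im (z + w) = linf_Im z + linf_Im w"
  "linf_Re (linf_scale c z) = Re c *\<^sub>R linf_Re z - Im c *\<^sub>R linf_Im z"
  "linf_Im (linf_scale c z) = Re c *\<^sub>R linf_Im z + Im c *\<^sub>R linf_Re z"
  "linf_complex (x + x') (y + y') = linf_complex x y + linf_complex x' y'"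
  "linf_scale c (linf_complex x y) = linf_complex (Re c *\<^sub>R x - Im c *\<^sub>R y) (Re c *\<^sub>R y + Im c *\<^sub>R x)"
  by (rule bcontfun_eqI, simp add: linf_Re_apply linf_Im_apply linf_complex_apply linf_scale_apply
      vec_eq_iff complex_eq_iff)+

lemma linf_scale_minus: "linf_scale a (- u) = - linf_scale a u"
  by (rule bcontfun_eqI) (simp add: linf_scale_apply vec_eq_iff)

lemma complex_extension_linear:
  assumes "linear A"
  shows "complex_linear (complex_extension A)"
  unfolding complex_linear_def complex_extension_def
  by (simp add: linf_parts_simps linear_add[OF assms] linear_diff[OF assms] linear_scale[OF assms])

lemma complex_extension_real:
  assumes "linear A"
  shows "complex_extension A (linf_complex x 0) = linf_complex (A x) 0"
  by (simp add: complex_extension_def linf_complex_parts linear_0[OF assms])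

lemma lin_bound_complex_extension: "lin_bound (decay_size \<Gamma>) A K \<Longrightarrow>
    lin_bound (decay_size \<Gamma>) (complex_extension A) (2 * K)"
  unfolding lin_bound_def complex_extension_def
  using decay_size_complex by (metis (no_types, opaque_lifting) mult_2 distrib_right mult_nonneg_nonneg
      zero_le_numeral)

context
  fixes \<Gamma> :: "int ^ 'm::finite \<Rightarrow> real" and NC :: "complex ^ 'n \<Rightarrow> real"
    and A :: "('m, real ^ 'n) linf \<Rightarrow> ('m, real ^ 'n) linf" and K :: real
  assumes \<Gamma>: "decay_function \<Gamma>" and NC: "is_norm NC" and lin: "linear A" and dbA: "lin_bound (decay_size \<Gamma>) A K"
begin

abbreviation "cA \<equiv> complex_extension A"

text \<open>Replaces the inverse function and its finite norm by an explicit two-sided inverse with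
  a numerical bound, the form in which resolvents are perturbed and estimated.\<close>

lemma Spec_iff: "\<mu> \<notin> Spec_decay \<Gamma> NC A \<longleftrightarrow> (\<exists>S C. inverse_decay \<Gamma> (\<lambda>z. cA z - linf_scale \<mu> z) S C)"
proof -
  let ?T = "\<lambda>z. cA z - linf_scale \<mu> z"
  have lin_bound_iff: "(\<exists>C. lin_bound (decay_size \<Gamma>) S C) \<longleftrightarrow> op_norm_decay \<Gamma> NC S < \<infinity>"
    if "complex_linear S" for S :: "('m, complex ^ 'n) linf \<Rightarrow> ('m, complex ^ 'n) linf"
    by (rule lin_bound_iff_op_norm_decay[OF NC \<Gamma> complex_linear_linear[OF that]])
  have "\<mu> \<notin> Spec_decay \<Gamma> NC A \<longleftrightarrow> bij ?T \<and> inv ?T \<in> complex_lin_decay \<Gamma> NC"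
    by (simp add: Spec_decay_def Let_def)
  also have "\<dots> \<longleftrightarrow> (\<exists>S C. inverse_decay \<Gamma> ?T S C)"
  proof
    assume a: "bij ?T \<and> inv ?T \<in> complex_lin_decay \<Gamma> NC"
    then have "complex_linear (inv ?T)" by (simp add: complex_lin_decay_def)
    moreover obtain C where "lin_bound (decay_size \<Gamma>) (inv ?T) C"
      using lin_bound_iff[OF calculation] a by (auto simp: complex_lin_decay_def)
    moreover have "inv ?T (?T u) = u" "?T (inv ?T u) = u" for u
      using a inv_f_f[of ?T u] surj_f_inv_f[of ?T u] by (auto simp: bij_def)
    ultimately show "\<exists>S C. inverse_decay \<Gamma> ?T S C" unfolding inverse_decay_def by blast
  next
    assume "\<exists>S C. inverse_decay \<Gamma> ?T S C"
    then obtain S C where S: "complex_linear S" "lin_bound (decay_size \<Gamma>) S C" "\<And>u. S (?T u) = u"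
        "\<And>u. ?T (S u) = u"
      unfolding inverse_decay_def by blast
    have b: "bij ?T" by (rule o_bij[of S]) (use S(3,4) in \<open>auto simp: fun_eq_iff\<close>)
    have "inv ?T = S" by (rule inv_equality) (use S(3,4) in auto)
    then show "bij ?T \<and> inv ?T \<in> complex_lin_decay \<Gamma> NC"
      using b S(1,2) lin_bound_iff[OF S(1)] by (auto simp: complex_lin_decay_def)
  qed
  finally show ?thesis .
qed

lemma cA_linear: "complex_linear cA"
  by (rule complex_extension_linear[OF lin])

lemma Spec_closed: "closed (Spec_decay \<Gamma> NC A)"
proof -
  have "open (- Spec_decay \<Gamma> NC A)"
    unfolding open_contains_ball
  proof
    fix \<mu> assume "\<mu> \<in> - Spec_decay \<Gamma> NC A"
    then obtain S C where S: "inverse_decay \<Gamma> (\<lambda>z. cA z - linf_scale \<mu> z) S C" using Spec_iff by auto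
    define e where "e = 1 / (2 * (\<bar>C\<bar> + 1))"
    have "ball \<mu> e \<subseteq> - Spec_decay \<Gamma> NC A"
    proof
      fix \<nu> assume "\<nu> \<in> ball \<mu> e"
      then have "cmod (\<nu> - \<mu>) < e" by (simp add: dist_norm norm_minus_commute)
      then have "cmod (\<nu> - \<mu>) * (\<bar>C\<bar> + 1) \<le> 1 / 2" by (simp add: e_def field_simps)
      moreover have "cmod (\<nu> - \<mu>) * C \<le> cmod (\<nu> - \<mu>) * (\<bar>C\<bar> + 1)" by (intro mult_left_mono) auto
      ultimately have "cmod (\<nu> - \<mu>) * C \<le> 1 / 2" by simp
      from inverse_decay_perturb[OF \<Gamma> S cA_linear this] show "\<nu> \<in> - Spec_decay \<Gamma> NC A" using Spec_iff by auto
    qed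
    then show "\<exists>e>0. ball \<mu> e \<subseteq> - Spec_decay \<Gamma> NC A" by (intro exI[of _ e]) (auto simp: e_def)
  qed
  then show ?thesis by (simp add: closed_def)
qed

text \<open>For nonzero \<open>\<zeta>\<close>, \<open>1 - \<zeta> A\<close> equals
  \<open>- \<zeta> (A - 1 / \<zeta>)\<close>, and \<open>1 / \<zeta>\<close> lies outside the
  spectrum.\<close>

lemma power_bound_forward:
  assumes "0 < \<rho>" "\<rho> < \<rho>'" and out: "\<And>\<mu>. \<mu> \<in> Spec_decay \<Gamma> NC A \<Longrightarrow> cmod \<mu> * \<rho>' \<le> 1"
  shows "\<exists>M. \<forall>n. lin_bound (decay_size \<Gamma>) (cA ^^ n) (M / \<rho> ^ n)"
proof (rule resolvent_power_bound[OF \<Gamma> cA_linear lin_bound_complex_extension[OF dbA] _ assms(1,2)])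
  fix \<zeta> assume z: "cmod \<zeta> < \<rho>'"
  show "\<exists>S C. inverse_decay \<Gamma> (\<lambda>u. u - linf_scale \<zeta> (cA u)) S C"
  proof (cases "\<zeta> = 0")
    case True
    then show ?thesis
      by (intro exI[of _ "\<lambda>u. u"] exI[of _ 1])
        (simp add: inverse_decay_def complex_linear_def lin_bound_def linf_scale_simps)
  next
    case False
    have "1 < cmod (1 / \<zeta>) * \<rho>'" using z False by (simp add: norm_divide field_simps)
    then have "1 / \<zeta> \<notin> Spec_decay \<Gamma> NC A" using out by fastforce
    then obtain S C where S: "complex_linear S" "lin_bound (decay_size \<Gamma>) S C"
      "\<And>u. S (cA u - linf_scale (1 / \<zeta>) u) = u" "\<And>u. cA (S u) - linf_scale (1 / \<zeta>) (S u) = u"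
      using Spec_iff unfolding inverse_decay_def by blast
    have eq: "u - linf_scale \<zeta> (cA u) = linf_scale (- \<zeta>) (cA u - linf_scale (1 / \<zeta>) u)" for u
      using False by (simp add: linf_scale_simps)
    have "inverse_decay \<Gamma> (\<lambda>u. u - linf_scale \<zeta> (cA u)) (\<lambda>u. linf_scale (- 1 / \<zeta>) (S u)) (cmod (- 1 / \<zeta>) * C)"
      unfolding inverse_decay_def
    proof (intro conjI allI)
      show "complex_linear (\<lambda>u. linf_scale (- 1 / \<zeta>) (S u))"
        unfolding complex_linear_def
        by (simp add: complex_linear_simps[OF S(1)] linf_scale_simps(1,5) mult.commute)
      show "lin_bound (decay_size \<Gamma>) (\<lambda>u. linf_scale (- 1 / \<zeta>) (S u)) (cmod (- 1 / \<zeta>) * C)"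
        by (rule lin_bound_compose[OF _ S(2)]) (unfold lin_bound_def, blast intro: decay_size_scale
            norm_ge_zero)
      show "linf_scale (- 1 / \<zeta>) (S (u - linf_scale \<zeta> (cA u))) = u" for u
        unfolding eq using False by (simp only: complex_linear_simps(2)[OF S(1)] S(3) linf_scale_simps(1))
            (simp add: linf_scale_simps(2))
      have "linf_scale (- 1 / \<zeta>) (S u) - linf_scale \<zeta> (cA (linf_scale (- 1 / \<zeta>) (S u))) =
         linf_scale (- \<zeta>) (linf_scale (- 1 / \<zeta>) (cA (S u) - linf_scale (1 / \<zeta>) (S u)))" for u
        unfolding eq complex_linear_simps(2)[OF cA_linear] using False
            by (simp add: linf_scale_simps linf_scale_minus mult.commute)
      then show "linf_scale (- 1 / \<zeta>) (S u) - linf_scale \<zeta> (cA (linf_scale (- 1 / \<zeta>) (S u))) = u" for u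
        unfolding S(4) using False by (simp add: linf_scale_simps(1,2))
    qed
    then show ?thesis by blast
  qed
qed

text \<open>\<open>1 - \<zeta> J\<close> equals \<open>(A - \<zeta>) J\<close>, so its inverse is
  \<open>A\<close> times the resolvent of \<open>A\<close> at \<open>\<zeta>\<close>.\<close>

lemma power_bound_backward:
  assumes J: "inverse_decay \<Gamma> cA J C" and "0 < \<rho>" "\<rho> < \<rho>'"
    and out: "\<And>\<mu>. \<mu> \<in> Spec_decay \<Gamma> NC A \<Longrightarrow> \<rho>' \<le> cmod \<mu>"
  shows "\<exists>M. \<forall>n. lin_bound (decay_size \<Gamma>) (J ^^ n) (M / \<rho> ^ n)"
proof -
  have J': "complex_linear J" "lin_bound (decay_size \<Gamma>) J C" "\<And>u. J (cA u) = u" "\<And>u. cA (J u) = u"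
    using J by (auto simp: inverse_decay_def)
  show ?thesis
  proof (rule resolvent_power_bound[OF \<Gamma> J'(1,2) _ assms(2,3)])
    fix \<zeta> assume z: "cmod \<zeta> < \<rho>'"
    then have "\<zeta> \<notin> Spec_decay \<Gamma> NC A" using out by fastforce
    then obtain S D where S: "complex_linear S" "lin_bound (decay_size \<Gamma>) S D"
      "\<And>u. S (cA u - linf_scale \<zeta> u) = u" "\<And>u. cA (S u) - linf_scale \<zeta> (S u) = u"
      using Spec_iff unfolding inverse_decay_def by blast
    have "inverse_decay \<Gamma> (\<lambda>u. u - linf_scale \<zeta> (J u)) (\<lambda>u. cA (S u)) (2 * K * D)"
      unfolding inverse_decay_def
    proof (intro conjI allI)
      show "complex_linear (\<lambda>u. cA (S u))"
        using S(1) cA_linear by (simp add: complex_linear_def)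
      show "lin_bound (decay_size \<Gamma>) (\<lambda>u. cA (S u)) (2 * K * D)"
        by (rule lin_bound_compose[OF lin_bound_complex_extension[OF dbA] S(2)])
      show "cA (S (u - linf_scale \<zeta> (J u))) = u" for u
        using S(3)[of "J u"] J'(4)[of u] by simp
      show "cA (S u) - linf_scale \<zeta> (J (cA (S u))) = u" for u
        using S(4)[of u] J'(3) by simp
    qed
    then show "\<exists>S C. inverse_decay \<Gamma> (\<lambda>u. u - linf_scale \<zeta> (J u)) S C" by blast
  qed
qed

text \<open>With an empty spectrum, both \<open>A\<close> and its inverse would have powers of size \<open>O(2\<^sup>-\<^sup>n)\<close>.\<close>

lemma Spec_nonempty:
  assumes "Spec_decay \<Gamma> NC A \<subseteq> ball 0 1" "0 \<notin> Spec_decay \<Gamma> NC A"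
  shows "Spec_decay \<Gamma> NC A \<noteq> {}"
proof
  assume e: "Spec_decay \<Gamma> NC A = {}"
  obtain J C where "inverse_decay \<Gamma> (\<lambda>z. cA z - linf_scale 0 z) J C" using Spec_iff[of 0] assms(2) by blast
  then have J: "inverse_decay \<Gamma> cA J C" by (simp add: linf_scale_simps)
  obtain M1 where M1: "\<And>n. lin_bound (decay_size \<Gamma>) (cA ^^ n) (M1 / 2 ^ n)"
    using power_bound_forward[of 2 3] e by auto
  obtain M2 where M2: "\<And>n. lin_bound (decay_size \<Gamma>) (J ^^ n) (M2 / 2 ^ n)"
    using power_bound_backward[OF J, of 2 3] e by auto
  define u :: "('m, complex ^ 'n) linf" where "u = const_bcontfun (\<chi> j. 1)"
  have "u \<noteq> 0"
  proof
    assume "u = 0"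
    then have "u 0 = 0" by simp
    then show False by (simp add: u_def const_bcontfun.rep_eq vec_eq_iff)
  qed
  have inv: "(cA ^^ n) ((J ^^ n) u) = u" for n
  proof (induction n)
    case (Suc n)
    have "(cA ^^ Suc n) ((J ^^ Suc n) u) = (cA ^^ n) (cA (J ((J ^^ n) u)))" by (simp add: funpow_swap1)
    then show ?case using Suc J by (simp add: inverse_decay_def)
  qed simp
  have "norm u \<le> (M1 * M2 * norm u) * (1 / 4) ^ n" for n
  proof -
    have "norm u \<le> M1 / 2 ^ n * M2 / 2 ^ n * norm u"
      using lin_bound_norm[OF lin_bound_compose[OF M1[of n] M2[of n]], of u] inv[of n] by simp
    also have "\<dots> = (M1 * M2 * norm u) * (1 / 4) ^ n"
      by (simp add: power_one_over power_mult_distrib[symmetric])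
    finally show ?thesis .
  qed
  moreover have "(\<lambda>n. (M1 * M2 * norm u) * (1 / 4) ^ n) \<longlonglongrightarrow> (M1 * M2 * norm u) * 0"
    by (intro tendsto_intros LIMSEQ_power_zero) auto
  ultimately have "norm u \<le> (M1 * M2 * norm u) * 0" by (intro LIMSEQ_le_const) auto
  then show False using \<open>u \<noteq> 0\<close> by simp
qed

text \<open>The spectrum is compact and nonempty, so \<open>\<alpha>\<close> and
  \<open>\<beta>\<close> are attained, which gives \<open>0 < \<alpha>\<close> and
  \<open>\<beta> < 1\<close>. The power bounds are proved over the complex numbers and restricted to
  real vectors.\<close>

theorem spectral_power_bounds:
  assumes sub: "Spec_decay \<Gamma> NC A \<subseteq> ball 0 1" and n0: "0 \<notin> Spec_decay \<Gamma> NC A"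
    and \<alpha>: "\<alpha> = Inf (cmod ` Spec_decay \<Gamma> NC A)" and \<beta>: "\<beta> = Sup (cmod ` Spec_decay \<Gamma> NC A)"
  shows "0 < \<alpha>" "\<alpha> \<le> \<beta>" "\<beta> < 1"
    "\<exists>Ai. (\<forall>x. A (Ai x) = x) \<and> (\<forall>x. Ai (A x) = x) \<and>
      (\<forall>b>\<beta>. \<exists>M. \<forall>n. lin_bound (decay_size \<Gamma>) (A ^^ n) (M * b ^ n)) \<and>
      (\<forall>a>1 / \<alpha>. \<exists>M. \<forall>n. lin_bound (decay_size \<Gamma>) (Ai ^^ n) (M * a ^ n))"
proof -
  let ?S = "Spec_decay \<Gamma> NC A"
  have ne: "?S \<noteq> {}" by (rule Spec_nonempty[OF sub n0])
  have "bounded ?S" using sub bounded_ball bounded_subset by blast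
  then have comp: "compact ?S" using Spec_closed compact_eq_bounded_closed by blast
  have comp': "compact (cmod ` ?S)" by (rule compact_continuous_image[OF _ comp]) (intro continuous_intros)
  have ne': "cmod ` ?S \<noteq> {}" using ne by simp
  have bdd: "bdd_above (cmod ` ?S)" "bdd_below (cmod ` ?S)"
    by (rule bounded_imp_bdd_above[OF compact_imp_bounded[OF comp']],
        rule bounded_imp_bdd_below[OF compact_imp_bounded[OF comp']])
  obtain \<mu>1 where \<mu>1: "\<mu>1 \<in> ?S" "\<alpha> = cmod \<mu>1"
    using closed_contains_Inf[OF ne' bdd(2) compact_imp_closed[OF comp']] \<alpha> by auto
  obtain \<mu>2 where \<mu>2: "\<mu>2 \<in> ?S" "\<beta> = cmod \<mu>2"
    using closed_contains_Sup[OF ne' bdd(1) compact_imp_closed[OF comp']] \<beta> by auto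
  have le: "\<alpha> \<le> cmod \<mu>" "cmod \<mu> \<le> \<beta>" if "\<mu> \<in> ?S" for \<mu>
    using that bdd unfolding \<alpha> \<beta> by (auto intro: cInf_lower cSup_upper)
  show \<alpha>0: "0 < \<alpha>" using \<mu>1 n0 by auto
  show \<alpha>\<beta>: "\<alpha> \<le> \<beta>" using le[OF \<mu>1(1)] by linarith
  show "\<beta> < 1" using \<mu>2 sub by auto
  obtain J C where "inverse_decay \<Gamma> (\<lambda>z. cA z - linf_scale 0 z) J C" using Spec_iff[of 0] n0 by blast
  then have J: "inverse_decay \<Gamma> cA J C" by (simp add: linf_scale_simps)
  then have J': "\<And>u. J (cA u) = u" "\<And>u. cA (J u) = u" by (auto simp: inverse_decay_def)
  \<comment> \<open>The complex inverse turns out to map real vectors to real ones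
    (\<open>JAi\<close>), so nothing is lost by taking the real part.\<close>
  define Ai where "Ai x = linf_Re (J (linf_complex x 0))" for x
  have re: "linf_Re (cA z) = A (linf_Re z)" for z
    by (simp add: complex_extension_def linf_complex_parts)
  have AAi: "A (Ai x) = x" for x
    unfolding Ai_def re[symmetric] J'(2) by (simp add: linf_complex_parts)
  have AiA: "Ai (A x) = x" for x
    unfolding Ai_def complex_extension_real[OF lin, symmetric] J'(1) by (simp add: linf_complex_parts)
  have JAi: "J (linf_complex x 0) = linf_complex (Ai x) 0" for x
    using J'(1)[of "linf_complex (Ai x) 0"] unfolding complex_extension_real[OF lin] AAi .
  have pA: "(cA ^^ n) (linf_complex x 0) = linf_complex ((A ^^ n) x) 0" for n x
    by (induction n) (auto simp: complex_extension_real[OF lin])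
  have pJ: "(J ^^ n) (linf_complex x 0) = linf_complex ((Ai ^^ n) x) 0" for n x
    by (induction n) (auto simp: JAi)
  have tr: "lin_bound (decay_size \<Gamma>) T c" if "lin_bound (decay_size \<Gamma>) T' c"
      "\<And>x. T' (linf_complex x 0) = linf_complex (T x) 0"
    for T c and T' :: "('m, complex ^ 'n) linf \<Rightarrow> ('m, complex ^ 'n) linf"
    using that unfolding lin_bound_def by (metis decay_size_complex(4))
  have 1: "\<exists>M. \<forall>n. lin_bound (decay_size \<Gamma>) (A ^^ n) (M * b ^ n)" if b: "\<beta> < b" for b
  proof -
    have b0: "0 < b" "0 < \<beta>" using b \<alpha>0 \<alpha>\<beta> by linarith+
    have "\<exists>M. \<forall>n. lin_bound (decay_size \<Gamma>) (cA ^^ n) (M / (1 / b) ^ n)"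
    proof (rule power_bound_forward)
      show "1 / b < 1 / \<beta>" using b b0 by (simp add: frac_less2)
      show "cmod \<mu> * (1 / \<beta>) \<le> 1" if "\<mu> \<in> ?S" for \<mu> using le(2)[OF that] b0 by simp
    qed (use b0 in simp)
    then obtain M where M: "\<And>n. lin_bound (decay_size \<Gamma>) (cA ^^ n) (M * b ^ n)" by (auto simp: power_one_over)
    show ?thesis using tr[OF M pA] by blast
  qed
  have 2: "\<exists>M. \<forall>n. lin_bound (decay_size \<Gamma>) (Ai ^^ n) (M * a ^ n)" if a: "1 / \<alpha> < a" for a
  proof -
    have a0: "0 < a" using a \<alpha>0 by (meson divide_pos_pos less_trans zero_less_one)
    have "\<exists>M. \<forall>n. lin_bound (decay_size \<Gamma>) (J ^^ n) (M / (1 / a) ^ n)"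
    proof (rule power_bound_backward[OF J])
      show "1 / a < \<alpha>" using a a0 \<alpha>0 by (simp add: field_simps)
    qed (use a0 le in auto)
    then obtain M where M: "\<And>n. lin_bound (decay_size \<Gamma>) (J ^^ n) (M * a ^ n)" by (auto simp: power_one_over)
    show ?thesis using tr[OF M pJ] by blast
  qed
  show "\<exists>Ai. (\<forall>x. A (Ai x) = x) \<and> (\<forall>x. Ai (A x) = x) \<and>
      (\<forall>b>\<beta>. \<exists>M. \<forall>n. lin_bound (decay_size \<Gamma>) (A ^^ n) (M * b ^ n)) \<and>
      (\<forall>a>1 / \<alpha>. \<exists>M. \<forall>n. lin_bound (decay_size \<Gamma>) (Ai ^^ n) (M * a ^ n))"
    using AAi AiA 1 2 by blast
qed

end

section \<open>Cutoff functions\<close>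

text \<open>The function \<open>t - t (zc t)\<^sup>N\<close> is the identity on \<open>[-1, 1]\<close>, is bounded with all its derivatives, and is
  of class \<open>C\<^sup>N\<^sup>-\<^sup>1\<close>. The derivatives of \<open>sgn(t)\<^sup>e zc(t)\<^sup>j (1 - zc(t))\<^sup>i\<close> are combinations of such functions
  again.\<close>

definition zc :: "real \<Rightarrow> real" where
  "zc t = max 0 (1 - exp (1 - \<bar>t\<bar>))"

lemma zc_bounds: "0 \<le> zc t" "zc t \<le> 1" "0 \<le> 1 - zc t" "1 - zc t \<le> 1"
  by (auto simp: zc_def)

lemma zc_inside: "\<bar>t\<bar> \<le> 1 \<Longrightarrow> zc t = 0"
  by (simp add: zc_def)

lemma zc_outside: "1 \<le> \<bar>t\<bar> \<Longrightarrow> zc t = 1 - exp (1 - \<bar>t\<bar>)"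
  by (simp add: zc_def)

lemma zc_le: "\<bar>t\<bar> \<le> 1 \<Longrightarrow> zc x \<le> \<bar>x - t\<bar>"
  using exp_ge_add_one_self[of "1 - \<bar>x\<bar>"] unfolding zc_def by linarith

text \<open>For \<open>\<bar>t\<bar> \<le> 1\<close>, kinks included, the function is at most the
  square of the distance to \<open>t\<close>, because \<open>2 \<le> j\<close>; so its derivative is
  \<open>0\<close>. Beyond, \<open>zc\<close> is \<open>1 - exp (1 - \<bar>t\<bar>)\<close>, whose
  derivative is \<open>sgn t * (1 - zc t)\<close>.\<close>

lemma zc_monomial_derivative:
  assumes j: "2 \<le> j"
  shows "((\<lambda>t. sgn t ^ e * zc t ^ j * (1 - zc t) ^ i) has_real_derivative
    sgn t ^ Suc e * (real j * zc t ^ (j - 1) * (1 - zc t) ^ Suc i - real i * zc t ^ j * (1 - zc t) ^ i)) (at t)"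
proof (cases "\<bar>t\<bar> \<le> 1")
  case True
  let ?f = "\<lambda>t. sgn t ^ e * zc t ^ j * (1 - zc t) ^ i"
  have bound: "\<bar>?f x\<bar> \<le> (x - t)\<^sup>2" if "\<bar>x - t\<bar> \<le> 1" for x
  proof -
    have "\<bar>?f x\<bar> = \<bar>sgn x\<bar> ^ e * zc x ^ j * (1 - zc x) ^ i"
      using zc_bounds[of x] by (simp add: abs_mult power_abs)
    also have "\<dots> \<le> 1 * zc x ^ j * 1"
      using zc_bounds[of x] by (intro mult_mono power_le_one) (auto simp: abs_sgn_eq)
    also have "zc x ^ j \<le> zc x ^ 2" using zc_bounds[of x] j by (intro power_decreasing) auto
    also have "\<dots> \<le> \<bar>x - t\<bar> ^ 2" using zc_bounds[of x] zc_le[OF True] by (intro power_mono) auto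
    finally show ?thesis by simp
  qed
  have "(?f has_derivative (\<lambda>h. 0)) (at t)"
  proof (rule has_derivative_eventuallyI)
    fix \<epsilon> :: real assume \<epsilon>: "0 < \<epsilon>"
    have ft: "?f t = 0" using bound[of t] by simp
    have "\<forall>\<^sub>F y in nhds t. y \<in> ball t (min 1 \<epsilon>)"
      using \<epsilon> by (intro eventually_nhds_in_open) auto
    then show "\<forall>\<^sub>F y in nhds t. norm (?f y - ?f t - 0) \<le> \<epsilon> * norm (y - t)"
    proof eventually_elim
      case (elim y)
      then have "\<bar>y - t\<bar> \<le> 1" "\<bar>y - t\<bar> \<le> \<epsilon>" by (auto simp: dist_real_def)
      then have "\<bar>?f y\<bar> \<le> \<bar>y - t\<bar> * \<bar>y - t\<bar>" using bound[of y] by (simp add: power2_eq_square)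
      also have "\<dots> \<le> \<epsilon> * \<bar>y - t\<bar>" using \<open>\<bar>y - t\<bar> \<le> \<epsilon>\<close> by (intro mult_right_mono) auto
      finally show ?case by (simp only: ft diff_0_right real_norm_def)
    qed
  qed simp
  then show ?thesis using zc_inside[OF True] j by (simp add: has_field_derivative_def zero_power lambda_zero)
next
  case False
  define \<sigma> where "\<sigma> = sgn t"
  have \<sigma>: "\<sigma> \<noteq> 0" "\<sigma> * t = \<bar>t\<bar>" "\<sigma> * \<sigma> = 1" using False by (auto simp: \<sigma>_def sgn_if)
  define S where "S = {x. 1 < \<sigma> * x}"
  have S: "open S" "t \<in> S" unfolding S_def using False \<sigma> by (auto intro!: open_Collect_less continuous_intros)
  have in_S: "sgn x = \<sigma>" "zc x = 1 - exp (1 - \<sigma> * x)" if "x \<in> S" for x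
  proof -
    have a: "\<bar>x\<bar> = \<sigma> * x \<and> sgn x = \<sigma>" using that unfolding S_def \<sigma>_def
      by (cases "t > 0"; cases "x > 0"; cases "t = 0"; cases "x = 0") (auto simp: sgn_if)
    then show "sgn x = \<sigma>" by simp
    have "1 \<le> \<bar>x\<bar>" using that a by (simp add: S_def)
    then show "zc x = 1 - exp (1 - \<sigma> * x)" using zc_outside[of x] a by simp
  qed
  have D: "((\<lambda>x. \<sigma> ^ e * (1 - exp (1 - \<sigma> * x)) ^ j * (1 - (1 - exp (1 - \<sigma> * x))) ^ i) has_real_derivative
    \<sigma> ^ e * (real j * (1 - exp (1 - \<sigma> * t)) ^ (j - 1) * (\<sigma> * exp (1 - \<sigma> * t)) * exp (1 - \<sigma> * t) ^ i +
       (1 - exp (1 - \<sigma> * t)) ^ j * (real i * exp (1 - \<sigma> * t) ^ (i - 1) * (- \<sigma> * exp (1 - \<sigma> * t))))) (at t)"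
    by (auto intro!: derivative_eq_intros simp: algebra_simps)
  have E: "real i * exp (1 - \<sigma> * t) ^ (i - 1) * (- \<sigma> * exp (1 - \<sigma> * t)) = - \<sigma> * real i * exp (1 - \<sigma> * t) ^ i"
    by (cases i) auto
  have "((\<lambda>x. \<sigma> ^ e * (1 - exp (1 - \<sigma> * x)) ^ j * (1 - (1 - exp (1 - \<sigma> * x))) ^ i) has_real_derivative
    sgn t ^ Suc e * (real j * zc t ^ (j - 1) * (1 - zc t) ^ Suc i - real i * zc t ^ j * (1 - zc t) ^ i)) (at t)"
    by (rule DERIV_cong[OF D[unfolded E]]) (simp add: in_S[OF S(2)] algebra_simps)
  then show ?thesis
    by (rule has_field_derivative_transform_within_open[OF _ S]) (simp add: in_S)
qed

fun diff_bounded :: "nat \<Rightarrow> (real \<Rightarrow> real) \<Rightarrow> bool" where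
  "diff_bounded 0 f \<longleftrightarrow> (\<exists>B. \<forall>t. \<bar>f t\<bar> \<le> B)"
| "diff_bounded (Suc k) f \<longleftrightarrow> (\<exists>B. \<forall>t. \<bar>f t\<bar> \<le> B) \<and>
     (\<exists>f'. (\<forall>t. (f has_real_derivative f' t) (at t)) \<and> diff_bounded k f')"

lemma diff_bounded_SucI:
  assumes "\<And>t. \<bar>f t\<bar> \<le> B" "\<And>t. (f has_real_derivative f' t) (at t)" "diff_bounded k f'"
  shows "diff_bounded (Suc k) f"
  unfolding diff_bounded.simps using assms by blast

lemma diff_bounded_add: "diff_bounded k f \<Longrightarrow> diff_bounded k g \<Longrightarrow> diff_bounded k (\<lambda>t. f t + g t)"
proof (induction k arbitrary: f g)
  case 0
  then obtain B C where "\<And>t. \<bar>f t\<bar> \<le> B" "\<And>t. \<bar>g t\<bar> \<le> C" by auto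
  then have "\<bar>f t + g t\<bar> \<le> B + C" for t by (meson abs_triangle_ineq add_mono order_trans)
  then show ?case by auto
next
  case (Suc k)
  obtain f' g' B C where fg: "\<And>t. (f has_real_derivative f' t) (at t)" "diff_bounded k f'" "\<And>t. \<bar>f t\<bar> \<le> B"
    "\<And>t. (g has_real_derivative g' t) (at t)" "diff_bounded k g'" "\<And>t. \<bar>g t\<bar> \<le> C"
    using Suc.prems by auto
  have "\<bar>f t + g t\<bar> \<le> B + C" for t using fg(3,6) by (meson abs_triangle_ineq add_mono order_trans)
  then show ?case by (rule diff_bounded_SucI[OF _ DERIV_add[OF fg(1,4)] Suc.IH[OF fg(2,5)]])
qed

lemma diff_bounded_cmult: "diff_bounded k f \<Longrightarrow> diff_bounded k (\<lambda>t. c * f t)"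
proof (induction k arbitrary: f)
  case 0
  then obtain B where "\<And>t. \<bar>f t\<bar> \<le> B" by auto
  then have "\<bar>c * f t\<bar> \<le> \<bar>c\<bar> * B" for t by (simp add: abs_mult mult_left_mono)
  then show ?case unfolding diff_bounded.simps by blast
next
  case (Suc k)
  obtain f' B where f: "\<And>t. (f has_real_derivative f' t) (at t)" "diff_bounded k f'" "\<And>t. \<bar>f t\<bar> \<le> B"
    using Suc.prems by auto
  have "\<bar>c * f t\<bar> \<le> \<bar>c\<bar> * B" for t using f(3) by (simp add: abs_mult mult_left_mono)
  then show ?case by (rule diff_bounded_SucI[OF _ DERIV_cmult[OF f(1)] Suc.IH[OF f(2)]])
qed

lemma diff_bounded_const: "diff_bounded k (\<lambda>t. c)"
proof (induction k arbitrary: c)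
  case (Suc k)
  show ?case by (rule diff_bounded_SucI[of _ "\<bar>c\<bar>", OF _ DERIV_const Suc]) simp
qed auto

lemma zc_monomial_le: "\<bar>sgn t ^ e * zc t ^ j * (1 - zc t) ^ i\<bar> \<le> 1"
proof -
  have "\<bar>sgn t ^ e * zc t ^ j * (1 - zc t) ^ i\<bar> = \<bar>sgn t\<bar> ^ e * zc t ^ j * (1 - zc t) ^ i"
    using zc_bounds[of t] by (simp add: abs_mult power_abs)
  also have "\<dots> \<le> 1 * 1 * 1"
    using zc_bounds[of t] by (intro mult_mono power_le_one mult_nonneg_nonneg) (auto simp: abs_sgn_eq)
  finally show ?thesis by simp
qed

lemma times_zc_le: "1 \<le> \<bar>t\<bar> \<Longrightarrow> \<bar>t\<bar> * (1 - zc t) \<le> 1"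
proof -
  assume t: "1 \<le> \<bar>t\<bar>"
  have "\<bar>t\<bar> \<le> exp (\<bar>t\<bar> - 1)" using exp_ge_add_one_self[of "\<bar>t\<bar> - 1"] by simp
  then have "\<bar>t\<bar> * exp (1 - \<bar>t\<bar>) \<le> exp (\<bar>t\<bar> - 1) * exp (1 - \<bar>t\<bar>)" by (intro mult_right_mono) auto
  then show ?thesis using zc_outside[OF t] by (simp flip: exp_add)
qed

lemma times_zc_monomial_le:
  assumes "1 \<le> j" "1 \<le> i"
  shows "\<bar>t * (sgn t ^ e * zc t ^ j * (1 - zc t) ^ i)\<bar> \<le> 1"
proof (cases "\<bar>t\<bar> \<le> 1")
  case True
  then show ?thesis using zc_inside[OF True] assms by (simp add: zero_power)
next
  case False
  obtain i' where i': "i = Suc i'" using assms(2) by (cases i) auto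
  have "\<bar>t * (sgn t ^ e * zc t ^ j * (1 - zc t) ^ i)\<bar> =
      (\<bar>t\<bar> * (1 - zc t)) * \<bar>sgn t ^ e * zc t ^ j * (1 - zc t) ^ i'\<bar>"
    using zc_bounds[of t] by (simp add: i' abs_mult)
  also have "\<dots> \<le> 1 * 1"
    using False zc_bounds[of t] by (intro mult_mono times_zc_le zc_monomial_le) auto
  finally show ?thesis by simp
qed

lemma diff_bounded_zc: "k < j \<Longrightarrow> diff_bounded k (\<lambda>t. sgn t ^ e * zc t ^ j * (1 - zc t) ^ i)"
proof (induction k arbitrary: e j i)
  case 0
  show ?case unfolding diff_bounded.simps using zc_monomial_le by blast
next
  case (Suc k)
  have "diff_bounded k (\<lambda>t. real j * (sgn t ^ Suc e * zc t ^ (j - 1) * (1 - zc t) ^ Suc i) +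
      (- real i) * (sgn t ^ Suc e * zc t ^ j * (1 - zc t) ^ i))"
    using Suc by (intro diff_bounded_add diff_bounded_cmult Suc.IH) auto
  then have "diff_bounded k (\<lambda>t. sgn t ^ Suc e * (real j * zc t ^ (j - 1) * (1 - zc t) ^ Suc i - real i
      * zc t ^ j * (1 - zc t) ^ i))"
    by (simp add: algebra_simps)
  moreover have "((\<lambda>t. sgn t ^ e * zc t ^ j * (1 - zc t) ^ i) has_real_derivative
    sgn t ^ Suc e * (real j * zc t ^ (j - 1) * (1 - zc t) ^ Suc i - real i * zc t ^ j
        * (1 - zc t) ^ i)) (at t)" for t
    by (rule zc_monomial_derivative) (use Suc in simp)
  ultimately show ?case by (intro diff_bounded_SucI[OF zc_monomial_le])
qed

text \<open>The factor \<open>1 - zc t\<close> decays exponentially and outweighs \<open>t\<close>.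
  Differentiation never lowers its exponent \<open>i\<close>, while it costs at most one power of
  \<open>zc\<close>.\<close>

lemma diff_bounded_times_zc:
  "k < j \<Longrightarrow> 1 \<le> i \<Longrightarrow> diff_bounded k (\<lambda>t. t * (sgn t ^ e * zc t ^ j * (1 - zc t) ^ i))"
proof (induction k arbitrary: e j i)
  case 0
  then have "\<bar>t * (sgn t ^ e * zc t ^ j * (1 - zc t) ^ i)\<bar> \<le> 1" for t
    by (intro times_zc_monomial_le) auto
  then show ?case unfolding diff_bounded.simps by blast
next
  case (Suc k)
  let ?m = "\<lambda>t. sgn t ^ e * zc t ^ j * (1 - zc t) ^ i"
  let ?m' = "\<lambda>t. sgn t ^ Suc e * (real j * zc t ^ (j - 1) * (1 - zc t) ^ Suc i - real i * zc t ^ j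
      * (1 - zc t) ^ i)"
  have "diff_bounded k (\<lambda>t. ?m t + (real j * (t * (sgn t ^ Suc e * zc t ^ (j - 1) * (1 - zc t) ^ Suc i)) +
      (- real i) * (t * (sgn t ^ Suc e * zc t ^ j * (1 - zc t) ^ i))))"
    using Suc.prems by (intro diff_bounded_add diff_bounded_cmult Suc.IH diff_bounded_zc) auto
  then have "diff_bounded k (\<lambda>t. 1 * ?m t + ?m' t * t)"
    by (simp add: algebra_simps)
  moreover have "((\<lambda>t. t * ?m t) has_real_derivative 1 * ?m t + ?m' t * t) (at t)" for t
    by (rule DERIV_mult[OF DERIV_ident zc_monomial_derivative]) (use Suc.prems in simp)
  moreover have "\<bar>t * ?m t\<bar> \<le> 1" for t
    by (rule times_zc_monomial_le) (use Suc.prems in auto)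
  ultimately show ?case by (intro diff_bounded_SucI)
qed

lemma diff_bounded_sequence:
  "diff_bounded k f \<Longrightarrow> \<exists>F B. F 0 = f \<and> (\<forall>l<k. \<forall>t. (F l has_real_derivative F (Suc l) t) (at t)) \<and>
     (\<forall>l\<le>k. \<forall>t. \<bar>F l t\<bar> \<le> B)"
proof (induction k arbitrary: f)
  case 0
  then show ?case by (auto intro!: exI[of _ "\<lambda>_. f"])
next
  case (Suc k)
  obtain f' B0 where f': "\<And>t. (f has_real_derivative f' t) (at t)" "diff_bounded k f'" "\<And>t. \<bar>f t\<bar> \<le> B0"
    using Suc.prems by auto
  obtain F B where F: "F 0 = f'" "\<And>l t. l < k \<Longrightarrow> (F l has_real_derivative F (Suc l) t) (at t)"
    "\<And>l t. l \<le> k \<Longrightarrow> \<bar>F l t\<bar> \<le> B"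
    using Suc.IH[OF f'(2)] by blast
  let ?F = "case_nat f F"
  have "(?F l has_real_derivative ?F (Suc l) t) (at t)" if "l < Suc k" for l t
    using that F f' by (cases l) auto
  moreover have "\<bar>?F l t\<bar> \<le> max B0 B" if "l \<le> Suc k" for l t
    using that F(3)[of "l - 1" t] f'(3)[of t] by (cases l) auto
  ultimately show ?case by (intro exI[of _ ?F] exI[of _ "max B0 B"]) auto
qed

lemma scalar_cutoff:
  "\<exists>F B. (\<forall>t. \<bar>t\<bar> \<le> 1 \<longrightarrow> F 0 t = t) \<and> (\<forall>l<Suc k. \<forall>t. (F l has_real_derivative F (Suc l) t) (at t)) \<and>
     (\<forall>l\<le>Suc k. \<forall>t. \<bar>F l t\<bar> \<le> (B::real))"
proof -
  \<comment> \<open>\<open>s'\<close> contains the power \<open>N - 1\<close> of \<open>zc\<close>,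
    which has to exceed its \<open>k\<close> derivatives.\<close>
  define N where "N = k + 2"
  define s where "s t = t - t * zc t ^ N" for t
  define s' where "s' t = 1 + (- 1) * (sgn t ^ 0 * zc t ^ N * (1 - zc t) ^ 0) +
     (- real N) * (t * (sgn t ^ 1 * zc t ^ (N - 1) * (1 - zc t) ^ 1))" for t
  have "\<bar>s t\<bar> \<le> real N" for t
  proof (cases "\<bar>t\<bar> \<le> 1")
    case True
    then show ?thesis using zc_inside[OF True] by (simp add: s_def N_def)
  next
    case False
    \<comment> \<open>Bernoulli's inequality compares \<open>1 - zc t ^ N\<close> with
      \<open>1 - zc t\<close>, whose product with \<open>\<bar>t\<bar>\<close> is bounded.\<close>
    have "1 + real N * (- (1 - zc t)) \<le> (1 + (- (1 - zc t))) ^ N"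
      by (rule Bernoulli_inequality) (use zc_bounds[of t] in simp)
    then have "1 - zc t ^ N \<le> real N * (1 - zc t)" by (simp add: algebra_simps)
    moreover have "0 \<le> 1 - zc t ^ N" using zc_bounds[of t] by (simp add: power_le_one)
    ultimately have "\<bar>t\<bar> * (1 - zc t ^ N) \<le> \<bar>t\<bar> * (real N * (1 - zc t))" by (intro mult_left_mono) auto
    also have "\<dots> = real N * (\<bar>t\<bar> * (1 - zc t))" by simp
    also have "\<dots> \<le> real N * 1" using times_zc_le[of t] False by (intro mult_left_mono) auto
    finally have "\<bar>t\<bar> * (1 - zc t ^ N) \<le> real N" by simp
    moreover have "s t = t * (1 - zc t ^ N)" by (simp add: s_def algebra_simps)
    ultimately show ?thesis using \<open>0 \<le> 1 - zc t ^ N\<close> by (simp add: abs_mult)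
  qed
  moreover have "(s has_real_derivative s' t) (at t)" for t
  proof -
    have "((\<lambda>t. sgn t ^ 0 * zc t ^ N * (1 - zc t) ^ 0) has_real_derivative
      sgn t ^ Suc 0 * (real N * zc t ^ (N - 1) * (1 - zc t) ^ Suc 0 - real 0 * zc t ^ N
          * (1 - zc t) ^ 0)) (at t)"
      by (rule zc_monomial_derivative) (simp add: N_def)
    then have "((\<lambda>t. zc t ^ N) has_real_derivative (sgn t * (real N * zc t ^ (N - 1) * (1 - zc t)))) (at t)"
      by simp
    from DERIV_diff[OF DERIV_ident DERIV_mult[OF DERIV_ident this]]
    show ?thesis unfolding s_def by (rule DERIV_cong) (simp add: s'_def algebra_simps)
  qed
  moreover have "diff_bounded k s'"
    unfolding s'_def
    by (intro diff_bounded_add diff_bounded_const diff_bounded_cmult diff_bounded_zc diff_bounded_times_zc)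
      (auto simp: N_def)
  ultimately have "diff_bounded (Suc k) s" by (intro diff_bounded_SucI)
  then obtain F B where F: "F 0 = s" "\<forall>l<Suc k. \<forall>t. (F l has_real_derivative F (Suc l) t) (at t)"
     "\<forall>l\<le>Suc k. \<forall>t. \<bar>F l t\<bar> \<le> B"
    using diff_bounded_sequence by blast
  moreover have "F 0 t = t" if "\<bar>t\<bar> \<le> 1" for t
    using zc_inside[OF that] F(1) by (simp add: s_def N_def)
  ultimately show ?thesis by blast
qed

lemma scalar_cutoff_small:
  assumes "0 < \<epsilon>"
  shows "\<exists>\<eta> F B. 0 < \<eta> \<and> (\<forall>t. \<bar>t\<bar> \<le> \<eta> \<longrightarrow> F 0 t = t) \<and> (\<forall>t. \<bar>F 0 t\<bar> \<le> \<epsilon>) \<and>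
     (\<forall>l<Suc k. \<forall>t. (F l has_real_derivative F (Suc l) t) (at t)) \<and> (\<forall>l\<le>Suc k. \<forall>t. \<bar>F l t\<bar> \<le> (B::real))"
proof -
  obtain F B where F: "\<And>t. \<bar>t\<bar> \<le> 1 \<Longrightarrow> F 0 t = t"
    "\<And>l t. l < Suc k \<Longrightarrow> (F l has_real_derivative F (Suc l) t) (at t)" "\<And>l t. l \<le> Suc k \<Longrightarrow> \<bar>F l t\<bar> \<le> (B::real)"
    using scalar_cutoff[of k] by blast
  have B: "1 \<le> B" using F(3)[of 0 1] F(1)[of 1] by simp
  \<comment> \<open>Rescaling to \<open>\<eta> * F 0 (t / \<eta>)\<close> keeps the identity near
    \<open>0\<close> and bounds the values by \<open>\<eta> * B\<close>, which is
    \<open>\<epsilon>\<close>.\<close>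
  define \<eta> where "\<eta> = \<epsilon> / B"
  have \<eta>: "0 < \<eta>" using assms B by (simp add: \<eta>_def)
  define G where "G l t = \<eta> * (1 / \<eta>) ^ l * F l (t / \<eta>)" for l t
  have "\<bar>G l t\<bar> \<le> (\<Sum>l\<le>Suc k. \<eta> * (1 / \<eta>) ^ l * B)" if "l \<le> Suc k" for l t
  proof -
    have "\<bar>G l t\<bar> = \<eta> * (1 / \<eta>) ^ l * \<bar>F l (t / \<eta>)\<bar>" using \<eta> by (simp add: G_def abs_mult)
    also have "\<dots> \<le> \<eta> * (1 / \<eta>) ^ l * B" using F(3)[OF that] \<eta> by (intro mult_left_mono) auto
    also have "\<dots> \<le> (\<Sum>l\<le>Suc k. \<eta> * (1 / \<eta>) ^ l * B)"
      by (rule member_le_sum[where f="\<lambda>l. \<eta> * (1 / \<eta>) ^ l * B"]) (use that \<eta> B in auto)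
    finally show ?thesis .
  qed
  moreover have "(G l has_real_derivative G (Suc l) t) (at t)" if "l < Suc k" for l t
  proof -
    have "((\<lambda>t. t / \<eta>) has_real_derivative 1 / \<eta>) (at t)" using \<eta> by (auto intro!: derivative_eq_intros)
    from DERIV_cmult[OF DERIV_chain2[OF F(2)[OF that] this], of "\<eta> * (1 / \<eta>) ^ l"]
    show ?thesis unfolding G_def[abs_def] by (rule DERIV_cong) (use \<eta> in simp)
  qed
  moreover have "G 0 t = t" if "\<bar>t\<bar> \<le> \<eta>" for t
    using F(1)[of "t / \<eta>"] that \<eta> by (simp add: G_def)
  moreover have "\<bar>G 0 t\<bar> \<le> \<epsilon>" for t
  proof -
    have "\<bar>G 0 t\<bar> \<le> \<eta> * B" using F(3)[of 0 "t / \<eta>"] \<eta> by (simp add: G_def abs_mult)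
    then show ?thesis using B by (simp add: \<eta>_def)
  qed
  ultimately show ?thesis using \<eta> by blast
qed

lemma scalar_mvt:
  fixes f :: "real \<Rightarrow> real"
  assumes "\<And>t. (f has_real_derivative f' t) (at t)"
  obtains \<xi> where "f y - f x = f' \<xi> * (y - x)" "\<bar>\<xi> - x\<bar> \<le> \<bar>y - x\<bar>"
proof -
  consider "x < y" | "y < x" | "x = y" by linarith
  then show thesis
  proof cases
    case 1
    obtain z where "x < z" "z < y" "f y - f x = (y - x) * f' z" using MVT2[OF 1, of f f'] assms by blast
    then show thesis by (intro that[of z]) (auto simp: mult.commute)
  next
    case 2
    obtain z where "y < z" "z < x" "f x - f y = (x - y) * f' z" using MVT2[OF 2, of f f'] assms by blast
    then show thesis by (intro that[of z]) (auto simp: algebra_simps)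
  next
    case 3
    then show thesis by (intro that[of x]) auto
  qed
qed

lemma norm_vec_le_card:
  fixes x :: "real ^ 'n"
  assumes "\<And>j. \<bar>x $ j\<bar> \<le> c"
  shows "norm x \<le> real CARD('n) * c"
proof -
  have "norm x \<le> (\<Sum>j\<in>UNIV. \<bar>x $ j\<bar>)" by (rule norm_le_l1_cart)
  also have "\<dots> \<le> (\<Sum>j\<in>(UNIV :: 'n set). c)" by (intro sum_mono assms)
  finally show ?thesis by simp
qed

lemma component_le_norm_linf: "\<bar>x i $ j\<bar> \<le> norm x" for x :: "('m::finite, real ^ 'n) linf"
  using component_le_norm_cart[of "x i" j] norm_bounded[of x i] by linarith

section \<open>The cutoff on the lattice\<close>

definition cutoff_jet :: "(nat \<Rightarrow> real \<Rightarrow> real) \<Rightarrow> nat \<Rightarrow> ('m::finite, real ^ 'n) linf \<Rightarrow> ('m, real ^ 'n) linf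
    list \<Rightarrow> ('m, real ^ 'n) linf" where
  "cutoff_jet F l x vs = Bcontfun (\<lambda>i. \<chi> j. F l (x i $ j) * (\<Prod>v\<leftarrow>vs. v i $ j))"

text \<open>Two derivatives beyond \<open>k\<close> are provided: the continuity of order
  \<open>k\<close> is read off from order \<open>Suc k\<close>, and differentiability has to be
  uniform over all lattice points, which comes from a quadratic remainder with a bound on
  \<open>F (k + 2)\<close>.\<close>

context
  fixes F :: "nat \<Rightarrow> real \<Rightarrow> real" and B :: real and k :: nat
  assumes der: "\<And>l t. l < Suc (Suc k) \<Longrightarrow> (F l has_real_derivative F (Suc l) t) (at t)"
    and B: "\<And>l t. l \<le> Suc (Suc k) \<Longrightarrow> \<bar>F l t\<bar> \<le> B"
begin

lemma B_nonneg: "0 \<le> B"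
  using B[of 0 0] by linarith

lemma prod_components_le:
  "\<bar>\<Prod>v\<leftarrow>vs. v i $ j\<bar> \<le> (\<Prod>v\<leftarrow>vs. norm v)" for vs :: "('m::finite, real ^ 'n) linf list"
proof (induction vs)
  case (Cons v vs)
  then show ?case by (simp add: abs_mult mult_mono component_le_norm_linf)
qed simp

lemma cutoff_jet_apply:
  fixes x :: "('m::finite, real ^ 'n) linf"
  assumes "l \<le> Suc (Suc k)"
  shows "cutoff_jet F l x vs i = (\<chi> j. F l (x i $ j) * (\<Prod>v\<leftarrow>vs. v i $ j))"
  unfolding cutoff_jet_def
proof (rule bounded_linf_apply)
  fix i
  show "norm (\<chi> j. F l (x i $ j) * (\<Prod>v\<leftarrow>vs. v i $ j)) \<le> real CARD('n) * (B * (\<Prod>v\<leftarrow>vs. norm v))"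
  proof (rule norm_vec_le_card)
    fix j
    show "\<bar>(\<chi> j. F l (x i $ j) * (\<Prod>v\<leftarrow>vs. v i $ j)) $ j\<bar> \<le> B * (\<Prod>v\<leftarrow>vs. norm v)"
      using B[OF assms, of "x i $ j"] prod_components_le[of i j vs] B_nonneg by (simp add: abs_mult mult_mono)
  qed
qed

text \<open>The map multiplies entries at one and the same lattice point, so the weights of the
  arguments multiply to the weight of the sum of their types.\<close>

lemma mult_bound_cutoff_jet:
  fixes x :: "('m::finite, real ^ 'n) linf"
  assumes \<Gamma>: "decay_function \<Gamma>" and l: "l \<le> Suc (Suc k)"
  shows "mult_bound (decay_size \<Gamma>) l (cutoff_jet F l x) (real CARD('n) * B)"
proof (rule mult_boundI)
  show "0 \<le> real CARD('n) * B" using B_nonneg by simp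
  fix L :: "((int ^ 'm) multiset \<times> real \<times> ('m, real ^ 'n) linf) list"
  assume L: "\<And>q. q \<in> set L \<Longrightarrow> decay_size \<Gamma> (fst q) (fst (snd q)) (snd (snd q))"
  let ?t = "\<Sum>q\<leftarrow>L. fst q" and ?c = "\<Prod>q\<leftarrow>L. fst (snd q)" and ?v = "map (\<lambda>q. snd (snd q)) L"
  have c: "0 \<le> ?c" by (rule prod_list_nonneg) (use L in \<open>auto simp: decay_size_def\<close>)
  have "norm (cutoff_jet F l x ?v i) \<le> real CARD('n) * B * ?c * decay_weight \<Gamma> ?t i" if t: "size ?t \<le> 1" for i
  proof -
    have "\<bar>\<Prod>v\<leftarrow>?v. v i $ j\<bar> \<le> ?c * decay_weight \<Gamma> ?t i" for j
      using L t
    proof (induction L)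
      case (Cons q L)
      have q: "decay_size \<Gamma> (fst q) (fst (snd q)) (snd (snd q))" by (rule Cons.prems) simp
      have s: "size (fst q) \<le> 1" "size (\<Sum>q\<leftarrow>L. fst q) \<le> 1" using Cons.prems(2) by auto
      have "\<bar>snd (snd q) i $ j\<bar> \<le> fst (snd q) * decay_weight \<Gamma> (fst q) i"
        using q s(1) component_le_norm_cart[of "snd (snd q) i" j] unfolding decay_size_def
            by (meson order_trans)
      moreover have "\<bar>\<Prod>v\<leftarrow>map (\<lambda>q. snd (snd q)) L. v i $ j\<bar>
          \<le> (\<Prod>q\<leftarrow>L. fst (snd q)) * decay_weight \<Gamma> (\<Sum>q\<leftarrow>L. fst q) i"
        by (rule Cons.IH[OF _ s(2)], rule Cons.prems) simp
      ultimately have "\<bar>snd (snd q) i $ j\<bar> * \<bar>\<Prod>v\<leftarrow>map (\<lambda>q. snd (snd q)) L. v i $ j\<bar> \<le>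
          (fst (snd q) * decay_weight \<Gamma> (fst q) i) * ((\<Prod>q\<leftarrow>L. fst (snd q)) * decay_weight \<Gamma> (\<Sum>q\<leftarrow>L. fst q) i)"
        by (intro mult_mono) auto
      then show ?case by (simp add: abs_mult decay_weight_add mult_ac)
    qed simp
    then have "\<bar>cutoff_jet F l x ?v i $ j\<bar> \<le> B * (?c * decay_weight \<Gamma> ?t i)" for j
      unfolding cutoff_jet_apply[OF l] using B[OF l, of "x i $ j"] B_nonneg by (simp add: abs_mult mult_mono)
    then have "norm (cutoff_jet F l x ?v i) \<le> real CARD('n) * (B * (?c * decay_weight \<Gamma> ?t i))"
      by (rule norm_vec_le_card)
    then show ?thesis by (simp add: mult.assoc)
  qed
  then show "decay_size \<Gamma> ?t (real CARD('n) * B * ?c) (cutoff_jet F l x ?v)"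
    using c B_nonneg by (simp add: decay_size_def)
qed

text \<open>The scalar mean value theorem, used twice in each component, gives a remainder quadratic
  in \<open>norm (y - x)\<close> with the same constant at every lattice point.\<close>

lemma cutoff_jet_derivative:
  fixes x :: "('m::finite, real ^ 'n) linf"
  assumes l: "l \<le> k"
  shows "((\<lambda>y. cutoff_jet F l y vs) has_derivative (\<lambda>h. cutoff_jet F (Suc l) x (h # vs))) (at x)"
proof (rule has_derivative_eventuallyI)
  let ?P = "\<Prod>v\<leftarrow>vs. norm v"
  have P: "0 \<le> ?P" by (rule prod_norm_nonneg)
  have l': "l \<le> Suc (Suc k)" "Suc l \<le> Suc (Suc k)" using l by auto
  show "bounded_linear (\<lambda>h. cutoff_jet F (Suc l) x (h # vs))"
  proof (rule bounded_linear_intro[where K="real CARD('n) * (B * ?P)"])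
    show "cutoff_jet F (Suc l) x ((g + h) # vs) = cutoff_jet F (Suc l) x (g # vs)
        + cutoff_jet F (Suc l) x (h # vs)" for g h
      by (rule bcontfun_eqI) (simp add: cutoff_jet_apply[OF l'(2)] vec_eq_iff algebra_simps)
    show "cutoff_jet F (Suc l) x ((c *\<^sub>R h) # vs) = c *\<^sub>R cutoff_jet F (Suc l) x (h # vs)" for c h
      by (rule bcontfun_eqI) (simp add: cutoff_jet_apply[OF l'(2)] vec_eq_iff)
    show "norm (cutoff_jet F (Suc l) x (h # vs)) \<le> norm h * (real CARD('n) * (B * ?P))" for h
    proof (rule norm_bound)
      fix i
      have "\<bar>cutoff_jet F (Suc l) x (h # vs) i $ j\<bar> \<le> B * (norm h * ?P)" for j
        using B[OF l'(2), of "x i $ j"] B_nonneg prod_components_le[of i j "h # vs"]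
        by (simp add: cutoff_jet_apply[OF l'(2)] abs_mult mult_mono)
      from norm_vec_le_card[OF this] show "norm (cutoff_jet F (Suc l) x (h # vs) i)
          \<le> norm h * (real CARD('n) * (B * ?P))"
        by (simp add: mult_ac)
    qed
  qed
  fix e :: real assume e: "0 < e"
  define M where "M = real CARD('n) * B * ?P + 1"
  have M: "0 < M" unfolding M_def using B_nonneg P by (simp add: add_nonneg_pos)
  have "\<forall>\<^sub>F y in nhds x. y \<in> ball x (e / M)" using e M by (intro eventually_nhds_in_open) auto
  then show "\<forall>\<^sub>F y in nhds x. norm (cutoff_jet F l y vs - cutoff_jet F l x vs - cutoff_jet F (Suc l) x ((y -
      x) # vs)) \<le> e * norm (y - x)"
  proof eventually_elim
    case (elim y)
    have near: "norm (y - x) * M \<le> e" using elim M by (simp add: dist_norm norm_minus_commute field_simps)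
    show ?case
    proof (rule norm_bound)
      fix i
      have "\<bar>(cutoff_jet F l y vs - cutoff_jet F l x vs - cutoff_jet F (Suc l) x ((y - x) # vs)) i $ j\<bar>
          \<le> B * norm (y - x) * norm (y - x) * ?P" for j
      proof -
        let ?a = "x i $ j" and ?b = "y i $ j"
        have ab: "\<bar>?b - ?a\<bar> \<le> norm (y - x)" using component_le_norm_linf[of "y - x" i j] by simp
        obtain \<xi> where \<xi>: "F l ?b - F l ?a = F (Suc l) \<xi> * (?b - ?a)" "\<bar>\<xi> - ?a\<bar> \<le> \<bar>?b - ?a\<bar>"
          by (rule scalar_mvt[of "F l" "F (Suc l)" ?b ?a]) (use der l in auto)
        obtain \<zeta> where \<zeta>: "F (Suc l) \<xi> - F (Suc l) ?a = F (Suc (Suc l)) \<zeta> * (\<xi> - ?a)"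
          by (rule scalar_mvt[of "F (Suc l)" "F (Suc (Suc l))" \<xi> ?a]) (use der l in auto)
        have "(cutoff_jet F l y vs - cutoff_jet F l x vs - cutoff_jet F (Suc l) x ((y - x) # vs)) i $ j =
            (F l ?b - F l ?a - F (Suc l) ?a * (?b - ?a)) * (\<Prod>v\<leftarrow>vs. v i $ j)"
          by (simp add: cutoff_jet_apply[OF l'(1)] cutoff_jet_apply[OF l'(2)] algebra_simps)
        also have "F l ?b - F l ?a - F (Suc l) ?a * (?b - ?a) = F (Suc (Suc l)) \<zeta> * (\<xi> - ?a) * (?b - ?a)"
          unfolding \<xi>(1) \<zeta>[symmetric] by (simp add: algebra_simps)
        finally have "\<bar>(cutoff_jet F l y vs - cutoff_jet F l x vs - cutoff_jet F (Suc l) x ((y - x) # vs)) i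
            $ j\<bar> =
            \<bar>F (Suc (Suc l)) \<zeta>\<bar> * \<bar>\<xi> - ?a\<bar> * \<bar>?b - ?a\<bar> * \<bar>\<Prod>v\<leftarrow>vs. v i $ j\<bar>"
          by (simp add: abs_mult)
        also have "\<dots> \<le> B * norm (y - x) * norm (y - x) * ?P"
          using B[of "Suc (Suc l)" \<zeta>] l \<xi>(2) ab B_nonneg by (intro mult_mono prod_components_le) auto
        finally show ?thesis .
      qed
      from norm_vec_le_card[OF this]
      have "norm ((cutoff_jet F l y vs - cutoff_jet F l x vs - cutoff_jet F (Suc l) x ((y - x) # vs)) i) \<le>
          (real CARD('n) * B * ?P * norm (y - x)) * norm (y - x)" by (simp add: mult_ac)
      also have "\<dots> \<le> e * norm (y - x)"
      proof (rule mult_right_mono)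
        show "real CARD('n) * B * ?P * norm (y - x) \<le> e" using near norm_ge_zero[of "y - x"]
          unfolding M_def by (simp only: distrib_left mult_1_right mult.commute[of "norm (y - x)"])
      qed simp
      finally show "norm ((cutoff_jet F l y vs - cutoff_jet F l x vs - cutoff_jet F (Suc l) x ((y - x) #
          vs)) i) \<le> e * norm (y - x)" .
    qed
  qed
qed

lemma jet_cutoff_jet:
  assumes \<Gamma>: "decay_function (\<Gamma> :: int ^ 'm::finite \<Rightarrow> real)"
  shows "jet k UNIV (cutoff_jet F :: nat \<Rightarrow> ('m, real ^ 'n) linf \<Rightarrow> _)"
proof (rule jetI_lipschitz)
  interpret sized "decay_size \<Gamma> :: _ \<Rightarrow> _ \<Rightarrow> ('m, real ^ 'n) linf \<Rightarrow> bool" norm 1 by (rule sized_decay_size[OF \<Gamma>])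
  show "op_bound l (cutoff_jet F l x) (real CARD('n) * B)" if "l \<le> Suc k" for l and x :: "('m, real ^ 'n) linf"
    using mult_bound_op_bound[OF mult_bound_cutoff_jet[OF \<Gamma>, of l x]] that by simp
qed (use cutoff_jet_derivative in auto)

end

section \<open>The conjugacy\<close>

text \<open>The supremum of a size along a family of linear maps. The family contains the identity,
  so that the new norm dominates the old one; the uniform bound \<open>C\<close> gives the
  converse.\<close>

lemma sized_pullback:
  fixes Z :: "'t::comm_monoid_add \<Rightarrow> real \<Rightarrow> 'e::banach \<Rightarrow> bool" and B :: "'s \<Rightarrow> 'e \<Rightarrow> 'e"
  assumes Z: "sized Z norm 1" and B: "\<And>s. linear (B s)" "\<And>s. lin_bound Z (B s) C" and id: "\<And>x. B s0 x = x"
      and C: "0 < C"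
  shows "sized (\<lambda>t c x. \<forall>s. Z t c (B s x)) (\<lambda>x. SUP s. norm (B s x)) C"
proof -
  interpret sized Z norm 1 by (rule Z)
  have nB: "norm (B s x) \<le> C * norm x" for s x
    using B(2)[of s] Z_refl[of x] unfolding lin_bound_def by (metis Z_nrm)
  have bl: "bounded_linear (B s)" for s
    by (rule bounded_linear_intro[where K=C])
      (use linear_add[OF B(1)] linear_scale[OF B(1)] nB in \<open>auto simp: mult.commute\<close>)
  have bdd: "bdd_above (range (\<lambda>s. norm (B s x)))" for x
    using nB by (intro bdd_aboveI2)
  show ?thesis
  proof
    fix t c d and x y :: 'e
    show "0 \<le> c" if "\<forall>s. Z t c (B s x)" using that Z_nonneg by blast
    show "\<forall>s. Z t d (B s x)" if "\<forall>s. Z t c (B s x)" "c \<le> d" using that Z_mono by blast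
    show "\<forall>s. Z t (c + d) (B s (x + y))" if "\<forall>s. Z t c (B s x)" "\<forall>s. Z t d (B s y)"
      using that Z_add by (simp add: linear_add[OF B(1)])
  next
    fix t c s and x :: 'e assume "\<forall>s. Z t c (B s x)"
    then show "\<forall>s'. Z t (\<bar>s\<bar> * c) (B s' (s *\<^sub>R x))" using Z_scaleR by (simp add: linear_scale[OF B(1)])
  next
    fix t show "\<forall>s. Z t 0 (B s 0)" using Z_zero by (simp add: linear_0[OF B(1)])
  next
    fix t c x and X :: "nat \<Rightarrow> 'e" assume "\<And>n. \<forall>s. Z t c (B s (X n))" "X \<longlonglongrightarrow> x"
    then show "\<forall>s. Z t c (B s x)"
      by (intro allI Z_lim[OF _ bounded_linear.tendsto[OF bl, of X x sequentially]]) auto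
  next
    fix t c and f f' :: "real \<Rightarrow> 'e"
    assume f: "\<And>s. s \<in> {0..1} \<Longrightarrow> (f has_vector_derivative f' s) (at s within {0..1})"
      "\<And>s. s \<in> {0..1} \<Longrightarrow> \<forall>u. Z t c (B u (f' s))"
    show "\<forall>u. Z t c (B u (f 1 - f 0))"
    proof
      fix u
      have "Z t c (B u (f 1) - B u (f 0))"
        by (rule Z_mvt[of "\<lambda>s. B u (f s)" "\<lambda>s. B u (f' s)"])
          (use f bounded_linear.has_vector_derivative[OF bl] in auto)
      then show "Z t c (B u (f 1 - f 0))" by (simp add: linear_diff[OF B(1)])
    qed
  next
    fix c and x :: 'e
    show "(\<forall>s. Z 0 c (B s x)) \<longleftrightarrow> (SUP s. norm (B s x)) \<le> c"
      using bdd[of x] by (simp add: Z_nrm cSUP_le_iff)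
    show "norm x \<le> (SUP s. norm (B s x))" using cSUP_upper[OF _ bdd, of s0 x] by (simp add: id)
    show "(SUP s. norm (B s x)) \<le> C * norm x" by (rule cSUP_least) (auto simp: nB)
  qed (rule C)
qed

lemma mult_bound_change:
  assumes m: "mult_bound Z1 k G C" and 1: "\<And>t c x. Z2 t c x \<Longrightarrow> Z1 t (k1 * c) x"
    and 2: "\<And>t c x. Z1 t c x \<Longrightarrow> Z2 t (k2 * c) x" and k: "0 \<le> k1" "0 \<le> k2"
  shows "mult_bound Z2 k G (k2 * (C * k1 ^ k))"
proof (rule mult_boundI)
  show "0 \<le> k2 * (C * k1 ^ k)" using mult_bound_nonneg[OF m] k by simp
  fix l :: "('a \<times> real \<times> 'b) list"
  assume l: "length l = k" "\<And>q. q \<in> set l \<Longrightarrow> Z2 (fst q) (fst (snd q)) (snd (snd q))"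
  let ?l = "map (\<lambda>q. (fst q, k1 * fst (snd q), snd (snd q))) l"
  have *: "Z1 (\<Sum>q\<leftarrow>?l. fst q) (C * (\<Prod>q\<leftarrow>?l. fst (snd q))) (G (map (\<lambda>q. snd (snd q)) ?l))"
    by (rule mult_boundD[OF m]) (use l 1 in auto)
  have p: "(\<Prod>q\<leftarrow>?l. fst (snd q)) = k1 ^ length l * (\<Prod>q\<leftarrow>l. fst (snd q))" by (induction l) auto
  have "Z1 (\<Sum>q\<leftarrow>l. fst q) (C * (k1 ^ k * (\<Prod>q\<leftarrow>l. fst (snd q)))) (G (map (\<lambda>q. snd (snd q)) l))"
    using * unfolding p l(1) by (simp add: o_def)
  from 2[OF this] show "Z2 (\<Sum>q\<leftarrow>l. fst q) (k2 * (C * k1 ^ k)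
      * (\<Prod>q\<leftarrow>l. fst (snd q))) (G (map (\<lambda>q. snd (snd q)) l))"
    by (simp add: mult.assoc)
qed

lemma multilinear_diff:
  "multilinear_map k G \<Longrightarrow> multilinear_map k G' \<Longrightarrow> multilinear_map k (\<lambda>vs. G vs - G' vs)"
  unfolding multilinear_map_def by (auto intro: linear_compose_sub)

lemma multilinear_Cons: "multilinear_map (Suc k) G \<Longrightarrow> multilinear_map k (\<lambda>vs. G (v # vs))"
  unfolding multilinear_map_def
proof (intro allI impI)
  fix vs ws :: "'a list"
  assume a: "\<forall>vs ws. length vs + 1 + length ws = Suc k \<longrightarrow> linear (\<lambda>u. G (vs @ u # ws))"
      "length vs + 1 + length ws = k"
  have "linear (\<lambda>u. G ((v # vs) @ u # ws))" by (rule a(1)[rule_format]) (use a(2) in simp)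
  then show "linear (\<lambda>u. G (v # vs @ u # ws))" by simp
qed

lemma multilinear_scale: "multilinear_map k G \<Longrightarrow> multilinear_map k (\<lambda>vs. c *\<^sub>R G vs)"
  unfolding multilinear_map_def by (auto intro: linear_compose_scale_right)

context
  fixes N :: "real ^ 'n \<Rightarrow> real" and V :: "('m::finite, real ^ 'n) linf set" and \<Gamma> :: "int ^ 'm \<Rightarrow> real"
  assumes N: "is_norm N" and V: "open V" and \<Gamma>: "decay_function \<Gamma>"
begin

text \<open>Frechet differentiability in operator norm is evaluated at fixed arguments; the
  constants of the two norms are absorbed by applying the hypothesis with a smaller
  \<open>e\<close>.\<close>

lemma jet_of_frechet_derivs:
  assumes f: "frechet_derivs N r V F D" and C: "\<And>j x. j \<le> r \<Longrightarrow> x \<in> V \<Longrightarrow> op_bound j (D j x) C"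
  shows "jet r V D"
proof -
  obtain c2 C2 where c2: "c2 > 0" "C2 > 0" "\<And>x :: ('m, real ^ 'n) linf. c2 * norm x \<le> supn N x"
    "\<And>x :: ('m, real ^ 'n) linf. supn N x \<le> C2 * norm x"
    using supn_equivalent[OF N] by metis
  have ml: "multilinear_map j (D j x)" if "j \<le> r" "x \<in> V" for j x
    using f that unfolding frechet_derivs_def by blast
  show ?thesis unfolding jet_def
  proof (intro conjI ballI allI impI)
    show "\<exists>C. \<forall>j\<le>r. \<forall>x\<in>V. op_bound j (D j x) C" using C by blast
    fix x assume x: "x \<in> V"
    have inV: "\<forall>\<^sub>F y in nhds x. y \<in> V" by (rule eventually_nhds_in_open[OF V x])
    show "((\<lambda>y. D j y vs) has_derivative (\<lambda>h. D (Suc j) x (h # vs))) (at x)"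
      if j: "j < r" and l: "length vs = j" for j vs
    proof (rule has_derivative_eventuallyI)
      show "bounded_linear (\<lambda>h. D (Suc j) x (h # vs))"
        using multilinear_bounded_linear[OF ml[of "Suc j" x] C[of "Suc j" x], of "[]" vs] j x l by simp
      fix e :: real assume e: "0 < e"
      obtain \<kappa> where \<kappa>: "0 \<le> \<kappa>" "\<And>K G. 0 \<le> K \<Longrightarrow> multilinear_map j G \<Longrightarrow> mult_norm N j G \<le> ennreal K \<Longrightarrow>
          op_bound j (G :: ('m, real ^ 'n) linf list \<Rightarrow> _) (\<kappa> * K)"
        using op_bound_of_mult_norm[OF N \<Gamma>, of j] by blast
      let ?P = "\<Prod>v\<leftarrow>vs. norm v"
      have P: "0 \<le> ?P" by (rule prod_norm_nonneg)
      define M where "M = \<kappa> * C2 * ?P + 1"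
      have M: "0 < M" unfolding M_def using \<kappa> c2 P by (simp add: add_nonneg_pos)
      have "0 < e / M" using e M by simp
      then have "\<forall>\<^sub>F y in nhds x. mult_norm N j (\<lambda>vs. D j y vs - D j x vs - D (Suc j) x ((y - x) # vs))
          \<le> ennreal (e / M * supn N (y - x))"
        using f j x unfolding frechet_derivs_def by blast
      then show "\<forall>\<^sub>F y in nhds x. norm (D j y vs - D j x vs - D (Suc j) x ((y - x) # vs)) \<le> e * norm (y - x)"
        using inV
      proof eventually_elim
        case (elim y)
        have s: "0 \<le> supn N (y - x)" using c2(1) c2(3)[of "y - x"]
            by (meson less_imp_le mult_nonneg_nonneg norm_ge_zero order_trans)
        have "op_bound j (\<lambda>vs. D j y vs - D j x vs - D (Suc j) x ((y - x) # vs)) (\<kappa> * (e / M * supn N (y - x)))"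
          by (rule \<kappa>(2)) (use elim e M s j x in \<open>auto intro!: multilinear_diff multilinear_Cons ml\<close>)
        from op_boundD[OF this l]
        have "norm (D j y vs - D j x vs - D (Suc j) x ((y - x) # vs)) \<le> \<kappa> * (e / M * supn N (y - x)) * ?P" .
        also have "\<dots> = (\<kappa> * ?P) * (e / M) * supn N (y - x)" by simp
        also have "\<dots> \<le> (\<kappa> * ?P) * (e / M) * (C2 * norm (y - x))"
          using c2(4) \<kappa> P e M by (intro mult_left_mono) auto
        also have "\<dots> = (e * norm (y - x)) * ((\<kappa> * C2 * ?P) / M)" by simp
        also have "\<dots> \<le> (e * norm (y - x)) * 1"
          using e M unfolding M_def by (intro mult_left_mono) auto
        finally show ?case by simp
      qed
    qed
    fix e :: real assume e: "0 < e"
    obtain \<kappa> where \<kappa>: "0 \<le> \<kappa>" "\<And>K G. 0 \<le> K \<Longrightarrow> multilinear_map r G \<Longrightarrow> mult_norm N r G \<le> ennreal K \<Longrightarrow>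
        op_bound r (G :: ('m, real ^ 'n) linf list \<Rightarrow> _) (\<kappa> * K)"
      using op_bound_of_mult_norm[OF N \<Gamma>, of r] by blast
    have "0 < e / (\<kappa> + 1)" using e \<kappa>(1) by (simp add: add_nonneg_pos)
    then have "\<forall>\<^sub>F y in nhds x. mult_norm N r (\<lambda>vs. D r y vs - D r x vs) \<le> ennreal (e / (\<kappa> + 1))"
      using f x unfolding frechet_derivs_def by blast
    then show "\<forall>\<^sub>F y in nhds x. op_bound r (\<lambda>vs. D r y vs - D r x vs) e"
      using inV
    proof eventually_elim
      case (elim y)
      have "op_bound r (\<lambda>vs. D r y vs - D r x vs) (\<kappa> * (e / (\<kappa> + 1)))"
        by (rule \<kappa>(2)) (use elim e \<kappa>(1) x in \<open>auto intro!: multilinear_diff ml\<close>)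
      then show ?case by (rule pl.mult_bound_mono) (use e \<kappa>(1) in \<open>simp add: field_simps\<close>)
    qed
  qed (rule V)
qed

lemma frechet_derivs_of_jet:
  assumes J: "jet r V D" and F: "\<And>x. x \<in> V \<Longrightarrow> D 0 x [] = F x"
  shows "frechet_derivs N r V F D"
  unfolding frechet_derivs_def
proof (intro conjI ballI allI impI)
  obtain c2 C2 where c2: "c2 > 0" "C2 > 0" "\<And>x :: ('m, real ^ 'n) linf. c2 * norm x \<le> supn N x"
    "\<And>x :: ('m, real ^ 'n) linf. supn N x \<le> C2 * norm x"
    using supn_equivalent[OF N] by metis
  have conv: "\<exists>\<kappa>\<ge>0. \<forall>C G. op_bound j G C \<longrightarrow> mult_norm N j (G :: ('m, real ^ 'n) linf list \<Rightarrow> _)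
      \<le> ennreal (\<kappa> * C)" for j
    by (rule mult_norm_of_op_bound[OF N \<Gamma>])
  fix x assume x: "x \<in> V"
  show "D 0 x [] = F x" by (rule F[OF x])
  show "multilinear_map j (D j x)" if "j \<le> r" for j by (rule jet_multilinear[OF J that x])
  show "mult_norm N j (D j x) < \<infinity>" if j: "j \<le> r" for j
  proof -
    obtain C where "op_bound j (D j x) C" by (rule jet_bound[OF J]) (use j x in blast)
    then obtain K where "mult_norm N j (D j x) \<le> ennreal K" using conv[of j] by blast
    then show ?thesis unfolding infinity_ennreal_def by (rule le_less_trans[OF _ ennreal_less_top])
  qed
  show "\<forall>\<^sub>F y in nhds x. mult_norm N j (\<lambda>vs. D j y vs - D j x vs - D (Suc j) x ((y - x) # vs))
      \<le> ennreal (e * supn N (y - x))"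
    if j: "j < r" and e: "0 < e" for j e
  proof -
    obtain \<kappa> where \<kappa>: "0 \<le> \<kappa>" "\<And>C G. op_bound j G C \<Longrightarrow>
        mult_norm N j (G :: ('m, real ^ 'n) linf list \<Rightarrow> _) \<le> ennreal (\<kappa> * C)"
      using conv[of j] by blast
    have "0 < e * c2 / (\<kappa> + 1)" using e c2 \<kappa>(1) by (simp add: add_nonneg_pos)
    from jet_taylor[OF J j x this] show ?thesis
    proof eventually_elim
      case (elim y)
      from \<kappa>(2)[OF elim] show ?case
      proof (rule order_trans, intro ennreal_leI)
        have "\<kappa> * (e * c2 / (\<kappa> + 1) * norm (y - x)) = (e * (c2 * norm (y - x))) * (\<kappa> / (\<kappa> + 1))" by simp
        also have "\<dots> \<le> (e * (c2 * norm (y - x))) * 1"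
          using e c2(1) \<kappa>(1) by (intro mult_left_mono) auto
        also have "\<dots> \<le> e * supn N (y - x)" using c2(3)[of "y - x"] e by simp
        finally show "\<kappa> * (e * c2 / (\<kappa> + 1) * norm (y - x)) \<le> e * supn N (y - x)" .
      qed
    qed
  qed
  show "\<forall>\<^sub>F y in nhds x. mult_norm N r (\<lambda>vs. D r y vs - D r x vs) \<le> ennreal e" if e: "0 < e" for e
  proof -
    obtain \<kappa> where \<kappa>: "0 \<le> \<kappa>" "\<And>C G. op_bound r G C \<Longrightarrow>
        mult_norm N r (G :: ('m, real ^ 'n) linf list \<Rightarrow> _) \<le> ennreal (\<kappa> * C)"
      using conv[of r] by blast
    have "0 < e / (\<kappa> + 1)" using e \<kappa>(1) by (simp add: add_nonneg_pos)
    from jet_opcont[OF J order_refl x this] show ?thesis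
    proof eventually_elim
      case (elim y)
      from \<kappa>(2)[OF elim] show ?case
        by (rule order_trans, intro ennreal_leI) (use e \<kappa>(1) in \<open>simp add: field_simps\<close>)
    qed
  qed
qed

text \<open>One constant \<open>M\<close> for all orders. Order \<open>0\<close> is separate, since
  the definition bounds \<open>F\<close> itself in \<open>supn\<close> rather than as a multilinear
  map.\<close>

lemma C_decay_bounds:
  assumes F: "F \<in> C_decay \<Gamma> N r V"
  obtains D M where "jet r V D" "\<And>x. x \<in> V \<Longrightarrow> D 0 x [] = F x" "1 \<le> M"
    "\<And>j x. j \<le> r \<Longrightarrow> x \<in> V \<Longrightarrow> mult_bound (decay_size \<Gamma>) j (D j x) M"
proof -
  interpret sized "decay_size \<Gamma> :: _ \<Rightarrow> _ \<Rightarrow> ('m, real ^ 'n) linf \<Rightarrow> bool" norm 1 by (rule sized_decay_size[OF \<Gamma>])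
  obtain D where D: "frechet_derivs N r V F D" "(SUP x\<in>V. ennreal (supn N (F x))) < \<infinity>"
    "\<And>j x. j \<in> {1..r} \<Longrightarrow> x \<in> V \<Longrightarrow> D j x \<in> mult_decay \<Gamma> N j"
    "\<And>j. j \<in> {1..r} \<Longrightarrow> (SUP x\<in>V. mult_norm_decay \<Gamma> N j (D j x)) < \<infinity>"
    using F unfolding C_decay_def by blast
  have D0: "D 0 x [] = F x" if "x \<in> V" for x using D(1) that unfolding frechet_derivs_def by blast
  obtain c2 C2 where c2: "c2 > 0" "C2 > 0" "\<And>x :: ('m, real ^ 'n) linf. c2 * norm x \<le> supn N x"
    "\<And>x :: ('m, real ^ 'n) linf. supn N x \<le> C2 * norm x"
    using supn_equivalent[OF N] by metis
  have ex: "\<exists>C. \<forall>x\<in>V. mult_bound (decay_size \<Gamma>) j (D j x) C" if j: "j \<le> r" for j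
  proof (cases "j = 0")
    case True
    obtain K where K: "0 \<le> K" "(SUP x\<in>V. ennreal (supn N (F x))) = ennreal K"
      using D(2) by (cases "SUP x\<in>V. ennreal (supn N (F x))") auto
    have "mult_bound (decay_size \<Gamma>) 0 (D 0 x) (K / c2)" if x: "x \<in> V" for x
    proof (rule mult_boundI)
      have "ennreal (supn N (F x)) \<le> ennreal K" unfolding K(2)[symmetric] by (rule SUP_upper[OF x])
      then have "supn N (F x) \<le> K" using K(1) by simp
      then have "norm (F x) \<le> K / c2" using c2(1) c2(3)[of "F x"] by (simp add: pos_le_divide_eq mult.commute)
      then have Z: "decay_size \<Gamma> 0 (K / c2) (D 0 x [])" by (simp add: Z_nrm D0[OF x])
      fix l :: "((int ^ 'm) multiset \<times> real \<times> ('m, real ^ 'n) linf) list" assume "length l = 0"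
      then show "decay_size \<Gamma> (\<Sum>q\<leftarrow>l. fst q) (K / c2 * (\<Prod>q\<leftarrow>l. fst (snd q))) (D 0 x (map (\<lambda>q. snd (snd q)) l))"
        using Z by simp
    qed (use K c2 in simp)
    then show ?thesis using True by blast
  next
    case False
    then have j1: "j \<in> {1..r}" using j by simp
    obtain K where K: "0 \<le> K" "(SUP x\<in>V. mult_norm_decay \<Gamma> N j (D j x)) = ennreal K"
      using D(4)[OF j1] by (cases "SUP x\<in>V. mult_norm_decay \<Gamma> N j (D j x)") auto
    obtain \<kappa> where \<kappa>: "\<And>K G. 0 \<le> K \<Longrightarrow> multilinear_map j G \<Longrightarrow> mult_norm_decay \<Gamma> N j G \<le> ennreal K \<Longrightarrow>
       mult_bound (decay_size \<Gamma>) j (G :: ('m, real ^ 'n) linf list \<Rightarrow> _) (\<kappa> * K)"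
      using mult_bound_of_mult_norm_decay[OF N \<Gamma>, of j] by blast
    have "mult_bound (decay_size \<Gamma>) j (D j x) (\<kappa> * K)" if x: "x \<in> V" for x
    proof (rule \<kappa>[OF K(1)])
      show "multilinear_map j (D j x)" using D(3)[OF j1 x] by (simp add: mult_decay_def)
      show "mult_norm_decay \<Gamma> N j (D j x) \<le> ennreal K" unfolding K(2)[symmetric] by (rule SUP_upper[OF x])
    qed
    then show ?thesis by blast
  qed
  have "\<forall>j\<in>{..r}. \<exists>C. \<forall>x\<in>V. mult_bound (decay_size \<Gamma>) j (D j x) C" using ex by simp
  from bchoice[OF this] obtain Cf where Cf: "\<And>j x. j \<le> r \<Longrightarrow> x \<in> V \<Longrightarrow>
      mult_bound (decay_size \<Gamma>) j (D j x) (Cf j)" by auto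
  define M where "M = max 1 (Max (Cf ` {..r}))"
  have M: "mult_bound (decay_size \<Gamma>) j (D j x) M" if "j \<le> r" "x \<in> V" for j x
  proof (rule mult_bound_mono[OF Cf[OF that]])
    have "Cf j \<le> Max (Cf ` {..r})" using that by (intro Max_ge) auto
    then show "Cf j \<le> M" by (simp add: M_def)
  qed
  have "jet r V D" by (rule jet_of_frechet_derivs[OF D(1)]) (use mult_bound_op_bound[OF M] in auto)
  then show thesis by (rule that[OF _ D0 _ M]) (auto simp: M_def)
qed

lemma C_decay_of_jet:
  assumes J: "jet r V D" and F: "\<And>x. x \<in> V \<Longrightarrow> D 0 x [] = F x"
    and M: "\<And>j x. j \<le> r \<Longrightarrow> x \<in> V \<Longrightarrow> mult_bound (decay_size \<Gamma>) j (D j x) M"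
  shows "F \<in> C_decay \<Gamma> N r V"
proof -
  interpret sized "decay_size \<Gamma> :: _ \<Rightarrow> _ \<Rightarrow> ('m, real ^ 'n) linf \<Rightarrow> bool" norm 1 by (rule sized_decay_size[OF \<Gamma>])
  obtain c2 C2 where c2: "c2 > 0" "C2 > 0" "\<And>x :: ('m, real ^ 'n) linf. c2 * norm x \<le> supn N x"
    "\<And>x :: ('m, real ^ 'n) linf. supn N x \<le> C2 * norm x"
    using supn_equivalent[OF N] by metis
  have fin: "e < \<infinity>" if "e \<le> ennreal K" for e K
    using that unfolding infinity_ennreal_def by (rule le_less_trans[OF _ ennreal_less_top])
  have "(SUP x\<in>V. ennreal (supn N (F x))) \<le> ennreal (C2 * M)"
  proof (intro SUP_least ennreal_leI)
    fix x assume x: "x \<in> V"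
    have "norm (F x) \<le> M" using mult_boundD[OF M[of 0, OF _ x], of "[]"] F[OF x] by (simp add: Z_nrm)
    then show "supn N (F x) \<le> C2 * M" using c2(2) c2(4)[of "F x"]
        by (meson less_imp_le mult_left_mono order_trans)
  qed
  moreover have "(\<forall>x\<in>V. D j x \<in> mult_decay \<Gamma> N j) \<and> (SUP x\<in>V. mult_norm_decay \<Gamma> N j (D j x)) < \<infinity>"
      if j: "j \<le> r" for j
  proof -
    obtain \<kappa> where \<kappa>: "\<And>C G. mult_bound (decay_size \<Gamma>) j G C \<Longrightarrow>
        mult_norm_decay \<Gamma> N j (G :: ('m, real ^ 'n) linf list \<Rightarrow> _) \<le> ennreal (\<kappa> * C)"
      using mult_norm_decay_of_mult_bound[OF N \<Gamma>, of j] by blast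
    have b: "mult_norm_decay \<Gamma> N j (D j x) \<le> ennreal (\<kappa> * M)" if "x \<in> V" for x by (rule \<kappa>[OF M[OF j that]])
    then have "(SUP x\<in>V. mult_norm_decay \<Gamma> N j (D j x)) \<le> ennreal (\<kappa> * M)" by (rule SUP_least)
    then show ?thesis using b jet_multilinear[OF J j] fin unfolding mult_decay_def infinity_ennreal_def by blast
  qed
  ultimately show ?thesis
    unfolding C_decay_def using frechet_derivs_of_jet[OF J F] fin by (auto intro!: exI[of _ D])
qed

end

section \<open>The adapted size and the assembly of the conjugacy\<close>

text \<open>The adapted size is the supremum of the sizes of \<open>b\<^sup>-\<^sup>n A\<^sup>n x\<close>
    and \<open>a\<^sup>-\<^sup>n A\<^sup>-\<^sup>n x\<close>. Both families are needed at the same time;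
  going from one to the other costs \<open>1 / a \<le> b\<close> or \<open>1 / b \<le> a\<close>.\<close>

lemma adapted_size:
  fixes Z :: "'t::comm_monoid_add \<Rightarrow> real \<Rightarrow> 'e::banach \<Rightarrow> bool"
  assumes Z: "sized Z norm 1" and lin: "linear A" "linear Ai"
    and inv: "\<And>x. A (Ai x) = x" "\<And>x. Ai (A x) = x"
    and pw: "\<And>n. lin_bound Z (A ^^ n) (C * b ^ n)" "\<And>n. lin_bound Z (Ai ^^ n) (C * a ^ n)"
    and ab: "0 < b" "0 < a" "1 \<le> a * b" and C: "1 \<le> C"
  obtains Z' nrm where "sized Z' nrm C" "lin_bound Z' A b" "lin_bound Z' Ai a"
    "\<And>t c x. Z' t c x \<Longrightarrow> Z t c x" "\<And>t c x. Z t c x \<Longrightarrow> Z' t (C * c) x"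
proof -
  interpret sized Z norm 1 by (rule Z)
  define B where "B s x = (case s of Inl n \<Rightarrow> (1 / b) ^ n *\<^sub>R (A ^^ n) x | Inr n \<Rightarrow> (1 / a) ^ n *\<^sub>R (Ai ^^ n) x)"
    for s :: "nat + nat" and x
  have linpow: "linear (T ^^ n)" if "linear T" for T :: "'e \<Rightarrow> 'e" and n
    by (induction n) (use that in \<open>auto intro!: linearI simp: linear_add linear_scale\<close>)
  have linB: "linear (B s)" for s
    unfolding B_def by (cases s) (auto intro!: linear_compose_scale_right linpow lin)
  have dbB: "lin_bound Z (B s) C" for s
    unfolding lin_bound_def
  proof (intro conjI allI impI)
    fix t c x assume x: "Z t c x"
    show "Z t (C * c) (B s x)"
    proof (cases s)
      case (Inl n)
      have "Z t (C * b ^ n * c) ((A ^^ n) x)" using pw(1)[of n] x unfolding lin_bound_def by blast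
      from Z_scaleR[OF this, of "(1 / b) ^ n"] show ?thesis
        using ab(1) by (simp add: B_def Inl power_divide)
    next
      case (Inr n)
      have "Z t (C * a ^ n * c) ((Ai ^^ n) x)" using pw(2)[of n] x unfolding lin_bound_def by blast
      from Z_scaleR[OF this, of "(1 / a) ^ n"] show ?thesis
        using ab(2) by (simp add: B_def Inr power_divide)
    qed
  qed (use C in simp)
  define Z' where "Z' t c x \<longleftrightarrow> (\<forall>s. Z t c (B s x))" for t c x
  have B0: "B (Inl 0) x = x" for x by (simp add: B_def)
  have step: "Z t (d * c) (B s' y)" if "Z' t c x" "B s' y = k *\<^sub>R B s x" "\<bar>k\<bar> \<le> d" for t c x y s s' k d
  proof (rule Z_mono)
    have "Z t c (B s x)" using that(1) by (simp add: Z'_def)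
    then show "Z t (\<bar>k\<bar> * c) (B s' y)" unfolding that(2) by (rule Z_scaleR)
    show "\<bar>k\<bar> * c \<le> d * c" using that(3) Z_nonneg[OF \<open>Z t c (B s x)\<close>] by (rule mult_right_mono)
  qed
  have "sized Z' (\<lambda>x. SUP s. norm (B s x)) C"
    unfolding Z'_def by (rule sized_pullback[where B=B and ?s0.0="Inl 0", OF Z linB dbB B0]) (use C in simp)
  moreover have "lin_bound Z' A b" unfolding lin_bound_def
  proof (intro conjI allI impI)
    fix t c x assume x: "Z' t c x"
    show "Z' t (b * c) (A x)" unfolding Z'_def
    proof
      fix s :: "nat + nat"
      show "Z t (b * c) (B s (A x))"
      proof (cases s)
        case (Inl n)
        show ?thesis by (rule step[OF x, of _ _ b "Inl (Suc n)"])
            (use ab in \<open>auto simp: B_def Inl funpow_swap1\<close>)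
      next
        case (Inr n)
        show ?thesis
        proof (cases n)
          case 0
          \<comment> \<open>The identity belongs to both families, so applying \<open>A\<close> to
            it leads into the forward one.\<close>
          show ?thesis by (rule step[OF x, of _ _ b "Inl (Suc 0)"]) (use ab in \<open>auto simp: B_def Inr 0\<close>)
        next
          case (Suc k)
          \<comment> \<open>Here \<open>A\<close> cancels one power of the inverse; the weights
            leave the factor \<open>1 / a\<close>.\<close>
          show ?thesis by (rule step[OF x, of _ _ "1 / a" "Inr k"])
              (use ab in \<open>auto simp: B_def Inr Suc funpow_swap1[of Ai] inv field_simps\<close>)
        qed
      qed
    qed
  qed (use ab in simp)
  moreover have "lin_bound Z' Ai a" unfolding lin_bound_def
  proof (intro conjI allI impI)
    fix t c x assume x: "Z' t c x"
    show "Z' t (a * c) (Ai x)" unfolding Z'_def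
    proof
      fix s :: "nat + nat"
      show "Z t (a * c) (B s (Ai x))"
      proof (cases s)
        case (Inr n)
        show ?thesis by (rule step[OF x, of _ _ a "Inr (Suc n)"])
            (use ab in \<open>auto simp: B_def Inr funpow_swap1\<close>)
      next
        case (Inl n)
        show ?thesis
        proof (cases n)
          case 0
          show ?thesis by (rule step[OF x, of _ _ a "Inr (Suc 0)"]) (use ab in \<open>auto simp: B_def Inl 0\<close>)
        next
          case (Suc k)
          show ?thesis by (rule step[OF x, of _ _ "1 / b" "Inl k"])
              (use ab in \<open>auto simp: B_def Inl Suc funpow_swap1[of A] inv field_simps\<close>)
        qed
      qed
    qed
  qed (use ab in simp)
  moreover have "Z t c x" if "Z' t c x" for t c x
    using that B0[of x] unfolding Z'_def by metis
  moreover have "Z' t (C * c) x" if "Z t c x" for t c x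
    using that dbB unfolding Z'_def lin_bound_def by blast
  ultimately show thesis by (rule that)
qed

lemma linf_cutoff:
  fixes \<Gamma> :: "int ^ 'm::finite \<Rightarrow> real"
  assumes \<Gamma>: "decay_function \<Gamma>" and \<epsilon>: "0 < \<epsilon>"
  obtains \<eta> K and P :: "nat \<Rightarrow> ('m, real ^ 'n) linf \<Rightarrow> ('m, real ^ 'n) linf list \<Rightarrow> ('m, real ^ 'n) linf"
  where "0 < \<eta>" "1 \<le> K" "jet r UNIV P" "\<And>x. norm x \<le> \<eta> \<Longrightarrow> P 0 x [] = x" "\<And>x. norm (P 0 x []) \<le> \<epsilon>"
    "\<And>j x. j \<le> r \<Longrightarrow> mult_bound (decay_size \<Gamma>) j (P j x) K"
proof -
  interpret sized "decay_size \<Gamma> :: _ \<Rightarrow> _ \<Rightarrow> ('m, real ^ 'n) linf \<Rightarrow> bool" norm 1 by (rule sized_decay_size[OF \<Gamma>])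
  define \<epsilon>' where "\<epsilon>' = \<epsilon> / real CARD('n)"
  have \<epsilon>': "0 < \<epsilon>'" "real CARD('n) * \<epsilon>' = \<epsilon>" using \<epsilon> by (simp_all add: \<epsilon>'_def)
  obtain \<eta> B and F :: "nat \<Rightarrow> real \<Rightarrow> real" where F: "0 < \<eta>" "\<And>t. \<bar>t\<bar> \<le> \<eta> \<Longrightarrow> F 0 t = t" "\<And>t. \<bar>F 0 t\<bar> \<le> \<epsilon>'"
    "\<And>l t. l < Suc (Suc r) \<Longrightarrow> (F l has_real_derivative F (Suc l) t) (at t)" "\<And>l t. l \<le> Suc (Suc r) \<Longrightarrow> \<bar>F l t\<bar> \<le> B"
    using scalar_cutoff_small[OF \<epsilon>'(1), of "Suc r"] by blast
  note ap = cutoff_jet_apply[of r F B, OF F(4,5)]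
  define K where "K = max 1 (real CARD('n) * B)"
  show thesis
  proof (rule that[of \<eta> K "cutoff_jet F"])
    show "jet r UNIV (cutoff_jet F :: nat \<Rightarrow> ('m, real ^ 'n) linf \<Rightarrow> _)"
        by (rule jet_cutoff_jet[of r F B, OF F(4,5) \<Gamma>])
    fix x :: "('m, real ^ 'n) linf"
    show "norm (cutoff_jet F 0 x []) \<le> \<epsilon>"
    proof (rule norm_bound)
      fix i
      have "\<bar>cutoff_jet F 0 x [] i $ j\<bar> \<le> \<epsilon>'" for j using F(3) by (simp add: ap)
      from norm_vec_le_card[OF this] show "norm (cutoff_jet F 0 x [] i) \<le> \<epsilon>" by (simp add: \<epsilon>'(2))
    qed
    show "cutoff_jet F 0 x [] = x" if "norm x \<le> \<eta>"
    proof (rule bcontfun_eqI)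
      fix i show "cutoff_jet F 0 x [] i = x i"
        using F(2) component_le_norm_linf[of x i] that by (auto simp: ap vec_eq_iff intro: order_trans)
    qed
    show "mult_bound (decay_size \<Gamma>) j (cutoff_jet F j x) K" if "j \<le> r" for j
      by (rule mult_bound_mono[OF mult_bound_cutoff_jet[of r F B, OF F(4,5) \<Gamma>]]) (use that in \<open>auto simp:
          K_def\<close>)
  qed (use F(1) in \<open>auto simp: K_def\<close>)
qed

text \<open>\<open>L > ln \<alpha> / ln \<beta>\<close> means \<open>\<beta> ^ L < \<alpha>\<close>,
  as \<open>ln \<beta>\<close> is negative. The inequality is strict, so it survives enlarging
  \<open>\<beta>\<close> to \<open>b\<close> and \<open>1 / \<alpha>\<close> to \<open>a\<close>. As
  \<open>\<alpha> \<le> \<beta>\<close>, the quotient is at least \<open>1\<close>, hence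
  \<open>2 \<le> L\<close>.\<close>

lemma spectral_gap_rates:
  fixes \<alpha> \<beta> :: real
  assumes "0 < \<alpha>" "\<alpha> \<le> \<beta>" "\<beta> < 1" and L: "L = nat \<lfloor>ln \<alpha> / ln \<beta>\<rfloor> + 1"
  obtains a b where "\<beta> < b" "b < 1" "1 / \<alpha> < a" "a * b ^ L < 1" "1 \<le> a * b" "2 \<le> L"
proof -
  let ?\<nu> = "ln \<alpha> / ln \<beta>"
  have \<beta>0: "0 < \<beta>" and ln: "ln \<beta> < 0" "ln \<alpha> \<le> ln \<beta>" using assms by auto
  have \<nu>1: "1 \<le> ?\<nu>" using ln by (simp add: le_divide_eq)
  have L2: "2 \<le> L" using \<nu>1 unfolding L by linarith
  have "?\<nu> < real L" using \<nu>1 unfolding L by linarith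
  then have "real L * ln \<beta> < ln \<alpha>" using ln(1) by (simp add: divide_less_eq)
  then have "ln (\<beta> ^ L) < ln \<alpha>" using \<beta>0 by (simp add: ln_realpow)
  then have lt: "\<beta> ^ L < \<alpha>" using assms(1) \<beta>0 by (subst (asm) ln_less_cancel_iff) auto
  have "((\<lambda>t. t ^ L) \<longlongrightarrow> \<beta> ^ L) (at_right \<beta>)" by (intro tendsto_intros)
  then have "\<forall>\<^sub>F t in at_right \<beta>. t ^ L < \<alpha>" by (rule order_tendstoD) (rule lt)
  moreover have "\<forall>\<^sub>F t in at_right \<beta>. t < 1"
    by (rule order_tendstoD(2)[OF tendsto_ident_at assms(3)])
  ultimately have "\<forall>\<^sub>F t in at_right \<beta>. \<beta> < t \<and> t < 1 \<and> t ^ L < \<alpha>"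
    using eventually_at_right_less[of \<beta>] by eventually_elim auto
  from eventually_happens'[OF _ this] obtain b where b: "\<beta> < b" "b < 1" "b ^ L < \<alpha>"
    by (auto simp: trivial_limit_at_right_real)
  have b0: "0 < b" using b(1) \<beta>0 by linarith
  then have bL: "0 < b ^ L" by simp
  have "1 / \<alpha> < 1 / b ^ L" using b(3) bL by (intro divide_strict_left_mono) auto
  from dense[OF this] obtain a where a: "1 / \<alpha> < a" "a < 1 / b ^ L" by blast
  have "a * b ^ L < 1" using a(2) bL by (simp add: pos_less_divide_eq)
  \<comment> \<open>The compatibility of the two families in \<open>adapted_size\<close>; it follows
    from \<open>1 / \<alpha> < a\<close> and \<open>\<alpha> \<le> \<beta> < b\<close>.\<close>
  moreover have "1 \<le> a * b"
  proof -
    have "1 = 1 / \<alpha> * \<alpha>" using assms(1) by simp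
    also have "\<dots> \<le> a * b"
    proof (rule mult_mono)
      have "0 < 1 / \<alpha>" using assms(1) by simp
      then show "0 \<le> a" using a(1) by linarith
    qed (use a(1) b(1) assms(1,2) in auto)
    finally show ?thesis .
  qed
  ultimately show thesis by (rule that[OF b(1,2) a(1) _ _ L2])
qed

theorem theorem8:
  fixes N :: "real ^ 'n \<Rightarrow> real"
    and NC :: "complex ^ 'n \<Rightarrow> real"
    and \<Gamma> :: "int ^ 'm \<Rightarrow> real"
    and U :: "('m::finite, real ^ 'n) linf set"
    and F A :: "('m, real ^ 'n) linf \<Rightarrow> ('m, real ^ 'n) linf"
    and r r\<^sub>0 :: nat
    and \<alpha> \<beta> \<nu> :: real
  assumes "is_norm N"
    and "is_norm NC" and "extends_norm NC N"
    and "decay_function \<Gamma>"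
    and "open U" and "0 \<in> U"
    and "r \<ge> 1" and "F \<in> C_decay \<Gamma> N r U" and "F 0 = 0"
    and "(F has_derivative A) (at 0)"
    and "\<alpha> = Inf (cmod ` Spec_decay \<Gamma> NC A)"
    and "\<beta> = Sup (cmod ` Spec_decay \<Gamma> NC A)"
    and "\<nu> = ln \<alpha> / ln \<beta>"
    and "r\<^sub>0 = nat \<lfloor>\<nu>\<rfloor> + 1"
    and "0 \<notin> Spec_decay \<Gamma> NC A"
    and "Spec_decay \<Gamma> NC A \<subseteq> ball 0 1"
    and "r \<ge> r\<^sub>0"
  shows "\<exists>H R. polynomial_decay \<Gamma> N r\<^sub>0 H \<and>
           R \<in> C_decay \<Gamma> N r UNIV \<and> R 0 = 0 \<and> (R has_derivative (\<lambda>h. h)) (at 0) \<and>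
           (\<exists>U\<^sub>1. open U\<^sub>1 \<and> 0 \<in> U\<^sub>1 \<and> U\<^sub>1 \<subseteq> U \<and> (\<forall>x\<in>U\<^sub>1. R (F x) = H (R x)))"
proof -
  note N = assms(1) and NC = assms(2) and \<Gamma> = assms(4) and U = assms(5,6)
  interpret w: sized "decay_size \<Gamma> :: _ \<Rightarrow> _ \<Rightarrow> ('m, real ^ 'n) linf \<Rightarrow> bool" norm 1
      by (rule sized_decay_size[OF \<Gamma>])
  obtain D M where D: "jet r U D" "\<And>x. x \<in> U \<Longrightarrow> D 0 x [] = F x" "1 \<le> M"
    "\<And>j x. j \<le> r \<Longrightarrow> x \<in> U \<Longrightarrow> mult_bound (decay_size \<Gamma>) j (D j x) M"
    using C_decay_bounds[OF N U(1) \<Gamma> assms(8)] by metis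
  have "((\<lambda>y. D 0 y []) has_derivative (\<lambda>h. D (Suc 0) 0 [h])) (at 0)"
    using jet_der[OF D(1), of 0 0 "[]"] assms(7) U by simp
  then have "(F has_derivative (\<lambda>h. D (Suc 0) 0 [h])) (at 0)"
    by (rule has_derivative_transform_within_open[OF _ U]) (simp add: D(2))
  from has_derivative_unique[OF this assms(10)] have DA: "D (Suc 0) 0 [h] = A h" for h
    by (rule fun_cong)
  have linA: "linear A" using assms(10) by (rule has_derivative_linear)
  have dbA: "lin_bound (decay_size \<Gamma>) A M" unfolding lin_bound_def
  proof (intro conjI allI impI)
    fix t c and x :: "('m, real ^ 'n) linf" assume x: "decay_size \<Gamma> t c x"
    show "decay_size \<Gamma> t (M * c) (A x)"
      using mult_boundD[OF D(4)[of "Suc 0" 0], of "[(t, c, x)]"] x assms(7) U by (simp add: DA)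
  qed (use D(3) in simp)
  note sp = spectral_power_bounds[OF \<Gamma> NC linA dbA assms(16,15,11,12)]
  obtain Ai where Ai: "\<And>x. A (Ai x) = x" "\<And>x. Ai (A x) = x"
    "\<And>b. b > \<beta> \<Longrightarrow> \<exists>M. \<forall>n. lin_bound (decay_size \<Gamma>) (A ^^ n) (M * b ^ n)"
    "\<And>a. a > 1 / \<alpha> \<Longrightarrow> \<exists>M. \<forall>n. lin_bound (decay_size \<Gamma>) (Ai ^^ n) (M * a ^ n)"
    using sp(4) by blast
  obtain a b where ab: "\<beta> < b" "b < 1" "1 / \<alpha> < a" "a * b ^ r\<^sub>0 < 1" "1 \<le> a * b" "2 \<le> r\<^sub>0"
    by (rule spectral_gap_rates[OF sp(1-3), of r\<^sub>0]) (use assms(13,14) in auto)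
  have ab0: "0 < b" "0 < a" using ab(1,3) sp(1,2) by (linarith, meson less_trans zero_less_divide_1_iff)
  obtain M1 M2 where M12: "\<And>n. lin_bound (decay_size \<Gamma>) (A ^^ n) (M1 * b ^ n)"
      "\<And>n. lin_bound (decay_size \<Gamma>) (Ai ^^ n) (M2 * a ^ n)"
    using Ai(3)[OF ab(1)] Ai(4)[OF ab(3)] by blast
  define C0 where "C0 = max 1 (max M1 M2)"
  have C0: "1 \<le> C0" by (simp add: C0_def)
  have pw: "lin_bound (decay_size \<Gamma>) (A ^^ n) (C0 * b ^ n)"
      "lin_bound (decay_size \<Gamma>) (Ai ^^ n) (C0 * a ^ n)" for n
    by (rule w.lin_bound_mono[OF M12(1)], use ab0 in \<open>simp add: C0_def mult_right_mono\<close>,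
        rule w.lin_bound_mono[OF M12(2)], use ab0 in \<open>simp add: C0_def mult_right_mono\<close>)
  have linAi: "linear Ai"
  proof (rule linearI)
    show "Ai (x + y) = Ai x + Ai y" for x y
      using Ai(2)[of "Ai x + Ai y"] by (simp add: linear_add[OF linA] Ai(1))
    show "Ai (c *\<^sub>R x) = c *\<^sub>R Ai x" for c x
      using Ai(2)[of "c *\<^sub>R Ai x"] by (simp add: linear_scale[OF linA] Ai(1))
  qed
  obtain Za nrm where Za: "sized Za nrm C0" "lin_bound Za A b" "lin_bound Za Ai a"
    "\<And>t c x. Za t c x \<Longrightarrow> decay_size \<Gamma> t c x" "\<And>t c x. decay_size \<Gamma> t c x \<Longrightarrow> Za t (C0 * c) x"
    by (rule adapted_size[OF w.sized_axioms linA linAi Ai(1,2) pw ab0 ab(5) C0]) (rule that)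
  interpret s: sized Za nrm C0 by (rule Za(1))
  obtain \<delta>0 where \<delta>0: "0 < \<delta>0" "ball 0 \<delta>0 \<subseteq> U" using U open_contains_ball by blast
  have sub: "{x. nrm x < \<delta>0} \<subseteq> U"
    using \<delta>0(2) by (auto simp: subset_iff intro: le_less_trans[OF s.norm_le])
  have C0M: "1 \<le> C0 * M" using C0 D(3) by (metis mult_mono mult_1 zero_le_one order_trans)
  interpret c: contraction_data Za nrm C0 D A Ai r r\<^sub>0 a b "C0 * M" \<delta>0
  proof (intro contraction_data.intro contraction_data_axioms.intro)
    show "jet r {x. nrm x < \<delta>0} D" by (rule jet_subset[OF D(1) s.open_nrm_ball sub])
    show "mult_bound Za j (D j x) (C0 * M)" if "j \<le> r" "nrm x < \<delta>0" for j x
    proof -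
      have "x \<in> U" using that sub by blast
      from mult_bound_change[OF D(4)[OF that(1) this], of Za 1 C0] Za(4,5) C0 show ?thesis by simp
    qed
    show "D 0 0 [] = 0" using D(2) U assms(9) by simp
    show "D 1 0 [v] = A v" for v by (simp add: DA)
    show "bounded_linear A" by (rule lin_bound_bounded_linear[OF dbA linA])
    show "bounded_linear Ai" using pw(2)[of 1] linAi by (intro lin_bound_bounded_linear) auto
  qed (use ab assms(17) \<delta>0 C0M Za Ai in auto)
  obtain \<delta> G C where G: "0 < \<delta>" "\<delta> \<le> \<delta>0" "jet r {x. nrm x < \<delta>} G"
    "\<And>j x. j \<le> r \<Longrightarrow> nrm x < \<delta> \<Longrightarrow> mult_bound Za j (G j x) C" "G 0 0 [] = 0" "\<And>v. G 1 0 [v] = v"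
    "\<And>x. nrm x < \<delta> \<Longrightarrow> nrm (D 0 x []) < \<delta> \<and> G 0 (D 0 x []) [] = c.H (G 0 x [])"
    using c.local_conjugacy unfolding mem_Collect_eq Ball_def by blast
  \<comment> \<open>The cutoff bounds the original norm, while the domain of \<open>G\<close> is a
    ball for \<open>nrm\<close>, which is at most \<open>C0\<close> times larger.\<close>
  have "0 < \<delta> / (2 * C0)" using G(1) C0 by simp
  then obtain \<eta> K and P :: "nat \<Rightarrow> ('m, real ^ 'n) linf \<Rightarrow> ('m, real ^ 'n) linf list \<Rightarrow> ('m, real ^ 'n) linf"
  where P: "0 < \<eta>" "1 \<le> K" "jet r UNIV P" "\<And>x. norm x \<le> \<eta> \<Longrightarrow> P 0 x [] = x" "\<And>x. norm (P 0 x []) \<le> \<delta> / (2 * C0)"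
    "\<And>j x. j \<le> r \<Longrightarrow> mult_bound (decay_size \<Gamma>) j (P j x) K"
    by (rule linf_cutoff[OF \<Gamma>, of _ r]) (blast intro: that)
  have P\<delta>: "nrm (P 0 x []) < \<delta>" for x
  proof -
    have "nrm (P 0 x []) \<le> C0 * (\<delta> / (2 * C0))"
      using s.nrm_le[of "P 0 x []"] P(5)[of x] C0 by (meson mult_left_mono order_trans zero_le_one)
    also have "\<dots> < \<delta>" using C0 G(1) by simp
    finally show ?thesis .
  qed
  \<comment> \<open>The cutoff is applied before \<open>G\<close>: it maps the whole space into the
    domain of \<open>G\<close> and is the identity near \<open>0\<close>.\<close>
  define R where "R x = G 0 (P 0 x []) []" for x
  have RG: "R x = G 0 x []" if "norm x \<le> \<eta>" for x using P(4)[OF that] by (simp add: R_def)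
  have Rj: "jet r UNIV (composite_jet G P)" by (rule comp_jet[OF G(3) P(3)]) (use P\<delta> assms(7) in auto)
  have Gw: "mult_bound (decay_size \<Gamma>) j (G j x) (C * C0 ^ r)" if "j \<le> r" "nrm x < \<delta>" for j x
  proof (rule w.mult_bound_mono)
    have g: "mult_bound Za j (G j x) C" by (rule G(4)[OF that])
    show "mult_bound (decay_size \<Gamma>) j (G j x) (1 * (C * C0 ^ j))"
      by (rule mult_bound_change[OF g]) (use Za(4,5) C0 in auto)
    show "1 * (C * C0 ^ j) \<le> C * C0 ^ r"
      using power_increasing[OF that(1) C0] mult_bound_nonneg[OF g] by (simp add: mult_left_mono)
  qed
  have "\<exists>K'. \<forall>j\<le>r. \<forall>x. mult_bound (decay_size \<Gamma>) j (composite_jet G P j x) K'"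
  proof -
    define B where "B j = (\<Sum>\<pi>\<leftarrow>parts j. (C * C0 ^ r) * K ^ j)" for j
    have "mult_bound (decay_size \<Gamma>) j (composite_jet G P j x) (Max (B ` {..r}))" if j: "j \<le> r" for j x
    proof (rule w.mult_bound_mono)
      show "mult_bound (decay_size \<Gamma>) j (composite_jet G P j x) (B j)"
        unfolding B_def by (rule w.mult_bound_composite_jet) (use j Gw P\<delta> P(2,6) in auto)
      show "B j \<le> Max (B ` {..r})" using j by (intro Max_ge) auto
    qed
    then show ?thesis by blast
  qed
  then obtain K' where K': "\<And>j x. j \<le> r \<Longrightarrow> mult_bound (decay_size \<Gamma>) j (composite_jet G P j x) K'" by blast
  have R1: "R \<in> C_decay \<Gamma> N r UNIV"
    by (rule C_decay_of_jet[OF N open_UNIV \<Gamma> Rj]) (use K' in \<open>auto simp: R_def\<close>)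
  have R2: "R 0 = 0" using RG[of 0] P(1) G(5) by simp
  have R3: "(R has_derivative (\<lambda>h. h)) (at 0)"
  proof (rule has_derivative_transform_within_open)
    show "((\<lambda>y. G 0 y []) has_derivative (\<lambda>h. h)) (at 0)"
      using jet_der[OF G(3), of 0 0 "[]"] assms(7) G(1,6) by simp
    show "open (ball (0 :: ('m, real ^ 'n) linf) \<eta>)" "0 \<in> ball (0 :: ('m, real ^ 'n) linf) \<eta>" using P(1) by auto
    show "G 0 x [] = R x" if "x \<in> ball 0 \<eta>" for x using that RG[of x] by simp
  qed
  have contF: "isCont F 0" using assms(10) by (rule has_derivative_continuous)
  \<comment> \<open>Both \<open>x\<close> and \<open>F x\<close> must lie where the cutoff is the
    identity; continuity of \<open>F\<close> at \<open>0\<close> supplies such a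
    neighbourhood.\<close>
  define V where "V = U \<inter> {x. nrm x < \<delta>} \<inter> ball 0 \<eta>"
  have V: "open V" "0 \<in> V" using U s.open_nrm_ball G(1) P(1) by (auto simp: V_def)
  have "(F \<longlongrightarrow> F 0) (nhds 0)" using contF by (simp add: isCont_def tendsto_at_iff_tendsto_nhds)
  from tendsto_norm[OF this] have "\<forall>\<^sub>F x in nhds 0. norm (F x) < \<eta>"
    by (rule order_tendstoD) (simp add: P(1) assms(9))
  moreover have "\<forall>\<^sub>F x in nhds 0. x \<in> V" by (rule eventually_nhds_in_open[OF V])
  ultimately have "\<forall>\<^sub>F x in nhds 0. norm (F x) < \<eta> \<and> x \<in> V" by eventually_elim blast
  then obtain U1 where U1: "open U1" "0 \<in> U1" "\<And>x. x \<in> U1 \<Longrightarrow> norm (F x) < \<eta> \<and> x \<in> V"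
    unfolding eventually_nhds by blast
  have conj: "R (F x) = c.H (R x)" if "x \<in> U1" for x
  proof -
    have x: "norm (F x) < \<eta>" "x \<in> U" "nrm x < \<delta>" "norm x < \<eta>" using U1(3)[OF that] by (auto simp: V_def)
    have "R (F x) = G 0 (D 0 x []) []" using RG[of "F x"] D(2) x by simp
    also have "\<dots> = c.H (R x)" using G(7) RG[of x] x by simp
    finally show ?thesis .
  qed
  have U1U: "U1 \<subseteq> U" using U1(3) by (auto simp: V_def)
  \<comment> \<open>The Taylor coefficients of \<open>F\<close>; the one of order \<open>0\<close>
    is \<open>F 0 = 0\<close> and provides the constant term of the polynomial.\<close>
  define Q where "Q k vs = (1 / fact k) *\<^sub>R D k 0 vs" for k vs
  have "polynomial_decay \<Gamma> N r\<^sub>0 c.H" unfolding polynomial_decay_def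
  proof (intro exI conjI ballI allI)
    fix k assume "k \<in> {1..r\<^sub>0}"
    then have k: "k \<le> r" using assms(17) by simp
    obtain \<kappa> where \<kappa>: "\<And>C G. mult_bound (decay_size \<Gamma>) k G C \<Longrightarrow>
        mult_norm_decay \<Gamma> N k (G :: ('m, real ^ 'n) linf list \<Rightarrow> _) \<le> ennreal (\<kappa> * C)"
      using mult_norm_decay_of_mult_bound[OF N \<Gamma>, of k] by blast
    have "mult_bound (decay_size \<Gamma>) k (Q k) (\<bar>1 / fact k\<bar> * M)"
      unfolding Q_def by (rule w.mult_bound_scaleR[OF D(4)[OF k U(2)]])
    from \<kappa>[OF this] have "mult_norm_decay \<Gamma> N k (Q k) < \<infinity>"
      unfolding infinity_ennreal_def by (rule le_less_trans[OF _ ennreal_less_top])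
    moreover have "multilinear_map k (Q k)"
      unfolding Q_def by (rule multilinear_scale[OF jet_multilinear[OF D(1) k U(2)]])
    ultimately show "Q k \<in> mult_decay \<Gamma> N k" by (simp add: mult_decay_def)
  next
    fix x
    have "c.H x = (\<Sum>k=0..r\<^sub>0. Q k (replicate k x))" by (simp add: c.H_def taylor_jet_def Q_def)
    also have "\<dots> = 0 + (\<Sum>k=1..r\<^sub>0. Q k (replicate k x))"
      by (subst sum.atLeast_Suc_atMost) (simp_all add: Q_def c.F0)
    finally show "c.H x = 0 + (\<Sum>k=1..r\<^sub>0. Q k (replicate k x))" .
  qed
  then show ?thesis using R1 R2 R3 U1(1,2) U1U conj by blast
qed

end
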